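(* Suppose that the state spaces $E_n$, $n\ge 0$, are Polish spaces. Let $(\alpha(N))_{N\ge1}$ be a nondecreasing sequence of positive numbers with $\alpha(N)\to\infty$ and $\alpha(N)/N\to0$, and let $n\ge0$. Then the sequence of random fields $(V_0^N,\dots,V_n^N)$ satisfies an MDP in the product space $\prod_{p=0}^n\mathcal M(E_p)$ equipped with the product $\tau$-topology, with speed $\alpha(N)$ and with the good rate function $I_{[0,n]}(\mu)=\sum_{p=0}^nI_p(\mu_p)$ for $\mu=(\mu_p)_{0\le p\le n}$, where the good rate functions $I_p$ on $\mathcal M(E_p)$ are given by $$I_p(\mu_p)=\sup_{f\in\mathcal B(E_p)}\Big(\mu_p(f)-\frac12\,\eta_{p-1}\big(K_{p,\eta_{p-1}}[f-K_{p,\eta_{p-1}}(f)]^2\big)\Big).$$ In addition, the sequence of random fields $W_n^N$ satisfies an MDP in $\mathcal M(E_n)$ (equipped with the $\tau$-topology), with speed $\alpha(N)$ and with the good rate function $$J_n(\nu)=\inf\Big\{\sum_{p=0}^nI_p(\mu_p):\ \mu=(\mu_p)_{0\le p\le n}\in\prod_{p=0}^n\mathcal M(E_p)\ \text{s.t.}\ \nu=\sum_{p=0}^n\mu_p\mathcal D_{p,n}\Big\}=\sup_{f\in\mathcal B(E_n)}\Big(\nu(f)-\frac12\,\mathbb E\big(W_n(f)^2\big)\Big).$$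
   Context: Notation. For a measurable space $(E,\mathcal E)$: $\mathcal P(E)$ is the set of probability measures, $\mathcal M(E)$ the set of finite signed measures, $\mathcal B(E)$ the bounded measurable real functions with the sup norm $\|\cdot\|$, $\mathrm{osc}(f)=\sup_{x,y}|f(x)-f(y)|$, $\mathrm{Osc}_1(E)=\{f\text{ measurable}:\mathrm{osc}(f)\le 1\}$, $\mu(f)=\int f\,d\mu$. A bounded integral operator $M$ from $E$ into $F$ is an operator $f\mapsto M(f)(x)=\int_F M(x,dy)f(y)$ from $\mathcal B(F)$ into $\mathcal B(E)$; $(\mu M)(f):=\mu(M(f))$; products of operators are compositions; $\beta(M):=\sup\{\mathrm{osc}(M(f)):f\in\mathrm{Osc}_1(F)\}$. The $\tau$-topology on $\mathcal M(E)$ is the coarsest topology making $\mu\mapsto\mu(A)$ continuous for every $A\in\mathcal E$; $\mathcal M(E)$ carries the $\sigma$-field generated by these maps. Model. $(E_n,\mathcal E_n)_{n\ge0}$ are measurable spaces; for $n\ge1$ and $\eta\in\mathcal P(E_{n-1})$, $K_{n,\eta}$ is a Markov kernel from $E_{n-1}$ to $E_n$; $\Phi_n(\eta):=\eta K_{n,\eta}\in\mathcal P(E_n)$; $\eta_0\in\mathcal P(E_0)$ is given and $\eta_n=\Phi_n(\eta_{n-1})$. The maps $(x^i)_{1\le i\le N}\mapsto K_{n+1,\frac1N\sum_j\delta_{x^j}}(x^i,A)$ are measurable for every measurable $A\subset E_{n+1}$. For $N\ge1$, the particle system $\xi_n=(\xi_n^{1},\dots,\xi_n^{N})\in E_n^N$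 is a Markov chain: $\xi_0$ consists of $N$ i.i.d. variables of law $\eta_0$, and given $\xi_0,\dots,\xi_{n-1}$ the $\xi_n^{i}$ are independent with respective laws $K_{n,\eta^N_{n-1}}(\xi_{n-1}^{i},\cdot)$, where $\eta^N_n:=\frac1N\sum_{j=1}^N\delta_{\xi_n^{j}}$. Set $V_n^N:=\sqrt N(\eta_n^N-\eta^N_{n-1}K_{n,\eta^N_{n-1}})$ for $n\ge1$, $V^N_0:=\sqrt N(\eta^N_0-\eta_0)$, and $W_n^N:=\sqrt N(\eta_n^N-\eta_n)$. Regularity class $\Upsilon(E_1,E_2)$: mappings $\Phi:\mathcal P(E_1)\to\mathcal P(E_2)$ with $\Phi(\mu)-\Phi(\eta)=(\mu-\eta)D_\eta\Phi+\mathcal R^\Phi(\mu,\eta)$ for all $\mu,\eta$, where (i) $D_\eta\Phi$ are bounded integral operators from $E_1$ into $E_2$ with $D_\eta\Phi(1)=0$ and $\sup_\eta\beta(D_\eta\Phi)<\infty$; (ii) $|\mathcal R^\Phi(\mu,\eta)(f)|\le\int|(\mu-\eta)^{\otimes2}(g)|\,R^\Phi_\eta(f,dg)$, where for each $f\in\mathcal B(E_2)$, $R^\Phi_\eta(f,\cdot)$ is a nonnegative measure on functions $g=g_1\otimes g_2$, $(g_1,g_2)\in\mathrm{Osc}_1(E_1)^2$, with $\sup_\eta\int\mathrm{osc}(g_1)\mathrm{osc}(g_2)R^\Phi_\eta(f,d(g_1\otimes g_2))\le\mathrm{osc}(f)\,\delta(R^\Phi)$ and $\delta(R^\Phi)<\infty$.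 Condition (K) for a family $K_\eta$, $\eta\in\mathcal P(E_1)$, of Markov kernels from $E_1$ to $E_2$: for all $f\in\mathrm{Osc}_1(E_2)$, $\|[K_\mu-K_\eta](f)\|\le\int|(\mu-\eta)(h)|\,T^K_\eta(f,dh)$ for some nonnegative measures $T^K_\eta(f,\cdot)$ on $\mathcal B(E_1)$ with $\sup_\eta\int\mathrm{osc}(h)T^K_\eta(f,dh)\le\mathrm{osc}(f)\,\delta(T^K)$, $\delta(T^K)<\infty$. Standing assumption (H1): for every $n\ge1$ the family $K_{n,\eta}$ satisfies (K) and $\Phi_n\in\Upsilon(E_{n-1},E_n)$. Set $\mathcal D_n:=D_{\eta_{n-1}}\Phi_n$, $\mathcal D_{p,n}:=\mathcal D_{p+1}\mathcal D_{p+2}\cdots\mathcal D_n$, $\mathcal D_{n,n}:=Id$. Limit fields. $\eta_{n-1}(K_{n,\eta_{n-1}}[f-K_{n,\eta_{n-1}}(f)]^2)$ means $\int\eta_{n-1}(dx)\int K_{n,\eta_{n-1}}(x,dy)[f(y)-K_{n,\eta_{n-1}}(f)(x)]^2$, with the convention for $n=0$ that $K_{0,\eta_{-1}}(x,dy)=\eta_0(dy)$ (so the expression is $\eta_0([f-\eta_0(f)]^2)$). $(V_n)_{n\ge0}$ are independent centered Gaussian random fields on $\mathcal B(E_n)$ with $\mathbb E(V_n(f)V_n(g))$ the corresponding bilinear form, and $W_n(f):=\sum_{p=0}^nV_p(\mathcal D_{p,n}(f))$. LDP/MDP. Let $S$ be a topological space with a $\sigma$-field $\mathcal S$. Random variables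 $\mathcal X^N$ with values in $(S,\mathcal S)$ satisfy an LDP with speed $\alpha(N)\to\infty$ and good rate function $I:S\to[0,\infty]$ if all level sets $\{I\le a\}$, $a<\infty$, are compact and, for every $A\in\mathcal S$ with interior $A^\circ$ and closure $\overline A$, $-\inf_{A^\circ}I\le\liminf_N\frac1{\alpha(N)}\log\mathbb P(\mathcal X^N\in A)\le\limsup_N\frac1{\alpha(N)}\log\mathbb P(\mathcal X^N\in A)\le-\inf_{\overline A}I$. A sequence $\mathcal Y^N$ satisfies an MDP with speed $\alpha(N)$ and good rate function $I$ if $\mathcal Y^N/\sqrt{\alpha(N)}$ satisfies an LDP with speed $\alpha(N)$ and good rate function $I$.
   Formalization: The measures T(f,dh) and R(f,dg), for which no σ-field on functions is given, are taken on any σ-field making evaluation (x,h)↦h(x) (for R, (x,y,g1,g2)↦g1(x)g2(y)) jointly measurable and the oscillation integrands measurable; without joint measurability the claim can fail. *)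

theory Defs
  imports "HOL-Probability.Probability"
begin

section \<open>Polish spaces, functions and signed measures\<close>

text \<open>The emeasure component of \<open>E\<close> plays no role: a measurable space is represented by its
  carrier and its \<open>\<sigma>\<close>-field only.\<close>

definition polish_borel :: "'a measure \<Rightarrow> bool" where
  "polish_borel E \<longleftrightarrow> (\<exists>X. completely_metrizable_space X \<and> second_countable X \<and>
     space E = topspace X \<and> sets E = sigma_sets (topspace X) {U. openin X U})"

text \<open>\<open>\<P>(E)\<close>\<close>

abbreviation probs :: "'a measure \<Rightarrow> 'a measure set" where
  "probs E \<equiv> space (prob_algebra E)"

text \<open>\<open>\<B>(E)\<close>; the values of a function outside \<open>space E\<close> never matter.\<close>

definition bdd_meas :: "'a measure \<Rightarrow> ('a \<Rightarrow> real) set" where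
  "bdd_meas E = {f. f \<in> borel_measurable E \<and> bounded (f ` space E)}"

definition osc :: "'a measure \<Rightarrow> ('a \<Rightarrow> real) \<Rightarrow> ennreal" where
  "osc E f = (SUP x\<in>space E. SUP y\<in>space E. ennreal \<bar>f x - f y\<bar>)"

definition Osc1 :: "'a measure \<Rightarrow> ('a \<Rightarrow> real) set" where
  "Osc1 E = {f. f \<in> borel_measurable E \<and> osc E f \<le> 1}"

text \<open>\<open>\<M>(E)\<close>: real-valued countably additive set functions, normalised to \<open>0\<close> off the
  \<open>\<sigma>\<close>-field so that equality of functions is equality of signed measures.\<close>

definition signed_measures :: "'a measure \<Rightarrow> ('a set \<Rightarrow> real) set" where
  "signed_measures E = {\<mu>. (\<forall>A. A \<notin> sets E \<longrightarrow> \<mu> A = 0) \<and>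
     (\<forall>F::nat \<Rightarrow> 'a set. range F \<subseteq> sets E \<longrightarrow> disjoint_family F \<longrightarrow>
        (\<lambda>i. \<mu> (F i)) sums \<mu> (\<Union>i. F i))}"

text \<open>Positive part in the Jordan decomposition, \<open>\<mu>\<^sup>+(A) = sup {\<mu>(B) | B \<subseteq> A}\<close>; \<open>ennreal\<close> sends
  negative reals to \<open>0\<close>, which does not change the supremum as \<open>\<mu>({}) = 0\<close>.\<close>

definition pos_variation :: "'a measure \<Rightarrow> ('a set \<Rightarrow> real) \<Rightarrow> 'a measure" where
  "pos_variation E \<mu> =
     measure_of (space E) (sets E) (\<lambda>A. SUP B\<in>{B \<in> sets E. B \<subseteq> A}. ennreal (\<mu> B))"

text \<open>\<open>\<mu>(f) = \<integral> f d\<mu>\<^sup>+ - \<integral> f d\<mu>\<^sup>-\<close>\<close>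

definition sm_integral :: "'a measure \<Rightarrow> ('a set \<Rightarrow> real) \<Rightarrow> ('a \<Rightarrow> real) \<Rightarrow> real" where
  "sm_integral E \<mu> f =
     (\<integral>x. f x \<partial>pos_variation E \<mu>) - (\<integral>x. f x \<partial>pos_variation E (\<lambda>A. - \<mu> A))"

definition tau_topology :: "'a measure \<Rightarrow> ('a set \<Rightarrow> real) topology" where
  "tau_topology E =
     topology_generated_by {{\<mu> \<in> signed_measures E. \<mu> A \<in> U} | A U. A \<in> sets E \<and> open U}"

definition sm_algebra :: "'a measure \<Rightarrow> ('a set \<Rightarrow> real) measure" where
  "sm_algebra E =
     sigma (signed_measures E)
       {{\<mu> \<in> signed_measures E. \<mu> A \<in> B} | A B. A \<in> sets E \<and> B \<in> sets borel}"

definition sm_scale :: "real \<Rightarrow> ('a set \<Rightarrow> real) \<Rightarrow> ('a set \<Rightarrow> real)" where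
  "sm_scale c \<mu> = (\<lambda>A. c * \<mu> A)"


section \<open>Integral operators and the regularity conditions\<close>

text \<open>The operator \<open>M(f)(x) = \<integral> M(x,dy) f(y)\<close> attached to a kernel \<open>k x = M(x,\<cdot>)\<close> of signed
  measures on \<open>F\<close>.\<close>

definition kernel_op ::
    "'b measure \<Rightarrow> ('a \<Rightarrow> 'b set \<Rightarrow> real) \<Rightarrow> ('b \<Rightarrow> real) \<Rightarrow> ('a \<Rightarrow> real)" where
  "kernel_op F k f = (\<lambda>x. sm_integral F (k x) f)"

definition bounded_integral_operator ::
    "'a measure \<Rightarrow> 'b measure \<Rightarrow> ('a \<Rightarrow> 'b set \<Rightarrow> real) \<Rightarrow> bool" where
  "bounded_integral_operator E F k \<longleftrightarrow>
     (\<forall>x\<in>space E. k x \<in> signed_measures F) \<and>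
     (\<forall>f\<in>bdd_meas F. kernel_op F k f \<in> bdd_meas E)"

text \<open>\<open>\<beta>(M)\<close>\<close>

definition dobrushin ::
    "'a measure \<Rightarrow> 'b measure \<Rightarrow> (('b \<Rightarrow> real) \<Rightarrow> ('a \<Rightarrow> real)) \<Rightarrow> ennreal" where
  "dobrushin E F M = (SUP f\<in>Osc1 F. osc E (M f))"

definition diff_int :: "'a measure \<Rightarrow> 'a measure \<Rightarrow> ('a \<Rightarrow> real) \<Rightarrow> real" where
  "diff_int \<mu> \<eta> f = (\<integral>x. f x \<partial>\<mu>) - (\<integral>x. f x \<partial>\<eta>)"

text \<open>\<open>\<R>\<^sup>\<Phi>(\<mu>,\<eta>)(f) = (\<Phi>(\<mu>) - \<Phi>(\<eta>))(f) - (\<mu> - \<eta>)(D\<^sub>\<eta>\<Phi>(f))\<close>, i.e. the first-order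
  expansion of \<open>\<Phi>\<close> solved for its remainder.\<close>

definition remainder ::
    "'b measure \<Rightarrow> ('a measure \<Rightarrow> 'b measure) \<Rightarrow> ('a measure \<Rightarrow> 'a \<Rightarrow> 'b set \<Rightarrow> real) \<Rightarrow>
     'a measure \<Rightarrow> 'a measure \<Rightarrow> ('b \<Rightarrow> real) \<Rightarrow> real" where
  "remainder F \<Phi> D \<mu> \<eta> f =
     diff_int (\<Phi> \<mu>) (\<Phi> \<eta>) f - diff_int \<mu> \<eta> (kernel_op F (D \<eta>) f)"

text \<open>\<open>upsilon_with E F \<Phi> D\<close>: the map \<open>\<Phi>\<close> belongs to the class \<open>\<Upsilon>(E,F)\<close>, with first-order
  operators \<open>D\<^sub>\<eta>\<Phi>\<close> given by the kernels \<open>D \<eta>\<close>.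

  A measure on tensor products \<open>g\<^sub>1 \<otimes> g\<^sub>2\<close> is represented by a measure \<open>R\<close> on pairs
  \<open>(g\<^sub>1, g\<^sub>2)\<close>, and \<open>(\<mu> - \<eta>)\<^sup>\<otimes>\<^sup>2(g\<^sub>1 \<otimes> g\<^sub>2) = (\<mu> - \<eta>)(g\<^sub>1) (\<mu> - \<eta>)(g\<^sub>2)\<close>. No \<open>\<sigma>\<close>-field on the set of
  functions is distinguished: any one is allowed for which evaluation \<open>(z, g) \<mapsto> g(z)\<close> is
  jointly measurable and the integrand \<open>osc(g\<^sub>1) osc(g\<^sub>2)\<close> is measurable. Joint measurability is
  what permits Fubini's theorem for such mixtures, and it cannot be replaced by measurability of
  \<open>g \<mapsto> (\<mu> - \<eta>)\<^sup>\<otimes>\<^sup>2(g)\<close> for fixed \<open>\<mu>\<close>, \<open>\<eta>\<close>: a countably additive \<open>{0,1}\<close>-valued measure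
  concentrated on large countable sets \<open>C\<close> would make \<open>\<integral> \<bar>(\<mu> - \<eta>)(1\<^sub>C)\<bar>\<close> the difference of
  the atomic masses of \<open>\<mu>\<close> and \<open>\<eta>\<close>.\<close>

definition upsilon_with ::
    "'a measure \<Rightarrow> 'b measure \<Rightarrow> ('a measure \<Rightarrow> 'b measure) \<Rightarrow>
     ('a measure \<Rightarrow> 'a \<Rightarrow> 'b set \<Rightarrow> real) \<Rightarrow> bool" where
  "upsilon_with E F \<Phi> D \<longleftrightarrow>
     (\<forall>\<eta>\<in>probs E. \<Phi> \<eta> \<in> probs F) \<and>
     (\<forall>\<eta>\<in>probs E. bounded_integral_operator E F (D \<eta>) \<and>
        (\<forall>x\<in>space E. kernel_op F (D \<eta>) (\<lambda>_. 1) x = 0)) \<and>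
     (SUP \<eta>\<in>probs E. dobrushin E F (kernel_op F (D \<eta>))) < \<infinity> \<and>
     (\<exists>\<delta><\<infinity>. \<forall>\<eta>\<in>probs E. \<forall>f\<in>bdd_meas F.
        \<exists>R :: (('a \<Rightarrow> real) \<times> ('a \<Rightarrow> real)) measure.
          space R \<subseteq> Osc1 E \<times> Osc1 E \<and>
          (\<lambda>((x, y), (g1, g2)). g1 x * g2 y) \<in> borel_measurable ((E \<Otimes>\<^sub>M E) \<Otimes>\<^sub>M R) \<and>
          (\<lambda>(g1, g2). osc E g1 * osc E g2) \<in> borel_measurable R \<and>
          (\<forall>\<mu>\<in>probs E. ennreal \<bar>remainder F \<Phi> D \<mu> \<eta> f\<bar>
             \<le> (\<integral>\<^sup>+(g1, g2). ennreal \<bar>diff_int \<mu> \<eta> g1 * diff_int \<mu> \<eta> g2\<bar> \<partial>R)) \<and>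
          (\<integral>\<^sup>+(g1, g2). osc E g1 * osc E g2 \<partial>R) \<le> osc F f * \<delta>)"

text \<open>Condition \<open>(K)\<close>, with the same convention on the measures \<open>T\<close>.\<close>

definition cond_K ::
    "'a measure \<Rightarrow> 'b measure \<Rightarrow> ('a measure \<Rightarrow> 'a \<Rightarrow> 'b measure) \<Rightarrow> bool" where
  "cond_K E F K \<longleftrightarrow>
     (\<exists>\<delta><\<infinity>. \<forall>\<eta>\<in>probs E. \<forall>f\<in>Osc1 F.
        \<exists>T :: ('a \<Rightarrow> real) measure.
          space T \<subseteq> bdd_meas E \<and>
          (\<lambda>(x, h). h x) \<in> borel_measurable (E \<Otimes>\<^sub>M T) \<and>
          osc E \<in> borel_measurable T \<and>
          (\<forall>\<mu>\<in>probs E. (SUP x\<in>space E. ennreal \<bar>diff_int (K \<mu> x) (K \<eta> x) f\<bar>)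
             \<le> (\<integral>\<^sup>+h. ennreal \<bar>diff_int \<mu> \<eta> h\<bar> \<partial>T)) \<and>
          (\<integral>\<^sup>+h. osc E h \<partial>T) \<le> osc F f * \<delta>)"


section \<open>The particle model\<close>

text \<open>\<open>\<Phi>\<^sub>n(\<eta>) = \<eta>K\<^sub>n\<^sub>,\<^sub>\<eta>\<close>\<close>

definition Phi :: "(nat \<Rightarrow> 'a measure \<Rightarrow> 'a \<Rightarrow> 'a measure) \<Rightarrow> nat \<Rightarrow> 'a measure \<Rightarrow> 'a measure" where
  "Phi K n \<eta> = \<eta> \<bind> K n \<eta>"

primrec flow ::
    "(nat \<Rightarrow> 'a measure \<Rightarrow> 'a \<Rightarrow> 'a measure) \<Rightarrow> 'a measure \<Rightarrow> nat \<Rightarrow> 'a measure" where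
  "flow K \<eta>0 0 = \<eta>0"
| "flow K \<eta>0 (Suc n) = Phi K (Suc n) (flow K \<eta>0 n)"

text \<open>\<open>(1/N) \<Sum>\<^sub>j \<delta>\<^bsub>x j\<^esub>\<close> as the image of the uniform distribution on \<open>{1..N}\<close>\<close>

definition empirical :: "'a measure \<Rightarrow> nat \<Rightarrow> (nat \<Rightarrow> 'a) \<Rightarrow> 'a measure" where
  "empirical E N x = distr (uniform_count_measure {1..N}) E x"

text \<open>The \<open>\<sigma>\<close>-field generated by \<open>\<xi>\<^sub>0, \<dots>, \<xi>\<^sub>n\<close>\<close>

definition past :: "(nat \<Rightarrow> 'a measure) \<Rightarrow> nat \<Rightarrow> 'w measure \<Rightarrow> (nat \<Rightarrow> nat \<Rightarrow> 'w \<Rightarrow> 'a) \<Rightarrow>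
    nat \<Rightarrow> 'w measure" where
  "past E N P \<xi> n = sigma (space P)
     {\<xi> k i -` A \<inter> space P | k i A. k \<le> n \<and> i \<in> {1..N} \<and> A \<in> sets (E k)}"

text \<open>\<open>\<xi> n i\<close> is the \<open>i\<close>-th particle at time \<open>n\<close>, for \<open>i \<in> {1..N}\<close>. The last clause states that,
  given \<open>\<xi>\<^sub>0, \<dots>, \<xi>\<^sub>n\<close>, the conditional law of \<open>\<xi>\<^sub>n\<^sub>+\<^sub>1\<close> is a product, by prescribing it on
  rectangles.\<close>

definition particle_system ::
    "(nat \<Rightarrow> 'a measure) \<Rightarrow> (nat \<Rightarrow> 'a measure \<Rightarrow> 'a \<Rightarrow> 'a measure) \<Rightarrow> 'a measure \<Rightarrow>
     nat \<Rightarrow> 'w measure \<Rightarrow> (nat \<Rightarrow> nat \<Rightarrow> 'w \<Rightarrow> 'a) \<Rightarrow> bool" where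
  "particle_system E K \<eta>0 N P \<xi> \<longleftrightarrow>
     prob_space P \<and>
     (\<forall>n. \<forall>i\<in>{1..N}. \<xi> n i \<in> measurable P (E n)) \<and>
     prob_space.indep_vars P (\<lambda>_. E 0) (\<xi> 0) {1..N} \<and>
     (\<forall>i\<in>{1..N}. distr P (E 0) (\<xi> 0 i) = \<eta>0) \<and>
     (\<forall>n A. (\<forall>i\<in>{1..N}. A i \<in> sets (E (Suc n))) \<longrightarrow>
        (AE \<omega> in P.
           real_cond_exp P (past E N P \<xi> n)
             (indicator {\<omega> \<in> space P. \<forall>i\<in>{1..N}. \<xi> (Suc n) i \<omega> \<in> A i}) \<omega>
           = (\<Prod>i\<in>{1..N}.
                measure (K (Suc n) (empirical (E n) N (\<lambda>j. \<xi> n j \<omega>)) (\<xi> n i \<omega>)) (A i))))"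

definition emp_process ::
    "(nat \<Rightarrow> 'a measure) \<Rightarrow> (nat \<Rightarrow> nat \<Rightarrow> nat \<Rightarrow> 'w \<Rightarrow> 'a) \<Rightarrow> nat \<Rightarrow> nat \<Rightarrow> 'w \<Rightarrow> 'a measure" where
  "emp_process E \<xi> N n \<omega> = empirical (E n) N (\<lambda>j. \<xi> N n j \<omega>)"

text \<open>\<open>V\<^sub>n\<^sup>N\<close> and \<open>W\<^sub>n\<^sup>N\<close> as signed measures; recall that \<open>measure\<close> vanishes off the \<open>\<sigma>\<close>-field.\<close>

primrec V_field ::
    "(nat \<Rightarrow> 'a measure) \<Rightarrow> (nat \<Rightarrow> 'a measure \<Rightarrow> 'a \<Rightarrow> 'a measure) \<Rightarrow> 'a measure \<Rightarrow>
     (nat \<Rightarrow> nat \<Rightarrow> nat \<Rightarrow> 'w \<Rightarrow> 'a) \<Rightarrow> nat \<Rightarrow> nat \<Rightarrow> 'w \<Rightarrow> 'a set \<Rightarrow> real" where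
  "V_field E K \<eta>0 \<xi> N 0 = (\<lambda>\<omega> A.
     sqrt (real N) * (measure (emp_process E \<xi> N 0 \<omega>) A - measure \<eta>0 A))"
| "V_field E K \<eta>0 \<xi> N (Suc n) = (\<lambda>\<omega> A.
     sqrt (real N) * (measure (emp_process E \<xi> N (Suc n) \<omega>) A
       - measure (emp_process E \<xi> N n \<omega> \<bind> K (Suc n) (emp_process E \<xi> N n \<omega>)) A))"

definition W_field ::
    "(nat \<Rightarrow> 'a measure) \<Rightarrow> (nat \<Rightarrow> 'a measure \<Rightarrow> 'a \<Rightarrow> 'a measure) \<Rightarrow> 'a measure \<Rightarrow>
     (nat \<Rightarrow> nat \<Rightarrow> nat \<Rightarrow> 'w \<Rightarrow> 'a) \<Rightarrow> nat \<Rightarrow> nat \<Rightarrow> 'w \<Rightarrow> 'a set \<Rightarrow> real" where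
  "W_field E K \<eta>0 \<xi> N n \<omega> A =
     sqrt (real N) * (measure (emp_process E \<xi> N n \<omega>) A - measure (flow K \<eta>0 n) A)"

text \<open>\<open>\<D>\<^sub>p\<^sub>,\<^sub>n = \<D>\<^sub>p\<^sub>+\<^sub>1 \<D>\<^sub>p\<^sub>+\<^sub>2 \<cdots> \<D>\<^sub>n\<close> with \<open>\<D>\<^sub>k\<close> the first-order operator of \<open>\<Phi>\<^sub>k\<close> at
  \<open>\<eta>\<^bsub>k-1\<^esub>\<close>, and \<open>\<D>\<^sub>n\<^sub>,\<^sub>n = Id\<close>\<close>

definition D_step ::
    "(nat \<Rightarrow> 'a measure) \<Rightarrow> (nat \<Rightarrow> 'a measure \<Rightarrow> 'a \<Rightarrow> 'a measure) \<Rightarrow> 'a measure \<Rightarrow>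
     (nat \<Rightarrow> 'a measure \<Rightarrow> 'a \<Rightarrow> 'a set \<Rightarrow> real) \<Rightarrow> nat \<Rightarrow> ('a \<Rightarrow> real) \<Rightarrow> ('a \<Rightarrow> real)" where
  "D_step E K \<eta>0 D k = kernel_op (E k) (D k (flow K \<eta>0 (k - 1)))"

definition D_semigroup ::
    "(nat \<Rightarrow> 'a measure) \<Rightarrow> (nat \<Rightarrow> 'a measure \<Rightarrow> 'a \<Rightarrow> 'a measure) \<Rightarrow> 'a measure \<Rightarrow>
     (nat \<Rightarrow> 'a measure \<Rightarrow> 'a \<Rightarrow> 'a set \<Rightarrow> real) \<Rightarrow> nat \<Rightarrow> nat \<Rightarrow> ('a \<Rightarrow> real) \<Rightarrow> ('a \<Rightarrow> real)" where
  "D_semigroup E K \<eta>0 D p n = foldr (\<circ>) (map (D_step E K \<eta>0 D) [Suc p..<Suc n]) id"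


section \<open>The limiting Gaussian fields\<close>

primrec field_cov ::
    "(nat \<Rightarrow> 'a measure \<Rightarrow> 'a \<Rightarrow> 'a measure) \<Rightarrow> 'a measure \<Rightarrow> nat \<Rightarrow>
     ('a \<Rightarrow> real) \<Rightarrow> ('a \<Rightarrow> real) \<Rightarrow> real" where
  "field_cov K \<eta>0 0 = (\<lambda>f g.
     \<integral>y. (f y - (\<integral>z. f z \<partial>\<eta>0)) * (g y - (\<integral>z. g z \<partial>\<eta>0)) \<partial>\<eta>0)"
| "field_cov K \<eta>0 (Suc n) = (\<lambda>f g.
     let \<eta> = flow K \<eta>0 n; k = K (Suc n) \<eta> in
     \<integral>x. (\<integral>y. (f y - (\<integral>z. f z \<partial>k x)) * (g y - (\<integral>z. g z \<partial>k x)) \<partial>k x) \<partial>\<eta>)"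

text \<open>Degenerate variables are centered Gaussian with variance \<open>0\<close>.\<close>

definition centered_gaussian :: "'g measure \<Rightarrow> ('g \<Rightarrow> real) \<Rightarrow> bool" where
  "centered_gaussian G X \<longleftrightarrow> X \<in> borel_measurable G \<and>
     ((AE \<omega> in G. X \<omega> = 0) \<or> (\<exists>\<sigma>>0. distributed G lborel X (normal_density 0 \<sigma>)))"

definition limit_fields ::
    "(nat \<Rightarrow> 'a measure) \<Rightarrow> (nat \<Rightarrow> 'a measure \<Rightarrow> 'a \<Rightarrow> 'a measure) \<Rightarrow> 'a measure \<Rightarrow>
     'g measure \<Rightarrow> (nat \<Rightarrow> ('a \<Rightarrow> real) \<Rightarrow> 'g \<Rightarrow> real) \<Rightarrow> bool" where
  "limit_fields E K \<eta>0 G V \<longleftrightarrow>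
     prob_space G \<and>
     prob_space.indep_vars G (\<lambda>p. PiM (bdd_meas (E p)) (\<lambda>_. borel))
       (\<lambda>p \<omega>. \<lambda>f\<in>bdd_meas (E p). V p f \<omega>) UNIV \<and>
     (\<forall>p. \<forall>A c. finite A \<longrightarrow> A \<subseteq> bdd_meas (E p) \<longrightarrow>
        centered_gaussian G (\<lambda>\<omega>. \<Sum>f\<in>A. c f * V p f \<omega>)) \<and>
     (\<forall>p. \<forall>f\<in>bdd_meas (E p). \<forall>g\<in>bdd_meas (E p).
        (\<integral>\<omega>. V p f \<omega> * V p g \<omega> \<partial>G) = field_cov K \<eta>0 p f g)"

definition W_limit ::
    "(nat \<Rightarrow> 'a measure) \<Rightarrow> (nat \<Rightarrow> 'a measure \<Rightarrow> 'a \<Rightarrow> 'a measure) \<Rightarrow> 'a measure \<Rightarrow>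
     (nat \<Rightarrow> 'a measure \<Rightarrow> 'a \<Rightarrow> 'a set \<Rightarrow> real) \<Rightarrow>
     (nat \<Rightarrow> ('a \<Rightarrow> real) \<Rightarrow> 'g \<Rightarrow> real) \<Rightarrow> nat \<Rightarrow> ('a \<Rightarrow> real) \<Rightarrow> 'g \<Rightarrow> real" where
  "W_limit E K \<eta>0 D V n f \<omega> = (\<Sum>p\<le>n. V p (D_semigroup E K \<eta>0 D p n f) \<omega>)"


section \<open>Large and moderate deviations\<close>

definition good_rate_function :: "'s topology \<Rightarrow> ('s \<Rightarrow> ereal) \<Rightarrow> bool" where
  "good_rate_function S I \<longleftrightarrow>
     (\<forall>x\<in>topspace S. 0 \<le> I x) \<and>
     (\<forall>a::real. compactin S {x \<in> topspace S. I x \<le> ereal a})"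

definition elog :: "real \<Rightarrow> ereal" where
  "elog p = (if p = 0 then - \<infinity> else ereal (ln p))"

text \<open>The sequence is indexed by \<open>N \<ge> 1\<close>; the variables may live on different probability
  spaces \<open>P N\<close>. The \<open>\<sigma>\<close>-field \<open>\<SS>\<close> need not be the Borel one.\<close>

definition LDP ::
    "'s topology \<Rightarrow> 's measure \<Rightarrow> (nat \<Rightarrow> 'w measure) \<Rightarrow> (nat \<Rightarrow> 'w \<Rightarrow> 's) \<Rightarrow>
     (nat \<Rightarrow> real) \<Rightarrow> ('s \<Rightarrow> ereal) \<Rightarrow> bool" where
  "LDP S \<SS> P X \<alpha> I \<longleftrightarrow>
     (\<forall>N\<ge>1. X N \<in> measurable (P N) \<SS>) \<and>
     filterlim \<alpha> at_top sequentially \<and>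
     good_rate_function S I \<and>
     (\<forall>A\<in>sets \<SS>.
        - (INF x\<in>S interior_of A. I x)
          \<le> liminf (\<lambda>N. ereal (1 / \<alpha> N) * elog (measure (P N) (X N -` A \<inter> space (P N)))) \<and>
        limsup (\<lambda>N. ereal (1 / \<alpha> N) * elog (measure (P N) (X N -` A \<inter> space (P N))))
          \<le> - (INF x\<in>S closure_of A. I x))"

text \<open>\<open>scal c x\<close> is scalar multiplication on the vector space \<open>S\<close>.\<close>

definition MDP ::
    "(real \<Rightarrow> 's \<Rightarrow> 's) \<Rightarrow> 's topology \<Rightarrow> 's measure \<Rightarrow> (nat \<Rightarrow> 'w measure) \<Rightarrow>
     (nat \<Rightarrow> 'w \<Rightarrow> 's) \<Rightarrow> (nat \<Rightarrow> real) \<Rightarrow> ('s \<Rightarrow> ereal) \<Rightarrow> bool" where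
  "MDP scal S \<SS> P Y \<alpha> I \<longleftrightarrow>
     LDP S \<SS> P (\<lambda>N \<omega>. scal (1 / sqrt (\<alpha> N)) (Y N \<omega>)) \<alpha> I"

definition rate_I ::
    "(nat \<Rightarrow> 'a measure) \<Rightarrow> (nat \<Rightarrow> 'a measure \<Rightarrow> 'a \<Rightarrow> 'a measure) \<Rightarrow> 'a measure \<Rightarrow> nat \<Rightarrow>
     ('a set \<Rightarrow> real) \<Rightarrow> ereal" where
  "rate_I E K \<eta>0 p \<mu> =
     (SUP f\<in>bdd_meas (E p). ereal (sm_integral (E p) \<mu> f - field_cov K \<eta>0 p f f / 2))"

text \<open>The constraint is \<open>\<nu> = \<Sum>\<^sub>p \<mu>\<^sub>p \<D>\<^sub>p\<^sub>,\<^sub>n\<close>, where \<open>(\<mu>M)(f) = \<mu>(M(f))\<close>.\<close>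

definition rate_J ::
    "(nat \<Rightarrow> 'a measure) \<Rightarrow> (nat \<Rightarrow> 'a measure \<Rightarrow> 'a \<Rightarrow> 'a measure) \<Rightarrow> 'a measure \<Rightarrow>
     (nat \<Rightarrow> 'a measure \<Rightarrow> 'a \<Rightarrow> 'a set \<Rightarrow> real) \<Rightarrow> nat \<Rightarrow> ('a set \<Rightarrow> real) \<Rightarrow> ereal" where
  "rate_J E K \<eta>0 D n \<nu> =
     Inf {(\<Sum>p\<le>n. rate_I E K \<eta>0 p (\<mu> p)) | \<mu>.
       \<mu> \<in> (\<Pi>\<^sub>E p\<in>{..n}. signed_measures (E p)) \<and>
       (\<forall>f\<in>bdd_meas (E n). sm_integral (E n) \<nu> f =
          (\<Sum>p\<le>n. sm_integral (E p) (\<mu> p) (D_semigroup E K \<eta>0 D p n f)))}"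

end

theory Submission
  imports Defs
begin

text \<open>
  All fields are treated as points of a space \<open>S\<close> whose topology is generated by linear coordinates
  \<open>ev f\<close>, and the rates are Legendre transforms \<open>x \<mapsto> sup\<^sub>f (ev f x - Q(f,f)/2)\<close> of a covariance form \<open>Q\<close>.
  If \<open>\<alpha>\<^sup>-\<^sup>1 ln E exp (\<alpha> ev f X) \<longrightarrow> Q(f,f)/2\<close> for every \<open>f\<close>, the upper bound follows by covering closed
  sets off a level set by finitely many half spaces, and the lower bound by tilting with \<open>f\<close>. Level sets
  are compact because every linear functional of finite rate is represented by a point of \<open>S\<close>: a
  functional on simple functions dominated by the covariance form of a field is a signed measure.

  Conditionally on the past, the log-Laplace transform of \<open>V\<^sub>p(f)\<close> is half the conditional variance up to
  a cubic error. By condition (K) and the remainder bound, \<open>W\<^sub>p(f)\<close> is subgaussian uniformly in \<open>N\<close> and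
  in \<open>osc f \<le> 1\<close>, since mixtures of subgaussian variables are subgaussian; hence the conditional
  variances are exponentially close to their limits. Finally \<open>W\<^sub>n(f) - \<Sum>\<^sub>p V\<^sub>p(\<D>\<^sub>p\<^sub>,\<^sub>n f)\<close> is quadratic in the
  fields and so negligible at the moderate scale.
\<close>

section \<open>Signed measures\<close>

text \<open>Only the values \<open>\<mu> A\<close> are continuous in the \<tau>-topology, so the
  coordinates are simple functions; evaluation at another bounded function need not be continuous.
  Hence a functional found from the coordinates must be extended to bounded functions before a
  measure can represent it. Likewise the map from (\<mu>_p) to the sum of the \<mu>_p D_{p,n} need
  not be continuous, since D_{p,n} of an indicator need not be simple. The principle for W is
  therefore derived from its own cumulants instead of by contraction, and the formula for J is a
  separate identity between Legendre transforms. Exponential tightness is bypassed: the finite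
  number of half spaces comes from a compact box in the finitely many coordinates that see a cover
  of the level set. Duality takes place in semi-inner product spaces that are never completed, with
  near-maximizing sequences in the roles of Riesz representation and Hahn-Banach extension. Errors
  are measured by scaled cumulants: a perturbation whose multiples all have asymptotically
  nonpositive cumulants is removed by Hoelder's inequality.\<close>

lemma signed_sums:
  assumes "\<mu> \<in> signed_measures E" "range F \<subseteq> sets E" "disjoint_family F"
  shows "(\<lambda>i::nat. \<mu> (F i)) sums \<mu> (\<Union>i. F i)"
  using assms unfolding signed_measures_def by blast

lemma signed_empty:
  assumes "\<mu> \<in> signed_measures E"
  shows "\<mu> {} = 0"
proof -
  have "(\<lambda>i::nat. \<mu> {}) sums \<mu> {}"
    using signed_sums[OF assms, of "\<lambda>_. {}"] by (simp add: disjoint_family_on_def)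
  then show ?thesis
    using sums_summable summable_const_iff by blast
qed

lemma signed_union:
  assumes "\<mu> \<in> signed_measures E" "A \<in> sets E" "B \<in> sets E" "A \<inter> B = {}"
  shows "\<mu> (A \<union> B) = \<mu> A + \<mu> B"
proof -
  have "disjoint_family (binaryset A B)"
    using assms(4) by (auto simp: disjoint_family_on_def binaryset_def)
  moreover have "range (binaryset A B) \<subseteq> sets E"
    using assms by (simp add: range_binaryset_eq)
  ultimately have "(\<lambda>i. \<mu> (binaryset A B i)) sums \<mu> (A \<union> B)"
    using signed_sums[OF assms(1)] UN_binaryset_eq by metis
  moreover have "(\<lambda>i. \<mu> (binaryset A B i)) sums (\<mu> A + \<mu> B)"
    by (rule binaryset_sums) (rule signed_empty[OF assms(1)])
  ultimately show ?thesis
    using sums_unique2 by blast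
qed

lemma signed_diff:
  assumes "\<mu> \<in> signed_measures E" "A \<in> sets E" "B \<in> sets E" "B \<subseteq> A"
  shows "\<mu> (A - B) = \<mu> A - \<mu> B"
proof -
  have "\<mu> (B \<union> (A - B)) = \<mu> B + \<mu> (A - B)"
    using assms by (intro signed_union) auto
  moreover have "B \<union> (A - B) = A" using assms by auto
  ultimately show ?thesis by simp
qed

lemma signed_uminus:
  assumes "\<mu> \<in> signed_measures E"
  shows "(\<lambda>A. - \<mu> A) \<in> signed_measures E"
  using assms unfolding signed_measures_def by (auto intro: sums_minus)

text \<open>If \<open>\<mu>\<close> were unbounded on the subsets of some set, one could split off infinitely many
  disjoint pieces of measure at least 1 in absolute value.\<close>

lemma signed_bounded:
  assumes \<mu>: "\<mu> \<in> signed_measures E"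
  shows "\<exists>c. \<forall>A\<in>sets E. \<bar>\<mu> A\<bar> \<le> c"
proof (rule ccontr)
  assume neg: "\<not> ?thesis"
  define unb where "unb A \<longleftrightarrow> A \<in> sets E \<and> (\<forall>c. \<exists>B\<in>sets E. B \<subseteq> A \<and> \<bar>\<mu> B\<bar> > c)" for A
  have unb0: "unb (space E)"
    using neg sets.sets_into_space unfolding unb_def by (metis not_le sets.top)
  have step: "\<exists>A'. unb A' \<and> (A' \<subseteq> A \<and> \<bar>\<mu> (A - A')\<bar> \<ge> 1)" if A: "unb A" for A
  proof -
    have AE: "A \<in> sets E" using A unb_def by blast
    \<comment> \<open>Whichever of \<open>B\<close> and \<open>A - B\<close> inherits the
      unboundedness is kept, and the other is split off. The margin
      \<open>\<bar>\<mu> A\<bar> + 1\<close> makes both have absolute value at least 1.\<close>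
    obtain B where B: "B \<in> sets E" "B \<subseteq> A" "\<bar>\<mu> B\<bar> > \<bar>\<mu> A\<bar> + 1"
      using A unfolding unb_def by blast
    have d: "\<mu> (A - B) = \<mu> A - \<mu> B" using \<mu> AE B signed_diff by blast
    have "unb B \<or> unb (A - B)"
    proof (rule ccontr)
      assume "\<not> (unb B \<or> unb (A - B))"
      then obtain c1 c2 where c: "\<And>C. C \<in> sets E \<Longrightarrow> C \<subseteq> B \<Longrightarrow> \<bar>\<mu> C\<bar> \<le> c1"
        "\<And>C. C \<in> sets E \<Longrightarrow> C \<subseteq> A - B \<Longrightarrow> \<bar>\<mu> C\<bar> \<le> c2"
        unfolding unb_def using AE B by (metis linorder_not_less sets.Diff)
      obtain C where C: "C \<in> sets E" "C \<subseteq> A" "\<bar>\<mu> C\<bar> > c1 + c2"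
        using A unfolding unb_def by blast
      have "\<mu> ((C \<inter> B) \<union> (C - B)) = \<mu> (C \<inter> B) + \<mu> (C - B)"
        using \<mu> B C by (intro signed_union) auto
      moreover have "(C \<inter> B) \<union> (C - B) = C" by auto
      moreover have "\<bar>\<mu> (C \<inter> B)\<bar> \<le> c1" "\<bar>\<mu> (C - B)\<bar> \<le> c2"
        using B C by (auto intro!: c)
      ultimately show False using C(3) abs_triangle_ineq[of "\<mu> (C \<inter> B)" "\<mu> (C - B)"] by simp
    qed
    then show ?thesis
    proof
      assume "unb B"
      moreover have "\<bar>\<mu> (A - B)\<bar> \<ge> 1" using d B by linarith
      ultimately show ?thesis using B by blast
    next
      assume "unb (A - B)"
      moreover have "A - (A - B) = B" using B by auto
      then have "\<bar>\<mu> (A - (A - B))\<bar> \<ge> 1" using B by simp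
      ultimately show ?thesis by blast
    qed
  qed
  have "\<exists>S. \<forall>n. unb (S n) \<and> (S (Suc n) \<subseteq> S n \<and> \<bar>\<mu> (S n - S (Suc n))\<bar> \<ge> 1)"
    using dependent_nat_choice[of "\<lambda>_. unb" "\<lambda>_ A A'. A' \<subseteq> A \<and> \<bar>\<mu> (A - A')\<bar> \<ge> 1"] unb0 step
    by blast
  then obtain S where S: "\<And>n. unb (S n)" "\<And>n. S (Suc n) \<subseteq> S n"
    "\<And>n::nat. \<bar>\<mu> (S n - S (Suc n))\<bar> \<ge> 1"
    by blast
  have dec: "S n \<subseteq> S m" if "m \<le> n" for m n
    by (rule lift_Suc_antimono_le[of S, OF S(2) that])
  have "disjoint_family (\<lambda>n. S n - S (Suc n))"
    unfolding disjoint_family_on_def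
  proof (intro ballI impI)
    fix m n :: nat assume "m \<noteq> n"
    then consider "Suc m \<le> n" | "Suc n \<le> m" by linarith
    then show "(S m - S (Suc m)) \<inter> (S n - S (Suc n)) = {}"
      by cases (use dec in blast)+
  qed
  moreover have "range (\<lambda>n. S n - S (Suc n)) \<subseteq> sets E"
    using S(1) unfolding unb_def by auto
  ultimately have "(\<lambda>n. \<mu> (S n - S (Suc n))) sums \<mu> (\<Union>n. S n - S (Suc n))"
    using signed_sums[OF \<mu>] by blast
  then have "(\<lambda>n. \<mu> (S n - S (Suc n))) \<longlonglongrightarrow> 0"
    using summable_LIMSEQ_zero sums_summable by blast
  then have "\<forall>\<^sub>F n in sequentially. \<bar>\<mu> (S n - S (Suc n))\<bar> < 1"
    using order_tendstoD(2)[OF tendsto_rabs, of _ 0 sequentially 1] by simp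
  then show False
    using S(3) by (auto simp: eventually_sequentially not_less[symmetric])
qed

section \<open>The Jordan decomposition of a signed measure\<close>

definition pos_part :: "'a measure \<Rightarrow> ('a set \<Rightarrow> real) \<Rightarrow> 'a set \<Rightarrow> real" where
  "pos_part E \<mu> A = (SUP B\<in>{B \<in> sets E. B \<subseteq> A}. \<mu> B)"

lemma pos_part_upper:
  assumes "\<mu> \<in> signed_measures E" "B \<in> sets E" "B \<subseteq> A"
  shows "\<mu> B \<le> pos_part E \<mu> A"
proof -
  obtain c where "\<forall>A\<in>sets E. \<bar>\<mu> A\<bar> \<le> c" using signed_bounded[OF assms(1)] by blast
  then have "bdd_above (\<mu> ` {B \<in> sets E. B \<subseteq> A})"
    by (intro bdd_aboveI[of _ c]) (auto dest: abs_le_D1)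
  then show ?thesis
    unfolding pos_part_def using assms by (intro cSUP_upper) auto
qed

lemma pos_part_least:
  assumes "\<And>B. B \<in> sets E \<Longrightarrow> B \<subseteq> A \<Longrightarrow> \<mu> B \<le> c"
  shows "pos_part E \<mu> A \<le> c"
  unfolding pos_part_def using assms by (intro cSUP_least) auto

lemma pos_part_nonneg:
  assumes "\<mu> \<in> signed_measures E"
  shows "0 \<le> pos_part E \<mu> A"
  using pos_part_upper[OF assms, of "{}" A] signed_empty[OF assms] by simp

lemma pos_part_ennreal:
  assumes \<mu>: "\<mu> \<in> signed_measures E"
  shows "(SUP B\<in>{B \<in> sets E. B \<subseteq> A}. ennreal (\<mu> B)) = ennreal (pos_part E \<mu> A)"
proof (rule antisym)
  show "(SUP B\<in>{B \<in> sets E. B \<subseteq> A}. ennreal (\<mu> B)) \<le> ennreal (pos_part E \<mu> A)"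
    using pos_part_upper[OF \<mu>] by (intro SUP_least ennreal_leI) auto
next
  define S where "S = (SUP B\<in>{B \<in> sets E. B \<subseteq> A}. ennreal (\<mu> B))"
  have up: "ennreal (\<mu> B) \<le> S" if "B \<in> sets E" "B \<subseteq> A" for B
    unfolding S_def using that by (intro SUP_upper) auto
  have "ennreal (pos_part E \<mu> A) \<le> S"
  proof (cases S)
    case (real s)
    have "pos_part E \<mu> A \<le> s"
    proof (rule pos_part_least)
      fix B assume "B \<in> sets E" "B \<subseteq> A"
      then have "ennreal (\<mu> B) \<le> ennreal s" using up real by simp
      then show "\<mu> B \<le> s" using real(1) ennreal_le_iff by blast
    qed
    then show ?thesis using real by (simp add: ennreal_leI)
  qed simp
  then show "ennreal (pos_part E \<mu> A) \<le> (SUP B\<in>{B \<in> sets E. B \<subseteq> A}. ennreal (\<mu> B))"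
    unfolding S_def .
qed

lemma pos_part_superadd:
  assumes \<mu>: "\<mu> \<in> signed_measures E" and "A \<in> sets E" "B \<in> sets E" "A \<inter> B = {}"
  shows "pos_part E \<mu> A + pos_part E \<mu> B \<le> pos_part E \<mu> (A \<union> B)"
proof -
  have "pos_part E \<mu> A \<le> pos_part E \<mu> (A \<union> B) - \<mu> D" if D: "D \<in> sets E" "D \<subseteq> B" for D
  proof (rule pos_part_least)
    fix C assume C: "C \<in> sets E" "C \<subseteq> A"
    have "\<mu> (C \<union> D) = \<mu> C + \<mu> D"
      using \<mu> C D assms(4) by (intro signed_union) auto
    moreover have "\<mu> (C \<union> D) \<le> pos_part E \<mu> (A \<union> B)"
      using \<mu> C D by (intro pos_part_upper) auto
    ultimately show "\<mu> C \<le> pos_part E \<mu> (A \<union> B) - \<mu> D" by simp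
  qed
  then have "pos_part E \<mu> B \<le> pos_part E \<mu> (A \<union> B) - pos_part E \<mu> A"
    by (intro pos_part_least) (simp add: algebra_simps)
  then show ?thesis by simp
qed

text \<open>Superadditivity bounds every partial sum by the value on the union; conversely a
  competitor \<open>B\<close> inside the union is cut into the pieces \<open>B \<inter> F i\<close>,
  each below its own supremum. This works without a Hahn decomposition.\<close>

lemma pos_part_sums:
  assumes \<mu>: "\<mu> \<in> signed_measures E" and F: "range F \<subseteq> sets E" "disjoint_family F"
  shows "(\<lambda>i::nat. pos_part E \<mu> (F i)) sums pos_part E \<mu> (\<Union>i. F i)"
proof -
  have Fi: "F i \<in> sets E" for i using F by auto
  let ?U = "\<Union>i. F i"
  have mono: "pos_part E \<mu> A \<le> pos_part E \<mu> B" if "A \<subseteq> B" for A B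
    using that \<mu> by (intro pos_part_least pos_part_upper) auto
  have part: "(\<Sum>i<n. pos_part E \<mu> (F i)) \<le> pos_part E \<mu> (\<Union>i<n. F i)" for n
  proof (induction n)
    case 0
    then show ?case using pos_part_nonneg[OF \<mu>] by simp
  next
    case (Suc n)
    have "F i \<inter> F n = {}" if "i < n" for i
      using F(2) that unfolding disjoint_family_on_def by (metis UNIV_I nat_neq_iff)
    then have "(\<Union>i<n. F i) \<inter> F n = {}" by blast
    then have "pos_part E \<mu> (\<Union>i<n. F i) + pos_part E \<mu> (F n) \<le> pos_part E \<mu> ((\<Union>i<n. F i) \<union> F n)"
      using \<mu> Fi by (intro pos_part_superadd) auto
    moreover have "(\<Union>i<n. F i) \<union> F n = (\<Union>i<Suc n. F i)"
      by (simp add: lessThan_Suc Un_commute)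
    ultimately show ?case using Suc by simp
  qed
  have part': "(\<Sum>i<n. pos_part E \<mu> (F i)) \<le> pos_part E \<mu> ?U" for n
    by (rule order_trans[OF part mono]) auto
  have s: "summable (\<lambda>i. pos_part E \<mu> (F i))"
    by (rule summableI_nonneg_bounded[where x = "pos_part E \<mu> ?U"])
      (auto simp: pos_part_nonneg[OF \<mu>] part')
  have 1: "(\<Sum>i. pos_part E \<mu> (F i)) \<le> pos_part E \<mu> ?U"
    using s part' by (intro suminf_le_const)
  have 2: "pos_part E \<mu> ?U \<le> (\<Sum>i. pos_part E \<mu> (F i))"
  proof (rule pos_part_least)
    fix B assume B: "B \<in> sets E" "B \<subseteq> ?U"
    have "(\<lambda>i. \<mu> (B \<inter> F i)) sums \<mu> (\<Union>i. B \<inter> F i)"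
      using F B Fi by (intro signed_sums[OF \<mu>]) (auto simp: disjoint_family_on_def)
    moreover have "(\<Union>i. B \<inter> F i) = B" using B by auto
    ultimately have sB: "(\<lambda>i. \<mu> (B \<inter> F i)) sums \<mu> B" by simp
    have "\<mu> (B \<inter> F i) \<le> pos_part E \<mu> (F i)" for i
      using B Fi by (intro pos_part_upper[OF \<mu>]) auto
    from sums_le[OF this sB summable_sums[OF s]]
    show "\<mu> B \<le> (\<Sum>i. pos_part E \<mu> (F i))" .
  qed
  show ?thesis using summable_sums[OF s] antisym[OF 1 2] by simp
qed

lemma sets_pos_variation [simp]: "sets (pos_variation E \<mu>) = sets E"
  by (simp add: pos_variation_def)

lemma space_pos_variation [simp]: "space (pos_variation E \<mu>) = space E"
  by (simp add: pos_variation_def)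

lemma emeasure_pos_variation:
  assumes \<mu>: "\<mu> \<in> signed_measures E" and A: "A \<in> sets E"
  shows "emeasure (pos_variation E \<mu>) A = ennreal (pos_part E \<mu> A)"
proof -
  have "emeasure (pos_variation E \<mu>) A = (SUP B\<in>{B \<in> sets E. B \<subseteq> A}. ennreal (\<mu> B))"
    unfolding pos_variation_def
  proof (rule emeasure_measure_of_sigma[OF sets.sigma_algebra_axioms _ _ A])
    have 0: "pos_part E \<mu> {} = 0"
      using signed_empty[OF \<mu>] pos_part_nonneg[OF \<mu>, of "{}"]
      by (intro antisym pos_part_least) auto
    show "positive (sets E) (\<lambda>A. SUP B\<in>{B \<in> sets E. B \<subseteq> A}. ennreal (\<mu> B))"
      unfolding pos_part_ennreal[OF \<mu>] positive_def using 0 by simp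
    show "countably_additive (sets E) (\<lambda>A. SUP B\<in>{B \<in> sets E. B \<subseteq> A}. ennreal (\<mu> B))"
      unfolding pos_part_ennreal[OF \<mu>] countably_additive_def
    proof (intro allI impI)
      fix F :: "nat \<Rightarrow> 'a set" assume F: "range F \<subseteq> sets E" "disjoint_family F"
      have "(\<lambda>i. pos_part E \<mu> (F i)) sums pos_part E \<mu> (\<Union>i. F i)"
        by (rule pos_part_sums[OF \<mu> F])
      then show "(\<Sum>i. ennreal (pos_part E \<mu> (F i))) = ennreal (pos_part E \<mu> (\<Union> (range F)))"
        using pos_part_nonneg[OF \<mu>] by (intro suminf_ennreal_eq) auto
    qed
  qed
  then show ?thesis unfolding pos_part_ennreal[OF \<mu>] .
qed

lemma finite_pos_variation:
  assumes "\<mu> \<in> signed_measures E"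
  shows "finite_measure (pos_variation E \<mu>)"
  by (rule finite_measureI)
    (simp add: emeasure_pos_variation[OF assms sets.top])

lemma measure_pos_variation:
  assumes "\<mu> \<in> signed_measures E" "A \<in> sets E"
  shows "measure (pos_variation E \<mu>) A = pos_part E \<mu> A"
  using emeasure_pos_variation[OF assms] pos_part_nonneg[OF assms(1)]
  by (simp add: measure_def)

text \<open>Passing from a competitor \<open>B\<close> to \<open>A - B\<close> compares the positive
  part with the negative one. Applying the resulting inequality to the measure and to its negative
  gives equality.\<close>

lemma jordan:
  assumes \<mu>: "\<mu> \<in> signed_measures E" and A: "A \<in> sets E"
  shows "pos_part E \<mu> A - pos_part E (\<lambda>A. - \<mu> A) A = \<mu> A"
proof -
  have le: "pos_part E \<nu> A \<le> \<nu> A + pos_part E (\<lambda>A. - \<nu> A) A"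
    if \<nu>: "\<nu> \<in> signed_measures E" for \<nu>
  proof (rule pos_part_least)
    fix B assume B: "B \<in> sets E" "B \<subseteq> A"
    have "- \<nu> (A - B) \<le> pos_part E (\<lambda>A. - \<nu> A) A"
      using B A by (intro pos_part_upper[OF signed_uminus[OF \<nu>]]) auto
    then show "\<nu> B \<le> \<nu> A + pos_part E (\<lambda>A. - \<nu> A) A"
      using signed_diff[OF \<nu> A B] by simp
  qed
  show ?thesis using le[OF \<mu>] le[OF signed_uminus[OF \<mu>]] by simp
qed

section \<open>Bounded measurable functions\<close>

lemma bdd_measI:
  assumes "f \<in> borel_measurable E" "\<And>x. x \<in> space E \<Longrightarrow> \<bar>f x\<bar> \<le> c"
  shows "f \<in> bdd_meas E"
  using assms unfolding bdd_meas_def bounded_iff by auto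

lemma bdd_meas_measurable [measurable_dest]: "f \<in> bdd_meas E \<Longrightarrow> f \<in> borel_measurable E"
  unfolding bdd_meas_def by auto

lemma bdd_measE:
  assumes "f \<in> bdd_meas E"
  obtains c where "c > 0" "\<And>x. x \<in> space E \<Longrightarrow> \<bar>f x\<bar> \<le> c"
proof -
  obtain c where "\<forall>x\<in>space E. \<bar>f x\<bar> \<le> c"
    using assms unfolding bdd_meas_def bounded_iff by auto
  then show ?thesis using that[of "max c 1"] by fastforce
qed

lemma bdd_meas_lincomb [intro]:
  assumes "f \<in> bdd_meas E" "g \<in> bdd_meas E"
  shows "(\<lambda>x. a * f x + b * g x) \<in> bdd_meas E"
proof -
  obtain c where c: "\<And>x. x \<in> space E \<Longrightarrow> \<bar>f x\<bar> \<le> c" using assms(1) by (rule bdd_measE) blast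
  obtain d where d: "\<And>x. x \<in> space E \<Longrightarrow> \<bar>g x\<bar> \<le> d" using assms(2) by (rule bdd_measE) blast
  show ?thesis
  proof (rule bdd_measI[where c = "\<bar>a\<bar> * c + \<bar>b\<bar> * d"])
    show "(\<lambda>x. a * f x + b * g x) \<in> borel_measurable E"
      using assms[THEN bdd_meas_measurable] by measurable
    fix x assume "x \<in> space E"
    then show "\<bar>a * f x + b * g x\<bar> \<le> \<bar>a\<bar> * c + \<bar>b\<bar> * d"
      using c d by (intro order_trans[OF abs_triangle_ineq] add_mono) (auto simp: abs_mult mult_left_mono)
  qed
qed

lemma bdd_meas_mult [intro]:
  assumes "f \<in> bdd_meas E" "g \<in> bdd_meas E"
  shows "(\<lambda>x. f x * g x) \<in> bdd_meas E"
proof -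
  obtain c where c: "c > 0" "\<And>x. x \<in> space E \<Longrightarrow> \<bar>f x\<bar> \<le> c" using assms(1) by (rule bdd_measE) blast
  obtain d where d: "\<And>x. x \<in> space E \<Longrightarrow> \<bar>g x\<bar> \<le> d" using assms(2) by (rule bdd_measE) blast
  show ?thesis
  proof (rule bdd_measI[where c = "c * d"])
    show "(\<lambda>x. f x * g x) \<in> borel_measurable E"
      using assms[THEN bdd_meas_measurable] by measurable
    fix x assume "x \<in> space E"
    then show "\<bar>f x * g x\<bar> \<le> c * d"
      unfolding abs_mult using c d by (intro mult_mono) auto
  qed
qed

lemma bdd_meas_const [intro, simp]: "(\<lambda>_. c) \<in> bdd_meas E"
  by (rule bdd_measI[where c = "\<bar>c\<bar>"]) auto

lemma bdd_meas_cmult [intro]: "f \<in> bdd_meas E \<Longrightarrow> (\<lambda>x. c * f x) \<in> bdd_meas E"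
  by (rule bdd_meas_mult) auto

lemma bdd_meas_diff [intro]:
  "f \<in> bdd_meas E \<Longrightarrow> g \<in> bdd_meas E \<Longrightarrow> (\<lambda>x. f x - g x) \<in> bdd_meas E"
  using bdd_meas_lincomb[of f E g 1 "- 1"] by simp

lemma bdd_meas_add [intro]:
  "f \<in> bdd_meas E \<Longrightarrow> g \<in> bdd_meas E \<Longrightarrow> (\<lambda>x. f x + g x) \<in> bdd_meas E"
  using bdd_meas_lincomb[of f E g 1 1] by simp

lemma bdd_meas_sum [intro]:
  "(\<And>i. i \<in> I \<Longrightarrow> f i \<in> bdd_meas E) \<Longrightarrow> (\<lambda>x. \<Sum>i\<in>I. f i x) \<in> bdd_meas E"
  by (induction I rule: infinite_finite_induct) auto

lemma bdd_meas_power2 [intro]: "f \<in> bdd_meas E \<Longrightarrow> (\<lambda>x. (f x)\<^sup>2) \<in> bdd_meas E"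
  unfolding power2_eq_square by (rule bdd_meas_mult)

lemma bdd_meas_indicator [intro, simp]: "A \<in> sets E \<Longrightarrow> indicator A \<in> bdd_meas E"
  by (rule bdd_measI[where c = 1]) (auto simp: indicator_def)

lemma bdd_meas_integrable:
  assumes "finite_measure M" "sets M = sets E" "f \<in> bdd_meas E"
  shows "integrable M f"
proof -
  obtain c where c: "\<And>x. x \<in> space E \<Longrightarrow> \<bar>f x\<bar> \<le> c" using assms(3) by (rule bdd_measE) blast
  show ?thesis
  proof (rule finite_measure.integrable_const_bound[OF assms(1), where B = c])
    show "AE x in M. norm (f x) \<le> c"
      using c sets_eq_imp_space_eq[OF assms(2)] by auto
    show "f \<in> borel_measurable M"
      using assms(2,3) bdd_meas_measurable measurable_cong_sets[of M E] by blast
  qed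
qed

text \<open>Rounding \<open>f\<close> down to the multiples of \<open>e\<close> leaves finitely many
  values, because \<open>f\<close> is bounded.\<close>

lemma bdd_meas_approx:
  assumes f: "f \<in> bdd_meas E" and e: "e > 0"
  shows "\<exists>g. simple_function E g \<and> (\<forall>x\<in>space E. \<bar>f x - g x\<bar> \<le> e)"
proof (intro exI conjI ballI)
  let ?g = "\<lambda>x. e * of_int \<lfloor>f x / e\<rfloor>"
  have [measurable]: "f \<in> borel_measurable E" using f by (rule bdd_meas_measurable)
  obtain c where c: "\<And>x. x \<in> space E \<Longrightarrow> \<bar>f x\<bar> \<le> c" using f by (rule bdd_measE) blast
  have "?g ` space E \<subseteq> (\<lambda>k. e * of_int k) ` {\<lfloor>- c / e\<rfloor>..\<lfloor>c / e\<rfloor>}"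
  proof
    fix y assume "y \<in> ?g ` space E"
    then obtain x where x: "x \<in> space E" "y = ?g x" by blast
    have "- c / e \<le> f x / e" "f x / e \<le> c / e"
      using c[OF x(1)] e by (auto intro: divide_right_mono simp only: abs_le_iff minus_le_iff)
    then have "\<lfloor>f x / e\<rfloor> \<in> {\<lfloor>- c / e\<rfloor>..\<lfloor>c / e\<rfloor>}"
      by (auto intro: floor_mono simp del: minus_divide_left[symmetric])
    then show "y \<in> (\<lambda>k. e * of_int k) ` {\<lfloor>- c / e\<rfloor>..\<lfloor>c / e\<rfloor>}"
      using x by blast
  qed
  then have "finite (?g ` space E)" using finite_subset by blast
  moreover have "?g \<in> borel_measurable E" by measurable
  ultimately show "simple_function E ?g" by (rule simple_function_borel_measurable[rotated])
  fix x assume "x \<in> space E"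
  have "\<bar>f x / e - of_int \<lfloor>f x / e\<rfloor>\<bar> \<le> 1" by linarith
  moreover have "f x - ?g x = e * (f x / e - of_int \<lfloor>f x / e\<rfloor>)"
    using e by (simp add: right_diff_distrib)
  ultimately show "\<bar>f x - ?g x\<bar> \<le> e"
    using e by (simp add: abs_mult mult_left_le)
qed

lemma simple_bdd_meas: "simple_function E f \<Longrightarrow> f \<in> bdd_meas (E :: 'a measure)" for f :: "'a \<Rightarrow> real"
  unfolding bdd_meas_def simple_function_def
  by (auto intro: borel_measurable_simple_function simple_functionD finite_imp_bounded simp: simple_function_def)

section \<open>Bounded linear functionals and the signed measures behind them\<close>

definition bdd_functional :: "'a measure \<Rightarrow> (('a \<Rightarrow> real) \<Rightarrow> real) \<Rightarrow> real \<Rightarrow> bool" where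
  "bdd_functional E l C \<longleftrightarrow>
     (\<forall>f\<in>bdd_meas E. \<forall>g\<in>bdd_meas E. \<forall>a b. l (\<lambda>x. a * f x + b * g x) = a * l f + b * l g) \<and>
     (\<forall>f\<in>bdd_meas E. \<forall>c. (\<forall>x\<in>space E. \<bar>f x\<bar> \<le> c) \<longrightarrow> \<bar>l f\<bar> \<le> C * c)"

lemma bdd_functional_lincomb:
  "bdd_functional E l C \<Longrightarrow> f \<in> bdd_meas E \<Longrightarrow> g \<in> bdd_meas E \<Longrightarrow>
     l (\<lambda>x. a * f x + b * g x) = a * l f + b * l g"
  unfolding bdd_functional_def by blast

lemma bdd_functional_bound:
  "bdd_functional E l C \<Longrightarrow> f \<in> bdd_meas E \<Longrightarrow> (\<And>x. x \<in> space E \<Longrightarrow> \<bar>f x\<bar> \<le> c) \<Longrightarrow> \<bar>l f\<bar> \<le> C * c"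
  unfolding bdd_functional_def by blast

lemma bdd_functional_diff:
  assumes "bdd_functional E l C" "f \<in> bdd_meas E" "g \<in> bdd_meas E"
  shows "l (\<lambda>x. f x - g x) = l f - l g"
  using bdd_functional_lincomb[OF assms, of 1 "- 1"] by simp

lemma bdd_functional_0:
  assumes "bdd_functional E l C"
  shows "l (\<lambda>x. 0) = 0"
  using bdd_functional_lincomb[OF assms bdd_meas_const bdd_meas_const, of 0 0 0 0] by simp

text \<open>The norm bound refers to pointwise bounds on \<open>space E\<close> alone, so a
  difference that vanishes there is bounded by \<open>C * 0\<close>.\<close>

lemma bdd_functional_cong:
  assumes "bdd_functional E l C" "f \<in> bdd_meas E" "g \<in> bdd_meas E" "\<And>x. x \<in> space E \<Longrightarrow> f x = g x"
  shows "l f = l g"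
proof -
  have "\<bar>l (\<lambda>x. f x - g x)\<bar> \<le> C * 0"
    using assms by (intro bdd_functional_bound[OF assms(1)]) auto
  then show ?thesis using bdd_functional_diff[OF assms(1-3)] by simp
qed

lemma bdd_functional_sum:
  assumes l: "bdd_functional E l C" and "finite I" "\<And>i. i \<in> I \<Longrightarrow> f i \<in> bdd_meas E"
  shows "l (\<lambda>x. \<Sum>i\<in>I. a i * f i x) = (\<Sum>i\<in>I. a i * l (f i))"
  using assms(2,3)
proof (induction I rule: finite_induct)
  case empty
  then show ?case using bdd_functional_0[OF l] by simp
next
  case (insert i I)
  have "l (\<lambda>x. a i * f i x + 1 * (\<Sum>i\<in>I. a i * f i x)) = a i * l (f i) + 1 * l (\<lambda>x. \<Sum>i\<in>I. a i * f i x)"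
    using insert by (intro bdd_functional_lincomb[OF l] bdd_meas_sum bdd_meas_cmult) auto
  then show ?case using insert by simp
qed

lemma bdd_functional_simple:
  fixes g :: "'a \<Rightarrow> real"
  assumes l: "bdd_functional E l C" and g: "simple_function E g"
  shows "l g = (\<Sum>y\<in>g ` space E. y * l (indicator (g -` {y} \<inter> space E)))"
proof -
  have S: "g -` {y} \<inter> space E \<in> sets E" for y using g by (rule simple_functionD)
  have "l g = l (\<lambda>x. \<Sum>y\<in>g ` space E. y * indicator (g -` {y} \<inter> space E) x)"
  proof (rule bdd_functional_cong[OF l simple_bdd_meas[OF g]])
    show "(\<lambda>x. \<Sum>y\<in>g ` space E. y * indicator (g -` {y} \<inter> space E) x) \<in> bdd_meas E"
      using S by (intro bdd_meas_sum bdd_meas_cmult) auto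
    fix x assume x: "x \<in> space E"
    have "(\<Sum>y\<in>g ` space E. y * indicator (g -` {y} \<inter> space E) x) = (\<Sum>y\<in>g ` space E. if y = g x then y else 0)"
      using x by (intro sum.cong) (auto simp: indicator_def)
    also have "\<dots> = g x"
      using simple_functionD(1)[OF g] x by (simp add: sum.delta)
    finally show "g x = (\<Sum>y\<in>g ` space E. y * indicator (g -` {y} \<inter> space E) x)" by simp
  qed
  also have "\<dots> = (\<Sum>y\<in>g ` space E. y * l (indicator (g -` {y} \<inter> space E)))"
    using S simple_functionD(1)[OF g] by (intro bdd_functional_sum[OF l]) auto
  finally show ?thesis .
qed

text \<open>Agreement on indicators passes to simple functions by linearity and then to bounded
  functions by uniform approximation. This is the standard way, here and below, of lifting an
  identity from sets to functions.\<close>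

lemma bdd_functional_unique:
  assumes l: "bdd_functional E l C" and l': "bdd_functional E l' C'"
    and eq: "\<And>A. A \<in> sets E \<Longrightarrow> l (indicator A) = l' (indicator A)"
    and f: "f \<in> bdd_meas E"
  shows "l f = l' f"
proof (rule ccontr)
  assume neq: "l f \<noteq> l' f"
  define d where "d = \<bar>l f - l' f\<bar>"
  \<comment> \<open>The two approximation errors then add up to at most \<open>d / 2\<close>; the
    summand 1 keeps the denominator positive.\<close>
  define e where "e = d / (2 * (\<bar>C\<bar> + \<bar>C'\<bar> + 1))"
  have "d > 0" using neq by (simp add: d_def)
  then have e: "e > 0" unfolding e_def by simp
  obtain g where g: "simple_function E g" "\<And>x. x \<in> space E \<Longrightarrow> \<bar>f x - g x\<bar> \<le> e"
    using bdd_meas_approx[OF f e] by blast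
  have gb: "g \<in> bdd_meas E" by (rule simple_bdd_meas[OF g(1)])
  have "l g = l' g"
    unfolding bdd_functional_simple[OF l g(1)] bdd_functional_simple[OF l' g(1)]
    using eq simple_functionD(2)[OF g(1)] by simp
  moreover have "\<bar>l f - l g\<bar> \<le> C * e" "\<bar>l' f - l' g\<bar> \<le> C' * e"
    unfolding bdd_functional_diff[OF l f gb, symmetric] bdd_functional_diff[OF l' f gb, symmetric]
    using f gb g(2) by (auto intro!: bdd_functional_bound[OF l] bdd_functional_bound[OF l'])
  ultimately have "d \<le> C * e + C' * e" unfolding d_def by linarith
  also have "\<dots> \<le> (\<bar>C\<bar> + \<bar>C'\<bar> + 1) * e"
    unfolding distrib_right using e by (intro add_increasing2 add_mono mult_right_mono) auto
  also have "\<dots> = d / 2" unfolding e_def by (simp add: field_simps)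
  finally show False using \<open>d > 0\<close> by simp
qed

lemma integral_bdd_functional:
  assumes "finite_measure M" "sets M = sets E"
  shows "bdd_functional E (\<lambda>f. \<integral>x. f x \<partial>M) (measure M (space M))"
  unfolding bdd_functional_def
proof (intro conjI ballI allI impI)
  fix f g a b assume "f \<in> bdd_meas E" "g \<in> bdd_meas E"
  then show "(\<integral>x. a * f x + b * g x \<partial>M) = a * (\<integral>x. f x \<partial>M) + b * (\<integral>x. g x \<partial>M)"
    using bdd_meas_integrable[OF assms] by simp
next
  interpret finite_measure M by fact
  fix f c assume f: "f \<in> bdd_meas E" "\<forall>x\<in>space E. \<bar>f x\<bar> \<le> c"
  have "\<bar>\<integral>x. f x \<partial>M\<bar> \<le> (\<integral>x. \<bar>f x\<bar> \<partial>M)" by (rule integral_abs_bound)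
  also have "\<dots> \<le> (\<integral>x. c \<partial>M)"
    using f bdd_meas_integrable[OF assms f(1)] sets_eq_imp_space_eq[OF assms(2)]
    by (intro integral_mono) auto
  finally show "\<bar>\<integral>x. f x \<partial>M\<bar> \<le> measure M (space M) * c" by (simp add: mult.commute)
qed

lemma bdd_functional_lin:
  assumes l: "bdd_functional E l C" and l': "bdd_functional E l' C'"
  shows "bdd_functional E (\<lambda>f. a * l f + b * l' f) (\<bar>a\<bar> * C + \<bar>b\<bar> * C')"
  unfolding bdd_functional_def
proof (intro conjI ballI allI impI)
  fix f g s t assume "f \<in> bdd_meas E" "g \<in> bdd_meas E"
  then show "a * l (\<lambda>x. s * f x + t * g x) + b * l' (\<lambda>x. s * f x + t * g x) =
      s * (a * l f + b * l' f) + t * (a * l g + b * l' g)"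
    by (simp add: bdd_functional_lincomb[OF l] bdd_functional_lincomb[OF l'] algebra_simps)
next
  fix f c assume "f \<in> bdd_meas E" "\<forall>x\<in>space E. \<bar>f x\<bar> \<le> c"
  then have "\<bar>l f\<bar> \<le> C * c" "\<bar>l' f\<bar> \<le> C' * c"
    by (auto intro!: bdd_functional_bound[OF l] bdd_functional_bound[OF l'])
  then have "\<bar>a\<bar> * \<bar>l f\<bar> \<le> \<bar>a\<bar> * (C * c)" "\<bar>b\<bar> * \<bar>l' f\<bar> \<le> \<bar>b\<bar> * (C' * c)"
    by (auto intro: mult_left_mono)
  moreover have "\<bar>a * l f + b * l' f\<bar> \<le> \<bar>a\<bar> * \<bar>l f\<bar> + \<bar>b\<bar> * \<bar>l' f\<bar>"
    by (metis abs_mult abs_triangle_ineq)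
  ultimately show "\<bar>a * l f + b * l' f\<bar> \<le> (\<bar>a\<bar> * C + \<bar>b\<bar> * C') * c"
    by (simp add: algebra_simps)
qed

lemma sm_bdd_functional:
  assumes \<mu>: "\<mu> \<in> signed_measures E"
  shows "\<exists>C. bdd_functional E (sm_integral E \<mu>) C"
proof -
  note \<mu>' = signed_uminus[OF \<mu>]
  have "bdd_functional E (\<lambda>f. 1 * (\<integral>x. f x \<partial>pos_variation E \<mu>)
      + (-1) * (\<integral>x. f x \<partial>pos_variation E (\<lambda>A. - \<mu> A)))
      (\<bar>1\<bar> * measure (pos_variation E \<mu>) (space (pos_variation E \<mu>))
      + \<bar>-1\<bar> * measure (pos_variation E (\<lambda>A. - \<mu> A)) (space (pos_variation E (\<lambda>A. - \<mu> A))))"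
    by (intro bdd_functional_lin integral_bdd_functional finite_pos_variation \<mu> \<mu>') auto
  then show ?thesis unfolding sm_integral_def by auto
qed

lemma sm_integral_indicator:
  assumes \<mu>: "\<mu> \<in> signed_measures E" and A: "A \<in> sets E"
  shows "sm_integral E \<mu> (indicator A) = \<mu> A"
proof -
  have [simp]: "A \<inter> space E = A" using sets.sets_into_space[OF A] by auto
  show ?thesis
    unfolding sm_integral_def using A jordan[OF \<mu> A]
    by (simp add: measure_pos_variation[OF \<mu>] measure_pos_variation[OF signed_uminus[OF \<mu>]])
qed

text \<open>Integrals against a signed measure are computed by exhibiting any bounded functional
  with the right values on sets, so the Jordan decomposition never has to be found
  explicitly.\<close>

lemma sm_integral_eqI:
  assumes "\<mu> \<in> signed_measures E" "bdd_functional E l C" "f \<in> bdd_meas E"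
    and "\<And>A. A \<in> sets E \<Longrightarrow> l (indicator A) = \<mu> A"
  shows "sm_integral E \<mu> f = l f"
proof -
  obtain C' where C': "bdd_functional E (sm_integral E \<mu>) C'" using sm_bdd_functional[OF assms(1)] by blast
  show ?thesis
    by (rule bdd_functional_unique[OF C' assms(2) _ assms(3)])
      (simp add: sm_integral_indicator[OF assms(1)] assms(4))
qed

lemma sm_integral_lincomb:
  assumes "\<mu> \<in> signed_measures E" "f \<in> bdd_meas E" "g \<in> bdd_meas E"
  shows "sm_integral E \<mu> (\<lambda>x. a * f x + b * g x) = a * sm_integral E \<mu> f + b * sm_integral E \<mu> g"
proof -
  obtain C where "bdd_functional E (sm_integral E \<mu>) C" using sm_bdd_functional[OF assms(1)] by blast
  from bdd_functional_lincomb[OF this assms(2,3)] show ?thesis .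
qed

text \<open>Bounded pointwise convergence to 0. Continuity along such sequences is what separates
  countably additive functionals from merely finitely additive ones.\<close>

definition bp_null :: "'a measure \<Rightarrow> (nat \<Rightarrow> 'a \<Rightarrow> real) \<Rightarrow> bool" where
  "bp_null E f \<longleftrightarrow> (\<forall>k. f k \<in> bdd_meas E) \<and> (\<exists>c. \<forall>k. \<forall>x\<in>space E. \<bar>f k x\<bar> \<le> c) \<and>
     (\<forall>x\<in>space E. (\<lambda>k. f k x) \<longlonglongrightarrow> 0)"

lemma bp_null_integral:
  assumes "finite_measure M" "sets M = sets E" "bp_null E f"
  shows "(\<lambda>k. \<integral>x. f k x \<partial>M) \<longlonglongrightarrow> 0"
proof -
  obtain c where c: "\<And>k x. x \<in> space E \<Longrightarrow> \<bar>f k x\<bar> \<le> c"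
    using assms(3) unfolding bp_null_def by blast
  have [simp]: "space M = space E" using sets_eq_imp_space_eq[OF assms(2)] .
  have m: "f k \<in> borel_measurable M" for k
    using assms(3) measurable_cong_sets[OF assms(2) refl] bdd_meas_measurable unfolding bp_null_def by blast
  have "(\<lambda>k. \<integral>x. f k x \<partial>M) \<longlonglongrightarrow> (\<integral>x. 0 \<partial>M)"
  proof (rule integral_dominated_convergence[where w = "\<lambda>_. c"])
    show "integrable M (\<lambda>_. c)" using assms(1) by (simp add: finite_measure.integrable_const)
    show "AE x in M. (\<lambda>k. f k x) \<longlonglongrightarrow> 0" using assms(3) unfolding bp_null_def by auto
  qed (use c m in auto)
  then show ?thesis by simp
qed

lemma sm_integral_bp_null:
  assumes \<mu>: "\<mu> \<in> signed_measures E" and f: "bp_null E f"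
  shows "(\<lambda>k. sm_integral E \<mu> (f k)) \<longlonglongrightarrow> 0"
proof -
  have "(\<lambda>k. sm_integral E \<mu> (f k)) \<longlonglongrightarrow> 0 - 0"
    unfolding sm_integral_def
    by (intro tendsto_diff bp_null_integral[OF _ _ f] finite_pos_variation \<mu> signed_uminus[OF \<mu>]) auto
  then show ?thesis by simp
qed

text \<open>A representation in the style of Daniell: the indicator of a disjoint union minus its
  partial sums is bounded by 1 and eventually 0 at every point, so the assumed continuity is
  countable additivity.\<close>

lemma functional_signed_measure:
  assumes l: "bdd_functional E l C"
    and c: "\<And>f. bp_null E f \<Longrightarrow> (\<lambda>k. l (f k)) \<longlonglongrightarrow> 0"
  shows "(\<lambda>A. if A \<in> sets E then l (indicator A) else 0) \<in> signed_measures E"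
  unfolding signed_measures_def
proof (intro CollectI conjI allI impI)
  fix F :: "nat \<Rightarrow> 'a set" assume F: "range F \<subseteq> sets E" "disjoint_family F"
  have Fi: "F i \<in> sets E" for i using F by auto
  let ?U = "\<Union>i. F i"
  let ?r = "\<lambda>n x. indicator ?U x - (\<Sum>i<n. 1 * indicator (F i) x) :: real"
  have sum: "(\<Sum>i<n. 1 * indicator (F i) x) = (indicator (\<Union>i<n. F i) x :: real)" for n x
    using F(2) by (subst indicator_UN_disjoint) (auto simp: disjoint_family_on_def)
  have "bp_null E ?r"
    unfolding bp_null_def
  proof (intro conjI allI ballI exI)
    show "?r n \<in> bdd_meas E" for n using Fi by (intro bdd_meas_diff bdd_meas_sum bdd_meas_cmult) auto
    show "\<bar>?r n x\<bar> \<le> 1" for n x unfolding sum by (auto simp: indicator_def)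
    show "(\<lambda>n. ?r n x) \<longlonglongrightarrow> 0" for x
    proof -
      have "\<exists>n0. \<forall>n\<ge>n0. ?r n x = 0"
      proof (cases "x \<in> ?U")
        case True
        then obtain i where "x \<in> F i" by blast
        then show ?thesis unfolding sum by (intro exI[of _ "Suc i"]) (auto simp: indicator_def)
      qed (auto simp: sum indicator_def)
      then show ?thesis by (intro tendsto_eventually) (auto simp: eventually_sequentially)
    qed
  qed
  then have "(\<lambda>n. l (?r n)) \<longlonglongrightarrow> 0" by (rule c)
  moreover have "l (?r n) = l (indicator ?U) - (\<Sum>i<n. l (indicator (F i)))" for n
  proof -
    have "l (?r n) = l (indicator ?U) - l (\<lambda>x. \<Sum>i<n. 1 * indicator (F i) x)"
      using Fi by (intro bdd_functional_diff[OF l] bdd_meas_sum bdd_meas_cmult) auto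
    also have "l (\<lambda>x. \<Sum>i<n. 1 * indicator (F i) x) = (\<Sum>i<n. 1 * l (indicator (F i)))"
      using Fi by (intro bdd_functional_sum[OF l]) auto
    finally show ?thesis by simp
  qed
  ultimately have "(\<lambda>n. l (indicator ?U) - (\<Sum>i<n. l (indicator (F i)))) \<longlonglongrightarrow> 0" by simp
  then have "(\<lambda>n. \<Sum>i<n. l (indicator (F i))) \<longlonglongrightarrow> l (indicator ?U)"
    by (subst (asm) tendsto_iff, subst tendsto_iff) (simp add: dist_real_def abs_minus_commute)
  then show "(\<lambda>i. if F i \<in> sets E then l (indicator (F i)) else 0) sums
      (if ?U \<in> sets E then l (indicator ?U) else 0)"
    using Fi by (simp add: sums_def)
qed auto

section \<open>Oscillation\<close>

lemma osc_le_iff: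
  "osc E f \<le> ennreal c \<longleftrightarrow> (\<forall>x\<in>space E. \<forall>y\<in>space E. \<bar>f x - f y\<bar> \<le> c)" if "c \<ge> 0"
  using that unfolding osc_def by (auto simp: SUP_le_iff ennreal_le_iff)

lemma osc_le:
  assumes "\<And>x y. x \<in> space E \<Longrightarrow> y \<in> space E \<Longrightarrow> \<bar>f x - f y\<bar> \<le> c"
  shows "osc E f \<le> ennreal c"
  using assms unfolding osc_def by (auto intro!: SUP_least ennreal_leI)

lemma osc_finite:
  assumes "f \<in> bdd_meas E"
  shows "osc E f < \<infinity>"
proof -
  obtain c where c: "\<And>x. x \<in> space E \<Longrightarrow> \<bar>f x\<bar> \<le> c" using assms by (rule bdd_measE) blast
  have "osc E f \<le> ennreal (2 * c)"
  proof (rule osc_le)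
    fix x y assume "x \<in> space E" "y \<in> space E"
    then show "\<bar>f x - f y\<bar> \<le> 2 * c" using c[of x] c[of y] by linarith
  qed
  then show ?thesis by (auto intro: le_less_trans)
qed

text \<open>The conversion sends an infinite oscillation to 0, so exact comparisons with
  \<open>osc\<close> go through \<open>osc_eq_rosc\<close>, which is restricted to bounded
  functions.\<close>

definition rosc :: "'a measure \<Rightarrow> ('a \<Rightarrow> real) \<Rightarrow> real" where
  "rosc E f = enn2real (osc E f)"

lemma rosc_nonneg: "0 \<le> rosc E f" by (simp add: rosc_def)

lemma osc_eq_rosc: "f \<in> bdd_meas E \<Longrightarrow> osc E f = ennreal (rosc E f)"
  using osc_finite[of f E] by (simp add: rosc_def)

lemma rosc_bound:
  assumes "f \<in> bdd_meas E" "x \<in> space E" "y \<in> space E"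
  shows "\<bar>f x - f y\<bar> \<le> rosc E f"
proof -
  have "osc E f \<le> ennreal (rosc E f)" using osc_eq_rosc[OF assms(1)] by simp
  then show ?thesis using osc_le_iff[of "rosc E f" E f] rosc_nonneg[of E f] assms by auto
qed

lemma rosc_le:
  assumes "c \<ge> 0" "\<And>x y. x \<in> space E \<Longrightarrow> y \<in> space E \<Longrightarrow> \<bar>f x - f y\<bar> \<le> c"
  shows "rosc E f \<le> c"
  using osc_le[of E f c, OF assms(2)] assms(1) unfolding rosc_def
  by (simp add: enn2real_leI)

lemma Osc1_bdd_meas:
  assumes "f \<in> Osc1 E"
  shows "f \<in> bdd_meas E" "rosc E f \<le> 1"
proof -
  have m: "f \<in> borel_measurable E" and o: "osc E f \<le> ennreal 1" using assms by (auto simp: Osc1_def)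
  have o': "\<bar>f x - f y\<bar> \<le> 1" if "x \<in> space E" "y \<in> space E" for x y
    using o that osc_le_iff[of 1 E f] by auto
  show "f \<in> bdd_meas E"
  proof (cases "space E = {}")
    case True
    then show ?thesis using m by (intro bdd_measI[where c = 0]) auto
  next
    case False
    then obtain y where y: "y \<in> space E" by blast
    show ?thesis
    proof (rule bdd_measI[OF m, where c = "\<bar>f y\<bar> + 1"])
      fix x assume "x \<in> space E"
      then show "\<bar>f x\<bar> \<le> \<bar>f y\<bar> + 1" using o'[of x y] y by linarith
    qed
  qed
  show "rosc E f \<le> 1" using o' by (intro rosc_le) auto
qed

lemma Osc1I:
  assumes "f \<in> bdd_meas E" "rosc E f \<le> 1"
  shows "f \<in> Osc1 E"
  using assms osc_eq_rosc[OF assms(1)] bdd_meas_measurable[OF assms(1)]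
  by (simp add: Osc1_def)

lemma rosc_cmult:
  assumes "f \<in> bdd_meas E"
  shows "rosc E (\<lambda>x. c * f x) \<le> \<bar>c\<bar> * rosc E f"
proof (rule rosc_le)
  fix x y assume "x \<in> space E" "y \<in> space E"
  then have "\<bar>c\<bar> * \<bar>f x - f y\<bar> \<le> \<bar>c\<bar> * rosc E f"
    using rosc_bound[OF assms] by (intro mult_left_mono) auto
  then show "\<bar>c * f x - c * f y\<bar> \<le> \<bar>c\<bar> * rosc E f"
    by (metis abs_mult right_diff_distrib)
qed (simp add: rosc_nonneg)

lemma rosc_le_sup:
  assumes "\<And>x. x \<in> space E \<Longrightarrow> \<bar>f x\<bar> \<le> c" "c \<ge> 0"
  shows "rosc E f \<le> 2 * c"
proof (rule rosc_le)
  fix x y assume "x \<in> space E" "y \<in> space E"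
  then show "\<bar>f x - f y\<bar> \<le> 2 * c" using assms(1)[of x] assms(1)[of y] by linarith
qed (use assms(2) in simp)

section \<open>Near-maximizers of a linear functional minus a quadratic form\<close>

definition lin_on :: "('i \<Rightarrow> real) set \<Rightarrow> (('i \<Rightarrow> real) \<Rightarrow> real) \<Rightarrow> bool" where
  "lin_on T l \<longleftrightarrow> (\<forall>f\<in>T. \<forall>g\<in>T. \<forall>a b. l (\<lambda>i. a * f i + b * g i) = a * l f + b * l g)"

lemma lin_onD: "lin_on T l \<Longrightarrow> f \<in> T \<Longrightarrow> g \<in> T \<Longrightarrow> l (\<lambda>i. a * f i + b * g i) = a * l f + b * l g"
  unfolding lin_on_def by blast

text \<open>A discriminant argument: the left side is maximal at \<open>t = b / c\<close>, and for
  \<open>c = 0\<close> it is linear in \<open>t\<close>, hence bounded above only if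
  \<open>b = 0\<close>.\<close>

lemma quadratic_bound_imp:
  fixes a b c :: real
  assumes "c \<ge> 0" and le: "\<And>t. 2 * t * b - t\<^sup>2 * c \<le> a"
  shows "b\<^sup>2 \<le> a * c"
proof (cases "c = 0")
  case True
  have "b = 0"
  proof (rule ccontr)
    assume "b \<noteq> 0"
    \<comment> \<open>This \<open>t\<close> makes the linear term equal to
      \<open>\<bar>a\<bar> + 1\<close>, which exceeds \<open>a\<close>.\<close>
    then show False using le[of "(\<bar>a\<bar> + 1) / (2 * b)"] True by simp
  qed
  then show ?thesis using True by simp
next
  case False
  then have c: "c > 0" using assms(1) by simp
  have "2 * (b / c) * b - (b / c)\<^sup>2 * c = b\<^sup>2 / c"
    using c by (simp add: field_simps power2_eq_square)
  then have "b\<^sup>2 / c \<le> a" using le[of "b / c"] by simp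
  then show ?thesis using c by (simp add: field_simps)
qed

lemma tendsto_0_square_le:
  fixes x y :: "nat \<Rightarrow> real"
  assumes "\<And>k. (x k)\<^sup>2 \<le> y k" "y \<longlonglongrightarrow> 0"
  shows "x \<longlonglongrightarrow> 0"
proof -
  have "(\<lambda>k. (x k)\<^sup>2) \<longlonglongrightarrow> 0"
    by (rule tendsto_sandwich[of "\<lambda>_. 0" _ sequentially y]) (use assms in auto)
  from tendsto_real_sqrt[OF this] show ?thesis
    by (simp add: tendsto_rabs_zero_iff)
qed

text \<open>\<open>Q\<close> is a semi-inner product, possibly degenerate, and \<open>T\<close> is
  not completed. The index type is arbitrary so that the same locale serves functions on one state
  space, tuples of functions, and coefficient vectors.\<close>

locale psd_form =
  fixes T :: "('i \<Rightarrow> real) set" and Q :: "('i \<Rightarrow> real) \<Rightarrow> ('i \<Rightarrow> real) \<Rightarrow> real"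
  assumes lincomb: "f \<in> T \<Longrightarrow> g \<in> T \<Longrightarrow> (\<lambda>i. a * f i + b * g i) \<in> T"
    and zero: "(\<lambda>i. 0) \<in> T"
    and Q_lin: "f \<in> T \<Longrightarrow> g \<in> T \<Longrightarrow> h \<in> T \<Longrightarrow> Q (\<lambda>i. a * f i + b * g i) h = a * Q f h + b * Q g h"
    and Q_sym: "f \<in> T \<Longrightarrow> g \<in> T \<Longrightarrow> Q f g = Q g f"
    and Q_nonneg: "f \<in> T \<Longrightarrow> 0 \<le> Q f f"
begin

lemma Q_expand:
  assumes "f \<in> T" "g \<in> T"
  shows "Q (\<lambda>i. a * f i + b * g i) (\<lambda>i. a * f i + b * g i) = a\<^sup>2 * Q f f + 2 * a * b * Q f g + b\<^sup>2 * Q g g"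
proof -
  let ?h = "\<lambda>i. a * f i + b * g i"
  have h: "?h \<in> T" using assms by (rule lincomb)
  have "Q ?h ?h = a * Q ?h f + b * Q ?h g"
    using Q_lin[OF assms h] Q_sym[OF h] assms by simp
  also have "\<dots> = a * (a * Q f f + b * Q g f) + b * (a * Q f g + b * Q g g)"
    using assms by (simp add: Q_lin)
  finally show ?thesis using Q_sym[OF assms] by (simp add: algebra_simps power2_eq_square)
qed

lemma Q_lin_right:
  assumes "f \<in> T" "g \<in> T" "h \<in> T"
  shows "Q h (\<lambda>i. a * f i + b * g i) = a * Q h f + b * Q h g"
  unfolding Q_sym[OF assms(3) lincomb[OF assms(1,2)]] Q_lin[OF assms]
  using assms by (simp add: Q_sym)

lemma cauchy_schwarz:
  assumes "f \<in> T" "g \<in> T"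
  shows "(Q f g)\<^sup>2 \<le> Q f f * Q g g"
proof (rule quadratic_bound_imp)
  fix t
  have "0 \<le> Q (\<lambda>i. 1 * f i + (-t) * g i) (\<lambda>i. 1 * f i + (-t) * g i)"
    using assms by (intro Q_nonneg lincomb)
  then show "2 * t * Q f g - t\<^sup>2 * Q g g \<le> Q f f"
    unfolding Q_expand[OF assms] by simp
qed (use assms Q_nonneg in auto)

text \<open>The first variation at a near-maximizer: moving \<open>f\<close> in the direction
  \<open>e\<close> by any \<open>t\<close> gains at most \<open>\<epsilon>\<close>, so
  \<open>l\<close> differs from \<open>Q f\<close> in that direction by at most the discriminant
  bound.\<close>

lemma near_maximizer:
  assumes l: "lin_on T l" and le: "\<And>f. f \<in> T \<Longrightarrow> l f - Q f f / 2 \<le> s"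
    and f: "f \<in> T" "s - \<epsilon> \<le> l f - Q f f / 2" and e: "e \<in> T"
  shows "(l e - Q f e)\<^sup>2 \<le> 2 * \<epsilon> * Q e e"
proof (rule quadratic_bound_imp)
  fix t
  have "l (\<lambda>i. 1 * f i + t * e i) - Q (\<lambda>i. 1 * f i + t * e i) (\<lambda>i. 1 * f i + t * e i) / 2 \<le> s"
    using f e by (intro le lincomb)
  then have 1: "l f + t * l e - (Q f f + 2 * (t * Q f e) + t\<^sup>2 * Q e e) / 2 \<le> s"
    unfolding Q_expand[OF f(1) e] lin_onD[OF l f(1) e] by (simp add: mult.assoc)
  have 2: "2 * t * (l e - Q f e) = 2 * (t * l e) - 2 * (t * Q f e)" by (simp add: right_diff_distrib)
  show "2 * t * (l e - Q f e) - t\<^sup>2 * Q e e \<le> 2 * \<epsilon>"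
    unfolding 2 using 1 f(2) by argo
qed (use e Q_nonneg in auto)

text \<open>Taking \<open>e = f\<close> in \<open>near_maximizer\<close> and then the
  arithmetic-geometric mean inequality gives
  \<open>\<bar>l f - Q f f\<bar> \<le> Q f f / 4 + 2 * \<epsilon>\<close>. Inserted into
  \<open>Q f f / 2 + (l f - Q f f) \<le> s\<close>, this leaves a quarter of \<open>Q f f\<close>,
  whence the constants 4 and 8.\<close>

lemma near_maximizer_norm:
  assumes l: "lin_on T l" and le: "\<And>f. f \<in> T \<Longrightarrow> l f - Q f f / 2 \<le> s"
    and f: "f \<in> T" "s - \<epsilon> \<le> l f - Q f f / 2" and e: "\<epsilon> \<ge> 0"
  shows "Q f f \<le> 4 * s + 8 * \<epsilon>"
proof -
  let ?q = "Q f f" and ?r = "l f - Q f f"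
  have "?r\<^sup>2 \<le> 2 * \<epsilon> * ?q" by (rule near_maximizer[OF l le f f(1)])
  also have "\<dots> \<le> (?q / 4 + 2 * \<epsilon>)\<^sup>2"
  proof -
    have "0 \<le> (?q / 4 - 2 * \<epsilon>)\<^sup>2" by simp
    then show ?thesis by (simp add: power2_eq_square algebra_simps)
  qed
  finally have "\<bar>?r\<bar>\<^sup>2 \<le> (?q / 4 + 2 * \<epsilon>)\<^sup>2" by simp
  then have "\<bar>?r\<bar> \<le> ?q / 4 + 2 * \<epsilon>"
    by (rule power2_le_imp_le) (use e Q_nonneg[OF f(1)] in simp)
  moreover have "?q / 2 + ?r \<le> s" using le[OF f(1)] by simp
  ultimately show ?thesis by linarith
qed

text \<open>A substitute for the Riesz theorem: in a Hilbert space \<open>b\<close> would converge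
  to the vector representing \<open>l\<close>, and the value \<open>s\<close> of the Legendre
  transform would be half its squared norm.\<close>

lemma maximizing_sequence:
  assumes l: "lin_on T l" and le: "\<And>f. f \<in> T \<Longrightarrow> l f - Q f f / 2 \<le> c"
  shows "\<exists>s b. s \<le> c \<and> (\<forall>k::nat. b k \<in> T) \<and>
    (\<forall>k. \<forall>e\<in>T. (l e - Q (b k) e)\<^sup>2 \<le> 2 * (1 / real (Suc k)) * Q e e) \<and>
    (\<lambda>k. Q (b k) (b k)) \<longlonglongrightarrow> 2 * s"
proof -
  define s where "s = (SUP f\<in>T. l f - Q f f / 2)"
  have bdd: "bdd_above ((\<lambda>f. l f - Q f f / 2) ` T)" using le by (intro bdd_aboveI2)
  have ne: "T \<noteq> {}" using zero by blast
  have les: "l f - Q f f / 2 \<le> s" if "f \<in> T" for f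
    unfolding s_def using that bdd by (rule cSUP_upper)
  have sc: "s \<le> c" unfolding s_def using ne le by (intro cSUP_least)
  have "\<exists>f\<in>T. s - 1 / real (Suc k) < l f - Q f f / 2" for k
    using less_cSUP_iff[OF ne bdd, of "s - 1 / real (Suc k)"] unfolding s_def by simp
  then obtain b where b: "\<And>k. b k \<in> T" "\<And>k. s - 1 / real (Suc k) \<le> l (b k) - Q (b k) (b k) / 2"
    by (metis less_imp_le)
  have nm: "(l e - Q (b k) e)\<^sup>2 \<le> 2 * (1 / real (Suc k)) * Q e e" if "e \<in> T" for k e
    by (rule near_maximizer[OF l les b(1) b(2) that])
  have qb: "Q (b k) (b k) \<le> 4 * s + 8" for k
  proof -
    have "Q (b k) (b k) \<le> 4 * s + 8 * (1 / real (Suc k))"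
      by (rule near_maximizer_norm[OF l les b(1) b(2)]) auto
    moreover have "1 / real (Suc k) \<le> 1" by simp
    ultimately show ?thesis by linarith
  qed
  have inv0: "(\<lambda>k. 1 / real (Suc k)) \<longlonglongrightarrow> 0" by (rule LIMSEQ_Suc[OF lim_1_over_n])
  have r0: "(\<lambda>k. l (b k) - Q (b k) (b k)) \<longlonglongrightarrow> 0"
  proof -
    have "(\<lambda>k. 2 * (1 / real (Suc k)) * (4 * s + 8)) \<longlonglongrightarrow> 2 * 0 * (4 * s + 8)"
      by (intro tendsto_intros inv0)
    then have y: "(\<lambda>k. 2 * (1 / real (Suc k)) * (4 * s + 8)) \<longlonglongrightarrow> 0" by simp
    show ?thesis
    proof (rule tendsto_0_square_le[OF _ y])
      fix k
      have "(l (b k) - Q (b k) (b k))\<^sup>2 \<le> 2 * (1 / real (Suc k)) * Q (b k) (b k)" by (rule nm[OF b(1)])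
      also have "\<dots> \<le> 2 * (1 / real (Suc k)) * (4 * s + 8)" using qb by (intro mult_left_mono) auto
      finally show "(l (b k) - Q (b k) (b k))\<^sup>2 \<le> 2 * (1 / real (Suc k)) * (4 * s + 8)" .
    qed
  qed
  have m: "(\<lambda>k. l (b k) - Q (b k) (b k) / 2) \<longlonglongrightarrow> s"
  proof (rule tendsto_sandwich[of "\<lambda>k. s - 1 / real (Suc k)" _ sequentially "\<lambda>_. s"])
    show "(\<lambda>k. s - 1 / real (Suc k)) \<longlonglongrightarrow> s" using tendsto_diff[OF tendsto_const inv0, of s] by simp
  qed (use b les in auto)
  have "(\<lambda>k. 2 * ((l (b k) - Q (b k) (b k) / 2) - (l (b k) - Q (b k) (b k)))) \<longlonglongrightarrow> 2 * (s - 0)"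
    by (intro tendsto_intros m r0)
  then have "(\<lambda>k. Q (b k) (b k)) \<longlonglongrightarrow> 2 * s" by simp
  with sc b(1) nm show ?thesis by blast
qed

lemma maximizing_sequence_limit:
  assumes "\<And>k e. e \<in> T \<Longrightarrow> (l e - Q (b k) e)\<^sup>2 \<le> 2 * (1 / real (Suc k)) * Q e e" "e \<in> T"
  shows "(\<lambda>k. Q (b k) e) \<longlonglongrightarrow> l e"
proof -
  have "(\<lambda>k. 2 * (1 / real (Suc k)) * Q e e) \<longlonglongrightarrow> 2 * 0 * Q e e"
    by (intro tendsto_intros LIMSEQ_Suc[OF lim_1_over_n])
  then have "(\<lambda>k. 2 * (1 / real (Suc k)) * Q e e) \<longlonglongrightarrow> 0" by simp
  from tendsto_0_square_le[OF assms(1)[OF assms(2)] this]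
  have "(\<lambda>k. l e - Q (b k) e) \<longlonglongrightarrow> 0" .
  then have "(\<lambda>k. l e - (l e - Q (b k) e)) \<longlonglongrightarrow> l e - 0" by (intro tendsto_intros)
  then show ?thesis by simp
qed

text \<open>A substitute for the Hahn-Banach theorem: a linear functional on the domain of \<open>A\<close>
  dominated by the pulled back form extends along \<open>A\<close> with the same Legendre bound, as the limit of
  \<open>Q (A (b k))\<close> along a maximizing sequence \<open>b\<close>.\<close>

lemma extension:
  fixes B :: "('k \<Rightarrow> real) set"
  assumes B: "psd_form B (\<lambda>b b'. Q (A b) (A b'))" and A: "\<And>b. b \<in> B \<Longrightarrow> A b \<in> T"
    and Alin: "\<And>a a' b b' e. b \<in> B \<Longrightarrow> b' \<in> B \<Longrightarrow> e \<in> T \<Longrightarrow>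
       Q (A (\<lambda>k. a * b k + a' * b' k)) e = a * Q (A b) e + a' * Q (A b') e"
    and z: "lin_on B \<zeta>" "\<And>b. b \<in> B \<Longrightarrow> \<zeta> b - Q (A b) (A b) / 2 \<le> c"
  shows "\<exists>l. lin_on T l \<and> (\<forall>f\<in>T. l f - Q f f / 2 \<le> c) \<and> (\<forall>b\<in>B. l (A b) = \<zeta> b)"
proof -
  interpret B: psd_form B "\<lambda>b b'. Q (A b) (A b')" by fact
  obtain s b where s: "s \<le> c" and b1: "\<forall>k::nat. b k \<in> B"
    and b2: "\<forall>k. \<forall>e\<in>B. (\<zeta> e - Q (A (b k)) (A e))\<^sup>2 \<le> 2 * (1 / real (Suc k)) * Q (A e) (A e)"
    and b3: "(\<lambda>k. Q (A (b k)) (A (b k))) \<longlonglongrightarrow> 2 * s"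
    using B.maximizing_sequence[OF z] by blast
  note b = b1[rule_format] b2[rule_format] b3
  have cau: "(Q (A (b k)) e - Q (A (b m)) e)\<^sup>2 \<le> 8 * (1 / real (Suc k) + 1 / real (Suc m)) * Q e e"
    if e: "e \<in> T" for k m e
  proof -
    define d where "d = (\<lambda>i. 1 * b k i + (-1) * b m i)"
    have d: "d \<in> B" unfolding d_def using b(1) by (intro B.lincomb)
    have dl: "Q (A d) e = Q (A (b k)) e - Q (A (b m)) e" if "e \<in> T" for e
      unfolding d_def using Alin[OF b(1) b(1) that, of 1 k "-1" m] by simp
    let ?D = "Q (A d) (A d)" and ?x = "\<zeta> d - Q (A (b k)) (A d)" and ?y = "\<zeta> d - Q (A (b m)) (A d)"
    have D0: "0 \<le> ?D" using d by (intro Q_nonneg A)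
    \<comment> \<open>\<open>?D\<close> is the difference of the two errors at \<open>d\<close>, and
      each squared error is at most a multiple of \<open>?D\<close> itself. Dividing by
      \<open>?D\<close> shows that the increments of the sequence become small in the
      seminorm.\<close>
    have "?D\<^sup>2 = (?y - ?x)\<^sup>2" using dl[OF A[OF d]] by simp
    also have "\<dots> \<le> 2 * ?x\<^sup>2 + 2 * ?y\<^sup>2"
    proof -
      have "0 \<le> (?x + ?y)\<^sup>2" by simp
      then show ?thesis by (simp add: power2_eq_square algebra_simps)
    qed
    also have "\<dots> \<le> 2 * (2 * (1 / real (Suc k)) * ?D) + 2 * (2 * (1 / real (Suc m)) * ?D)"
      using b(2)[OF d] by (intro add_mono mult_left_mono) auto
    finally have "?D * ?D \<le> (4 * (1 / real (Suc k) + 1 / real (Suc m))) * ?D"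
      by (simp add: power2_eq_square algebra_simps)
    then have D: "?D \<le> 8 * (1 / real (Suc k) + 1 / real (Suc m))"
    proof (cases "?D = 0")
      case False
      then have "?D \<le> 4 * (1 / real (Suc k) + 1 / real (Suc m))"
        using D0 by (intro mult_right_le_imp_le[OF \<open>?D * ?D \<le> _\<close>]) simp
      then show ?thesis by (rule order_trans) (intro mult_right_mono, auto)
    qed simp
    have "(Q (A d) e)\<^sup>2 \<le> ?D * Q e e" using e d by (intro cauchy_schwarz A)
    also have "\<dots> \<le> 8 * (1 / real (Suc k) + 1 / real (Suc m)) * Q e e"
      using D Q_nonneg[OF e] by (rule mult_right_mono)
    finally show ?thesis unfolding dl[OF e] .
  qed
  have conv: "convergent (\<lambda>k. Q (A (b k)) e)" if e: "e \<in> T" for e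
  proof (rule Cauchy_convergent, rule CauchyI)
    fix \<epsilon> :: real assume \<epsilon>: "\<epsilon> > 0"
    have "(\<lambda>k. 16 * (1 / real (Suc k)) * Q e e) \<longlonglongrightarrow> 16 * 0 * Q e e"
      by (intro tendsto_intros LIMSEQ_Suc[OF lim_1_over_n])
    then have "\<forall>\<^sub>F k in sequentially. 16 * (1 / real (Suc k)) * Q e e < \<epsilon>\<^sup>2"
      using \<epsilon> by (intro order_tendstoD(2)[of _ "16 * 0 * Q e e"]) auto
    then obtain M where M: "\<And>k. k \<ge> M \<Longrightarrow> 16 * (1 / real (Suc k)) * Q e e < \<epsilon>\<^sup>2"
      unfolding eventually_sequentially by blast
    show "\<exists>M. \<forall>m\<ge>M. \<forall>n\<ge>M. norm (Q (A (b m)) e - Q (A (b n)) e) < \<epsilon>"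
    proof (intro exI allI impI)
      fix m n assume mn: "m \<ge> M" "n \<ge> M"
      have "(Q (A (b m)) e - Q (A (b n)) e)\<^sup>2 \<le> 8 * (1 / real (Suc m) + 1 / real (Suc n)) * Q e e"
        by (rule cau[OF e])
      also have "\<dots> < \<epsilon>\<^sup>2"
      proof -
        have "8 * (x + y) * q < z" if "16 * x * q < z" "16 * y * q < z" for x y q z :: real
          using that by (simp add: algebra_simps)
        then show ?thesis using M[OF mn(1)] M[OF mn(2)] .
      qed
      finally have "(norm (Q (A (b m)) e - Q (A (b n)) e))\<^sup>2 < \<epsilon>\<^sup>2" by simp
      then show "norm (Q (A (b m)) e - Q (A (b n)) e) < \<epsilon>"
        by (rule power2_less_imp_less) (use \<epsilon> in simp)
    qed
  qed
  define l where "l e = lim (\<lambda>k. Q (A (b k)) e)" for e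
  have lim: "(\<lambda>k. Q (A (b k)) e) \<longlonglongrightarrow> l e" if "e \<in> T" for e
    unfolding l_def using conv[OF that] by (simp add: convergent_LIMSEQ_iff)
  have "lin_on T l"
    unfolding lin_on_def
  proof (intro ballI allI)
    fix f g a a' assume fg: "f \<in> T" "g \<in> T"
    have "Q (A (b k)) (\<lambda>i. a * f i + a' * g i) = a * Q (A (b k)) f + a' * Q (A (b k)) g" for k
      by (rule Q_lin_right[OF fg A[OF b(1)]])
    moreover have "(\<lambda>k. a * Q (A (b k)) f + a' * Q (A (b k)) g) \<longlonglongrightarrow> a * l f + a' * l g"
      by (intro tendsto_add tendsto_mult tendsto_const lim fg)
    ultimately have "(\<lambda>k. Q (A (b k)) (\<lambda>i. a * f i + a' * g i)) \<longlonglongrightarrow> a * l f + a' * l g"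
      by simp
    from LIMSEQ_unique[OF lim[OF lincomb[OF fg]] this]
    show "l (\<lambda>i. a * f i + a' * g i) = a * l f + a' * l g" .
  qed
  moreover have "l f - Q f f / 2 \<le> c" if f: "f \<in> T" for f
  proof -
    \<comment> \<open>This is nonnegativity of the form at \<open>A (b k) - f\<close>. In the limit
      the right side becomes \<open>s\<close>, which is at most \<open>c\<close>.\<close>
    have "Q (A (b k)) f - Q f f / 2 \<le> Q (A (b k)) (A (b k)) / 2" for k
    proof -
      have "0 \<le> Q (\<lambda>i. 1 * A (b k) i + (-1) * f i) (\<lambda>i. 1 * A (b k) i + (-1) * f i)"
        using f A[OF b(1)] by (intro Q_nonneg lincomb)
      then show ?thesis unfolding Q_expand[OF A[OF b(1)] f] by simp
    qed
    then have "\<forall>\<^sub>F k in sequentially. Q (A (b k)) f - Q f f / 2 \<le> Q (A (b k)) (A (b k)) / 2"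
      by simp
    moreover have "(\<lambda>k. Q (A (b k)) f - Q f f / 2) \<longlonglongrightarrow> l f - Q f f / 2"
      by (intro tendsto_diff tendsto_const lim f)
    moreover have "(\<lambda>k. Q (A (b k)) (A (b k)) / 2) \<longlonglongrightarrow> 2 * s / 2"
      by (intro tendsto_divide tendsto_const b(3)) simp
    ultimately have "l f - Q f f / 2 \<le> 2 * s / 2"
      by (intro tendsto_le[OF sequentially_bot])
    then show ?thesis using s by simp
  qed
  moreover have "l (A e) = \<zeta> e" if "e \<in> B" for e
    by (rule LIMSEQ_unique[OF lim[OF A[OF that]] B.maximizing_sequence_limit[OF b(2) that]])
  ultimately show ?thesis by blast
qed

end

section \<open>Large deviations with a quadratic limit\<close>

lemma (in psd_form) sum_in_T:
  "finite F \<Longrightarrow> F \<subseteq> T \<Longrightarrow> (\<lambda>i. \<Sum>f\<in>F. \<beta> f * f i) \<in> T"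
proof (induction F rule: finite_induct)
  case empty
  then show ?case using zero by simp
next
  case (insert g F)
  have "(\<lambda>i. \<beta> g * g i + 1 * (\<Sum>f\<in>F. \<beta> f * f i)) \<in> T"
    using insert by (intro lincomb) auto
  then show ?case using insert by simp
qed

lemma (in psd_form) lin_on_0: "lin_on T l \<Longrightarrow> l (\<lambda>i. 0) = 0"
  using lin_onD[of T l "\<lambda>i. 0" "\<lambda>i. 0" 0 0] zero by simp

lemma (in psd_form) lin_on_sum:
  assumes l: "lin_on T l"
  shows "finite F \<Longrightarrow> F \<subseteq> T \<Longrightarrow> l (\<lambda>i. \<Sum>f\<in>F. \<beta> f * f i) = (\<Sum>f\<in>F. \<beta> f * l f)"
proof (induction F rule: finite_induct)
  case empty
  then show ?case using lin_on_0[OF l] by simp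
next
  case (insert g F)
  have "l (\<lambda>i. \<beta> g * g i + 1 * (\<Sum>f\<in>F. \<beta> f * f i)) = \<beta> g * l g + 1 * l (\<lambda>i. \<Sum>f\<in>F. \<beta> f * f i)"
    using insert by (intro lin_onD[OF l] sum_in_T) auto
  then show ?case using insert by simp
qed

lemma openin_finite_INT:
  assumes "finite F" "\<And>f. f \<in> F \<Longrightarrow> openin X (B f)"
  shows "openin X (topspace X \<inter> (\<Inter>f\<in>F. B f))"
  using assms
proof (induction F rule: finite_induct)
  case (insert f F)
  then have "openin X (B f \<inter> (topspace X \<inter> (\<Inter>f\<in>F. B f)))" by blast
  moreover have "B f \<inter> (topspace X \<inter> (\<Inter>f\<in>F. B f)) = topspace X \<inter> (\<Inter>f\<in>insert f F. B f)" by blast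
  ultimately show ?case by simp
qed simp

text \<open>The general principle needs only this: the coordinates generate the topology
  (\<open>ev_open\<close>, \<open>nbhd\<close>), they separate points, and every linear functional
  of finite rate comes from a point (\<open>complete\<close>). For measures, \<open>complete\<close>
  is where countable additivity has to be proved.\<close>

locale coord_space = psd_form T Q for T :: "('i \<Rightarrow> real) set" and Q +
  fixes S :: "'s topology" and ev :: "('i \<Rightarrow> real) \<Rightarrow> 's \<Rightarrow> real"
  assumes ev_lin: "x \<in> topspace S \<Longrightarrow> lin_on T (\<lambda>f. ev f x)"
    and ev_open: "f \<in> T \<Longrightarrow> open U \<Longrightarrow> openin S {x \<in> topspace S. ev f x \<in> U}"
    and nbhd: "openin S G \<Longrightarrow> x \<in> G \<Longrightarrow>
      \<exists>F \<epsilon>. finite F \<and> F \<subseteq> T \<and> \<epsilon> > 0 \<and> {y \<in> topspace S. \<forall>f\<in>F. \<bar>ev f y - ev f x\<bar> < \<epsilon>} \<subseteq> G"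
    and complete: "lin_on T l \<Longrightarrow> (\<And>f. f \<in> T \<Longrightarrow> l f - Q f f / 2 \<le> c) \<Longrightarrow>
      \<exists>x\<in>topspace S. \<forall>f\<in>T. ev f x = l f"
    and sep: "x \<in> topspace S \<Longrightarrow> y \<in> topspace S \<Longrightarrow> (\<And>f. f \<in> T \<Longrightarrow> ev f x = ev f y) \<Longrightarrow> x = y"
begin

section \<open>Legendre rates: compact level sets and covers by half spaces\<close>

definition rate :: "'s \<Rightarrow> ereal" where
  "rate x = (SUP f\<in>T. ereal (ev f x - Q f f / 2))"

lemma rate_le_iff: "rate x \<le> ereal a \<longleftrightarrow> (\<forall>f\<in>T. ev f x - Q f f / 2 \<le> a)"
  unfolding rate_def by (simp add: SUP_le_iff)

lemma Q_0: "Q (\<lambda>i. 0) (\<lambda>i. 0) = 0"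
  using Q_lin[OF zero zero zero, of 0 0] by simp

lemma rate_nonneg: "x \<in> topspace S \<Longrightarrow> 0 \<le> rate x"
  unfolding rate_def using lin_on_0[OF ev_lin] Q_0 zero
  by (intro SUP_upper2[OF zero]) simp

lemma Q_minus: "f \<in> T \<Longrightarrow> Q (\<lambda>i. - f i) (\<lambda>i. - f i) = Q f f"
  using Q_expand[of f f "-1" 0] by simp

lemma minus_T: "f \<in> T \<Longrightarrow> (\<lambda>i. - f i) \<in> T"
  using lincomb[of f f "-1" 0] by simp

lemma lin_on_minus: "lin_on T l \<Longrightarrow> f \<in> T \<Longrightarrow> l (\<lambda>i. - f i) = - l f"
  using lin_onD[of T l f f "-1" 0] by simp

abbreviation prodtop :: "('i \<Rightarrow> real) set \<Rightarrow> (('i \<Rightarrow> real) \<Rightarrow> real) topology" where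
  "prodtop F \<equiv> product_topology (\<lambda>_. euclideanreal) F"

text \<open>An argument of Banach-Alaoglu type. The coordinate map sends the level set onto a closed
  subset \<open>Y\<close> of a product of compact intervals: linearity and the rate bound are closed
  conditions, and \<open>complete\<close> supplies a point for every element of \<open>Y\<close>.
  The inverse is continuous because neighbourhoods are read off finitely many coordinates.\<close>

lemma compact_level: "compactin S {x \<in> topspace S. rate x \<le> ereal a}"
proof -
  let ?X = "prodtop T"
  \<comment> \<open>Testing the rate bound with \<open>f\<close> and with its negative confines the
    coordinate \<open>f\<close> to this interval.\<close>
  let ?B = "\<Pi>\<^sub>E f\<in>T. {- (a + Q f f / 2)..a + Q f f / 2}"
  define Y where "Y = {l \<in> ?B. lin_on T l \<and> (\<forall>f\<in>T. l f - Q f f / 2 \<le> a)}"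
  have top: "topspace ?X = PiE T (\<lambda>_. UNIV)" by simp
  have cB: "compactin ?X ?B" unfolding compactin_PiE by simp
  have c1: "closedin ?X {l \<in> topspace ?X. l f - Q f f / 2 \<le> a}" if "f \<in> T" for f
  proof -
    have "continuous_map ?X euclideanreal (\<lambda>l. l f - Q f f / 2)"
      using that by (intro continuous_intros continuous_map_product_projection) auto
    then have "closedin ?X {l \<in> topspace ?X. l f - Q f f / 2 \<in> {..a}}"
      by (rule closedin_continuous_map_preimage) simp
    then show ?thesis by simp
  qed
  have c2: "closedin ?X {l \<in> topspace ?X. l (\<lambda>i. s * f i + t * g i) = s * l f + t * l g}"
    if fg: "f \<in> T" "g \<in> T" for f g s t
  proof -
    have "continuous_map ?X euclideanreal (\<lambda>l. l (\<lambda>i. s * f i + t * g i) - (s * l f + t * l g))"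
      using fg lincomb[OF fg] by (intro continuous_intros continuous_map_product_projection) auto
    then have "closedin ?X {l \<in> topspace ?X. l (\<lambda>i. s * f i + t * g i) - (s * l f + t * l g) \<in> {0}}"
      by (rule closedin_continuous_map_preimage) simp
    then show ?thesis by simp
  qed
  \<comment> \<open>\<open>topspace ?X\<close> is inserted to make the family visibly nonempty, as
    an intersection of closed sets in a topology on a carrier demands.\<close>
  define \<C> where "\<C> = insert (topspace ?X) ({{l \<in> topspace ?X. l f - Q f f / 2 \<le> a} | f. f \<in> T} \<union>
    {{l \<in> topspace ?X. l (\<lambda>i. s * f i + t * g i) = s * l f + t * l g} | f g s t. f \<in> T \<and> g \<in> T})"
  have mem: "{l \<in> topspace ?X. l f - Q f f / 2 \<le> a} \<in> \<C>" if "f \<in> T" for f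
    unfolding \<C>_def using that by blast
  have mem': "{l \<in> topspace ?X. l (\<lambda>i. s * f i + t * g i) = s * l f + t * l g} \<in> \<C>"
    if "f \<in> T" "g \<in> T" for f g s t
    unfolding \<C>_def using that by blast
  have "closedin ?X C" if "C \<in> \<C>" for C
    using that c1 c2 closedin_topspace[of ?X] unfolding \<C>_def by blast
  then have "closedin ?X (\<Inter>\<C>)" by (intro closedin_Inter) (auto simp: \<C>_def simp del: topspace_product_topology)
  then have "compactin ?X (\<Inter>\<C> \<inter> ?B)"
    using cB by (rule closed_Int_compactin)
  moreover have "\<Inter>\<C> \<inter> ?B = Y"
  proof (intro equalityI subsetI)
    fix l assume l: "l \<in> \<Inter>\<C> \<inter> ?B"
    have "l f - Q f f / 2 \<le> a" if "f \<in> T" for f using l mem[OF that] by blast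
    moreover have "l (\<lambda>i. s * f i + t * g i) = s * l f + t * l g" if "f \<in> T" "g \<in> T" for f g s t
      using l mem'[OF that, of s t] by blast
    ultimately show "l \<in> Y" using l unfolding Y_def lin_on_def by blast
  next
    fix l assume l: "l \<in> Y"
    have "?B \<subseteq> topspace ?X" unfolding top by (rule PiE_mono) auto
    then have "l \<in> topspace ?X" using l unfolding Y_def by blast
    then have "l \<in> C" if "C \<in> \<C>" for C using that l unfolding \<C>_def Y_def lin_on_def by blast
    then show "l \<in> \<Inter>\<C> \<inter> ?B" using l unfolding Y_def by blast
  qed
  ultimately have cY: "compactin ?X Y" by simp
  \<comment> \<open>The inverse of the coordinate map on \<open>Y\<close>. Any choice will do, since
    \<open>sep\<close> makes the point unique.\<close>
  define g where "g l = (SOME x. x \<in> topspace S \<and> (\<forall>f\<in>T. ev f x = l f))" for l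
  have g: "g l \<in> topspace S" "\<And>f. f \<in> T \<Longrightarrow> ev f (g l) = l f" if "l \<in> Y" for l
  proof -
    have "\<exists>x\<in>topspace S. \<forall>f\<in>T. ev f x = l f"
      using that by (intro complete[of l a]) (auto simp: Y_def)
    then have "\<exists>x. x \<in> topspace S \<and> (\<forall>f\<in>T. ev f x = l f)" by blast
    from someI_ex[OF this] have "g l \<in> topspace S \<and> (\<forall>f\<in>T. ev f (g l) = l f)" unfolding g_def .
    then show "g l \<in> topspace S" "\<And>f. f \<in> T \<Longrightarrow> ev f (g l) = l f" by auto
  qed
  have YX: "Y \<subseteq> topspace ?X" using cY compactin_subset_topspace by blast
  have cont: "continuous_map (subtopology ?X Y) S g"
    unfolding continuous_map_def
  proof (intro conjI allI impI)
    show "g \<in> topspace (subtopology ?X Y) \<rightarrow> topspace S" using g(1) YX by auto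
    fix U assume U: "openin S U"
    show "openin (subtopology ?X Y) {l \<in> topspace (subtopology ?X Y). g l \<in> U}"
    proof (subst openin_subopen, intro ballI)
      fix l assume "l \<in> {l \<in> topspace (subtopology ?X Y). g l \<in> U}"
      then have l: "l \<in> Y" "g l \<in> U" by auto
      obtain F \<epsilon> where F: "finite F" "F \<subseteq> T" "\<epsilon> > 0"
        "{y \<in> topspace S. \<forall>f\<in>F. \<bar>ev f y - ev f (g l)\<bar> < \<epsilon>} \<subseteq> U"
        using nbhd[OF U l(2)] by blast
      let ?W = "topspace ?X \<inter> (\<Inter>f\<in>F. {l' \<in> topspace ?X. l' f \<in> ball (l f) \<epsilon>})"
      have "openin ?X {l' \<in> topspace ?X. l' f \<in> ball (l f) \<epsilon>}" if "f \<in> F" for f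
        using that F by (intro openin_continuous_map_preimage[OF continuous_map_product_projection]) auto
      then have "openin ?X ?W"
        by (rule openin_finite_INT[OF F(1)])
      then have "openin (subtopology ?X Y) (?W \<inter> Y)" unfolding openin_subtopology by blast
      moreover have "l \<in> ?W \<inter> Y" using l YX F(3) by (auto simp del: topspace_product_topology)
      moreover have "?W \<inter> Y \<subseteq> {l \<in> topspace (subtopology ?X Y). g l \<in> U}"
      proof
        fix l' assume l': "l' \<in> ?W \<inter> Y"
        have "\<bar>ev f (g l') - ev f (g l)\<bar> < \<epsilon>" if "f \<in> F" for f
        proof -
          have "f \<in> T" using that F(2) by blast
          then show ?thesis using g(2)[of l' f] g(2)[OF l(1), of f] l' that
            by (auto simp: dist_real_def abs_minus_commute)
        qed
        then have "g l' \<in> U" using F(4) g(1)[of l'] l' by blast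
        then show "l' \<in> {l \<in> topspace (subtopology ?X Y). g l \<in> U}" using l' YX by auto
      qed
      ultimately show "\<exists>W. openin (subtopology ?X Y) W \<and> l \<in> W \<and>
          W \<subseteq> {l \<in> topspace (subtopology ?X Y). g l \<in> U}" by blast
    qed
  qed
  have "compactin (subtopology ?X Y) Y" using cY by (simp add: compactin_subtopology)
  then have "compactin S (g ` Y)" using cont by (rule image_compactin)
  moreover have "g ` Y = {x \<in> topspace S. rate x \<le> ereal a}"
  proof (intro equalityI subsetI)
    fix x assume "x \<in> g ` Y"
    then obtain l where l: "l \<in> Y" "x = g l" by blast
    then show "x \<in> {x \<in> topspace S. rate x \<le> ereal a}"
      using g[OF l(1)] by (auto simp: rate_le_iff Y_def)
  next
    fix x assume "x \<in> {x \<in> topspace S. rate x \<le> ereal a}"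
    then have x: "x \<in> topspace S" "\<And>f. f \<in> T \<Longrightarrow> ev f x - Q f f / 2 \<le> a"
      by (auto simp: rate_le_iff)
    define l where "l = restrict (\<lambda>f. ev f x) T"
    have "lin_on T l"
      using ev_lin[OF x(1)] lincomb unfolding lin_on_def l_def by simp
    moreover have "- (a + Q f f / 2) \<le> ev f x \<and> ev f x \<le> a + Q f f / 2" if "f \<in> T" for f
      using x(2)[OF that] x(2)[OF minus_T[OF that]] Q_minus[OF that] lin_on_minus[OF ev_lin[OF x(1)] that]
      by simp
    then have "l \<in> ?B" unfolding l_def by (simp add: PiE_iff)
    ultimately have l: "l \<in> Y" unfolding Y_def using x(2) by (simp add: l_def)
    have "g l = x" using g[OF l] x(1) by (intro sep) (auto simp: l_def)
    then show "x \<in> g ` Y" using l by blast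
  qed
  ultimately show ?thesis by simp
qed

lemma good_rate: "good_rate_function S rate"
  unfolding good_rate_function_def using rate_nonneg compact_level by blast

text \<open>\<open>C\<close> itself need not be compact, so the compactness used is that of the
  level set. Finitely many cylinders cover the level set and miss \<open>C\<close>. They depend on
  finitely many coordinates, so one may pass to a compact box in a finite-dimensional space and
  remove the cylinders from it. Every remaining vector lies in some half space, for otherwise it
  would extend to a point of the level set; compactness of the remainder then gives finitely
  many.\<close>

lemma half_space_cover:
  assumes C: "closedin S C" and Ca: "\<And>x. x \<in> C \<Longrightarrow> \<not> rate x \<le> ereal a"
  shows "\<exists>H. finite H \<and> H \<subseteq> T \<and> C \<subseteq> (\<Union>h\<in>H. {x \<in> topspace S. ev h x - Q h h / 2 > a})"
proof -
  let ?K = "{x \<in> topspace S. rate x \<le> ereal a}"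
  have CS: "C \<subseteq> topspace S" using C closedin_subset by blast
  let ?good = "\<lambda>x p. finite (fst p) \<and> fst p \<subseteq> T \<and> snd p > 0 \<and>
      {y \<in> topspace S. \<forall>f\<in>fst p. \<bar>ev f y - ev f x\<bar> < snd p} \<subseteq> topspace S - C"
  have "\<forall>x\<in>?K. \<exists>p. ?good x p"
  proof
    fix x assume "x \<in> ?K"
    then have "x \<in> topspace S - C" using Ca by blast
    from nbhd[OF openin_diff[OF openin_topspace C] this] obtain F \<epsilon> where
      "finite F" "F \<subseteq> T" "\<epsilon> > 0" "{y \<in> topspace S. \<forall>f\<in>F. \<bar>ev f y - ev f x\<bar> < \<epsilon>} \<subseteq> topspace S - C"
      by blast
    then show "\<exists>p. ?good x p" by (intro exI[of _ "(F, \<epsilon>)"]) simp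
  qed
  from bchoice[OF this] obtain p where p: "\<forall>x\<in>?K. ?good x (p x)" ..
  define F \<epsilon> where "F x = fst (p x)" and "\<epsilon> x = snd (p x)" for x
  have F: "finite (F x)" "F x \<subseteq> T" "\<epsilon> x > 0"
    "{y \<in> topspace S. \<forall>f\<in>F x. \<bar>ev f y - ev f x\<bar> < \<epsilon> x} \<subseteq> topspace S - C" if "x \<in> ?K" for x
    using p that unfolding F_def \<epsilon>_def by blast+
  define cyl where "cyl x = {y \<in> topspace S. \<forall>f\<in>F x. \<bar>ev f y - ev f x\<bar> < \<epsilon> x}" for x
  have ocyl: "openin S (cyl x)" if x: "x \<in> ?K" for x
  proof -
    have "openin S {y \<in> topspace S. ev f y \<in> ball (ev f x) (\<epsilon> x)}" if "f \<in> F x" for f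
      using F(2)[OF x] that by (intro ev_open) auto
    then have "openin S (topspace S \<inter> (\<Inter>f\<in>F x. {y \<in> topspace S. ev f y \<in> ball (ev f x) (\<epsilon> x)}))"
      by (rule openin_finite_INT[OF F(1)[OF x]])
    moreover have "topspace S \<inter> (\<Inter>f\<in>F x. {y \<in> topspace S. ev f y \<in> ball (ev f x) (\<epsilon> x)}) = cyl x"
      unfolding cyl_def by (auto simp: dist_real_def abs_minus_commute)
    ultimately show ?thesis by simp
  qed
  have "\<exists>\<F>. finite \<F> \<and> \<F> \<subseteq> cyl ` ?K \<and> ?K \<subseteq> \<Union>\<F>"
  proof -
    have "?K \<subseteq> \<Union>(cyl ` ?K)" using F(3) by (auto simp: cyl_def)
    then show ?thesis using ocyl by (intro compactinD[OF compact_level]) auto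
  qed
  then obtain \<F> where \<F>: "finite \<F>" "\<F> \<subseteq> cyl ` ?K" "?K \<subseteq> \<Union>\<F>" by blast
  obtain D where D: "D \<subseteq> ?K" "finite D" "\<F> = cyl ` D"
    using finite_subset_image[OF \<F>(1,2)] by blast
  then have D: "finite D" "D \<subseteq> ?K" "?K \<subseteq> (\<Union>x\<in>D. cyl x)" using \<F>(3) by simp_all
  \<comment> \<open>The finitely many coordinates on which the covering cylinders depend.\<close>
  define FF where "FF = (\<Union>x\<in>D. F x)"
  have FD: "finite (F x)" "F x \<subseteq> T" if "x \<in> D" for x using that D(2) F(1,2) by blast+
  have FF: "finite FF" "FF \<subseteq> T" unfolding FF_def using D(1) FD by auto
  let ?X = "prodtop FF"
  let ?B = "\<Pi>\<^sub>E f\<in>FF. {- (a + Q f f / 2)..a + Q f f / 2}"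
  define Ucyl where "Ucyl x = topspace ?X \<inter> (\<Inter>f\<in>F x. {z \<in> topspace ?X. z f \<in> ball (ev f x) (\<epsilon> x)})" for x
  define Z where "Z = ?B - (\<Union>x\<in>D. Ucyl x)"
  have "openin ?X (Ucyl x)" if x: "x \<in> D" for x
  proof -
    have "openin ?X {z \<in> topspace ?X. z f \<in> ball (ev f x) (\<epsilon> x)}" if "f \<in> F x" for f
      using that x FF_def by (intro openin_continuous_map_preimage[OF continuous_map_product_projection]) auto
    then show ?thesis unfolding Ucyl_def by (rule openin_finite_INT[OF FD(1)[OF x]])
  qed
  then have "closedin ?X (topspace ?X - (\<Union>x\<in>D. Ucyl x))"
    by (intro closedin_diff openin_Union closedin_topspace) auto
  moreover have "compactin ?X ?B" unfolding compactin_PiE by simp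
  ultimately have "compactin ?X ((topspace ?X - (\<Union>x\<in>D. Ucyl x)) \<inter> ?B)" by (rule closed_Int_compactin)
  moreover have BX: "?B \<subseteq> topspace ?X" by (simp, rule PiE_mono) auto
  then have "(topspace ?X - (\<Union>x\<in>D. Ucyl x)) \<inter> ?B = Z" unfolding Z_def by blast
  ultimately have cZ: "compactin ?X Z" by simp
  \<comment> \<open>Half spaces in the finite-dimensional picture are indexed by coefficient
    functions \<open>\<beta>\<close>. Their values off \<open>FF\<close> do not affect
    \<open>A \<beta>\<close>, so the form pulled back along \<open>A\<close> is degenerate, which
    \<open>psd_form\<close> permits.\<close>
  define A where "A \<beta> = (\<lambda>i. \<Sum>f\<in>FF. \<beta> f * f i)" for \<beta> :: "('i \<Rightarrow> real) \<Rightarrow> real"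
  have AT: "A \<beta> \<in> T" for \<beta> unfolding A_def using FF by (rule sum_in_T)
  have Alin: "A (\<lambda>k. s * \<beta> k + t * \<beta>' k) = (\<lambda>i. s * A \<beta> i + t * A \<beta>' i)" for s t \<beta> \<beta>'
    unfolding A_def by (simp add: sum.distrib sum_distrib_left algebra_simps)
  have B: "psd_form UNIV (\<lambda>\<beta> \<beta>'. Q (A \<beta>) (A \<beta>'))"
    by unfold_locales (auto simp: Alin Q_lin[OF AT AT AT] Q_nonneg[OF AT] intro: Q_sym[OF AT AT])
  define H where "H \<beta> = {z \<in> topspace ?X. (\<Sum>f\<in>FF. \<beta> f * z f) - Q (A \<beta>) (A \<beta>) / 2 > a}" for \<beta>
  have oH: "openin ?X (H \<beta>)" for \<beta>
  proof -
    have "continuous_map ?X euclideanreal (\<lambda>z. (\<Sum>f\<in>FF. \<beta> f * z f) - Q (A \<beta>) (A \<beta>) / 2)"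
      using FF by (intro continuous_intros continuous_map_product_projection) auto
    then have "openin ?X {z \<in> topspace ?X. (\<Sum>f\<in>FF. \<beta> f * z f) - Q (A \<beta>) (A \<beta>) / 2 \<in> {a<..}}"
      by (rule openin_continuous_map_preimage) simp
    then show ?thesis unfolding H_def by simp
  qed
  have ZH: "Z \<subseteq> \<Union>(range H)"
  proof
    fix z assume z: "z \<in> Z"
    show "z \<in> \<Union>(range H)"
    proof (rule ccontr)
      assume "z \<notin> \<Union>(range H)"
      moreover have zX: "z \<in> topspace ?X" using z BX unfolding Z_def by blast
      ultimately have le: "(\<Sum>f\<in>FF. \<beta> f * z f) - Q (A \<beta>) (A \<beta>) / 2 \<le> a" for \<beta>
        unfolding H_def by (auto simp: not_less simp del: topspace_product_topology)
      \<comment> \<open>A vector outside all half spaces is a linear functional of the coefficients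
        dominated by the pulled back form. Its extension to \<open>T\<close> is represented by a
        point of the level set, which lies in one of the cylinders.\<close>
      have "\<exists>l. lin_on T l \<and> (\<forall>f\<in>T. l f - Q f f / 2 \<le> a) \<and> (\<forall>\<beta>\<in>UNIV. l (A \<beta>) = (\<Sum>f\<in>FF. \<beta> f * z f))"
        using le by (intro extension B AT)
          (auto simp: Alin Q_lin[OF AT AT] lin_on_def sum.distrib sum_distrib_left algebra_simps)
      then obtain l where l: "lin_on T l" "\<And>f. f \<in> T \<Longrightarrow> l f - Q f f / 2 \<le> a"
        "\<And>\<beta>. l (A \<beta>) = (\<Sum>f\<in>FF. \<beta> f * z f)" by blast
      have lz: "l f = z f" if "f \<in> FF" for f
      proof -
        have "A (\<lambda>g. if g = f then 1 else 0) = f"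
          unfolding A_def using FF that by (simp add: if_distrib[of "\<lambda>x. x * _"] sum.delta cong: if_cong)
        moreover have "(\<Sum>g\<in>FF. (if g = f then 1 else 0) * z g) = z f"
          using FF that by (simp add: if_distrib[of "\<lambda>x. x * _"] sum.delta cong: if_cong)
        ultimately show ?thesis using l(3)[of "\<lambda>g. if g = f then 1 else 0"] by simp
      qed
      obtain x where x: "x \<in> topspace S" "\<And>f. f \<in> T \<Longrightarrow> ev f x = l f"
        using complete[OF l(1,2)] by blast
      then have "x \<in> ?K" using l(2) by (auto simp: rate_le_iff)
      then obtain y where y: "y \<in> D" "x \<in> cyl y" using D by blast
      have "z \<in> Ucyl y"
        unfolding Ucyl_def
      proof (intro IntI INT_I CollectI conjI zX)
        fix f assume f: "f \<in> F y"
        then have "f \<in> FF" "f \<in> T" using y FF unfolding FF_def by auto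
        then show "z f \<in> ball (ev f y) (\<epsilon> y)"
          using y(2) f lz x(2) unfolding cyl_def by (auto simp: dist_real_def abs_minus_commute)
      qed
      then show False using z y unfolding Z_def by blast
    qed
  qed
  have "\<exists>\<F>. finite \<F> \<and> \<F> \<subseteq> range H \<and> Z \<subseteq> \<Union>\<F>"
    using ZH oH by (intro compactinD[OF cZ]) auto
  then obtain \<G> where \<G>: "finite \<G>" "\<G> \<subseteq> range H" "Z \<subseteq> \<Union>\<G>" by blast
  obtain N where "finite N" "\<G> = H ` N"
    using finite_subset_image[OF \<G>(1,2)] by blast
  then have N: "finite N" "Z \<subseteq> (\<Union>\<beta>\<in>N. H \<beta>)" using \<G>(3) by simp_all
  \<comment> \<open>The coordinates and their negatives take care of points whose projection leaves
    the box; the combinations from \<open>N\<close> take care of those inside it.\<close>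
  let ?HH = "FF \<union> (\<lambda>f i. - f i) ` FF \<union> A ` N"
  have cov: "C \<subseteq> (\<Union>h\<in>?HH. {x \<in> topspace S. ev h x - Q h h / 2 > a})"
  proof
    fix x assume xC: "x \<in> C"
    then have x: "x \<in> topspace S" using CS by blast
    note l = ev_lin[OF x]
    define z where "z = restrict (\<lambda>f. ev f x) FF"
    show "x \<in> (\<Union>h\<in>?HH. {x \<in> topspace S. ev h x - Q h h / 2 > a})"
    proof (cases "z \<in> ?B")
      case True
      have "z \<notin> Ucyl y" if y: "y \<in> D" for y
      proof
        assume "z \<in> Ucyl y"
        then have U: "z f \<in> ball (ev f y) (\<epsilon> y)" if "f \<in> F y" for f
          using that unfolding Ucyl_def by blast
        have "\<forall>f\<in>F y. \<bar>ev f x - ev f y\<bar> < \<epsilon> y"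
        proof
          fix f assume f: "f \<in> F y"
          then have "f \<in> FF" using y unfolding FF_def by blast
          then show "\<bar>ev f x - ev f y\<bar> < \<epsilon> y"
            using U[OF f] unfolding z_def by (simp add: dist_real_def abs_minus_commute)
        qed
        then have "x \<in> topspace S - C" using F(4)[of y] y D x by blast
        then show False using xC by blast
      qed
      then have "z \<in> Z" using True unfolding Z_def by blast
      then obtain \<beta> where \<beta>: "\<beta> \<in> N" "z \<in> H \<beta>" using N by blast
      have "ev (A \<beta>) x = (\<Sum>f\<in>FF. \<beta> f * z f)"
        using lin_on_sum[OF l FF, of \<beta>] unfolding A_def z_def by simp
      then have "ev (A \<beta>) x - Q (A \<beta>) (A \<beta>) / 2 > a" using \<beta>(2) unfolding H_def by simp
      then show ?thesis using \<beta>(1) x by blast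
    next
      case False
      then obtain f where f: "f \<in> FF" "z f \<notin> {- (a + Q f f / 2)..a + Q f f / 2}"
        unfolding z_def by (auto simp: PiE_iff)
      have fT: "f \<in> T" using f FF by blast
      have "ev f x - Q f f / 2 > a \<or> ev (\<lambda>i. - f i) x - Q (\<lambda>i. - f i) (\<lambda>i. - f i) / 2 > a"
        using f unfolding Q_minus[OF fT] lin_on_minus[OF l fT] z_def by auto
      then show ?thesis using f(1) x by blast
    qed
  qed
  have fin: "finite ?HH" using FF N by simp
  have sub: "?HH \<subseteq> T"
  proof (intro Un_least image_subsetI AT FF(2))
    fix f assume "f \<in> FF"
    then have "f \<in> T" using FF(2) by blast
    then show "(\<lambda>i. - f i) \<in> T" by (rule minus_T)
  qed
  show ?thesis by (intro exI[of _ ?HH] conjI fin sub cov)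
qed

end

section \<open>Upper and lower large deviation bounds from quadratic cumulants\<close>

lemma (in prob_space) expectation_exp_pos:
  fixes f :: "'a \<Rightarrow> real"
  assumes "integrable M (\<lambda>x. exp (f x))"
  shows "0 < (\<integral>x. exp (f x) \<partial>M)"
proof -
  have "(\<integral>x. exp (f x) \<partial>M) \<noteq> 0"
  proof
    assume "(\<integral>x. exp (f x) \<partial>M) = 0"
    then have "AE x in M. exp (f x) = 0" using assms by (subst (asm) integral_nonneg_eq_0_iff_AE) auto
    then have "AE x in M. False" by simp
    then show False using AE_False by simp
  qed
  moreover have "0 \<le> (\<integral>x. exp (f x) \<partial>M)" by (intro integral_nonneg_AE) simp
  ultimately show ?thesis by (simp add: less_le)
qed

lemma eventually_const_le_exp:
  fixes \<alpha> :: "nat \<Rightarrow> real"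
  assumes "filterlim \<alpha> at_top sequentially" "e > 0"
  shows "\<forall>\<^sub>F N in sequentially. c \<le> exp (\<alpha> N * e)"
proof -
  have "\<forall>\<^sub>F N in sequentially. \<bar>c\<bar> / e \<le> \<alpha> N"
    using assms(1) by (simp add: filterlim_at_top)
  then show ?thesis
  proof eventually_elim
    case (elim N)
    then have "\<bar>c\<bar> \<le> \<alpha> N * e" using assms(2) by (simp add: field_simps)
    also have "\<dots> \<le> exp (\<alpha> N * e)" using exp_ge_add_one_self[of "\<alpha> N * e"] by linarith
    finally show ?case by simp
  qed
qed

text \<open>As \<open>T\<close> is a vector space and evaluation is linear, \<open>mgf\<close> for
  single elements of \<open>T\<close> already contains the joint cumulants of any finite set of
  coordinates.\<close>

locale ldp_family = coord_space T Q S ev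
  for T :: "('i \<Rightarrow> real) set" and Q and S :: "'s topology" and ev +
  fixes P :: "nat \<Rightarrow> 'w measure" and X :: "nat \<Rightarrow> 'w \<Rightarrow> 's" and \<alpha> :: "nat \<Rightarrow> real"
  assumes \<alpha>_pos: "N \<ge> 1 \<Longrightarrow> \<alpha> N > 0"
    and \<alpha>_top: "filterlim \<alpha> at_top sequentially"
    and prob: "N \<ge> 1 \<Longrightarrow> prob_space (P N)"
    and X_top: "N \<ge> 1 \<Longrightarrow> w \<in> space (P N) \<Longrightarrow> X N w \<in> topspace S"
    and X_rv: "N \<ge> 1 \<Longrightarrow> f \<in> T \<Longrightarrow> (\<lambda>w. ev f (X N w)) \<in> borel_measurable (P N)"
    and X_int: "N \<ge> 1 \<Longrightarrow> f \<in> T \<Longrightarrow> integrable (P N) (\<lambda>w. exp (\<alpha> N * ev f (X N w)))"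
    and mgf: "f \<in> T \<Longrightarrow> (\<lambda>N. ln (\<integral>w. exp (\<alpha> N * ev f (X N w)) \<partial>P N) / \<alpha> N) \<longlonglongrightarrow> Q f f / 2"
begin

lemma mgf_bounds:
  assumes f: "f \<in> T" and e: "e > 0"
  shows "\<forall>\<^sub>F N in sequentially. N \<ge> 1 \<and>
     exp (\<alpha> N * (Q f f / 2 - e)) \<le> (\<integral>w. exp (\<alpha> N * ev f (X N w)) \<partial>P N) \<and>
     (\<integral>w. exp (\<alpha> N * ev f (X N w)) \<partial>P N) \<le> exp (\<alpha> N * (Q f f / 2 + e))"
proof -
  have "\<forall>\<^sub>F N in sequentially. dist (ln (\<integral>w. exp (\<alpha> N * ev f (X N w)) \<partial>P N) / \<alpha> N) (Q f f / 2) < e"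
    using mgf[OF f] e by (rule tendstoD)
  then show ?thesis using eventually_ge_at_top[of 1]
  proof eventually_elim
    case (elim N)
    let ?E = "\<integral>w. exp (\<alpha> N * ev f (X N w)) \<partial>P N"
    have pos: "?E > 0" using elim X_int[OF _ f] prob by (intro prob_space.expectation_exp_pos) auto
    have a: "\<alpha> N > 0" using elim \<alpha>_pos by simp
    have "\<bar>ln ?E / \<alpha> N - Q f f / 2\<bar> < e" using elim by (simp add: dist_real_def)
    then have "Q f f / 2 - e \<le> ln ?E / \<alpha> N" "ln ?E / \<alpha> N \<le> Q f f / 2 + e" by linarith+
    then have "\<alpha> N * (Q f f / 2 - e) \<le> ln ?E" "ln ?E \<le> \<alpha> N * (Q f f / 2 + e)"
      using a by (simp_all add: pos_le_divide_eq pos_divide_le_eq mult.commute)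
    then have "exp (\<alpha> N * (Q f f / 2 - e)) \<le> exp (ln ?E)" "exp (ln ?E) \<le> exp (\<alpha> N * (Q f f / 2 + e))"
      unfolding exp_le_cancel_iff by blast+
    then show ?case using elim(2) unfolding exp_ln[OF pos] by blast
  qed
qed

text \<open>Markov's inequality for the exponential of \<open>\<alpha> N\<close> times the
  coordinate. There is no multiplier to optimise: the offset \<open>Q h h / 2\<close> in the half
  space is exactly the limiting cumulant and cancels against it.\<close>

lemma half_space_bound:
  assumes h: "h \<in> T" and e: "e > 0"
  shows "\<forall>\<^sub>F N in sequentially. measure (P N) {w \<in> space (P N). ev h (X N w) - Q h h / 2 > a}
     \<le> exp (- \<alpha> N * (a - e))"
  using mgf_bounds[OF h e]
proof eventually_elim
  case (elim N)
  then have N: "N \<ge> 1" by simp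
  interpret prob_space "P N" using prob[OF N] .
  have a: "\<alpha> N > 0" by (rule \<alpha>_pos[OF N])
  let ?c = "exp (\<alpha> N * (a + Q h h / 2))"
  let ?E = "\<integral>w. exp (\<alpha> N * ev h (X N w)) \<partial>P N"
  have m: "(\<lambda>w. ev h (X N w)) \<in> borel_measurable (P N)" by (rule X_rv[OF N h])
  have "prob {w \<in> space (P N). ev h (X N w) - Q h h / 2 > a} \<le> prob {w \<in> space (P N). exp (\<alpha> N * ev h (X N w)) \<ge> ?c}"
  proof (intro finite_measure_mono subsetI)
    fix w assume w: "w \<in> {w \<in> space (P N). ev h (X N w) - Q h h / 2 > a}"
    then have "a + Q h h / 2 \<le> ev h (X N w)" by simp
    then have "\<alpha> N * (a + Q h h / 2) \<le> \<alpha> N * ev h (X N w)"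
      using a by (intro mult_left_mono) auto
    then show "w \<in> {w \<in> space (P N). exp (\<alpha> N * ev h (X N w)) \<ge> ?c}" using w by simp
  next
    show "{w \<in> space (P N). exp (\<alpha> N * ev h (X N w)) \<ge> ?c} \<in> events" using m by measurable
  qed
  also have "\<dots> \<le> ?E / ?c"
    by (rule integral_Markov_inequality_measure[where A = "{}"]) (use X_int[OF N h] in auto)
  also have "\<dots> \<le> exp (\<alpha> N * (Q h h / 2 + e)) / ?c"
    using elim by (intro divide_right_mono) auto
  also have "\<dots> = exp (- \<alpha> N * (a - e))" by (simp add: exp_diff[symmetric] algebra_simps)
  finally show ?case .
qed

lemma event_upper_bound:
  assumes A: "\<And>N. N \<ge> 1 \<Longrightarrow> {w \<in> space (P N). X N w \<in> A} \<in> sets (P N)"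
    and a: "\<And>x. x \<in> S closure_of A \<Longrightarrow> \<not> rate x \<le> ereal a" and e: "e > 0"
  shows "\<forall>\<^sub>F N in sequentially. measure (P N) {w \<in> space (P N). X N w \<in> A} \<le> exp (- \<alpha> N * (a - e))"
proof -
  have "\<exists>H. finite H \<and> H \<subseteq> T \<and> S closure_of A \<subseteq> (\<Union>h\<in>H. {x \<in> topspace S. ev h x - Q h h / 2 > a})"
    by (rule half_space_cover[OF closedin_closure_of]) (rule a)
  then obtain H where H: "finite H" "H \<subseteq> T"
    "S closure_of A \<subseteq> (\<Union>h\<in>H. {x \<in> topspace S. ev h x - Q h h / 2 > a})" by (elim exE conjE)
  let ?B = "\<lambda>N h. {w \<in> space (P N). ev h (X N w) - Q h h / 2 > a}"
  \<comment> \<open>Half of \<open>e\<close> pays for the convergence of the cumulants and the other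
    half for the number of half spaces in the union bound.\<close>
  have "\<forall>\<^sub>F N in sequentially. \<forall>h\<in>H. measure (P N) (?B N h) \<le> exp (- \<alpha> N * (a - e / 2))"
    using H e by (intro eventually_ball_finite ballI half_space_bound) auto
  moreover have "\<forall>\<^sub>F N in sequentially. real (card H) \<le> exp (\<alpha> N * (e / 2))"
    using \<alpha>_top e by (intro eventually_const_le_exp) auto
  ultimately show ?thesis using eventually_ge_at_top[of 1]
  proof eventually_elim
    case (elim N)
    interpret prob_space "P N" using prob[OF elim(3)] .
    have Bm: "?B N h \<in> sets (P N)" if "h \<in> H" for h
      using X_rv[OF elim(3), of h] that H(2) by auto
    have "prob {w \<in> space (P N). X N w \<in> A} \<le> prob (\<Union>h\<in>H. ?B N h)"
    proof (rule finite_measure_mono)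
      show "(\<Union>h\<in>H. ?B N h) \<in> sets (P N)" using Bm H(1) by auto
      show "{w \<in> space (P N). X N w \<in> A} \<subseteq> (\<Union>h\<in>H. ?B N h)"
      proof
        fix w assume w: "w \<in> {w \<in> space (P N). X N w \<in> A}"
        then have "X N w \<in> S closure_of A"
          using X_top[OF elim(3)] closure_of_subset_Int[of S A] by auto
        then show "w \<in> (\<Union>h\<in>H. ?B N h)" using H(3) w by blast
      qed
    qed
    also have "\<dots> \<le> (\<Sum>h\<in>H. prob (?B N h))"
      using H(1) Bm by (intro finite_measure_subadditive_finite) auto
    also have "\<dots> \<le> (\<Sum>h\<in>H. exp (- \<alpha> N * (a - e / 2)))" using elim(1) by (intro sum_mono) auto
    also have "\<dots> = real (card H) * exp (- \<alpha> N * (a - e / 2))" by simp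
    also have "\<dots> \<le> exp (\<alpha> N * (e / 2)) * exp (- \<alpha> N * (a - e / 2))"
      using elim(2) by (intro mult_right_mono) auto
    also have "\<dots> = exp (- \<alpha> N * (a - e))" by (simp add: exp_add[symmetric] algebra_simps)
    finally show ?case .
  qed
qed

text \<open>Under the law tilted by \<open>f\<close>, every coordinate \<open>g\<close> concentrates at \<open>Q f g\<close>.\<close>

lemma tilted_lower_bound:
  assumes f: "f \<in> T" and F: "finite F" "F \<subseteq> T" and \<delta>: "\<delta> > 0" and e: "e > 0"
  shows "\<forall>\<^sub>F N in sequentially. exp (- \<alpha> N * (Q f f / 2 + e)) \<le>
     measure (P N) {w \<in> space (P N). \<forall>g\<in>F. \<bar>ev g (X N w) - Q f g\<bar> < \<delta>}"
proof -
  \<comment> \<open>Negatives turn one-sided estimates into two-sided ones. Including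
    \<open>f\<close> itself bounds the weight \<open>exp (\<alpha> N * ev f)\<close> from above on
    the good event.\<close>
  define G where "G = insert f F \<union> (\<lambda>g i. - g i) ` insert f F"
  have G: "finite G" "G \<subseteq> T" using F f unfolding G_def by (auto intro!: minus_T)
  define d where "d = min \<delta> (e / 2)"
  have d: "d > 0" "d \<le> \<delta>" "d \<le> e / 2" using \<delta> e unfolding d_def by auto
  \<comment> \<open>With \<open>t * Q g g \<le> d\<close> a Chernoff bound in direction
    \<open>g\<close> gains \<open>t * d\<close> and loses at most \<open>t * d / 2\<close>. The net
    gain is twice the \<open>\<eta>\<close> chosen below, so a gain of \<open>\<eta>\<close>
    survives the cumulant error \<open>\<eta>\<close>.\<close>
  define t where "t = d / (1 + (\<Sum>g\<in>G. Q g g))"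
  have Qsum: "0 \<le> (\<Sum>g\<in>G. Q g g)" using G Q_nonneg by (intro sum_nonneg) auto
  have t: "t > 0" unfolding t_def using d Qsum by simp
  have tQ: "t * Q g g \<le> d" if "g \<in> G" for g
  proof -
    have "Q g g \<le> (\<Sum>g\<in>G. Q g g)" using that G Q_nonneg by (intro member_le_sum) auto
    then have "t * Q g g \<le> t * (1 + (\<Sum>g\<in>G. Q g g))" using t by (intro mult_left_mono) auto
    also have "\<dots> = d" unfolding t_def using Qsum by simp
    finally show ?thesis .
  qed
  define \<eta> where "\<eta> = t * d / 4"
  have \<eta>: "\<eta> > 0" unfolding \<eta>_def using t d by simp
  \<comment> \<open>Small enough that the bad event, after the number of directions is absorbed by
    \<open>\<eta> / 2\<close>, carries at most half of the total weight; the bound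
    \<open>e / 4\<close> is for the final accounting.\<close>
  define \<kappa> where "\<kappa> = min (\<eta> / 2) (e / 4)"
  have \<kappa>: "\<kappa> > 0" "\<kappa> \<le> \<eta> / 2" "\<kappa> \<le> e / 4" unfolding \<kappa>_def using \<eta> e by auto
  define tilt where "tilt g = (\<lambda>i. 1 * f i + t * g i)" for g :: "'i \<Rightarrow> real"
  have tiltT: "tilt g \<in> T" if "g \<in> G" for g unfolding tilt_def using f that G by (intro lincomb) auto
  have "\<forall>\<^sub>F N in sequentially. \<forall>g\<in>G. N \<ge> 1 \<and>
      exp (\<alpha> N * (Q (tilt g) (tilt g) / 2 - \<eta>)) \<le> (\<integral>w. exp (\<alpha> N * ev (tilt g) (X N w)) \<partial>P N) \<and>
      (\<integral>w. exp (\<alpha> N * ev (tilt g) (X N w)) \<partial>P N) \<le> exp (\<alpha> N * (Q (tilt g) (tilt g) / 2 + \<eta>))"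
    using G(1) \<eta> tiltT by (intro eventually_ball_finite ballI mgf_bounds) auto
  moreover note mgf_bounds[OF f \<kappa>(1)]
  moreover have "\<forall>\<^sub>F N in sequentially. 2 * real (card G) \<le> exp (\<alpha> N * (\<eta> / 2))"
    using \<alpha>_top \<eta> by (intro eventually_const_le_exp) auto
  moreover have "\<forall>\<^sub>F N in sequentially. 2 \<le> exp (\<alpha> N * (e / 4))"
    using \<alpha>_top e by (intro eventually_const_le_exp) auto
  ultimately show ?thesis using eventually_ge_at_top[of 1]
  proof eventually_elim
    case (elim N)
    interpret prob_space "P N" using prob[OF elim(5)] .
    note N = elim(5)
    have a: "\<alpha> N > 0" by (rule \<alpha>_pos[OF N])
    let ?D = "{w \<in> space (P N). \<forall>g\<in>G. ev g (X N w) - Q f g < d}"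
    let ?D' = "{w \<in> space (P N). \<forall>g\<in>F. \<bar>ev g (X N w) - Q f g\<bar> < \<delta>}"
    have Dm: "?D \<in> sets (P N)" "?D' \<in> sets (P N)"
      using X_rv[OF N] G F by (auto intro!: sets.sets_Collect_finite_All' borel_measurable_less sets.sets_Collect_finite_All simp: subset_iff)
    have lin: "lin_on T (\<lambda>f. ev f (X N w))" if "w \<in> space (P N)" for w
      using ev_lin X_top[OF N that] by blast
    have DD: "?D \<subseteq> ?D'"
    proof
      fix w assume w: "w \<in> ?D"
      have "\<bar>ev g (X N w) - Q f g\<bar> < \<delta>" if g: "g \<in> F" for g
      proof -
        have gT: "g \<in> T" using g F by blast
        have "g \<in> G" "(\<lambda>i. - g i) \<in> G" using g unfolding G_def by auto
        then have "ev g (X N w) - Q f g < d" "ev (\<lambda>i. - g i) (X N w) - Q f (\<lambda>i. - g i) < d"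
          using w by auto
        moreover have "ev (\<lambda>i. - g i) (X N w) = - ev g (X N w)"
          using w gT by (intro lin_on_minus lin) auto
        moreover have "Q f (\<lambda>i. - g i) = - Q f g"
          using Q_lin_right[OF gT gT f, of "-1" 0] by simp
        ultimately show ?thesis using d by linarith
      qed
      then show "w \<in> ?D'" using w by auto
    qed
    let ?u = "\<lambda>w. exp (\<alpha> N * ev f (X N w))"
    let ?v = "\<lambda>g w. exp (- \<alpha> N * t * (Q f g + d)) * exp (\<alpha> N * ev (tilt g) (X N w))"
    have ui: "integrable (P N) ?u" by (rule X_int[OF N f])
    have vi: "integrable (P N) (?v g)" if "g \<in> G" for g
      by (intro integrable_mult_right X_int[OF N tiltT[OF that]])
    have di: "integrable (P N) (\<lambda>w. exp (\<alpha> N * (Q f f + d)) * indicator ?D w)"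
      using Dm by (intro integrable_mult_right integrable_real_indicator) (auto simp: emeasure_eq_measure)
    have si: "integrable (P N) (\<lambda>w. \<Sum>g\<in>G. ?v g w)"
      using vi by (rule Bochner_Integration.integrable_sum)
    have sumI: "(\<integral>w. (\<Sum>g\<in>G. ?v g w) \<partial>P N) = (\<Sum>g\<in>G. \<integral>w. ?v g w \<partial>P N)"
      by (rule Bochner_Integration.integral_sum[OF vi])
    \<comment> \<open>The tilted law is not constructed. Its weight is split instead: off
      \<open>?D\<close> some direction \<open>g\<close> exceeds its mean by \<open>d\<close>, and
      there tilting further by \<open>t * g\<close> only increases the weight.\<close>
    have pt: "?u w \<le> exp (\<alpha> N * (Q f f + d)) * indicator ?D w + (\<Sum>g\<in>G. ?v g w)"
      if w: "w \<in> space (P N)" for w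
    proof (cases "w \<in> ?D")
      case True
      have "f \<in> G" unfolding G_def by simp
      then have "ev f (X N w) - Q f f < d" using True by blast
      then have "?u w \<le> exp (\<alpha> N * (Q f f + d)) * indicator ?D w"
        using True a by simp
      moreover have "0 \<le> (\<Sum>g\<in>G. ?v g w)" by (intro sum_nonneg) simp
      ultimately show ?thesis by linarith
    next
      case False
      then obtain g where g: "g \<in> G" "ev g (X N w) - Q f g \<ge> d" using w by force
      have gT: "g \<in> T" using g G by blast
      have "ev (tilt g) (X N w) = ev f (X N w) + t * ev g (X N w)"
        unfolding tilt_def using lin_onD[OF lin[OF w] f gT, of 1 t] by simp
      then have "?v g w = exp (\<alpha> N * ev f (X N w) + \<alpha> N * t * (ev g (X N w) - Q f g - d))"
        by (simp add: exp_add[symmetric] algebra_simps)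
      moreover have "0 \<le> \<alpha> N * t * (ev g (X N w) - Q f g - d)" using a t g by simp
      ultimately have "?u w \<le> ?v g w" by simp
      also have "\<dots> \<le> (\<Sum>g\<in>G. ?v g w)" using g G by (intro member_le_sum) auto
      finally show ?thesis using False by simp
    qed
    have "(\<integral>w. ?u w \<partial>P N) \<le> (\<integral>w. exp (\<alpha> N * (Q f f + d)) * indicator ?D w + (\<Sum>g\<in>G. ?v g w) \<partial>P N)"
      by (rule integral_mono[OF ui Bochner_Integration.integrable_add[OF di si] pt])
    also have "\<dots> = exp (\<alpha> N * (Q f f + d)) * prob ?D + (\<Sum>g\<in>G. \<integral>w. ?v g w \<partial>P N)"
      unfolding Bochner_Integration.integral_add[OF di si] sumI using Dm by simp
    also have "(\<Sum>g\<in>G. \<integral>w. ?v g w \<partial>P N) \<le> (\<Sum>g\<in>G. exp (\<alpha> N * (Q f f / 2 - \<eta>)))"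
    proof (rule sum_mono)
      fix g assume g: "g \<in> G"
      have gT: "g \<in> T" using g G by blast
      have "(\<integral>w. ?v g w \<partial>P N) = exp (- \<alpha> N * t * (Q f g + d)) * (\<integral>w. exp (\<alpha> N * ev (tilt g) (X N w)) \<partial>P N)"
        by simp
      also have "\<dots> \<le> exp (- \<alpha> N * t * (Q f g + d)) * exp (\<alpha> N * (Q (tilt g) (tilt g) / 2 + \<eta>))"
        using elim(1) g by (intro mult_left_mono) auto
      also have "\<dots> = exp (\<alpha> N * (Q f f / 2 + t * (t * Q g g) / 2 - t * d + \<eta>))"
        unfolding tilt_def Q_expand[OF f gT] exp_add[symmetric] by (simp add: algebra_simps power2_eq_square add_divide_distrib)
      also have "\<dots> \<le> exp (\<alpha> N * (Q f f / 2 - \<eta>))"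
      proof -
        have "t * (t * Q g g) \<le> t * d" using tQ[OF g] t by (intro mult_left_mono) auto
        then have "Q f f / 2 + t * (t * Q g g) / 2 - t * d + \<eta> \<le> Q f f / 2 - \<eta>"
          unfolding \<eta>_def by argo
        then show ?thesis using a by simp
      qed
      finally show "(\<integral>w. ?v g w \<partial>P N) \<le> exp (\<alpha> N * (Q f f / 2 - \<eta>))" .
    qed
    also have "(\<Sum>g\<in>G. exp (\<alpha> N * (Q f f / 2 - \<eta>))) = real (card G) * exp (\<alpha> N * (Q f f / 2 - \<eta>))"
      by simp
    also have "\<dots> \<le> exp (\<alpha> N * (\<eta> / 2)) / 2 * exp (\<alpha> N * (Q f f / 2 - \<eta>))"
      using elim(3) by (intro mult_right_mono) auto
    also have "\<dots> = exp (\<alpha> N * (Q f f / 2 - \<eta> / 2)) / 2"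
      by (simp add: exp_add[symmetric] algebra_simps)
    also have "\<dots> \<le> exp (\<alpha> N * (Q f f / 2 - \<kappa>)) / 2" using \<kappa> a by simp
    also have "\<dots> \<le> (\<integral>w. ?u w \<partial>P N) / 2" using elim(2) by simp
    finally have "(\<integral>w. ?u w \<partial>P N) \<le> exp (\<alpha> N * (Q f f + d)) * (2 * prob ?D)" by simp
    then have "exp (\<alpha> N * (Q f f / 2 - \<kappa>)) \<le> exp (\<alpha> N * (Q f f + d)) * (2 * prob ?D)"
      using elim(2) by linarith
    also have "\<dots> \<le> exp (\<alpha> N * (Q f f + d)) * (exp (\<alpha> N * (e / 4)) * prob ?D)"
      using elim(4) by (intro mult_left_mono mult_right_mono) auto
    finally have "exp (\<alpha> N * (Q f f / 2 - \<kappa>)) / (exp (\<alpha> N * (Q f f + d)) * exp (\<alpha> N * (e / 4))) \<le> prob ?D"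
      by (simp add: field_simps)
    also have "exp (\<alpha> N * (Q f f / 2 - \<kappa>)) / (exp (\<alpha> N * (Q f f + d)) * exp (\<alpha> N * (e / 4)))
        = exp (\<alpha> N * (- Q f f / 2 - \<kappa> - d - e / 4))"
      by (simp add: exp_add[symmetric] exp_diff[symmetric] algebra_simps)
    finally have "exp (\<alpha> N * (- Q f f / 2 - \<kappa> - d - e / 4)) \<le> prob ?D" .
    \<comment> \<open>The losses are at most \<open>e / 4\<close> for \<open>\<kappa>\<close>,
      \<open>e / 2\<close> for \<open>d\<close>, and \<open>e / 4\<close> for the factor 2.\<close>
    moreover have "exp (- \<alpha> N * (Q f f / 2 + e)) \<le> exp (\<alpha> N * (- Q f f / 2 - \<kappa> - d - e / 4))"
    proof -
      have "- (Q f f / 2 + e) \<le> - Q f f / 2 - \<kappa> - d - e / 4" using \<kappa> d by simp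
      then have "\<alpha> N * (- (Q f f / 2 + e)) \<le> \<alpha> N * (- Q f f / 2 - \<kappa> - d - e / 4)"
        using a by (intro mult_left_mono) auto
      then show ?thesis unfolding exp_le_cancel_iff by (simp only: mult_minus_left mult_minus_right)
    qed
    moreover have "prob ?D \<le> prob ?D'" using DD Dm by (intro finite_measure_mono) auto
    ultimately show ?case by linarith
  qed
qed

text \<open>The point \<open>x\<close> need not be of the form \<open>Q f\<close>, so no tilt is
  centred exactly at it. Along a maximizing sequence the centres \<open>Q (b k)\<close> approach
  \<open>x\<close> in the finitely many relevant coordinates, while the costs
  \<open>Q (b k) (b k) / 2\<close> tend to the value of the transform.\<close>

lemma event_lower_bound:
  assumes A: "\<And>N. N \<ge> 1 \<Longrightarrow> {w \<in> space (P N). X N w \<in> A} \<in> sets (P N)"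
    and x: "x \<in> S interior_of A" "rate x \<le> ereal c" and e: "e > 0"
  shows "\<forall>\<^sub>F N in sequentially. exp (- \<alpha> N * (c + e)) \<le> measure (P N) {w \<in> space (P N). X N w \<in> A}"
proof -
  have xS: "x \<in> topspace S" using x(1) interior_of_subset_topspace[of S A] by blast
  note l = ev_lin[OF xS]
  obtain F \<epsilon> where F: "finite F" "F \<subseteq> T" "\<epsilon> > 0"
    "{y \<in> topspace S. \<forall>f\<in>F. \<bar>ev f y - ev f x\<bar> < \<epsilon>} \<subseteq> S interior_of A"
    using nbhd[OF openin_interior_of x(1)] by blast
  have le: "ev f x - Q f f / 2 \<le> c" if "f \<in> T" for f using x(2) that by (simp add: rate_le_iff)
  obtain s b where sb: "s \<le> c" "\<forall>k::nat. b k \<in> T"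
    "\<forall>k. \<forall>e\<in>T. (ev e x - Q (b k) e)\<^sup>2 \<le> 2 * (1 / real (Suc k)) * Q e e"
    "(\<lambda>k. Q (b k) (b k)) \<longlonglongrightarrow> 2 * s"
    using maximizing_sequence[OF l le] by blast
  have "(\<lambda>k. Q (b k) g) \<longlonglongrightarrow> ev g x" if "g \<in> T" for g
    by (rule maximizing_sequence_limit[OF _ that]) (use sb(3) in blast)
  then have "\<forall>\<^sub>F k in sequentially. dist (Q (b k) g) (ev g x) < \<epsilon> / 2" if "g \<in> T" for g
    using that F(3) by (intro tendstoD) auto
  then have "\<forall>\<^sub>F k in sequentially. \<forall>g\<in>F. dist (Q (b k) g) (ev g x) < \<epsilon> / 2"
    using F by (intro eventually_ball_finite) auto
  moreover have "\<forall>\<^sub>F k in sequentially. Q (b k) (b k) < 2 * s + e"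
    using sb(4) e by (intro order_tendstoD(2)) auto
  ultimately have "\<forall>\<^sub>F k in sequentially. (\<forall>g\<in>F. dist (Q (b k) g) (ev g x) < \<epsilon> / 2) \<and> Q (b k) (b k) < 2 * s + e"
    by eventually_elim blast
  then obtain k where k: "\<forall>g\<in>F. dist (Q (b k) g) (ev g x) < \<epsilon> / 2" "Q (b k) (b k) < 2 * s + e"
    unfolding eventually_sequentially by blast
  have "\<forall>\<^sub>F N in sequentially. exp (- \<alpha> N * (Q (b k) (b k) / 2 + e / 2)) \<le>
     measure (P N) {w \<in> space (P N). \<forall>g\<in>F. \<bar>ev g (X N w) - Q (b k) g\<bar> < \<epsilon> / 2}"
    using F e sb(2) by (intro tilted_lower_bound) auto
  then show ?thesis using eventually_ge_at_top[of 1]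
  proof eventually_elim
    case (elim N)
    interpret prob_space "P N" using prob[OF elim(2)] .
    have "exp (- \<alpha> N * (c + e)) \<le> exp (- \<alpha> N * (Q (b k) (b k) / 2 + e / 2))"
    proof -
      have "Q (b k) (b k) / 2 + e / 2 \<le> c + e" using k sb(1) by simp
      then show ?thesis using \<alpha>_pos[OF elim(2)] by simp
    qed
    also note elim(1)
    also have "prob {w \<in> space (P N). \<forall>g\<in>F. \<bar>ev g (X N w) - Q (b k) g\<bar> < \<epsilon> / 2}
        \<le> prob {w \<in> space (P N). X N w \<in> A}"
    proof (rule finite_measure_mono[OF _ A[OF elim(2)]], rule subsetI)
      fix w assume w: "w \<in> {w \<in> space (P N). \<forall>g\<in>F. \<bar>ev g (X N w) - Q (b k) g\<bar> < \<epsilon> / 2}"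
      have "\<bar>ev g (X N w) - ev g x\<bar> < \<epsilon>" if "g \<in> F" for g
      proof -
        have "\<bar>ev g (X N w) - Q (b k) g\<bar> < \<epsilon> / 2" "\<bar>Q (b k) g - ev g x\<bar> < \<epsilon> / 2"
          using w k(1) that by (auto simp: dist_real_def)
        then show ?thesis by linarith
      qed
      then have "X N w \<in> S interior_of A" using F(4) X_top[OF elim(2)] w by blast
      then show "w \<in> {w \<in> space (P N). X N w \<in> A}" using interior_of_subset w by fastforce
    qed
    finally show ?case .
  qed
qed

lemma elog_le:
  assumes "p \<ge> 0" "p \<le> exp (- \<alpha> N * b)" "\<alpha> N > 0"
  shows "ereal (1 / \<alpha> N) * elog p \<le> ereal (- b)"
proof (cases "p = 0")
  case False
  then have "ln p \<le> - \<alpha> N * b" using assms by (metis ln_exp ln_le_cancel_iff exp_gt_zero order_le_less)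
  then have "ln p / \<alpha> N \<le> - b" using assms(3) by (simp add: field_simps)
  then show ?thesis using False by (simp add: elog_def)
qed (use assms in \<open>simp add: elog_def\<close>)

lemma elog_ge:
  assumes "p \<ge> exp (- \<alpha> N * b)" "\<alpha> N > 0"
  shows "ereal (- b) \<le> ereal (1 / \<alpha> N) * elog p"
proof -
  have p: "p > 0" using assms(1) exp_gt_zero by (rule less_le_trans[rotated])
  then have "- \<alpha> N * b \<le> ln p" using assms by (metis ln_exp ln_le_cancel_iff exp_gt_zero)
  then have "- b \<le> ln p / \<alpha> N" using assms(2) by (simp add: field_simps)
  then show ?thesis using p by (simp add: elog_def)
qed

theorem ldp:
  assumes X: "\<And>N. N \<ge> 1 \<Longrightarrow> X N \<in> measurable (P N) \<SS>"
  shows "LDP S \<SS> P X \<alpha> rate"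
  unfolding LDP_def
proof (intro conjI ballI allI impI)
  fix A assume A: "A \<in> sets \<SS>"
  let ?p = "\<lambda>N. measure (P N) (X N -` A \<inter> space (P N))"
  have ev: "X N -` A \<inter> space (P N) = {w \<in> space (P N). X N w \<in> A}" for N by auto
  have Am: "{w \<in> space (P N). X N w \<in> A} \<in> sets (P N)" if "N \<ge> 1" for N
    using measurable_sets[OF X[OF that] A] unfolding ev .
  show "- (INF x\<in>S interior_of A. rate x) \<le> liminf (\<lambda>N. ereal (1 / \<alpha> N) * elog (?p N))"
  proof (subst ereal_uminus_le_reorder, rule INF_greatest)
    fix x assume x: "x \<in> S interior_of A"
    have xS: "x \<in> topspace S" using x interior_of_subset_topspace[of S A] by blast
    show "- liminf (\<lambda>N. ereal (1 / \<alpha> N) * elog (?p N)) \<le> rate x"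
    proof (cases "rate x")
      case (real c)
      have "ereal (- (c + e)) \<le> liminf (\<lambda>N. ereal (1 / \<alpha> N) * elog (?p N))" if e: "e > 0" for e
      proof (rule Liminf_bounded)
        have "\<forall>\<^sub>F N in sequentially. exp (- \<alpha> N * (c + e)) \<le> measure (P N) {w \<in> space (P N). X N w \<in> A}"
          by (rule event_lower_bound[OF _ x eq_refl[OF real(1)] e]) (rule Am)
        from eventually_conj[OF this eventually_ge_at_top[of 1]]
        show "\<forall>\<^sub>F N in sequentially. ereal (- (c + e)) \<le> ereal (1 / \<alpha> N) * elog (?p N)"
          unfolding ev by (rule eventually_mono, elim conjE) (rule elog_ge, assumption, erule \<alpha>_pos)
      qed
      then have "- ereal (c + e) \<le> liminf (\<lambda>N. ereal (1 / \<alpha> N) * elog (?p N))" if "e > 0" for e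
        using that unfolding uminus_ereal.simps by blast
      then have le: "- liminf (\<lambda>N. ereal (1 / \<alpha> N) * elog (?p N)) \<le> ereal c + ereal e" if "e > 0" for e
        using that unfolding plus_ereal.simps(1) by (subst ereal_uminus_le_reorder) blast
      show ?thesis unfolding real by (rule ereal_le_epsilon2) (use le in auto)
    qed (use rate_nonneg[OF xS] in auto)
  qed
  show "limsup (\<lambda>N. ereal (1 / \<alpha> N) * elog (?p N)) \<le> - (INF x\<in>S closure_of A. rate x)"
  \<comment> \<open>Negating the claim produces a real level \<open>a\<close> strictly below the
    infimum, also when that infimum is infinite.\<close>
  proof (rule ccontr)
    assume "\<not> ?thesis"
    then have "- limsup (\<lambda>N. ereal (1 / \<alpha> N) * elog (?p N)) < (INF x\<in>S closure_of A. rate x)"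
      by (subst ereal_uminus_less_reorder) (simp only: not_le)
    then obtain a where a: "- limsup (\<lambda>N. ereal (1 / \<alpha> N) * elog (?p N)) < ereal a"
      "ereal a < (INF x\<in>S closure_of A. rate x)"
      using ereal_dense2 by blast
    have na: "\<not> rate x \<le> ereal a" if "x \<in> S closure_of A" for x
      using a(2) that by (meson INF_lower le_less_trans leD)
    have lim0: "limsup (\<lambda>N. ereal (1 / \<alpha> N) * elog (?p N)) \<le> ereal (- (a - e))" if e: "e > 0" for e
    proof (rule Limsup_bounded)
      have "\<forall>\<^sub>F N in sequentially. measure (P N) {w \<in> space (P N). X N w \<in> A} \<le> exp (- \<alpha> N * (a - e))"
        by (rule event_upper_bound[OF _ na e]) (rule Am)
      from eventually_conj[OF this eventually_ge_at_top[of 1]]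
      show "\<forall>\<^sub>F N in sequentially. ereal (1 / \<alpha> N) * elog (?p N) \<le> ereal (- (a - e))"
        unfolding ev by (rule eventually_mono, elim conjE) (rule elog_le[OF measure_nonneg], assumption, erule \<alpha>_pos)
    qed
    have lim: "limsup (\<lambda>N. ereal (1 / \<alpha> N) * elog (?p N)) \<le> ereal (- a) + ereal e" if "e > 0" for e
    proof -
      have "- (a - e) = - a + e" by simp
      from lim0[OF that] show ?thesis unfolding plus_ereal.simps(1) \<open>- (a - e) = - a + e\<close> .
    qed
    have "limsup (\<lambda>N. ereal (1 / \<alpha> N) * elog (?p N)) \<le> ereal (- a)"
      by (rule ereal_le_epsilon2) (rule lim)
    then have "ereal a \<le> - limsup (\<lambda>N. ereal (1 / \<alpha> N) * elog (?p N))"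
      unfolding uminus_ereal.simps(1)[symmetric]
      by (metis ereal_minus_le_minus ereal_uminus_uminus)
    then show False using a(1) by (meson leD)
  qed
qed (use X \<alpha>_top good_rate in auto)

end

section \<open>The \<open>\<tau>\<close>-topology as a coordinate space\<close>

text \<open>The two extra conditions are inherited by functionals dominated by the form: control by
  the oscillation makes them bounded, and sequential continuity makes them countably
  additive.\<close>

definition cov_form :: "'a measure \<Rightarrow> (('a \<Rightarrow> real) \<Rightarrow> ('a \<Rightarrow> real) \<Rightarrow> real) \<Rightarrow> bool" where
  "cov_form E Q \<longleftrightarrow> psd_form (bdd_meas E) Q \<and>
     (\<exists>C. \<forall>f\<in>bdd_meas E. Q f f \<le> C * (rosc E f)\<^sup>2) \<and>
     (\<forall>f. bp_null E f \<longrightarrow> (\<lambda>k. Q (f k) (f k)) \<longlonglongrightarrow> 0)"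

lemma cov_form_psd: "cov_form E Q \<Longrightarrow> psd_form (bdd_meas E) Q"
  unfolding cov_form_def by blast

lemma cov_form_bp_null: "cov_form E Q \<Longrightarrow> bp_null E f \<Longrightarrow> (\<lambda>k. Q (f k) (f k)) \<longlonglongrightarrow> 0"
  unfolding cov_form_def by blast

lemma (in psd_form) functional_square_le:
  assumes "lin_on T l" "\<And>f. f \<in> T \<Longrightarrow> l f - Q f f / 2 \<le> c" "f \<in> T"
  shows "(l f)\<^sup>2 \<le> 2 * c * Q f f"
proof (rule quadratic_bound_imp[OF Q_nonneg[OF assms(3)]])
  fix t
  have "(\<lambda>i. t * f i + 0 * f i) \<in> T" using assms(3) by (intro lincomb)
  from assms(2)[OF this]
  have "t * l f - t\<^sup>2 * Q f f / 2 \<le> c"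
    unfolding Q_expand[OF assms(3,3)] lin_onD[OF assms(1,3,3)] by simp
  then show "2 * t * l f - t\<^sup>2 * Q f f \<le> 2 * c" by (simp add: field_simps)
qed

text \<open>A finite Legendre transform gives \<open>(l f)\<^sup>2 \<le> 2 * c * Q f f\<close>, so
  \<open>l\<close> inherits both continuity properties of the form. Its values on indicators are
  then a signed measure, and integration against that measure recovers \<open>l\<close>.\<close>

lemma representation:
  assumes ne: "space E \<noteq> {}" and Q: "cov_form E Q" and l: "lin_on (bdd_meas E) l"
    and c: "\<And>f. f \<in> bdd_meas E \<Longrightarrow> l f - Q f f / 2 \<le> c"
  shows "\<exists>\<mu>\<in>signed_measures E. \<forall>f\<in>bdd_meas E. sm_integral E \<mu> f = l f"
proof -
  interpret psd_form "bdd_meas E" Q using Q by (rule cov_form_psd)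
  obtain C where C: "\<And>f. f \<in> bdd_meas E \<Longrightarrow> Q f f \<le> C * (rosc E f)\<^sup>2"
    using Q unfolding cov_form_def by blast
  have sq: "(l f)\<^sup>2 \<le> 2 * c * Q f f" if "f \<in> bdd_meas E" for f
    using l c that by (rule functional_square_le)
  have c0: "0 \<le> c"
  proof -
    have "l (\<lambda>i. 0) = 0" "Q (\<lambda>i. 0) (\<lambda>i. 0) = 0"
      using lin_on_0[OF l] Q_lin[OF zero zero zero, of 0 0] by simp_all
    then show ?thesis using c[OF zero] by simp
  qed
  have bf: "bdd_functional E l (2 * sqrt (2 * c * \<bar>C\<bar>))"
    unfolding bdd_functional_def
  proof (intro conjI ballI allI impI)
    fix f g a b assume "f \<in> bdd_meas E" "g \<in> bdd_meas E"
    then show "l (\<lambda>x. a * f x + b * g x) = a * l f + b * l g" by (rule lin_onD[OF l])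
  next
    fix f d assume f: "f \<in> bdd_meas E" and d: "\<forall>x\<in>space E. \<bar>f x\<bar> \<le> d"
    show "\<bar>l f\<bar> \<le> 2 * sqrt (2 * c * \<bar>C\<bar>) * d"
    proof -
      obtain x where "x \<in> space E" using ne by blast
      then have "\<bar>f x\<bar> \<le> d" using d by blast
      then have d0: "0 \<le> d" by simp
      have r: "(rosc E f)\<^sup>2 \<le> (2 * d)\<^sup>2"
        using d d0 by (intro power_mono rosc_le_sup rosc_nonneg) auto
      have "(l f)\<^sup>2 \<le> 2 * c * Q f f" by (rule sq[OF f])
      also have "\<dots> \<le> 2 * c * (\<bar>C\<bar> * (2 * d)\<^sup>2)"
      proof (rule mult_left_mono)
        have "C * (rosc E f)\<^sup>2 \<le> \<bar>C\<bar> * (2 * d)\<^sup>2" using r by (intro mult_mono) auto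
        then show "Q f f \<le> \<bar>C\<bar> * (2 * d)\<^sup>2" using C[OF f] by linarith
      qed (use c0 in simp)
      finally have "\<bar>l f\<bar> \<le> sqrt (2 * c * (\<bar>C\<bar> * (2 * d)\<^sup>2))"
        by (metis real_sqrt_abs real_sqrt_le_mono)
      also have "2 * c * (\<bar>C\<bar> * (2 * d)\<^sup>2) = 2 * c * \<bar>C\<bar> * (2 * d)\<^sup>2" by simp
      also have "sqrt \<dots> = sqrt (2 * c * \<bar>C\<bar>) * \<bar>2 * d\<bar>" unfolding real_sqrt_mult real_sqrt_abs ..
      also have "\<dots> = 2 * sqrt (2 * c * \<bar>C\<bar>) * d" using d0 by simp
      finally show ?thesis .
    qed
  qed
  have bn: "(\<lambda>k. l (f k)) \<longlonglongrightarrow> 0" if f: "bp_null E f" for f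
  proof (rule tendsto_0_square_le)
    show "(l (f k))\<^sup>2 \<le> 2 * c * Q (f k) (f k)" for k using f by (intro sq) (simp add: bp_null_def)
    have "(\<lambda>k. 2 * c * Q (f k) (f k)) \<longlonglongrightarrow> 2 * c * 0"
      by (intro tendsto_mult tendsto_const cov_form_bp_null[OF Q f])
    then show "(\<lambda>k. 2 * c * Q (f k) (f k)) \<longlonglongrightarrow> 0" by simp
  qed
  have sm: "(\<lambda>A. if A \<in> sets E then l (indicator A) else 0) \<in> signed_measures E"
    by (rule functional_signed_measure[OF bf bn])
  have "sm_integral E (\<lambda>A. if A \<in> sets E then l (indicator A) else 0) f = l f" if "f \<in> bdd_meas E" for f
    using that by (intro sm_integral_eqI[OF sm bf]) auto
  then show ?thesis using sm by blast
qed

text \<open>The coordinates of the \<tau>-topology: a simple function is a finite combination of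
  indicators, so evaluation at it is continuous. Signed measures have no common bound on their total
  variation, so uniform limits of such evaluations are not covered.\<close>

definition simples :: "'a measure \<Rightarrow> ('a \<Rightarrow> real) set" where
  "simples E = {f. simple_function E f}"

lemma simples_bdd_meas: "simples E \<subseteq> bdd_meas E"
  unfolding simples_def using simple_bdd_meas by blast

lemma simples_indicator: "A \<in> sets E \<Longrightarrow> indicator A \<in> simples E"
  unfolding simples_def by simp

lemma psd_form_simples:
  assumes "cov_form E Q"
  shows "psd_form (simples E) Q"
proof -
  interpret psd_form "bdd_meas E" Q using assms by (rule cov_form_psd)
  have s: "f \<in> simples E \<Longrightarrow> f \<in> bdd_meas E" for f using simples_bdd_meas by blast
  show ?thesis
  proof
    fix f g :: "'a \<Rightarrow> real" and a b assume "f \<in> simples E" "g \<in> simples E"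
    then show "(\<lambda>i. a * f i + b * g i) \<in> simples E"
      unfolding simples_def by auto
  qed (auto simp: simples_def[of E, symmetric] intro: Q_lin Q_nonneg Q_sym s, simp add: simples_def)
qed

lemma topspace_tau [simp]: "topspace (tau_topology E) = signed_measures E"
proof -
  have "signed_measures E = {\<mu> \<in> signed_measures E. \<mu> {} \<in> UNIV}" by simp
  then have "signed_measures E \<in> {{\<mu> \<in> signed_measures E. \<mu> A \<in> U} | A U. A \<in> sets E \<and> open U}"
    using sets.empty_sets open_UNIV by blast
  then show ?thesis
    unfolding tau_topology_def topology_generated_by_topspace by blast
qed

lemma continuous_map_tau_eval:
  assumes "A \<in> sets E"
  shows "continuous_map (tau_topology E) euclideanreal (\<lambda>\<mu>. \<mu> A)"
  unfolding continuous_map_def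
proof (intro conjI allI impI)
  fix U :: "real set" assume "openin euclideanreal U"
  then have "{\<mu> \<in> signed_measures E. \<mu> A \<in> U} \<in>
      {{\<mu> \<in> signed_measures E. \<mu> A \<in> U} | A U. A \<in> sets E \<and> open U}"
    using assms by auto
  then show "openin (tau_topology E) {\<mu> \<in> topspace (tau_topology E). \<mu> A \<in> U}"
    unfolding topspace_tau unfolding tau_topology_def by (rule topology_generated_by_Basis)
qed simp

lemma continuous_map_tau_simple:
  assumes "f \<in> simples E"
  shows "continuous_map (tau_topology E) euclideanreal (\<lambda>\<mu>. sm_integral E \<mu> f)"
proof -
  have f: "simple_function E f" using assms by (simp add: simples_def)
  have "continuous_map (tau_topology E) euclideanreal
      (\<lambda>\<mu>. \<Sum>y\<in>f ` space E. y * \<mu> (f -` {y} \<inter> space E))"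
    using simple_functionD[OF f]
    by (intro continuous_map_sum continuous_map_real_mult continuous_map_tau_eval) auto
  then show ?thesis
  proof (rule continuous_map_eq)
    fix \<mu> assume "\<mu> \<in> topspace (tau_topology E)"
    then have \<mu>: "\<mu> \<in> signed_measures E" by simp
    obtain C where C: "bdd_functional E (sm_integral E \<mu>) C" using sm_bdd_functional[OF \<mu>] by blast
    show "(\<Sum>y\<in>f ` space E. y * \<mu> (f -` {y} \<inter> space E)) = sm_integral E \<mu> f"
      unfolding bdd_functional_simple[OF C f]
      by (simp add: sm_integral_indicator[OF \<mu> simple_functionD(2)[OF f]])
  qed
qed

lemma tau_nbhd:
  assumes "openin (tau_topology E) G" "\<mu> \<in> G"
  shows "\<exists>F \<epsilon>. finite F \<and> F \<subseteq> sets E \<and> \<epsilon> > 0 \<and>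
    {\<nu> \<in> signed_measures E. \<forall>A\<in>F. \<bar>\<nu> A - \<mu> A\<bar> < \<epsilon>} \<subseteq> G"
proof -
  have "generate_topology_on {{\<mu> \<in> signed_measures E. \<mu> A \<in> U} | A U. A \<in> sets E \<and> open U} G"
    using assms(1) unfolding tau_topology_def openin_topology_generated_by_iff .
  then show ?thesis using assms(2)
  proof (induction arbitrary: \<mu>)
    case (Int a b)
    then have ab: "\<mu> \<in> a" "\<mu> \<in> b" by auto
    obtain F \<epsilon> where F: "finite F" "F \<subseteq> sets E" "\<epsilon> > 0"
      "{\<nu> \<in> signed_measures E. \<forall>A\<in>F. \<bar>\<nu> A - \<mu> A\<bar> < \<epsilon>} \<subseteq> a"
      using Int.IH(1)[OF ab(1)] by (elim exE conjE)
    obtain F' \<epsilon>' where F': "finite F'" "F' \<subseteq> sets E" "\<epsilon>' > 0"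
      "{\<nu> \<in> signed_measures E. \<forall>A\<in>F'. \<bar>\<nu> A - \<mu> A\<bar> < \<epsilon>'} \<subseteq> b"
      using Int.IH(2)[OF ab(2)] by (elim exE conjE)
    show ?case
    proof (intro exI[of _ "F \<union> F'"] exI[of _ "min \<epsilon> \<epsilon>'"] conjI)
      show "{\<nu> \<in> signed_measures E. \<forall>A\<in>F \<union> F'. \<bar>\<nu> A - \<mu> A\<bar> < min \<epsilon> \<epsilon>'} \<subseteq> a \<inter> b"
        using F(4) F'(4) by (simp add: subset_iff)
    qed (use F F' in auto)
  next
    case (UN K)
    then obtain k where k: "k \<in> K" "\<mu> \<in> k" by blast
    then obtain F \<epsilon> where "finite F" "F \<subseteq> sets E" "\<epsilon> > 0"
      "{\<nu> \<in> signed_measures E. \<forall>A\<in>F. \<bar>\<nu> A - \<mu> A\<bar> < \<epsilon>} \<subseteq> k" using UN.IH[OF k] by (elim exE conjE)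
    moreover have "k \<subseteq> \<Union>K" using k by blast
    ultimately show ?case by (intro exI[of _ F] exI[of _ \<epsilon>] conjI) simp_all
  next
    case (Basis s)
    then obtain A U where A: "A \<in> sets E" "open U" "s = {\<mu> \<in> signed_measures E. \<mu> A \<in> U}" by blast
    then obtain \<epsilon> where \<epsilon>: "\<epsilon> > 0" "ball (\<mu> A) \<epsilon> \<subseteq> U"
      using Basis.prems openE[OF A(2), of "\<mu> A"] by auto
    have "{\<nu> \<in> signed_measures E. \<forall>B\<in>{A}. \<bar>\<nu> B - \<mu> B\<bar> < \<epsilon>} \<subseteq> s"
      using \<epsilon> A by (auto simp: subset_iff dist_real_def abs_minus_commute)
    then show ?case using A \<epsilon> by (intro exI[of _ "{A}"] exI[of _ \<epsilon>]) auto
  qed auto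
qed

lemma coord_space_tau:
  assumes ne: "space E \<noteq> {}" and Q: "cov_form E Q"
  shows "coord_space (simples E) Q (tau_topology E) (\<lambda>f \<mu>. sm_integral E \<mu> f)"
proof -
  interpret psd_form "simples E" Q using Q by (rule psd_form_simples)
  interpret b: psd_form "bdd_meas E" Q using Q by (rule cov_form_psd)
  show ?thesis
  proof
    fix \<mu> assume "\<mu> \<in> topspace (tau_topology E)"
    then show "lin_on (simples E) (sm_integral E \<mu>)"
      unfolding lin_on_def using simples_bdd_meas by (auto intro!: sm_integral_lincomb)
  next
    fix f and U :: "real set" assume "f \<in> simples E" "open U"
    then show "openin (tau_topology E) {\<mu> \<in> topspace (tau_topology E). sm_integral E \<mu> f \<in> U}"
      by (intro openin_continuous_map_preimage[OF continuous_map_tau_simple]) auto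
  next
    fix G \<mu> assume G: "openin (tau_topology E) G" "\<mu> \<in> G"
    then have \<mu>: "\<mu> \<in> signed_measures E" using openin_subset by fastforce
    obtain F \<epsilon> where F: "finite F" "F \<subseteq> sets E" "\<epsilon> > 0"
      "{\<nu> \<in> signed_measures E. \<forall>A\<in>F. \<bar>\<nu> A - \<mu> A\<bar> < \<epsilon>} \<subseteq> G" using tau_nbhd[OF G] by blast
    have "{\<nu> \<in> topspace (tau_topology E). \<forall>f\<in>indicator ` F. \<bar>sm_integral E \<nu> f - sm_integral E \<mu> f\<bar> < \<epsilon>} \<subseteq> G"
    proof
      fix \<nu> assume \<nu>: "\<nu> \<in> {\<nu> \<in> topspace (tau_topology E). \<forall>f\<in>indicator ` F. \<bar>sm_integral E \<nu> f - sm_integral E \<mu> f\<bar> < \<epsilon>}"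
      have "\<bar>\<nu> A - \<mu> A\<bar> < \<epsilon>" if "A \<in> F" for A
        using \<nu> that F(2) sm_integral_indicator[OF \<mu>, of A] sm_integral_indicator[of \<nu> E A] by force
      then show "\<nu> \<in> G" using F(4) \<nu> by auto
    qed
    moreover have "indicator ` F \<subseteq> simples E" using F(2) simples_indicator by blast
    ultimately show "\<exists>F \<epsilon>. finite F \<and> F \<subseteq> simples E \<and> \<epsilon> > 0 \<and>
        {\<nu> \<in> topspace (tau_topology E). \<forall>f\<in>F. \<bar>sm_integral E \<nu> f - sm_integral E \<mu> f\<bar> < \<epsilon>} \<subseteq> G"
      using F(1,3) by blast
  next
    fix l c assume l: "lin_on (simples E) l" "\<And>f. f \<in> simples E \<Longrightarrow> l f - Q f f / 2 \<le> c"
    \<comment> \<open>On simple functions alone \<open>l\<close> could not be tested against bounded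
      pointwise limits, so it is first extended along the inclusion with the same bound
      \<open>c\<close>.\<close>
    have "\<exists>l'. lin_on (bdd_meas E) l' \<and> (\<forall>f\<in>bdd_meas E. l' f - Q f f / 2 \<le> c) \<and> (\<forall>b\<in>simples E. l' b = l b)"
    proof (rule b.extension[where A = "\<lambda>b. b"])
      show "psd_form (simples E) Q" by unfold_locales
      show "Q (\<lambda>k. a * b k + a' * b' k) e = a * Q b e + a' * Q b' e"
        if "b \<in> simples E" "b' \<in> simples E" "e \<in> bdd_meas E" for a a' b b' e
        using that simples_bdd_meas by (intro b.Q_lin) auto
    qed (use l simples_bdd_meas in auto)
    then obtain l' where l': "lin_on (bdd_meas E) l'" "\<And>f. f \<in> bdd_meas E \<Longrightarrow> l' f - Q f f / 2 \<le> c"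
      "\<And>f. f \<in> simples E \<Longrightarrow> l' f = l f" by blast
    obtain \<mu> where \<mu>: "\<mu> \<in> signed_measures E" "\<forall>f\<in>bdd_meas E. sm_integral E \<mu> f = l' f"
      using representation[OF ne Q l'(1,2)] by blast
    show "\<exists>\<mu>\<in>topspace (tau_topology E). \<forall>f\<in>simples E. sm_integral E \<mu> f = l f"
    proof (intro bexI[of _ \<mu>] ballI)
      fix f assume f: "f \<in> simples E"
      then have "f \<in> bdd_meas E" using simples_bdd_meas by blast
      then show "sm_integral E \<mu> f = l f" using \<mu>(2) l'(3)[OF f] by simp
    qed (use \<mu> in simp)
  next
    fix \<mu> \<nu> assume *: "\<mu> \<in> topspace (tau_topology E)" "\<nu> \<in> topspace (tau_topology E)"
      "\<And>f. f \<in> simples E \<Longrightarrow> sm_integral E \<mu> f = sm_integral E \<nu> f"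
    show "\<mu> = \<nu>"
    proof
      fix A
      show "\<mu> A = \<nu> A"
      proof (cases "A \<in> sets E")
        case True
        then show ?thesis
          using * simples_indicator[OF True] sm_integral_indicator[OF _ True, of \<mu>] sm_integral_indicator[OF _ True, of \<nu>]
          by simp
      next
        case False
        then show ?thesis using *(1,2) by (simp add: signed_measures_def)
      qed
    qed
  qed
qed

text \<open>Uniform simple approximations differ from \<open>f\<close> by a \<open>bp_null\<close>
  sequence, along which both the measure and the form are continuous. Coordinates restricted to
  simple functions thus lose nothing of the rate.\<close>

lemma rate_simples_eq:
  assumes Q: "cov_form E Q" and \<mu>: "\<mu> \<in> signed_measures E"
  shows "(SUP f\<in>simples E. ereal (sm_integral E \<mu> f - Q f f / 2)) =
    (SUP f\<in>bdd_meas E. ereal (sm_integral E \<mu> f - Q f f / 2))" (is "?S = ?B")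
proof (rule antisym)
  show "?S \<le> ?B" by (rule SUP_subset_mono[OF simples_bdd_meas order_refl])
next
  interpret psd_form "bdd_meas E" Q using Q by (rule cov_form_psd)
  obtain C where bf: "bdd_functional E (sm_integral E \<mu>) C" using sm_bdd_functional[OF \<mu>] by blast
  show "?B \<le> ?S"
  proof (rule SUP_least)
    fix f assume f: "f \<in> bdd_meas E"
    have "\<exists>g. simple_function E g \<and> (\<forall>x\<in>space E. \<bar>f x - g x\<bar> \<le> 1 / real (Suc k))" for k
      by (rule bdd_meas_approx[OF f]) simp
    then obtain g where g: "\<And>k. simple_function E (g k)"
      "\<And>k x. x \<in> space E \<Longrightarrow> \<bar>f x - g k x\<bar> \<le> 1 / real (Suc k)" by metis
    have gb: "g k \<in> bdd_meas E" for k using g(1) by (rule simple_bdd_meas)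
    define d where "d k = (\<lambda>x. 1 * f x + (-1) * g k x)" for k
    have db: "d k \<in> bdd_meas E" for k unfolding d_def using f gb by (intro bdd_meas_lincomb)
    have bp: "bp_null E d"
      unfolding bp_null_def
    proof (intro conjI allI ballI)
      show "\<exists>c. \<forall>k. \<forall>x\<in>space E. \<bar>d k x\<bar> \<le> c"
      proof (intro exI[of _ 1] allI ballI)
        fix k x assume "x \<in> space E"
        then have "\<bar>f x - g k x\<bar> \<le> 1 / real (Suc k)" by (rule g(2))
        also have "\<dots> \<le> 1" by simp
        finally show "\<bar>d k x\<bar> \<le> 1" by (simp add: d_def)
      qed
      fix x assume x: "x \<in> space E"
      show "(\<lambda>k. d k x) \<longlonglongrightarrow> 0"
        by (rule Lim_null_comparison[OF _ LIMSEQ_Suc[OF lim_1_over_n]]) (use g(2)[OF x] in \<open>simp add: d_def\<close>)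
    qed (rule db)
    have g_eq: "g k = (\<lambda>x. 1 * f x + (-1) * d k x)" for k unfolding d_def by simp
    have qd: "(\<lambda>k. Q (d k) (d k)) \<longlonglongrightarrow> 0" by (rule cov_form_bp_null[OF Q bp])
    have qfd: "(\<lambda>k. Q f (d k)) \<longlonglongrightarrow> 0"
    proof (rule tendsto_0_square_le)
      show "(Q f (d k))\<^sup>2 \<le> Q f f * Q (d k) (d k)" for k by (rule cauchy_schwarz[OF f db])
      show "(\<lambda>k. Q f f * Q (d k) (d k)) \<longlonglongrightarrow> 0" using tendsto_mult[OF tendsto_const qd] by simp
    qed
    have "Q (g k) (g k) = Q f f - 2 * Q f (d k) + Q (d k) (d k)" for k
      unfolding g_eq Q_expand[OF f db] by simp
    moreover have "sm_integral E \<mu> (g k) = sm_integral E \<mu> f - sm_integral E \<mu> (d k)" for k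
      unfolding g_eq[of k] using bdd_functional_lincomb[OF bf f db, of 1 "-1"] by simp
    moreover have "(\<lambda>k. (sm_integral E \<mu> f - sm_integral E \<mu> (d k)) - (Q f f - 2 * Q f (d k) + Q (d k) (d k)) / 2)
        \<longlonglongrightarrow> (sm_integral E \<mu> f - 0) - (Q f f - 2 * 0 + 0) / 2"
      by (intro tendsto_diff tendsto_add tendsto_mult tendsto_divide tendsto_const qd qfd sm_integral_bp_null[OF \<mu> bp]) simp
    ultimately have "(\<lambda>k. sm_integral E \<mu> (g k) - Q (g k) (g k) / 2) \<longlonglongrightarrow> sm_integral E \<mu> f - Q f f / 2"
      by simp
    then have "(\<lambda>k. ereal (sm_integral E \<mu> (g k) - Q (g k) (g k) / 2)) \<longlonglongrightarrow> ereal (sm_integral E \<mu> f - Q f f / 2)"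
      by simp
    then show "ereal (sm_integral E \<mu> f - Q f f / 2) \<le> ?S"
    proof (rule Lim_bounded[where M = 0], intro allI impI)
      fix k
      show "ereal (sm_integral E \<mu> (g k) - Q (g k) (g k) / 2) \<le> ?S"
        by (rule SUP_upper) (simp add: simples_def g(1))
    qed
  qed
qed

section \<open>Finite products\<close>

lemma sum_not_MInfty:
  fixes f :: "'b \<Rightarrow> ereal"
  assumes "\<And>x. x \<in> A \<Longrightarrow> f x \<noteq> - \<infinity>"
  shows "sum f A \<noteq> - \<infinity>"
  using assms
proof (induction A rule: infinite_finite_induct)
  case (insert x A)
  have "sum f A \<noteq> - \<infinity>" "f x \<noteq> - \<infinity>" using insert by auto
  then show ?case using insert by (cases "f x"; cases "sum f A") auto
qed auto

text \<open>The real summand \<open>r\<close> serves the induction: the value chosen at the last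
  index is moved into it. Nonempty index sets exclude minus infinity, so adding a constant commutes
  with the suprema.\<close>

lemma sum_SUP_le:
  fixes a :: "nat \<Rightarrow> 'b \<Rightarrow> real"
  assumes ne: "\<And>p. p \<le> n \<Longrightarrow> T p \<noteq> {}"
    and le: "\<And>F. (\<And>p. p \<le> n \<Longrightarrow> F p \<in> T p) \<Longrightarrow> ereal ((\<Sum>p\<le>n. a p (F p)) + r) \<le> z"
  shows "(\<Sum>p\<le>n. SUP f\<in>T p. ereal (a p f)) + ereal r \<le> z"
  using assms
proof (induction n arbitrary: r)
  case 0
  have "(SUP f\<in>T 0. ereal (a 0 f)) + ereal r = (SUP f\<in>T 0. ereal (a 0 f) + ereal r)"
    using 0(1) by (intro SUP_ereal_add_left[symmetric]) auto
  also have "\<dots> \<le> z" using 0(2)[of "\<lambda>_. f" for f] by (intro SUP_least) simp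
  finally show ?case by simp
next
  case (Suc n)
  let ?A = "\<Sum>p\<le>n. SUP f\<in>T p. ereal (a p f)"
  have fin: "(SUP f\<in>T p. ereal (a p f)) \<noteq> - \<infinity>" if "p \<le> Suc n" for p
  proof -
    obtain f where "f \<in> T p" using Suc.prems(1)[OF \<open>p \<le> Suc n\<close>] by blast
    then have "ereal (a p f) \<le> (SUP f\<in>T p. ereal (a p f))" by (rule SUP_upper)
    then show ?thesis by auto
  qed
  have "?A \<noteq> - \<infinity>" using fin by (intro sum_not_MInfty) auto
  then have A: "?A + ereal r \<noteq> - \<infinity>" by simp
  have step: "?A + ereal r + ereal (a (Suc n) f) \<le> z" if f: "f \<in> T (Suc n)" for f
  proof -
    have "?A + ereal (a (Suc n) f + r) \<le> z"
    proof (rule Suc.IH)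
      fix F assume F: "\<And>p. p \<le> n \<Longrightarrow> F p \<in> T p"
      have "ereal ((\<Sum>p\<le>Suc n. a p ((F(Suc n := f)) p)) + r) \<le> z"
        using F f by (intro Suc.prems(2)) (auto simp: le_Suc_eq)
      then show "ereal ((\<Sum>p\<le>n. a p (F p)) + (a (Suc n) f + r)) \<le> z" by (simp add: add.assoc)
    qed (use Suc.prems(1) in auto)
    moreover have "ereal (a (Suc n) f + r) = ereal r + ereal (a (Suc n) f)" by simp
    ultimately show ?thesis by (simp only: add.assoc)
  qed
  have "(\<Sum>p\<le>Suc n. SUP f\<in>T p. ereal (a p f)) + ereal r = ?A + ereal r + (SUP f\<in>T (Suc n). ereal (a (Suc n) f))"
    by (simp add: ac_simps)
  also have "\<dots> = (SUP f\<in>T (Suc n). ?A + ereal r + ereal (a (Suc n) f))"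
    using Suc.prems(1)[of "Suc n"] A by (intro SUP_ereal_add_right[symmetric]) auto
  also have "\<dots> \<le> z" using step by (rule SUP_least)
  finally show ?case .
qed

text \<open>A tuple of functions is encoded as one function on pairs of a time and a state, because
  \<open>psd_form\<close> is about sets of real functions with pointwise operations.\<close>

definition embed_at :: "nat \<Rightarrow> ('a \<Rightarrow> real) \<Rightarrow> (nat \<times> 'a \<Rightarrow> real)" where
  "embed_at p f = (\<lambda>(q, x). if q = p then f x else 0)"

definition slice :: "(nat \<times> 'a \<Rightarrow> real) \<Rightarrow> nat \<Rightarrow> ('a \<Rightarrow> real)" where
  "slice f p = (\<lambda>x. f (p, x))"

text \<open>Slices beyond \<open>n\<close> are required to vanish, so that an element is the sum of
  its embedded slices.\<close>

definition prod_space :: "nat \<Rightarrow> (nat \<Rightarrow> ('a \<Rightarrow> real) set) \<Rightarrow> (nat \<times> 'a \<Rightarrow> real) set" where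
  "prod_space n T = {f. (\<forall>p\<le>n. slice f p \<in> T p) \<and> (\<forall>p>n. slice f p = (\<lambda>_. 0))}"

definition prod_form :: "nat \<Rightarrow> (nat \<Rightarrow> ('a \<Rightarrow> real) \<Rightarrow> ('a \<Rightarrow> real) \<Rightarrow> real) \<Rightarrow>
    (nat \<times> 'a \<Rightarrow> real) \<Rightarrow> (nat \<times> 'a \<Rightarrow> real) \<Rightarrow> real" where
  "prod_form n Q f g = (\<Sum>p\<le>n. Q p (slice f p) (slice g p))"

lemma slice_embed: "slice (embed_at p f) q = (if q = p then f else (\<lambda>_. 0))"
  unfolding slice_def embed_at_def by auto

lemma slice_lincomb: "slice (\<lambda>i. a * f i + b * g i) p = (\<lambda>x. a * slice f p x + b * slice g p x)"
  unfolding slice_def by simp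

lemma embed_lincomb: "embed_at p (\<lambda>x. a * f x + b * g x) = (\<lambda>i. a * embed_at p f i + b * embed_at p g i)"
  unfolding embed_at_def by auto

locale psd_family =
  fixes n :: nat and T :: "nat \<Rightarrow> ('a \<Rightarrow> real) set" and Q
  assumes psd: "p \<le> n \<Longrightarrow> psd_form (T p) (Q p)"
begin

lemma sliceT: "f \<in> prod_space n T \<Longrightarrow> p \<le> n \<Longrightarrow> slice f p \<in> T p"
  unfolding prod_space_def by blast

lemma Q_0: "p \<le> n \<Longrightarrow> g \<in> T p \<Longrightarrow> Q p (\<lambda>_. 0) g = 0"
proof -
  assume p: "p \<le> n" and g: "g \<in> T p"
  interpret psd_form "T p" "Q p" by (rule psd[OF p])
  show ?thesis using Q_lin[OF zero zero g, of 0 0] by simp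
qed

lemma psd_prod: "psd_form (prod_space n T) (prod_form n Q)"
proof
  fix f g :: "nat \<times> 'a \<Rightarrow> real" and a b assume fg: "f \<in> prod_space n T" "g \<in> prod_space n T"
  show "(\<lambda>i. a * f i + b * g i) \<in> prod_space n T"
    using fg unfolding prod_space_def mem_Collect_eq slice_lincomb by (auto intro: psd_form.lincomb[OF psd])
  show "prod_form n Q f g = prod_form n Q g f"
    unfolding prod_form_def using fg by (intro sum.cong refl psd_form.Q_sym[OF psd] sliceT) auto
  fix h assume h: "h \<in> prod_space n T"
  have "prod_form n Q (\<lambda>i. a * f i + b * g i) h
      = (\<Sum>p\<le>n. a * Q p (slice f p) (slice h p) + b * Q p (slice g p) (slice h p))"
    unfolding prod_form_def slice_lincomb
    using fg h by (intro sum.cong refl psd_form.Q_lin[OF psd] sliceT) auto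
  then show "prod_form n Q (\<lambda>i. a * f i + b * g i) h = a * prod_form n Q f h + b * prod_form n Q g h"
    unfolding prod_form_def by (simp add: sum.distrib sum_distrib_left)
next
  show "(\<lambda>i. 0) \<in> prod_space n T"
    unfolding prod_space_def slice_def using psd_form.zero[OF psd] by auto
  fix f assume "f \<in> prod_space n T"
  then show "0 \<le> prod_form n Q f f"
    unfolding prod_form_def by (intro sum_nonneg psd_form.Q_nonneg[OF psd] sliceT) auto
qed

lemma embedT: "p \<le> n \<Longrightarrow> f \<in> T p \<Longrightarrow> embed_at p f \<in> prod_space n T"
  unfolding prod_space_def mem_Collect_eq slice_embed using psd_form.zero[OF psd] by auto

lemma prod_form_embed: "p \<le> n \<Longrightarrow> f \<in> T p \<Longrightarrow> prod_form n Q (embed_at p f) (embed_at p f) = Q p f f"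
proof -
  assume p: "p \<le> n" and f: "f \<in> T p"
  have "prod_form n Q (embed_at p f) (embed_at p f) = (\<Sum>q\<le>n. if q = p then Q p f f else 0)"
    unfolding prod_form_def slice_embed using p Q_0[OF _ psd_form.zero[OF psd]] by (intro sum.cong) auto
  then show ?thesis using p by simp
qed

lemma lin_on_embed:
  assumes "lin_on (prod_space n T) l" "p \<le> n"
  shows "lin_on (T p) (\<lambda>f. l (embed_at p f))"
  unfolding lin_on_def embed_lincomb using assms embedT by (auto intro: lin_onD)

lemma decompose:
  assumes l: "lin_on (prod_space n T) l" and f: "f \<in> prod_space n T"
  shows "l f = (\<Sum>p\<le>n. l (embed_at p (slice f p)))"
proof -
  interpret psd_form "prod_space n T" "prod_form n Q" by (rule psd_prod)
  have "m \<le> Suc n \<Longrightarrow> (\<lambda>i. \<Sum>p<m. embed_at p (slice f p) i) \<in> prod_space n T \<and>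
      l (\<lambda>i. \<Sum>p<m. embed_at p (slice f p) i) = (\<Sum>p<m. l (embed_at p (slice f p)))" for m
  proof (induction m)
    case 0
    then show ?case using zero lin_on_0[OF l] by simp
  next
    case (Suc m)
    then have IH: "(\<lambda>i. \<Sum>p<m. embed_at p (slice f p) i) \<in> prod_space n T"
      "l (\<lambda>i. \<Sum>p<m. embed_at p (slice f p) i) = (\<Sum>p<m. l (embed_at p (slice f p)))" by auto
    have e: "embed_at m (slice f m) \<in> prod_space n T" using Suc.prems f by (intro embedT sliceT) auto
    show ?case
      using lincomb[OF IH(1) e, of 1 1] lin_onD[OF l IH(1) e, of 1 1] IH(2) by simp
  qed
  from this[of "Suc n"] have "l (\<lambda>i. \<Sum>p<Suc n. embed_at p (slice f p) i) = (\<Sum>p<Suc n. l (embed_at p (slice f p)))"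
    by simp
  moreover have "(\<lambda>i. \<Sum>p<Suc n. embed_at p (slice f p) i) = f"
  proof
    fix i :: "nat \<times> 'a"
    obtain q x where i: "i = (q, x)" by (cases i)
    have "(\<Sum>p<Suc n. embed_at p (slice f p) i) = (\<Sum>p<Suc n. if p = q then f (q, x) else 0)"
      unfolding i embed_at_def slice_def by (intro sum.cong) auto
    also have "\<dots> = (if q \<le> n then f (q, x) else 0)" by (simp add: less_Suc_eq_le)
    also have "\<dots> = f (q, x)" using f unfolding prod_space_def slice_def by (auto dest: fun_cong simp: not_le)
    finally show "(\<Sum>p<Suc n. embed_at p (slice f p) i) = f i" unfolding i .
  qed
  ultimately show ?thesis by (simp add: lessThan_Suc_atMost)
qed

end

text \<open>The slices of a test function can be chosen independently of each other, so one supremum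
  over tuples splits into a sum of suprema.\<close>

lemma prod_form_rate:
  assumes E: "\<And>p. p \<le> n \<Longrightarrow> cov_form (E p) (Q p)" and \<mu>: "\<And>p. p \<le> n \<Longrightarrow> \<mu> p \<in> signed_measures (E p)"
  shows "(SUP f\<in>prod_space n (\<lambda>p. simples (E p)).
      ereal ((\<Sum>p\<le>n. sm_integral (E p) (\<mu> p) (slice f p)) - prod_form n Q f f / 2))
    = (\<Sum>p\<le>n. SUP f\<in>bdd_meas (E p). ereal (sm_integral (E p) (\<mu> p) f - Q p f f / 2))" (is "?S = ?R")
proof (rule antisym)
  let ?a = "\<lambda>p f. sm_integral (E p) (\<mu> p) f - Q p f f / 2"
  have R: "?R = (\<Sum>p\<le>n. SUP f\<in>simples (E p). ereal (?a p f))"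
    using rate_simples_eq[OF E \<mu>] by (intro sum.cong) auto
  have eq: "(\<Sum>p\<le>n. sm_integral (E p) (\<mu> p) (slice f p)) - prod_form n Q f f / 2 = (\<Sum>p\<le>n. ?a p (slice f p))" for f
    unfolding prod_form_def by (simp add: sum_subtractf sum_divide_distrib)
  show "?S \<le> ?R"
  proof (rule SUP_least)
    fix f assume f: "f \<in> prod_space n (\<lambda>p. simples (E p))"
    have "ereal (\<Sum>p\<le>n. ?a p (slice f p)) = (\<Sum>p\<le>n. ereal (?a p (slice f p)))" by simp
    also have "\<dots> \<le> (\<Sum>p\<le>n. SUP f\<in>simples (E p). ereal (?a p f))"
      using f unfolding prod_space_def by (intro sum_mono SUP_upper) auto
    finally show "ereal ((\<Sum>p\<le>n. sm_integral (E p) (\<mu> p) (slice f p)) - prod_form n Q f f / 2) \<le> ?R"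
      unfolding eq R .
  qed
  have "(\<Sum>p\<le>n. SUP f\<in>simples (E p). ereal (?a p f)) + ereal 0 \<le> ?S"
  proof (rule sum_SUP_le)
    show "simples (E p) \<noteq> {}" for p using simples_indicator[OF sets.empty_sets] by blast
    fix F assume F: "\<And>p. p \<le> n \<Longrightarrow> F p \<in> simples (E p)"
    define f where "f = (\<lambda>(p, x). if p \<le> n then F p x else 0)"
    have sl: "slice f p = (if p \<le> n then F p else (\<lambda>_. 0))" for p unfolding f_def slice_def by auto
    have "f \<in> prod_space n (\<lambda>p. simples (E p))" unfolding prod_space_def mem_Collect_eq sl using F by auto
    then have "ereal (\<Sum>p\<le>n. ?a p (slice f p)) \<le> ?S" unfolding eq[symmetric] by (rule SUP_upper)
    then show "ereal ((\<Sum>p\<le>n. ?a p (F p)) + 0) \<le> ?S" unfolding sl by simp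
  qed
  then show "?R \<le> ?S" unfolding R by simp
qed

text \<open>Evaluation at an embedded function sees a single component, and every coordinate is a
  sum of such evaluations. The axioms therefore follow from those of the factors; for
  \<open>complete\<close> the functional is restricted to each factor and represented there.\<close>

lemma coord_space_prod_tau:
  assumes ne: "\<And>p. p \<le> n \<Longrightarrow> space (E p) \<noteq> {}" and Q: "\<And>p. p \<le> n \<Longrightarrow> cov_form (E p) (Q p)"
  shows "coord_space (prod_space n (\<lambda>p. simples (E p))) (prod_form n Q)
    (product_topology (\<lambda>p. tau_topology (E p)) {..n})
    (\<lambda>f \<mu>. \<Sum>p\<le>n. sm_integral (E p) (\<mu> p) (slice f p))" (is "coord_space ?T _ ?X ?ev")
proof -
  interpret psd_family n "\<lambda>p. simples (E p)" Q by (rule psd_family.intro, rule psd_form_simples[OF Q])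
  interpret psd_form ?T "prod_form n Q" by (rule psd_prod)
  have cs: "coord_space (simples (E p)) (Q p) (tau_topology (E p)) (\<lambda>f \<mu>. sm_integral (E p) \<mu> f)" if "p \<le> n" for p
    using that by (intro coord_space_tau ne Q)
  have ev_embed: "?ev (embed_at p f) \<mu> = sm_integral (E p) (\<mu> p) f"
    if p: "p \<le> n" and \<mu>: "\<And>q. q \<le> n \<Longrightarrow> \<mu> q \<in> signed_measures (E q)" for p f \<mu>
  proof -
    have "sm_integral (E q) (\<mu> q) (slice (embed_at p f) q) = (if q = p then sm_integral (E p) (\<mu> p) f else 0)"
      if "q \<le> n" for q
      using sm_integral_lincomb[OF \<mu>[OF that] bdd_meas_const bdd_meas_const, of 0 0 0 0]
      by (simp add: slice_embed)
    then show ?thesis using p by simp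
  qed
  show ?thesis
  proof
    fix \<mu> assume \<mu>: "\<mu> \<in> topspace ?X"
    then have \<mu>p: "p \<le> n \<Longrightarrow> \<mu> p \<in> signed_measures (E p)" for p by auto
    show "lin_on ?T (\<lambda>f. ?ev f \<mu>)"
      unfolding lin_on_def
    proof (intro ballI allI)
      fix f g a b assume fg: "f \<in> ?T" "g \<in> ?T"
      have "?ev (\<lambda>i. a * f i + b * g i) \<mu> =
          (\<Sum>p\<le>n. a * sm_integral (E p) (\<mu> p) (slice f p) + b * sm_integral (E p) (\<mu> p) (slice g p))"
        unfolding slice_lincomb
        using fg \<mu>p by (intro sum.cong refl sm_integral_lincomb) (auto intro!: subsetD[OF simples_bdd_meas] sliceT)
      then show "?ev (\<lambda>i. a * f i + b * g i) \<mu> = a * ?ev f \<mu> + b * ?ev g \<mu>"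
        by (simp add: sum.distrib sum_distrib_left)
    qed
  next
    fix f and U :: "real set" assume f: "f \<in> ?T" and U: "open U"
    have "continuous_map ?X euclideanreal (?ev f)"
    proof (rule continuous_map_sum)
      fix p assume p: "p \<in> {..n}"
      have "continuous_map ?X euclideanreal ((\<lambda>\<mu>. sm_integral (E p) \<mu> (slice f p)) \<circ> (\<lambda>\<mu>. \<mu> p))"
      proof (rule continuous_map_compose)
        show "continuous_map ?X (tau_topology (E p)) (\<lambda>\<mu>. \<mu> p)"
          using continuous_map_product_projection[OF p, of "\<lambda>p. tau_topology (E p)"] .
        show "continuous_map (tau_topology (E p)) euclideanreal (\<lambda>\<mu>. sm_integral (E p) \<mu> (slice f p))"
          using p f by (intro continuous_map_tau_simple sliceT) auto
      qed
      then show "continuous_map ?X euclideanreal (\<lambda>\<mu>. sm_integral (E p) (\<mu> p) (slice f p))"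
        by (simp add: o_def)
    qed simp
    then show "openin ?X {\<mu> \<in> topspace ?X. ?ev f \<mu> \<in> U}"
      using U by (intro openin_continuous_map_preimage) auto
  next
    fix G \<mu> assume G: "openin ?X G" "\<mu> \<in> G"
    then have \<mu>X: "\<mu> \<in> topspace ?X" using openin_subset by blast
    then have \<mu>p: "p \<le> n \<Longrightarrow> \<mu> p \<in> signed_measures (E p)" for p by auto
    have "\<exists>U. finite {i \<in> {..n}. U i \<noteq> topspace (tau_topology (E i))} \<and>
        (\<forall>i\<in>{..n}. openin (tau_topology (E i)) (U i)) \<and> \<mu> \<in> PiE {..n} U \<and> PiE {..n} U \<subseteq> G"
      using G unfolding openin_product_topology_alt by blast
    then obtain U where "\<forall>i\<in>{..n}. openin (tau_topology (E i)) (U i)"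
      and U2: "\<mu> \<in> PiE {..n} U" "PiE {..n} U \<subseteq> G"
      by blast
    then have U: "\<And>p. p \<le> n \<Longrightarrow> openin (tau_topology (E p)) (U p)" "\<mu> \<in> PiE {..n} U" "PiE {..n} U \<subseteq> G"
      by simp_all
    have "\<forall>p\<in>{..n}. \<exists>F\<epsilon>. finite (fst F\<epsilon>) \<and> fst F\<epsilon> \<subseteq> simples (E p) \<and> snd F\<epsilon> > 0 \<and>
        {\<nu> \<in> signed_measures (E p). \<forall>f\<in>fst F\<epsilon>. \<bar>sm_integral (E p) \<nu> f - sm_integral (E p) (\<mu> p) f\<bar> < snd F\<epsilon>} \<subseteq> U p"
    proof
      fix p assume "p \<in> {..n}"
      then have p: "p \<le> n" by simp
      have "\<mu> p \<in> U p" using U(2) p by auto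
      from coord_space.nbhd[OF cs[OF p] U(1)[OF p] this]
      show "\<exists>F\<epsilon>. finite (fst F\<epsilon>) \<and> fst F\<epsilon> \<subseteq> simples (E p) \<and> snd F\<epsilon> > 0 \<and>
        {\<nu> \<in> signed_measures (E p). \<forall>f\<in>fst F\<epsilon>. \<bar>sm_integral (E p) \<nu> f - sm_integral (E p) (\<mu> p) f\<bar> < snd F\<epsilon>} \<subseteq> U p"
        by simp
    qed
    from bchoice[OF this] obtain c where c0: "\<forall>p\<in>{..n}. finite (fst (c p)) \<and> fst (c p) \<subseteq> simples (E p) \<and> snd (c p) > 0 \<and>
        {\<nu> \<in> signed_measures (E p). \<forall>f\<in>fst (c p). \<bar>sm_integral (E p) \<nu> f - sm_integral (E p) (\<mu> p) f\<bar> < snd (c p)} \<subseteq> U p" ..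
    have c: "\<And>p. p \<le> n \<Longrightarrow> finite (fst (c p))"
      "\<And>p. p \<le> n \<Longrightarrow> fst (c p) \<subseteq> simples (E p)" "\<And>p. p \<le> n \<Longrightarrow> snd (c p) > 0"
      "\<And>p. p \<le> n \<Longrightarrow> {\<nu> \<in> signed_measures (E p). \<forall>f\<in>fst (c p).
          \<bar>sm_integral (E p) \<nu> f - sm_integral (E p) (\<mu> p) f\<bar> < snd (c p)} \<subseteq> U p"
      using c0 by (simp_all only: atMost_iff)
    define F where "F = (\<Union>p\<le>n. embed_at p ` fst (c p))"
    define \<epsilon> where "\<epsilon> = Min ((\<lambda>p. snd (c p)) ` {..n})"
    have "finite F" unfolding F_def using c(1) by auto
    moreover have "F \<subseteq> ?T" unfolding F_def using c(2) embedT by fastforce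
    moreover have "\<epsilon> > 0" unfolding \<epsilon>_def using c(3) by (subst Min_gr_iff) auto
    moreover have "{\<nu> \<in> topspace ?X. \<forall>f\<in>F. \<bar>?ev f \<nu> - ?ev f \<mu>\<bar> < \<epsilon>} \<subseteq> G"
    proof
      fix \<nu> assume \<nu>: "\<nu> \<in> {\<nu> \<in> topspace ?X. \<forall>f\<in>F. \<bar>?ev f \<nu> - ?ev f \<mu>\<bar> < \<epsilon>}"
      then have \<nu>p: "p \<le> n \<Longrightarrow> \<nu> p \<in> signed_measures (E p)" for p by auto
      have "\<nu> p \<in> U p" if p: "p \<le> n" for p
      proof -
        have "\<bar>sm_integral (E p) (\<nu> p) f - sm_integral (E p) (\<mu> p) f\<bar> < snd (c p)" if f: "f \<in> fst (c p)" for f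
        proof -
          have "embed_at p f \<in> F" unfolding F_def using f p by blast
          then have "\<bar>?ev (embed_at p f) \<nu> - ?ev (embed_at p f) \<mu>\<bar> < \<epsilon>" using \<nu> by blast
          moreover have "\<epsilon> \<le> snd (c p)" unfolding \<epsilon>_def using p by (intro Min_le) auto
          moreover have "?ev (embed_at p f) \<nu> = sm_integral (E p) (\<nu> p) f" by (rule ev_embed[OF p \<nu>p])
          moreover have "?ev (embed_at p f) \<mu> = sm_integral (E p) (\<mu> p) f" by (rule ev_embed[OF p \<mu>p])
          ultimately show ?thesis by linarith
        qed
        then show ?thesis using c(4)[OF p] \<nu>p[OF p] by blast
      qed
      moreover have "\<nu> \<in> extensional {..n}" using \<nu> by (auto simp: PiE_iff)
      ultimately have "\<nu> \<in> PiE {..n} U" by (auto simp: PiE_iff)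
      then show "\<nu> \<in> G" using U(3) by blast
    qed
    ultimately show "\<exists>F \<epsilon>. finite F \<and> F \<subseteq> ?T \<and> \<epsilon> > 0 \<and> {\<nu> \<in> topspace ?X. \<forall>f\<in>F. \<bar>?ev f \<nu> - ?ev f \<mu>\<bar> < \<epsilon>} \<subseteq> G"
      by blast
  next
    fix l c assume l: "lin_on ?T l" "\<And>f. f \<in> ?T \<Longrightarrow> l f - prod_form n Q f f / 2 \<le> c"
    have "\<forall>p\<in>{..n}. \<exists>\<mu>. \<mu> \<in> signed_measures (E p) \<and> (\<forall>f\<in>simples (E p). sm_integral (E p) \<mu> f = l (embed_at p f))"
    proof
      fix p assume "p \<in> {..n}"
      then have p: "p \<le> n" by simp
      have "l (embed_at p f) - Q p f f / 2 \<le> c" if "f \<in> simples (E p)" for f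
        using l(2)[OF embedT[OF p that]] unfolding prod_form_embed[OF p that] .
      from coord_space.complete[OF cs[OF p] lin_on_embed[OF l(1) p] this]
      show "\<exists>\<mu>. \<mu> \<in> signed_measures (E p) \<and> (\<forall>f\<in>simples (E p). sm_integral (E p) \<mu> f = l (embed_at p f))"
        by auto
    qed
    from bchoice[OF this] obtain m where
      "\<forall>p\<in>{..n}. m p \<in> signed_measures (E p) \<and> (\<forall>f\<in>simples (E p). sm_integral (E p) (m p) f = l (embed_at p f))" ..
    then have m: "\<And>p. p \<le> n \<Longrightarrow> m p \<in> signed_measures (E p)"
      "\<And>p f. p \<le> n \<Longrightarrow> f \<in> simples (E p) \<Longrightarrow> sm_integral (E p) (m p) f = l (embed_at p f)"
      by simp_all
    show "\<exists>\<mu>\<in>topspace ?X. \<forall>f\<in>?T. ?ev f \<mu> = l f"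
    proof (intro bexI ballI)
      show "restrict m {..n} \<in> topspace ?X" using m(1) by auto
      fix f assume f: "f \<in> ?T"
      show "?ev f (restrict m {..n}) = l f"
        unfolding decompose[OF l(1) f] using m(2) sliceT[OF f] by (intro sum.cong) auto
    qed
  next
    fix \<mu> \<nu> assume *: "\<mu> \<in> topspace ?X" "\<nu> \<in> topspace ?X" "\<And>f. f \<in> ?T \<Longrightarrow> ?ev f \<mu> = ?ev f \<nu>"
    have \<mu>p: "p \<le> n \<Longrightarrow> \<mu> p \<in> signed_measures (E p)" "p \<le> n \<Longrightarrow> \<nu> p \<in> signed_measures (E p)" for p
      using *(1,2) by auto
    have "\<mu> p = \<nu> p" if p: "p \<le> n" for p
    proof (rule coord_space.sep[OF cs[OF p]])
      fix f assume f: "f \<in> simples (E p)"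
      show "sm_integral (E p) (\<mu> p) f = sm_integral (E p) (\<nu> p) f"
      proof -
        have "?ev (embed_at p f) \<mu> = sm_integral (E p) (\<mu> p) f" by (rule ev_embed[OF p \<mu>p(1)])
        moreover have "?ev (embed_at p f) \<nu> = sm_integral (E p) (\<nu> p) f" by (rule ev_embed[OF p \<mu>p(2)])
        ultimately show ?thesis using *(3)[OF embedT[OF p f]] by simp
      qed
    qed (use \<mu>p p in auto)
    then show "\<mu> = \<nu>" using *(1,2) by (intro PiE_ext[of \<mu> "{..n}" _ \<nu>]) auto
  qed
qed

section \<open>Markov kernels and covariance forms\<close>

lemma probsD: "\<rho> \<in> probs E \<Longrightarrow> prob_space \<rho>" "\<rho> \<in> probs E \<Longrightarrow> sets \<rho> = sets E"
    "\<rho> \<in> probs E \<Longrightarrow> space \<rho> = space E"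
  by (auto simp: space_prob_algebra dest: sets_eq_imp_space_eq)

lemma probs_integrable: "\<rho> \<in> probs E \<Longrightarrow> f \<in> bdd_meas E \<Longrightarrow> integrable \<rho> f"
  by (intro bdd_meas_integrable[of _ E] prob_space.finite_measure) (auto dest: probsD)

lemma probs_functional:
  assumes "\<rho> \<in> probs E"
  shows "bdd_functional E (\<lambda>f. \<integral>x. f x \<partial>\<rho>) 1"
  using integral_bdd_functional[OF prob_space.finite_measure[OF probsD(1)[OF assms]] probsD(2)[OF assms]]
    prob_space.prob_space[OF probsD(1)[OF assms]] by simp

lemma probs_bound:
  assumes "\<rho> \<in> probs E" "f \<in> bdd_meas E" "\<And>x. x \<in> space E \<Longrightarrow> \<bar>f x\<bar> \<le> c"
  shows "\<bar>\<integral>x. f x \<partial>\<rho>\<bar> \<le> c"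
  using bdd_functional_bound[OF probs_functional[OF assms(1)] assms(2,3)] by simp

lemma probs_mono:
  assumes "\<rho> \<in> probs E" "f \<in> bdd_meas E" "g \<in> bdd_meas E" "\<And>x. x \<in> space E \<Longrightarrow> f x \<le> g x"
  shows "(\<integral>x. f x \<partial>\<rho>) \<le> (\<integral>x. g x \<partial>\<rho>)"
  using assms probsD[OF assms(1)] by (intro integral_mono probs_integrable) auto

lemma probs_const:
  assumes "\<rho> \<in> probs E"
  shows "(\<integral>x. c \<partial>\<rho>) = (c::real)"
  using prob_space.prob_space[OF probsD(1)[OF assms]] by simp

lemma probs_nonempty:
  assumes "\<rho> \<in> probs E"
  shows "space E \<noteq> {}"
  using prob_space.not_empty[OF probsD(1)[OF assms]] probsD(3)[OF assms] by simp

lemma bp_null_bdd: "bp_null E f \<Longrightarrow> f k \<in> bdd_meas E"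
  unfolding bp_null_def by blast

lemma bp_null_mult:
  assumes f: "bp_null E f" and g: "bp_null E g"
  shows "bp_null E (\<lambda>k x. f k x * g k x)"
proof -
  obtain c where c: "\<And>k x. x \<in> space E \<Longrightarrow> \<bar>f k x\<bar> \<le> c" using f unfolding bp_null_def by blast
  obtain d where d: "\<And>k x. x \<in> space E \<Longrightarrow> \<bar>g k x\<bar> \<le> d" using g unfolding bp_null_def by blast
  show ?thesis
    unfolding bp_null_def
  proof (intro conjI allI ballI)
    show "\<exists>c. \<forall>k. \<forall>x\<in>space E. \<bar>f k x * g k x\<bar> \<le> c"
    proof (intro exI[of _ "\<bar>c\<bar> * \<bar>d\<bar>"] allI ballI)
      fix k x assume "x \<in> space E"
      from c[OF this, of k] d[OF this, of k] show "\<bar>f k x * g k x\<bar> \<le> \<bar>c\<bar> * \<bar>d\<bar>"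
        unfolding abs_mult by (intro mult_mono) auto
    qed
    fix x assume "x \<in> space E"
    then have "(\<lambda>k. f k x) \<longlonglongrightarrow> 0" "(\<lambda>k. g k x) \<longlonglongrightarrow> 0" using f g unfolding bp_null_def by auto
    from tendsto_mult[OF this] show "(\<lambda>k. f k x * g k x) \<longlonglongrightarrow> 0" by simp
  qed (use bp_null_bdd[OF f] bp_null_bdd[OF g] in auto)
qed

locale markov_kernel =
  fixes E :: "'a measure" and F :: "'b measure" and k :: "'a \<Rightarrow> 'b measure"
  assumes k: "k \<in> measurable E (prob_algebra F)"
begin

definition op :: "('b \<Rightarrow> real) \<Rightarrow> 'a \<Rightarrow> real" where
  "op f x = (\<integral>y. f y \<partial>k x)"

lemma kx: "x \<in> space E \<Longrightarrow> k x \<in> probs F"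
  using measurable_space[OF k] .

lemma op_bound:
  "f \<in> bdd_meas F \<Longrightarrow> (\<And>y. y \<in> space F \<Longrightarrow> \<bar>f y\<bar> \<le> c) \<Longrightarrow> x \<in> space E \<Longrightarrow> \<bar>op f x\<bar> \<le> c"
  unfolding op_def using probs_bound[OF kx] by blast

lemma op_bdd:
  assumes f: "f \<in> bdd_meas F"
  shows "op f \<in> bdd_meas E"
proof -
  obtain c where c: "\<And>y. y \<in> space F \<Longrightarrow> \<bar>f y\<bar> \<le> c" using f by (rule bdd_measE) blast
  have "(\<lambda>x. \<integral>y. f y \<partial>k x) \<in> borel_measurable E"
    by (rule measurable_compose[OF measurable_prob_algebraD[OF k] integral_measurable_subprob_algebra])
      (use f in \<open>rule bdd_meas_measurable\<close>)
  then have "op f \<in> borel_measurable E" unfolding op_def[abs_def] .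
  then show ?thesis by (rule bdd_measI) (rule op_bound[OF f c])
qed

lemma op_lincomb:
  "x \<in> space E \<Longrightarrow> f \<in> bdd_meas F \<Longrightarrow> g \<in> bdd_meas F \<Longrightarrow>
     op (\<lambda>y. a * f y + b * g y) x = a * op f x + b * op g x"
  unfolding op_def using bdd_functional_lincomb[OF probs_functional[OF kx]] by blast

lemma op_const: "x \<in> space E \<Longrightarrow> op (\<lambda>_. c) x = c"
  unfolding op_def using probs_const[OF kx] by blast

lemma op_dev:
  assumes f: "f \<in> bdd_meas F" and x: "x \<in> space E" and y: "y \<in> space F"
  shows "\<bar>f y - op f x\<bar> \<le> rosc F f"
proof -
  have "op (\<lambda>z. 1 * f y + (-1) * f z) x = 1 * f y + (-1) * op f x"
    using op_lincomb[OF x bdd_meas_const f, of 1 "f y" "-1"] op_const[OF x] by simp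
  moreover have "\<bar>op (\<lambda>z. 1 * f y + (-1) * f z) x\<bar> \<le> rosc F f"
    using f x y rosc_bound[OF f y] by (intro op_bound bdd_meas_lincomb) auto
  ultimately show ?thesis by simp
qed

lemma op_bp_null:
  assumes f: "bp_null F f"
  shows "bp_null E (\<lambda>n. op (f n))"
proof -
  obtain c where c: "\<And>k x. x \<in> space F \<Longrightarrow> \<bar>f k x\<bar> \<le> c" using f unfolding bp_null_def by blast
  show ?thesis
    unfolding bp_null_def
  proof (intro conjI allI ballI)
    show "\<exists>c. \<forall>k. \<forall>x\<in>space E. \<bar>op (f k) x\<bar> \<le> c"
      using op_bound[OF bp_null_bdd[OF f] c] by blast
    fix x assume "x \<in> space E"
    from kx[OF this] show "(\<lambda>n. op (f n) x) \<longlonglongrightarrow> 0"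
      unfolding op_def using f by (intro bp_null_integral[of _ F]) (auto dest: probsD intro: prob_space.finite_measure)
  qed (rule op_bdd[OF bp_null_bdd[OF f]])
qed

lemma op_covariance:
  assumes f: "f \<in> bdd_meas F" and g: "g \<in> bdd_meas F" and x: "x \<in> space E"
  shows "(\<integral>y. (f y - op f x) * (g y - op g x) \<partial>k x) = op (\<lambda>y. f y * g y) x - op f x * op g x"
proof -
  note L = bdd_functional_lincomb[OF probs_functional[OF kx[OF x]]]
  have fg: "(\<lambda>y. f y * g y) \<in> bdd_meas F" using f g by blast
  have one: "(\<lambda>y. 1) \<in> bdd_meas F" by simp
  have "(\<integral>y. (f y - op f x) * (g y - op g x) \<partial>k x) =
      (\<integral>y. 1 * (1 * (f y * g y) + (- op g x) * f y) + 1 * ((- op f x) * g y + (op f x * op g x) * 1) \<partial>k x)"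
    by (intro Bochner_Integration.integral_cong) (auto simp: algebra_simps)
  also have "\<dots> = 1 * (1 * op (\<lambda>y. f y * g y) x + (- op g x) * op f x)
      + 1 * ((- op f x) * op g x + (op f x * op g x) * op (\<lambda>y. 1) x)"
    unfolding L[OF bdd_meas_lincomb[OF fg f] bdd_meas_lincomb[OF g one]] L[OF fg f] L[OF g one]
    unfolding op_def[symmetric] ..
  finally show ?thesis unfolding op_const[OF x] by simp
qed

definition cv :: "'a measure \<Rightarrow> ('b \<Rightarrow> real) \<Rightarrow> ('b \<Rightarrow> real) \<Rightarrow> real" where
  "cv \<rho> f g = (\<integral>x. (\<integral>y. (f y - op f x) * (g y - op g x) \<partial>k x) \<partial>\<rho>)"

lemma cv_alt:
  assumes \<rho>: "\<rho> \<in> probs E" and f: "f \<in> bdd_meas F" and g: "g \<in> bdd_meas F"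
  shows "cv \<rho> f g = (\<integral>x. op (\<lambda>y. f y * g y) x - op f x * op g x \<partial>\<rho>)"
  unfolding cv_def using op_covariance[OF f g] probsD(3)[OF \<rho>]
  by (intro Bochner_Integration.integral_cong) auto

lemma cv_integrand_bdd:
  "f \<in> bdd_meas F \<Longrightarrow> g \<in> bdd_meas F \<Longrightarrow> (\<lambda>x. op (\<lambda>y. f y * g y) x - op f x * op g x) \<in> bdd_meas E"
  by (intro bdd_meas_diff bdd_meas_mult op_bdd)

lemma variance_bounds:
  assumes f: "f \<in> bdd_meas F" and x: "x \<in> space E"
  shows "0 \<le> op (\<lambda>y. f y * f y) x - op f x * op f x"
    "op (\<lambda>y. f y * f y) x - op f x * op f x \<le> (rosc F f)\<^sup>2"
    "op (\<lambda>y. f y * f y) x - op f x * op f x \<le> op (\<lambda>y. f y * f y) x"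
proof -
  note eq = op_covariance[OF f f x, symmetric]
  show "0 \<le> op (\<lambda>y. f y * f y) x - op f x * op f x" unfolding eq by (intro integral_nonneg_AE) auto
  have b: "(\<lambda>y. (f y - op f x) * (f y - op f x)) \<in> bdd_meas F"
    using f by (intro bdd_meas_mult bdd_meas_diff bdd_meas_const)
  have "\<bar>\<integral>y. (f y - op f x) * (f y - op f x) \<partial>k x\<bar> \<le> (rosc F f)\<^sup>2"
  proof (rule probs_bound[OF kx[OF x] b])
    fix y assume "y \<in> space F"
    from power_mono[OF op_dev[OF f x this] abs_ge_zero, of 2]
    show "\<bar>(f y - op f x) * (f y - op f x)\<bar> \<le> (rosc F f)\<^sup>2" by (simp add: power2_eq_square abs_mult)
  qed
  then show "op (\<lambda>y. f y * f y) x - op f x * op f x \<le> (rosc F f)\<^sup>2" unfolding eq by simp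
qed simp

lemma cov_form_cv_nonneg:
  assumes \<rho>: "\<rho> \<in> probs E" and f: "f \<in> bdd_meas F"
  shows "0 \<le> cv \<rho> f f"
  unfolding cv_alt[OF \<rho> f f] using variance_bounds(1)[OF f] probsD(3)[OF \<rho>]
  by (intro integral_nonneg_AE) auto

text \<open>A variance is at most the squared oscillation, and at most the second moment. The latter
  bound reduces sequential continuity to dominated convergence.\<close>

lemma cov_form_cv:
  assumes \<rho>: "\<rho> \<in> probs E"
  shows "cov_form F (cv \<rho>)"
  unfolding cov_form_def
proof (intro conjI allI impI)
  note fin = prob_space.finite_measure[OF probsD(1)[OF \<rho>]]
  show "psd_form (bdd_meas F) (cv \<rho>)"
  proof
    fix f g h :: "'b \<Rightarrow> real" and a b
    assume f: "f \<in> bdd_meas F" and g: "g \<in> bdd_meas F"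
    show "(\<lambda>i. a * f i + b * g i) \<in> bdd_meas F" using f g by blast
    show "cv \<rho> f g = cv \<rho> g f" unfolding cv_def by (simp add: mult.commute)
    assume h: "h \<in> bdd_meas F"
    let ?I = "\<lambda>f x. op (\<lambda>y. f y * h y) x - op f x * op h x"
    have fg: "(\<lambda>i. a * f i + b * g i) \<in> bdd_meas F" using f g by blast
    have "cv \<rho> (\<lambda>i. a * f i + b * g i) h = (\<integral>x. a * ?I f x + b * ?I g x \<partial>\<rho>)"
      unfolding cv_alt[OF \<rho> fg h]
    proof (intro Bochner_Integration.integral_cong refl)
      fix x assume "x \<in> space \<rho>"
      then have x: "x \<in> space E" using probsD(3)[OF \<rho>] by simp
      have "op (\<lambda>y. (a * f y + b * g y) * h y) x = a * op (\<lambda>y. f y * h y) x + b * op (\<lambda>y. g y * h y) x"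
        using op_lincomb[OF x bdd_meas_mult[OF f h] bdd_meas_mult[OF g h], of a b] by (simp add: algebra_simps)
      then show "op (\<lambda>y. (a * f y + b * g y) * h y) x - op (\<lambda>i. a * f i + b * g i) x * op h x =
          a * ?I f x + b * ?I g x"
        unfolding op_lincomb[OF x f g] by (simp add: algebra_simps)
    qed
    also have "\<dots> = a * cv \<rho> f h + b * cv \<rho> g h"
      unfolding cv_alt[OF \<rho> f h] cv_alt[OF \<rho> g h]
      by (rule bdd_functional_lincomb[OF probs_functional[OF \<rho>] cv_integrand_bdd[OF f h] cv_integrand_bdd[OF g h]])
    finally show "cv \<rho> (\<lambda>i. a * f i + b * g i) h = a * cv \<rho> f h + b * cv \<rho> g h" .
  next
    fix f :: "'b \<Rightarrow> real" assume f: "f \<in> bdd_meas F"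
    show "0 \<le> cv \<rho> f f" by (rule cov_form_cv_nonneg[OF \<rho> f])
  qed simp
  show "\<exists>C. \<forall>f\<in>bdd_meas F. cv \<rho> f f \<le> C * (rosc F f)\<^sup>2"
  proof (intro exI[of _ 1] ballI)
    fix f assume f: "f \<in> bdd_meas F"
    have "(\<integral>x. op (\<lambda>y. f y * f y) x - op f x * op f x \<partial>\<rho>) \<le> (\<integral>x. (rosc F f)\<^sup>2 \<partial>\<rho>)"
      using variance_bounds(2)[OF f] by (intro probs_mono[OF \<rho>] cv_integrand_bdd f bdd_meas_const)
    then show "cv \<rho> f f \<le> 1 * (rosc F f)\<^sup>2" unfolding cv_alt[OF \<rho> f f] probs_const[OF \<rho>] by simp
  qed
  fix f assume f: "bp_null F f"
  note fb = bp_null_bdd[OF f]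
  have "(\<lambda>n. \<integral>x. op (\<lambda>y. f n y * f n y) x \<partial>\<rho>) \<longlonglongrightarrow> 0"
    by (rule bp_null_integral[OF fin probsD(2)[OF \<rho>] op_bp_null[OF bp_null_mult[OF f f]]])
  note lim = this
  show "(\<lambda>n. cv \<rho> (f n) (f n)) \<longlonglongrightarrow> 0"
  proof (rule tendsto_sandwich[OF _ _ tendsto_const lim])
    show "\<forall>\<^sub>F n in sequentially. 0 \<le> cv \<rho> (f n) (f n)"
      using cov_form_cv_nonneg[OF \<rho> fb] by simp
    show "\<forall>\<^sub>F n in sequentially. cv \<rho> (f n) (f n) \<le> (\<integral>x. op (\<lambda>y. f n y * f n y) x \<partial>\<rho>)"
      unfolding cv_alt[OF \<rho> fb fb] using variance_bounds(3)[OF fb]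
      by (intro always_eventually allI probs_mono[OF \<rho>] cv_integrand_bdd op_bdd bdd_meas_mult fb)
  qed
qed

end

section \<open>Operators compatible with covariance forms\<close>

text \<open>What is needed to pull a \<open>cov_form\<close> back along \<open>M\<close>. Linearity
  is demanded only on \<open>space E\<close>, since kernel operators are unspecified
  elsewhere.\<close>

definition bounded_op :: "'a measure \<Rightarrow> 'b measure \<Rightarrow> (('b \<Rightarrow> real) \<Rightarrow> ('a \<Rightarrow> real)) \<Rightarrow> bool" where
  "bounded_op E F M \<longleftrightarrow> (\<forall>f\<in>bdd_meas F. M f \<in> bdd_meas E) \<and>
     (\<forall>f\<in>bdd_meas F. \<forall>g\<in>bdd_meas F. \<forall>a b. \<forall>x\<in>space E. M (\<lambda>y. a * f y + b * g y) x = a * M f x + b * M g x) \<and>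
     (\<exists>\<beta>\<ge>0. \<forall>f\<in>bdd_meas F. rosc E (M f) \<le> \<beta> * rosc F f) \<and>
     (\<forall>f. bp_null F f \<longrightarrow> bp_null E (\<lambda>k. M (f k)))"

lemma bounded_op_bdd: "bounded_op E F M \<Longrightarrow> f \<in> bdd_meas F \<Longrightarrow> M f \<in> bdd_meas E"
  unfolding bounded_op_def by blast

lemma bounded_op_lincomb:
  "bounded_op E F M \<Longrightarrow> f \<in> bdd_meas F \<Longrightarrow> g \<in> bdd_meas F \<Longrightarrow> x \<in> space E \<Longrightarrow>
     M (\<lambda>y. a * f y + b * g y) x = a * M f x + b * M g x"
  unfolding bounded_op_def by blast

lemma bounded_op_rosc:
  assumes "bounded_op E F M"
  obtains \<beta> where "\<beta> \<ge> 0" "\<And>f. f \<in> bdd_meas F \<Longrightarrow> rosc E (M f) \<le> \<beta> * rosc F f"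
  using assms unfolding bounded_op_def by blast

lemma bounded_op_bp_null: "bounded_op E F M \<Longrightarrow> bp_null F f \<Longrightarrow> bp_null E (\<lambda>k. M (f k))"
  unfolding bounded_op_def by blast

lemma bounded_op_id: "bounded_op E E id"
  unfolding bounded_op_def by (auto intro!: exI[of _ 1])

text \<open>The difference has oscillation 0, hence zero seminorm, and Cauchy-Schwarz removes it.
  This compensates for identities that hold only on the state space.\<close>

lemma cov_form_cong:
  assumes Q: "cov_form E Q" and "f \<in> bdd_meas E" "f' \<in> bdd_meas E" "g \<in> bdd_meas E"
    and eq: "\<And>x. x \<in> space E \<Longrightarrow> f x = f' x"
  shows "Q f g = Q f' g"
proof -
  interpret psd_form "bdd_meas E" Q using Q by (rule cov_form_psd)
  obtain C where C: "\<And>f. f \<in> bdd_meas E \<Longrightarrow> Q f f \<le> C * (rosc E f)\<^sup>2"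
    using Q unfolding cov_form_def by blast
  define d where "d = (\<lambda>x. 1 * f x + (-1) * f' x)"
  have d: "d \<in> bdd_meas E" unfolding d_def using assms by blast
  have "rosc E d \<le> 0" using eq by (intro rosc_le) (auto simp: d_def)
  then have "rosc E d = 0" using rosc_nonneg[of E d] by simp
  then have "Q d d = 0" using C[OF d] Q_nonneg[OF d] by simp
  then have "Q d g = 0" using cauchy_schwarz[OF d assms(4)] by simp
  then show ?thesis unfolding d_def using Q_lin[OF assms(2-4), of 1 "-1"] by simp
qed

text \<open>Linearity of \<open>N\<close> is known only on \<open>space F\<close>, so
  \<open>M\<close> must not see values off that set; \<open>cong\<close> says so.\<close>

lemma bounded_op_comp:
  assumes M: "bounded_op E F M" and N: "bounded_op F G N"
    and cong: "\<And>f f' x. f \<in> bdd_meas F \<Longrightarrow> f' \<in> bdd_meas F \<Longrightarrow> (\<And>y. y \<in> space F \<Longrightarrow> f y = f' y) \<Longrightarrow>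
      x \<in> space E \<Longrightarrow> M f x = M f' x"
  shows "bounded_op E G (M \<circ> N)"
proof -
  obtain \<beta> where \<beta>: "\<beta> \<ge> 0" "\<And>f. f \<in> bdd_meas F \<Longrightarrow> rosc E (M f) \<le> \<beta> * rosc F f"
    using M by (rule bounded_op_rosc) blast
  obtain \<gamma> where \<gamma>: "\<gamma> \<ge> 0" "\<And>f. f \<in> bdd_meas G \<Longrightarrow> rosc F (N f) \<le> \<gamma> * rosc G f"
    using N by (rule bounded_op_rosc) blast
  note Nb = bounded_op_bdd[OF N] and Mb = bounded_op_bdd[OF M]
  show ?thesis
    unfolding bounded_op_def o_def
  proof (intro conjI ballI allI impI)
    fix f g a b x assume f: "f \<in> bdd_meas G" and g: "g \<in> bdd_meas G" and x: "x \<in> space E"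
    have "M (N (\<lambda>y. a * f y + b * g y)) x = M (\<lambda>y. a * N f y + b * N g y) x"
      using f g x by (intro cong Nb bdd_meas_lincomb bounded_op_lincomb[OF N])
    then show "M (N (\<lambda>y. a * f y + b * g y)) x = a * M (N f) x + b * M (N g) x"
      using bounded_op_lincomb[OF M Nb[OF f] Nb[OF g] x] by simp
  next
    show "\<exists>\<beta>\<ge>0. \<forall>f\<in>bdd_meas G. rosc E (M (N f)) \<le> \<beta> * rosc G f"
    proof (intro exI[of _ "\<beta> * \<gamma>"] conjI ballI)
      fix f assume f: "f \<in> bdd_meas G"
      have "rosc E (M (N f)) \<le> \<beta> * rosc F (N f)" by (rule \<beta>(2)[OF Nb[OF f]])
      also have "\<dots> \<le> \<beta> * (\<gamma> * rosc G f)" using \<gamma>(2)[OF f] \<beta>(1) by (intro mult_left_mono)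
      finally show "rosc E (M (N f)) \<le> \<beta> * \<gamma> * rosc G f" by simp
    qed (use \<beta> \<gamma> in simp)
  next
    fix f assume f: "f \<in> bdd_meas G"
    show "M (N f) \<in> bdd_meas E" by (rule Mb[OF Nb[OF f]])
  next
    fix f assume f: "bp_null G f"
    show "bp_null E (\<lambda>k. M (N (f k)))"
      by (rule bounded_op_bp_null[OF M bounded_op_bp_null[OF N f]])
  qed
qed

lemma cov_form_pullback:
  assumes Q: "cov_form E Q" and M: "bounded_op E F M"
  shows "cov_form F (\<lambda>f g. Q (M f) (M g))"
proof -
  interpret psd_form "bdd_meas E" Q using Q by (rule cov_form_psd)
  note Mb = bounded_op_bdd[OF M]
  obtain C where C: "\<And>f. f \<in> bdd_meas E \<Longrightarrow> Q f f \<le> C * (rosc E f)\<^sup>2"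
    using Q unfolding cov_form_def by blast
  obtain \<beta> where \<beta>: "\<beta> \<ge> 0" "\<And>f. f \<in> bdd_meas F \<Longrightarrow> rosc E (M f) \<le> \<beta> * rosc F f"
    using M by (rule bounded_op_rosc) blast
  show ?thesis
    unfolding cov_form_def
  proof (intro conjI allI impI)
    show "psd_form (bdd_meas F) (\<lambda>f g. Q (M f) (M g))"
    proof
      fix f g h a b assume f: "f \<in> bdd_meas F" and g: "g \<in> bdd_meas F"
      show "(\<lambda>i. a * f i + b * g i) \<in> bdd_meas F" using f g by blast
      show "Q (M f) (M g) = Q (M g) (M f)" by (rule Q_sym[OF Mb[OF f] Mb[OF g]])
      assume h: "h \<in> bdd_meas F"
      have "Q (M (\<lambda>i. a * f i + b * g i)) (M h) = Q (\<lambda>x. a * M f x + b * M g x) (M h)"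
        using f g h by (intro cov_form_cong[OF Q] Mb bdd_meas_lincomb bounded_op_lincomb[OF M])
      then show "Q (M (\<lambda>i. a * f i + b * g i)) (M h) = a * Q (M f) (M h) + b * Q (M g) (M h)"
        using Q_lin[OF Mb[OF f] Mb[OF g] Mb[OF h]] by simp
    next
      fix f assume "f \<in> bdd_meas F"
      then show "0 \<le> Q (M f) (M f)" by (intro Q_nonneg Mb)
    qed simp
    show "\<exists>C. \<forall>f\<in>bdd_meas F. Q (M f) (M f) \<le> C * (rosc F f)\<^sup>2"
    proof (intro exI[of _ "\<bar>C\<bar> * \<beta>\<^sup>2"] ballI)
      fix f assume f: "f \<in> bdd_meas F"
      have "(rosc E (M f))\<^sup>2 \<le> (\<beta> * rosc F f)\<^sup>2"
        using \<beta>(2)[OF f] by (intro power_mono rosc_nonneg)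
      then have "C * (rosc E (M f))\<^sup>2 \<le> \<bar>C\<bar> * (\<beta> * rosc F f)\<^sup>2" by (intro mult_mono) auto
      then show "Q (M f) (M f) \<le> \<bar>C\<bar> * \<beta>\<^sup>2 * (rosc F f)\<^sup>2"
        using C[OF Mb[OF f]] by (simp add: power_mult_distrib)
    qed
    fix f assume "bp_null F f"
    then show "(\<lambda>k. Q (M (f k)) (M (f k))) \<longlonglongrightarrow> 0"
      by (intro cov_form_bp_null[OF Q] bounded_op_bp_null[OF M])
  qed
qed

lemma cov_form_sum:
  assumes Q: "\<And>p. p \<in> I \<Longrightarrow> cov_form E (Q p)" and I: "finite I"
  shows "cov_form E (\<lambda>f g. \<Sum>p\<in>I. Q p f g)"
  unfolding cov_form_def
proof (intro conjI allI impI)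
  note psd = cov_form_psd[OF Q]
  show "psd_form (bdd_meas E) (\<lambda>f g. \<Sum>p\<in>I. Q p f g)"
  proof
    fix f g h a b assume f: "f \<in> bdd_meas E" and g: "g \<in> bdd_meas E"
    show "(\<lambda>i. a * f i + b * g i) \<in> bdd_meas E" using f g by blast
    show "(\<Sum>p\<in>I. Q p f g) = (\<Sum>p\<in>I. Q p g f)"
      using f g by (intro sum.cong refl psd_form.Q_sym[OF psd])
    assume h: "h \<in> bdd_meas E"
    have "(\<Sum>p\<in>I. Q p (\<lambda>i. a * f i + b * g i) h) = (\<Sum>p\<in>I. a * Q p f h + b * Q p g h)"
      using f g h by (intro sum.cong refl psd_form.Q_lin[OF psd])
    then show "(\<Sum>p\<in>I. Q p (\<lambda>i. a * f i + b * g i) h) = a * (\<Sum>p\<in>I. Q p f h) + b * (\<Sum>p\<in>I. Q p g h)"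
      by (simp add: sum.distrib sum_distrib_left)
  next
    fix f assume "f \<in> bdd_meas E"
    then show "0 \<le> (\<Sum>p\<in>I. Q p f f)" by (intro sum_nonneg psd_form.Q_nonneg[OF psd])
  qed simp
  have "\<forall>p\<in>I. \<exists>C. \<forall>f\<in>bdd_meas E. Q p f f \<le> C * (rosc E f)\<^sup>2"
    using Q unfolding cov_form_def by blast
  from bchoice[OF this] obtain C where C: "\<forall>p\<in>I. \<forall>f\<in>bdd_meas E. Q p f f \<le> C p * (rosc E f)\<^sup>2" ..
  show "\<exists>C. \<forall>f\<in>bdd_meas E. (\<Sum>p\<in>I. Q p f f) \<le> C * (rosc E f)\<^sup>2"
  proof (intro exI[of _ "\<Sum>p\<in>I. C p"] ballI)
    fix f assume "f \<in> bdd_meas E"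
    then show "(\<Sum>p\<in>I. Q p f f) \<le> (\<Sum>p\<in>I. C p) * (rosc E f)\<^sup>2"
      unfolding sum_distrib_right using C by (intro sum_mono) blast
  qed
  fix f assume "bp_null E f"
  then have "(\<lambda>k. Q p (f k) (f k)) \<longlonglongrightarrow> 0" if "p \<in> I" for p
    using cov_form_bp_null[OF Q[OF that]] by blast
  then have "(\<lambda>k. \<Sum>p\<in>I. Q p (f k) (f k)) \<longlonglongrightarrow> (\<Sum>p\<in>I. 0)" by (rule tendsto_sum)
  then show "(\<lambda>k. \<Sum>p\<in>I. Q p (f k) (f k)) \<longlonglongrightarrow> 0" by simp
qed

lemma kernel_op_cong:
  assumes "k x \<in> signed_measures F" "f \<in> bdd_meas F" "g \<in> bdd_meas F" "\<And>y. y \<in> space F \<Longrightarrow> f y = g y"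
  shows "kernel_op F k f x = kernel_op F k g x"
  using sm_bdd_functional[OF assms(1)] bdd_functional_cong[OF _ assms(2-4)] unfolding kernel_op_def by blast

text \<open>The coefficient is defined on functions of oscillation at most 1, so \<open>f\<close> is
  divided by some \<open>r > 0\<close> above its oscillation. The oscillation itself may be 0; it is
  approached by adding \<open>e / (\<beta> + 1)\<close>, which costs at most \<open>e\<close> in the
  bound.\<close>

lemma dobrushin_rosc:
  assumes M: "\<And>f. f \<in> bdd_meas F \<Longrightarrow> M f \<in> bdd_meas E"
    and lin: "\<And>f c x. f \<in> bdd_meas F \<Longrightarrow> x \<in> space E \<Longrightarrow> M (\<lambda>y. c * f y) x = c * M f x"
    and d: "dobrushin E F M < \<infinity>"
  shows "\<exists>\<beta>\<ge>0. \<forall>f\<in>bdd_meas F. rosc E (M f) \<le> \<beta> * rosc F f"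
proof -
  define \<beta> where "\<beta> = enn2real (dobrushin E F M)"
  have \<beta>: "dobrushin E F M = ennreal \<beta>" "\<beta> \<ge> 0" using d unfolding \<beta>_def by auto
  have O: "rosc E (M f) \<le> \<beta>" if f: "f \<in> Osc1 F" for f
  proof -
    have "osc E (M f) \<le> ennreal \<beta>" unfolding \<beta>(1)[symmetric] dobrushin_def using f by (rule SUP_upper)
    then show ?thesis unfolding rosc_def using \<beta>(2) by (simp add: enn2real_leI)
  qed
  have "rosc E (M f) \<le> \<beta> * r" if f: "f \<in> bdd_meas F" and r: "rosc F f \<le> r" "r > 0" for f r
  proof -
    have g: "(\<lambda>y. (1 / r) * f y) \<in> bdd_meas F" using f by blast
    have "rosc F (\<lambda>y. (1 / r) * f y) \<le> \<bar>1 / r\<bar> * rosc F f" by (rule rosc_cmult[OF f])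
    also have "\<dots> \<le> 1" using r by simp
    finally have "rosc E (M (\<lambda>y. (1 / r) * f y)) \<le> \<beta>" by (intro O Osc1I g)
    then have b: "\<bar>M (\<lambda>y. (1 / r) * f y) x - M (\<lambda>y. (1 / r) * f y) x'\<bar> \<le> \<beta>" if "x \<in> space E" "x' \<in> space E" for x x'
      using rosc_bound[OF M[OF g] that] by linarith
    show ?thesis
    proof (rule rosc_le)
      fix x x' assume x: "x \<in> space E" "x' \<in> space E"
      have "M (\<lambda>y. (1 / r) * f y) x - M (\<lambda>y. (1 / r) * f y) x' = (M f x - M f x') / r"
        unfolding lin[OF f x(1)] lin[OF f x(2)] by (simp add: diff_divide_distrib)
      then have "\<bar>M f x - M f x'\<bar> / r \<le> \<beta>" using b[OF x] r(2) by simp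
      then show "\<bar>M f x - M f x'\<bar> \<le> \<beta> * r" using r(2) by (simp add: field_simps)
    qed (use \<beta> r in simp)
  qed
  note le = this
  have "rosc E (M f) \<le> \<beta> * rosc F f" if f: "f \<in> bdd_meas F" for f
  proof (rule field_le_epsilon)
    fix e :: real assume e: "e > 0"
    have "rosc E (M f) \<le> \<beta> * (rosc F f + e / (\<beta> + 1))"
      using e \<beta>(2) rosc_nonneg[of F f] by (intro le[OF f]) (auto simp: add_nonneg_pos)
    also have "\<dots> \<le> \<beta> * rosc F f + e" using e \<beta>(2) by (simp add: field_simps)
    finally show "rosc E (M f) \<le> \<beta> * rosc F f + e" .
  qed
  then show ?thesis using \<beta>(2) by blast
qed

text \<open>Pointwise convergence is dominated convergence for each \<open>k x\<close>, but a bound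
  uniform in \<open>x\<close> is also required. The values at one point \<open>x0\<close> converge
  and so are bounded, and the oscillation bound carries this over to all other points.\<close>

lemma bounded_op_kernel:
  assumes k: "bounded_integral_operator E F k" and d: "dobrushin E F (kernel_op F k) < \<infinity>"
    and ne: "space E \<noteq> {}"
  shows "bounded_op E F (kernel_op F k)"
proof -
  have kx: "k x \<in> signed_measures F" if "x \<in> space E" for x using k that unfolding bounded_integral_operator_def by blast
  have b: "kernel_op F k f \<in> bdd_meas E" if "f \<in> bdd_meas F" for f
    using k that unfolding bounded_integral_operator_def by blast
  have lin: "kernel_op F k (\<lambda>y. a * f y + b * g y) x = a * kernel_op F k f x + b * kernel_op F k g x"
    if "f \<in> bdd_meas F" "g \<in> bdd_meas F" "x \<in> space E" for a b f g x
    unfolding kernel_op_def using that by (intro sm_integral_lincomb kx)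
  have c: "kernel_op F k (\<lambda>y. c * f y) x = c * kernel_op F k f x" if "f \<in> bdd_meas F" "x \<in> space E" for c f x
    using lin[OF that(1,1,2), of c 0] by simp
  have r: "\<exists>\<beta>\<ge>0. \<forall>f\<in>bdd_meas F. rosc E (kernel_op F k f) \<le> \<beta> * rosc F f"
    using b c d by (rule dobrushin_rosc)
  then obtain \<beta> where \<beta>: "\<beta> \<ge> 0" "\<And>f. f \<in> bdd_meas F \<Longrightarrow> rosc E (kernel_op F k f) \<le> \<beta> * rosc F f" by blast
  have "bp_null E (\<lambda>n. kernel_op F k (f n))" if f: "bp_null F f" for f
  proof -
    obtain c where c: "\<And>n x. x \<in> space F \<Longrightarrow> \<bar>f n x\<bar> \<le> c" using f unfolding bp_null_def by blast
    have lim: "(\<lambda>n. kernel_op F k (f n) x) \<longlonglongrightarrow> 0" if "x \<in> space E" for x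
      unfolding kernel_op_def by (rule sm_integral_bp_null[OF kx[OF that] f])
    obtain x0 where x0: "x0 \<in> space E" using ne by blast
    obtain B where B: "\<And>n. \<bar>kernel_op F k (f n) x0\<bar> \<le> B"
      using convergent_imp_Bseq[OF convergentI[OF lim[OF x0]]] unfolding Bseq_def by auto
    have "\<bar>kernel_op F k (f n) x\<bar> \<le> B + \<beta> * (2 * \<bar>c\<bar>)" if x: "x \<in> space E" for n x
    proof -
      have "rosc F (f n) \<le> 2 * \<bar>c\<bar>" using order_trans[OF c abs_ge_self] by (intro rosc_le_sup) auto
      then have "\<beta> * rosc F (f n) \<le> \<beta> * (2 * \<bar>c\<bar>)" using \<beta>(1) by (rule mult_left_mono)
      moreover have "\<bar>kernel_op F k (f n) x - kernel_op F k (f n) x0\<bar> \<le> rosc E (kernel_op F k (f n))"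
        using bp_null_bdd[OF f] b x x0 by (intro rosc_bound) auto
      ultimately show ?thesis using \<beta>(2)[OF bp_null_bdd[OF f], of n] B[of n] by linarith
    qed
    then show ?thesis unfolding bp_null_def using b bp_null_bdd[OF f] lim by blast
  qed
  then show ?thesis unfolding bounded_op_def using b lin r by blast
qed

section \<open>The limiting objects\<close>

locale mf_model =
  fixes E :: "nat \<Rightarrow> 'a measure"
    and K :: "nat \<Rightarrow> 'a measure \<Rightarrow> 'a \<Rightarrow> 'a measure"
    and \<eta>0 :: "'a measure"
    and D :: "nat \<Rightarrow> 'a measure \<Rightarrow> 'a \<Rightarrow> 'a set \<Rightarrow> real"
  assumes init: "\<eta>0 \<in> probs (E 0)"
    and markov: "\<eta> \<in> probs (E m) \<Longrightarrow> K (Suc m) \<eta> \<in> measurable (E m) (prob_algebra (E (Suc m)))"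
    and H1_K: "cond_K (E m) (E (Suc m)) (K (Suc m))"
    and H1_Phi: "upsilon_with (E m) (E (Suc m)) (Phi K (Suc m)) (D (Suc m))"
begin

abbreviation \<eta> :: "nat \<Rightarrow> 'a measure" where "\<eta> \<equiv> flow K \<eta>0"

lemma Phi_probs: "\<rho> \<in> probs (E m) \<Longrightarrow> Phi K (Suc m) \<rho> \<in> probs (E (Suc m))"
  using H1_Phi[of m] unfolding upsilon_with_def by blast

lemma flow_probs: "\<eta> n \<in> probs (E n)"
  by (induction n) (auto intro: init Phi_probs simp del: space_prob_algebra)

lemma nonempty: "space (E n) \<noteq> {}"
  by (rule probs_nonempty[OF flow_probs])

text \<open>Since \<open>0 - 1 = 0\<close> on naturals, time 0 is covered by the constant kernel \<open>\<eta>0\<close> on \<open>E 0\<close>.\<close>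

definition lim_kernel :: "nat \<Rightarrow> 'a \<Rightarrow> 'a measure" where
  "lim_kernel p = (if p = 0 then (\<lambda>_. \<eta>0) else K p (\<eta> (p - 1)))"

lemma lim_kernel: "markov_kernel (E (p - 1)) (E p) (lim_kernel p)"
proof (cases p)
  case 0
  have "(\<lambda>_. \<eta>0) \<in> measurable (E 0) (prob_algebra (E 0))" using init by (rule measurable_const)
  then show ?thesis unfolding lim_kernel_def markov_kernel_def 0 by simp
next
  case (Suc m)
  then show ?thesis unfolding lim_kernel_def markov_kernel_def using markov[OF flow_probs] by simp
qed

lemma field_cov_eq: "field_cov K \<eta>0 p = markov_kernel.cv (lim_kernel p) (\<eta> (p - 1))"
proof -
  interpret markov_kernel "E (p - 1)" "E p" "lim_kernel p" by (rule lim_kernel)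
  show ?thesis
  proof (intro ext)
    fix f g
    show "field_cov K \<eta>0 p f g = cv (\<eta> (p - 1)) f g"
    proof (cases p)
      case 0
      show ?thesis
        unfolding cv_def op_def unfolding lim_kernel_def 0 using probs_const[OF init] by simp
    next
      case (Suc m)
      then show ?thesis unfolding cv_def op_def unfolding lim_kernel_def by (simp add: Let_def)
    qed
  qed
qed

lemma cov_form_field: "cov_form (E p) (field_cov K \<eta>0 p)"
  unfolding field_cov_eq by (rule markov_kernel.cov_form_cv[OF lim_kernel flow_probs])

abbreviation Dstep :: "nat \<Rightarrow> ('a \<Rightarrow> real) \<Rightarrow> ('a \<Rightarrow> real)" where
  "Dstep \<equiv> D_step E K \<eta>0 D"

abbreviation Dsg :: "nat \<Rightarrow> nat \<Rightarrow> ('a \<Rightarrow> real) \<Rightarrow> ('a \<Rightarrow> real)" where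
  "Dsg \<equiv> D_semigroup E K \<eta>0 D"

lemma Dstep_Suc: "Dstep (Suc m) = kernel_op (E (Suc m)) (D (Suc m) (\<eta> m))"
  unfolding D_step_def by simp

lemma D_operator: "bounded_integral_operator (E m) (E (Suc m)) (D (Suc m) (\<eta> m))"
  using H1_Phi[of m] flow_probs[of m] unfolding upsilon_with_def by blast

lemma bounded_op_Dstep: "bounded_op (E m) (E (Suc m)) (Dstep (Suc m))"
  unfolding Dstep_Suc
proof (rule bounded_op_kernel[OF D_operator _ nonempty])
  have "dobrushin (E m) (E (Suc m)) (kernel_op (E (Suc m)) (D (Suc m) (\<eta> m)))
      \<le> (SUP \<rho>\<in>probs (E m). dobrushin (E m) (E (Suc m)) (kernel_op (E (Suc m)) (D (Suc m) \<rho>)))"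
    using flow_probs by (rule SUP_upper)
  also have "\<dots> < \<infinity>" using H1_Phi[of m] unfolding upsilon_with_def by blast
  finally show "dobrushin (E m) (E (Suc m)) (kernel_op (E (Suc m)) (D (Suc m) (\<eta> m))) < \<infinity>" .
qed

lemma Dstep_cong:
  "f \<in> bdd_meas (E (Suc m)) \<Longrightarrow> g \<in> bdd_meas (E (Suc m)) \<Longrightarrow> (\<And>y. y \<in> space (E (Suc m)) \<Longrightarrow> f y = g y) \<Longrightarrow>
     x \<in> space (E m) \<Longrightarrow> Dstep (Suc m) f x = Dstep (Suc m) g x"
  unfolding Dstep_Suc using D_operator[of m] unfolding bounded_integral_operator_def
  by (intro kernel_op_cong) auto

lemma Dsg_same: "Dsg n n = id"
  unfolding D_semigroup_def by simp

lemma foldr_comp_snoc: "foldr (\<circ>) (xs @ [g]) id = foldr (\<circ>) xs id \<circ> g"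
  by (induction xs) (auto simp: o_assoc)

lemma Dsg_Suc:
  assumes "p \<le> n"
  shows "Dsg p (Suc n) = Dsg p n \<circ> Dstep (Suc n)"
proof -
  have "[Suc p..<Suc (Suc n)] = [Suc p..<Suc n] @ [Suc n]" using assms by simp
  then show ?thesis unfolding D_semigroup_def by (simp only: map_append list.map foldr_comp_snoc)
qed

lemma Dsg_cong:
  assumes "p \<le> n" "f \<in> bdd_meas (E n)" "g \<in> bdd_meas (E n)" "\<And>y. y \<in> space (E n) \<Longrightarrow> f y = g y" "x \<in> space (E p)"
  shows "Dsg p n f x = Dsg p n g x"
  using assms
proof (induction n arbitrary: f g rule: dec_induct[of p])
  case base
  then show ?case by (simp add: Dsg_same)
next
  case (step n)
  show ?case
    unfolding Dsg_Suc[OF step(1)] o_apply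
    using step.prems by (intro step.IH bounded_op_bdd[OF bounded_op_Dstep] Dstep_cong)
qed

lemma bounded_op_Dsg: "p \<le> n \<Longrightarrow> bounded_op (E p) (E n) (Dsg p n)"
proof (induction n rule: dec_induct)
  case base
  then show ?case unfolding Dsg_same by (rule bounded_op_id)
next
  case (step n)
  show ?case
    unfolding Dsg_Suc[OF step(1)]
    by (rule bounded_op_comp[OF step.IH bounded_op_Dstep]) (rule Dsg_cong[OF step(1)])
qed

lemma Dsg_bdd: "p \<le> n \<Longrightarrow> f \<in> bdd_meas (E n) \<Longrightarrow> Dsg p n f \<in> bdd_meas (E p)"
  by (rule bounded_op_bdd[OF bounded_op_Dsg])

text \<open>The variance form of the limit of W, written without reference to the Gaussian fields;
  \<open>limit_variance\<close> makes the connection.\<close>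

definition QW :: "nat \<Rightarrow> ('a \<Rightarrow> real) \<Rightarrow> ('a \<Rightarrow> real) \<Rightarrow> real" where
  "QW n f g = (\<Sum>p\<le>n. field_cov K \<eta>0 p (Dsg p n f) (Dsg p n g))"

lemma cov_form_QW: "cov_form (E n) (QW n)"
proof -
  have "cov_form (E n) (\<lambda>f g. \<Sum>p\<in>{..n}. field_cov K \<eta>0 p (Dsg p n f) (Dsg p n g))"
    by (intro cov_form_sum cov_form_pullback[OF cov_form_field bounded_op_Dsg]) auto
  then show ?thesis unfolding QW_def[abs_def] .
qed

text \<open>The lower bound extends \<open>\<nu>\<close> along \<open>f \<mapsto> (\<D>\<^sub>p\<^sub>,\<^sub>n f)\<^sub>p\<close>; the extension splits into the measures
  \<open>\<mu>\<^sub>p\<close>, which attain the infimum.\<close>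

lemma rate_J_eq:
  assumes \<nu>: "\<nu> \<in> signed_measures (E n)"
  shows "rate_J E K \<eta>0 D n \<nu> = (SUP f\<in>bdd_meas (E n). ereal (sm_integral (E n) \<nu> f - QW n f f / 2))"
    (is "?J = ?S")
proof (rule antisym)
  let ?Q = "field_cov K \<eta>0"
  let ?T = "\<lambda>p. bdd_meas (E p)"
  show "?S \<le> ?J"
    unfolding rate_J_def
  proof (rule Inf_greatest, clarify)
    fix \<mu> assume \<mu>: "\<mu> \<in> (\<Pi>\<^sub>E p\<in>{..n}. signed_measures (E p))"
      and c: "\<forall>f\<in>bdd_meas (E n). sm_integral (E n) \<nu> f = (\<Sum>p\<le>n. sm_integral (E p) (\<mu> p) (Dsg p n f))"
    show "?S \<le> (\<Sum>p\<le>n. rate_I E K \<eta>0 p (\<mu> p))"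
    proof (rule SUP_least)
      fix f assume f: "f \<in> bdd_meas (E n)"
      have "ereal (sm_integral (E n) \<nu> f - QW n f f / 2) =
          (\<Sum>p\<le>n. ereal (sm_integral (E p) (\<mu> p) (Dsg p n f) - ?Q p (Dsg p n f) (Dsg p n f) / 2))"
        using c f by (simp add: QW_def sum_subtractf sum_divide_distrib)
      also have "\<dots> \<le> (\<Sum>p\<le>n. rate_I E K \<eta>0 p (\<mu> p))"
        unfolding rate_I_def using f by (intro sum_mono SUP_upper Dsg_bdd) auto
      finally show "ereal (sm_integral (E n) \<nu> f - QW n f f / 2) \<le> (\<Sum>p\<le>n. rate_I E K \<eta>0 p (\<mu> p))" .
    qed
  qed
  interpret psd_family n ?T ?Q by (rule psd_family.intro, rule cov_form_psd[OF cov_form_field])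
  interpret pp: psd_form "prod_space n ?T" "prod_form n ?Q" by (rule psd_prod)
  interpret w: psd_form "bdd_meas (E n)" "QW n" by (rule cov_form_psd[OF cov_form_QW])
  show "?J \<le> ?S"
  proof (cases ?S)
    case PInf
    then show ?thesis by simp
  next
    case MInf
    have "ereal (sm_integral (E n) \<nu> (\<lambda>_. 0) - QW n (\<lambda>_. 0) (\<lambda>_. 0) / 2) \<le> ?S"
      by (rule SUP_upper) simp
    then show ?thesis using MInf by simp
  next
    case (real c)
    \<comment> \<open>The tuple of the functions \<open>Dsg p n f\<close>. Pulling the product form
      back along it gives \<open>QW n\<close>, so the Legendre bound on \<open>\<nu>\<close> is a
      bound for the product form.\<close>
    define A where "A f = (\<lambda>(p, x). if p \<le> n then Dsg p n f x else 0)" for f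
    have slA: "slice (A f) p = (if p \<le> n then Dsg p n f else (\<lambda>_. 0))" for f p
      unfolding slice_def A_def by auto
    have AT: "A f \<in> prod_space n ?T" if "f \<in> bdd_meas (E n)" for f
      unfolding prod_space_def mem_Collect_eq slA using Dsg_bdd that by auto
    have QA: "prod_form n ?Q (A f) (A g) = QW n f g" for f g
      unfolding prod_form_def slA QW_def by simp
    have le: "sm_integral (E n) \<nu> f - QW n f f / 2 \<le> c" if "f \<in> bdd_meas (E n)" for f
    proof -
      have "ereal (sm_integral (E n) \<nu> f - QW n f f / 2) \<le> ?S" using that by (rule SUP_upper)
      then show ?thesis using real by simp
    qed
    have "\<exists>l. lin_on (prod_space n ?T) l \<and> (\<forall>f\<in>prod_space n ?T. l f - prod_form n ?Q f f / 2 \<le> c) \<and>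
        (\<forall>f\<in>bdd_meas (E n). l (A f) = sm_integral (E n) \<nu> f)"
    proof (rule pp.extension)
      show "psd_form (bdd_meas (E n)) (\<lambda>b b'. prod_form n ?Q (A b) (A b'))"
        unfolding QA by unfold_locales
      show "lin_on (bdd_meas (E n)) (sm_integral (E n) \<nu>)"
        unfolding lin_on_def by (auto intro: sm_integral_lincomb[OF \<nu>])
      fix a a' b b' e assume b: "b \<in> bdd_meas (E n)" "b' \<in> bdd_meas (E n)" and e: "e \<in> prod_space n ?T"
      have "?Q p (Dsg p n (\<lambda>k. a * b k + a' * b' k)) (slice e p)
          = a * ?Q p (Dsg p n b) (slice e p) + a' * ?Q p (Dsg p n b') (slice e p)" if p: "p \<le> n" for p
      proof -
        have "?Q p (Dsg p n (\<lambda>k. a * b k + a' * b' k)) (slice e p)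
            = ?Q p (\<lambda>k. a * Dsg p n b k + a' * Dsg p n b' k) (slice e p)"
          using b e p by (intro cov_form_cong[OF cov_form_field] Dsg_bdd bdd_meas_lincomb sliceT
              bounded_op_lincomb[OF bounded_op_Dsg])
        also have "\<dots> = a * ?Q p (Dsg p n b) (slice e p) + a' * ?Q p (Dsg p n b') (slice e p)"
          using b e p by (intro psd_form.Q_lin[OF psd] Dsg_bdd sliceT)
        finally show ?thesis .
      qed
      then show "prod_form n ?Q (A (\<lambda>k. a * b k + a' * b' k)) e
          = a * prod_form n ?Q (A b) e + a' * prod_form n ?Q (A b') e"
        unfolding prod_form_def slA by (simp add: sum.distrib sum_distrib_left)
    qed (use AT le in \<open>simp_all add: QA\<close>)
    then obtain l where l: "lin_on (prod_space n ?T) l"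
      "\<And>f. f \<in> prod_space n ?T \<Longrightarrow> l f - prod_form n ?Q f f / 2 \<le> c"
      "\<And>f. f \<in> bdd_meas (E n) \<Longrightarrow> l (A f) = sm_integral (E n) \<nu> f" by blast
    have "\<forall>p\<in>{..n}. \<exists>\<mu>. \<mu> \<in> signed_measures (E p) \<and> (\<forall>f\<in>bdd_meas (E p). sm_integral (E p) \<mu> f = l (embed_at p f))"
    proof
      fix p assume "p \<in> {..n}"
      then have p: "p \<le> n" by simp
      have "l (embed_at p f) - ?Q p f f / 2 \<le> c" if "f \<in> bdd_meas (E p)" for f
        using l(2)[OF embedT[OF p that]] unfolding prod_form_embed[OF p that] .
      from representation[OF nonempty cov_form_field lin_on_embed[OF l(1) p] this]
      show "\<exists>\<mu>. \<mu> \<in> signed_measures (E p) \<and> (\<forall>f\<in>bdd_meas (E p). sm_integral (E p) \<mu> f = l (embed_at p f))"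
        by blast
    qed
    from bchoice[OF this] obtain m where
      "\<forall>p\<in>{..n}. m p \<in> signed_measures (E p) \<and> (\<forall>f\<in>bdd_meas (E p). sm_integral (E p) (m p) f = l (embed_at p f))" ..
    then have m: "\<And>p. p \<le> n \<Longrightarrow> m p \<in> signed_measures (E p)"
      "\<And>p f. p \<le> n \<Longrightarrow> f \<in> bdd_meas (E p) \<Longrightarrow> sm_integral (E p) (m p) f = l (embed_at p f)"
      by simp_all
    define \<mu> where "\<mu> = restrict m {..n}"
    have "\<mu> \<in> (\<Pi>\<^sub>E p\<in>{..n}. signed_measures (E p))" unfolding \<mu>_def using m(1) by auto
    moreover have "sm_integral (E n) \<nu> f = (\<Sum>p\<le>n. sm_integral (E p) (\<mu> p) (Dsg p n f))"
      if f: "f \<in> bdd_meas (E n)" for f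
      unfolding l(3)[OF f, symmetric] decompose[OF l(1) AT[OF f]]
      using m(2) f by (intro sum.cong refl) (simp add: \<mu>_def slA Dsg_bdd)
    ultimately have "?J \<le> (\<Sum>p\<le>n. rate_I E K \<eta>0 p (\<mu> p))"
      unfolding rate_J_def by (intro Inf_lower) blast
    also have "\<dots> \<le> ?S"
    proof -
      \<comment> \<open>Independently chosen \<open>F p\<close> assemble into one test function, on
        which the extended functional is bounded by \<open>c\<close>. Hence the sum of the rates,
        and not just each of them, is at most \<open>c\<close>.\<close>
      have "(\<Sum>p\<le>n. SUP f\<in>bdd_meas (E p). ereal (sm_integral (E p) (\<mu> p) f - ?Q p f f / 2)) + ereal 0 \<le> ereal c"
      proof (rule sum_SUP_le)
        fix F assume F: "\<And>p. p \<le> n \<Longrightarrow> F p \<in> bdd_meas (E p)"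
        define f where "f = (\<lambda>(p, x). if p \<le> n then F p x else 0)"
        have sl: "slice f p = (if p \<le> n then F p else (\<lambda>_. 0))" for p unfolding f_def slice_def by auto
        have f: "f \<in> prod_space n ?T" unfolding prod_space_def mem_Collect_eq sl using F by auto
        have "(\<Sum>p\<le>n. sm_integral (E p) (\<mu> p) (F p) - ?Q p (F p) (F p) / 2) = l f - prod_form n ?Q f f / 2"
          unfolding decompose[OF l(1) f] prod_form_def sum_divide_distrib sum_subtractf[symmetric]
          using m(2) F by (intro sum.cong refl) (simp add: \<mu>_def sl)
        then show "ereal ((\<Sum>p\<le>n. sm_integral (E p) (\<mu> p) (F p) - ?Q p (F p) (F p) / 2) + 0) \<le> ereal c"
          using l(2)[OF f] by simp
      qed (use bdd_meas_const in blast)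
      then show ?thesis unfolding rate_I_def real by simp
    qed
    finally show ?thesis .
  qed
qed

lemma limit_variance:
  assumes V: "limit_fields E K \<eta>0 G V" and f: "f \<in> bdd_meas (E n)"
  shows "(\<integral>w. (W_limit E K \<eta>0 D V n f w)\<^sup>2 \<partial>G) = QW n f f"
proof -
  note V' = V[unfolded limit_fields_def]
  note V1 = V'[THEN conjunct1] and V2 = V'[THEN conjunct2, THEN conjunct1]
    and V3 = V'[THEN conjunct2, THEN conjunct2, THEN conjunct1, rule_format]
    and V4 = V'[THEN conjunct2, THEN conjunct2, THEN conjunct2, rule_format]
  interpret prob_space G by (rule V1)
  define g where "g p = Dsg p n f" for p
  have g: "g p \<in> bdd_meas (E p)" if "p \<le> n" for p unfolding g_def using that f by (rule Dsg_bdd)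
  have cg: "centered_gaussian G (V p h)" if "h \<in> bdd_meas (E p)" for p h
  proof -
    have "centered_gaussian G (\<lambda>w. \<Sum>f\<in>{h}. 1 * V p f w)"
      by (rule V3) (use that in auto)
    then show ?thesis by simp
  qed
  have int: "integrable G (V p h) \<and> integrable G (\<lambda>w. (V p h w)\<^sup>2) \<and> (\<integral>w. V p h w \<partial>G) = 0"
    if h: "h \<in> bdd_meas (E p)" for p h
  proof (cases "AE w in G. V p h w = 0")
    case True
    have m: "V p h \<in> borel_measurable G" using cg[OF h] unfolding centered_gaussian_def by blast
    have "integrable G (V p h) = integrable G (\<lambda>_. 0 :: real)"
      using m True by (intro integrable_cong_AE) auto
    moreover have "integrable G (\<lambda>w. (V p h w)\<^sup>2) = integrable G (\<lambda>_. 0 :: real)"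
      using m True by (intro integrable_cong_AE) auto
    moreover have "(\<integral>w. V p h w \<partial>G) = (\<integral>w. 0 \<partial>G)"
      using m True by (intro integral_cong_AE) auto
    ultimately show ?thesis by simp
  next
    case False
    then obtain \<sigma> where s: "\<sigma> > 0" and d: "distributed G lborel (V p h) (normal_density 0 \<sigma>)"
      using cg[OF h] unfolding centered_gaussian_def by blast
    have "integrable lborel (\<lambda>x. normal_density 0 \<sigma> x * x)"
      using integrable_normal_moment[OF s, of 0 1] by simp
    then have "integrable G (V p h)"
      by (subst distributed_integrable[OF d, of "\<lambda>x. x", symmetric]) auto
    moreover have "integrable lborel (\<lambda>x. normal_density 0 \<sigma> x * x\<^sup>2)"
      using integrable_normal_moment[OF s, of 0 2] by simp
    then have "integrable G (\<lambda>w. (V p h w)\<^sup>2)"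
      by (subst distributed_integrable[OF d, of "\<lambda>x. x\<^sup>2", symmetric]) auto
    moreover have "expectation (V p h) = 0" by (rule normal_distributed_expectation[OF s d])
    ultimately show ?thesis by blast
  qed
  have mult: "integrable G (\<lambda>w. V p h w * V q h' w)"
    if "h \<in> bdd_meas (E p)" "h' \<in> bdd_meas (E q)" for p q h h'
  proof (rule Bochner_Integration.integrable_bound)
    show "integrable G (\<lambda>w. (V p h w)\<^sup>2 + (V q h' w)\<^sup>2)" using int that by (intro Bochner_Integration.integrable_add) auto
    show "(\<lambda>w. V p h w * V q h' w) \<in> borel_measurable G"
      using int that by (intro borel_measurable_times borel_measurable_integrable) auto
    show "AE w in G. norm (V p h w * V q h' w) \<le> norm ((V p h w)\<^sup>2 + (V q h' w)\<^sup>2)"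
    proof (rule AE_I2)
      fix w
      have "0 \<le> (\<bar>V p h w\<bar> - \<bar>V q h' w\<bar>)\<^sup>2" by simp
      then have "2 * (\<bar>V p h w\<bar> * \<bar>V q h' w\<bar>) \<le> (V p h w)\<^sup>2 + (V q h' w)\<^sup>2"
        by (simp add: power2_eq_square algebra_simps)
      moreover have "0 \<le> \<bar>V p h w\<bar> * \<bar>V q h' w\<bar>" by simp
      ultimately have "\<bar>V p h w\<bar> * \<bar>V q h' w\<bar> \<le> (V p h w)\<^sup>2 + (V q h' w)\<^sup>2" by linarith
      then show "norm (V p h w * V q h' w) \<le> norm ((V p h w)\<^sup>2 + (V q h' w)\<^sup>2)"
        by (simp add: abs_mult)
    qed
  qed
  have cross: "(\<integral>w. V p (g p) w * V q (g q) w \<partial>G) = (if p = q then field_cov K \<eta>0 p (g p) (g p) else 0)"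
    if "p \<le> n" "q \<le> n" for p q
  proof (cases "p = q")
    case True
    then show ?thesis using V4[OF g[OF that(1)] g[OF that(1)]] by simp
  next
    case False
    \<comment> \<open>The function \<open>g p\<close> is known to be bounded measurable for
      \<open>p \<le> n\<close> only, so the index set is cut down before the fields are evaluated at
      \<open>g p\<close>.\<close>
    from V2 have "indep_vars (\<lambda>p. PiM (bdd_meas (E p)) (\<lambda>_. borel)) (\<lambda>p w. \<lambda>f\<in>bdd_meas (E p). V p f w) {..n}"
      by (rule indep_vars_subset) simp
    then have "indep_vars (\<lambda>_. borel) (\<lambda>p. (\<lambda>v. v (g p)) \<circ> (\<lambda>w. \<lambda>f\<in>bdd_meas (E p). V p f w)) {..n}"
      by (rule indep_vars_compose) (auto intro!: measurable_component_singleton g)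
    then have "indep_vars (\<lambda>_. borel) (\<lambda>p. V p (g p)) {..n}"
      by (rule indep_vars_cong[THEN iffD1, rotated -1]) (auto simp: g)
    then have "indep_vars (\<lambda>_. borel) (\<lambda>p. V p (g p)) {p, q}"
      by (rule indep_vars_subset) (use that in auto)
    then have "(\<integral>w. (\<Prod>i\<in>{p, q}. V i (g i) w) \<partial>G) = (\<Prod>i\<in>{p, q}. \<integral>w. V i (g i) w \<partial>G)"
      using int g that by (intro indep_vars_lebesgue_integral) auto
    then have "(\<integral>w. V p (g p) w * V q (g q) w \<partial>G) = (\<integral>w. V p (g p) w \<partial>G) * (\<integral>w. V q (g q) w \<partial>G)"
      using False by simp
    then show ?thesis using int[OF g[OF that(1)]] False by simp
  qed
  have "(\<integral>w. (W_limit E K \<eta>0 D V n f w)\<^sup>2 \<partial>G) = (\<integral>w. (\<Sum>p\<le>n. \<Sum>q\<le>n. V p (g p) w * V q (g q) w) \<partial>G)"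
    unfolding W_limit_def g_def by (simp add: power2_eq_square sum_product)
  also have "\<dots> = (\<Sum>p\<le>n. \<Sum>q\<le>n. \<integral>w. V p (g p) w * V q (g q) w \<partial>G)"
  proof -
    have m: "integrable G (\<lambda>w. V p (g p) w * V q (g q) w)" if "p \<in> {..n}" "q \<in> {..n}" for p q
      by (rule mult) (use that g in auto)
    have "(\<integral>w. (\<Sum>p\<le>n. \<Sum>q\<le>n. V p (g p) w * V q (g q) w) \<partial>G)
        = (\<Sum>p\<le>n. \<integral>w. (\<Sum>q\<le>n. V p (g p) w * V q (g q) w) \<partial>G)"
      by (rule Bochner_Integration.integral_sum) (rule Bochner_Integration.integrable_sum, rule m)
    also have "\<dots> = (\<Sum>p\<le>n. \<Sum>q\<le>n. \<integral>w. V p (g p) w * V q (g q) w \<partial>G)"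
      by (intro sum.cong refl Bochner_Integration.integral_sum m)
    finally show ?thesis .
  qed
  also have "\<dots> = (\<Sum>p\<le>n. \<Sum>q\<le>n. if p = q then field_cov K \<eta>0 p (g p) (g p) else 0)"
    using cross by (intro sum.cong) auto
  also have "\<dots> = QW n f f" unfolding QW_def g_def by simp
  finally show ?thesis .
qed

end

section \<open>Exponentially negligible perturbations\<close>

lemma bdd_meas_exp: "X \<in> bdd_meas M \<Longrightarrow> (\<lambda>w. exp (X w)) \<in> bdd_meas M"
proof -
  assume X: "X \<in> bdd_meas M"
  obtain c where c: "\<And>x. x \<in> space M \<Longrightarrow> \<bar>X x\<bar> \<le> c" using X by (rule bdd_measE) blast
  show ?thesis
  proof (rule bdd_measI)
    show "(\<lambda>w. exp (X w)) \<in> borel_measurable M" using bdd_meas_measurable[OF X] by measurable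
    fix w assume "w \<in> space M"
    from c[OF this] show "\<bar>exp (X w)\<bar> \<le> exp c" by simp
  qed
qed

context prob_space
begin

lemma bdd_integrable: "X \<in> bdd_meas M \<Longrightarrow> integrable M X"
  by (rule bdd_meas_integrable[OF finite_measure_axioms refl])

definition log_mgf :: "('a \<Rightarrow> real) \<Rightarrow> real" where
  "log_mgf X = ln (\<integral>w. exp (X w) \<partial>M)"

lemma exp_log_mgf: "X \<in> bdd_meas M \<Longrightarrow> exp (log_mgf X) = (\<integral>w. exp (X w) \<partial>M)"
  unfolding log_mgf_def by (intro exp_ln expectation_exp_pos bdd_integrable bdd_meas_exp)

lemma log_mgf_le:
  assumes X: "X \<in> bdd_meas M" and le: "(\<integral>w. exp (X w) \<partial>M) \<le> exp c"
  shows "log_mgf X \<le> c"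
  using le unfolding exp_log_mgf[OF X, symmetric] by simp

lemma log_mgf_mono:
  assumes X: "X \<in> bdd_meas M" and Y: "Y \<in> bdd_meas M" and le: "\<And>w. w \<in> space M \<Longrightarrow> X w \<le> Y w"
  shows "log_mgf X \<le> log_mgf Y"
proof (rule log_mgf_le[OF X])
  have "(\<integral>w. exp (X w) \<partial>M) \<le> (\<integral>w. exp (Y w) \<partial>M)"
    using le by (intro integral_mono bdd_integrable bdd_meas_exp X Y) auto
  then show "(\<integral>w. exp (X w) \<partial>M) \<le> exp (log_mgf Y)" unfolding exp_log_mgf[OF Y] .
qed

lemma log_mgf_add_const: "X \<in> bdd_meas M \<Longrightarrow> log_mgf (\<lambda>w. X w + c) = log_mgf X + c"
proof -
  assume X: "X \<in> bdd_meas M"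
  have "(\<lambda>w. X w + c) \<in> bdd_meas M" by (intro bdd_meas_add X bdd_meas_const)
  from exp_log_mgf[OF this] have "exp (log_mgf (\<lambda>w. X w + c)) = exp (log_mgf X + c)"
    unfolding exp_add exp_log_mgf[OF X] by simp
  then show ?thesis by (rule exp_inj_iff[THEN iffD1])
qed

text \<open>Hoelder's inequality. Subtracting the cumulants normalises both exponentials to mean 1,
  and pointwise convexity of the exponential then suffices.\<close>

lemma log_mgf_convex:
  assumes X: "X \<in> bdd_meas M" and Y: "Y \<in> bdd_meas M" and s: "0 < s" "s < 1"
  shows "log_mgf (\<lambda>w. s * X w + (1 - s) * Y w) \<le> s * log_mgf X + (1 - s) * log_mgf Y"
proof (rule log_mgf_le)
  let ?a = "log_mgf X" and ?b = "log_mgf Y"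
  let ?c = "s * ?a + (1 - s) * ?b"
  show Z: "(\<lambda>w. s * X w + (1 - s) * Y w) \<in> bdd_meas M" using X Y by blast
  have X': "(\<lambda>w. X w + (- ?a)) \<in> bdd_meas M" and Y': "(\<lambda>w. Y w + (- ?b)) \<in> bdd_meas M"
    by (intro bdd_meas_add X Y bdd_meas_const)+
  have one: "(\<integral>w. exp (X w + (- ?a)) \<partial>M) = 1" "(\<integral>w. exp (Y w + (- ?b)) \<partial>M) = 1"
    unfolding exp_log_mgf[OF X', symmetric] exp_log_mgf[OF Y', symmetric]
      log_mgf_add_const[OF X] log_mgf_add_const[OF Y] by simp_all
  have "(\<integral>w. exp (s * X w + (1 - s) * Y w) \<partial>M) \<le>
      (\<integral>w. exp ?c * (s * exp (X w + (- ?a)) + (1 - s) * exp (Y w + (- ?b))) \<partial>M)"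
  proof (rule integral_mono)
    show "integrable M (\<lambda>w. exp (s * X w + (1 - s) * Y w))"
      by (intro bdd_integrable bdd_meas_exp Z)
    show "integrable M (\<lambda>w. exp ?c * (s * exp (X w + (- ?a)) + (1 - s) * exp (Y w + (- ?b))))"
      by (intro bdd_integrable bdd_meas_cmult bdd_meas_lincomb bdd_meas_exp X' Y')
    fix w
    have "exp ((1 - (1 - s)) * (X w + (- ?a)) + (1 - s) * (Y w + (- ?b)))
        \<le> (1 - (1 - s)) * exp (X w + (- ?a)) + (1 - s) * exp (Y w + (- ?b))"
      using s convex_onD[OF exp_convex, of "1 - s" "X w + (- ?a)" "Y w + (- ?b)"] by simp
    then have le1: "exp ?c * exp (s * (X w + (- ?a)) + (1 - s) * (Y w + (- ?b)))
        \<le> exp ?c * (s * exp (X w + (- ?a)) + (1 - s) * exp (Y w + (- ?b)))"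
      by (intro mult_left_mono) auto
    have eq1: "exp ?c * exp (s * (X w + (- ?a)) + (1 - s) * (Y w + (- ?b))) = exp (s * X w + (1 - s) * Y w)"
      unfolding exp_add[symmetric] by (rule arg_cong[of _ _ exp]) (simp add: algebra_simps)
    show "exp (s * X w + (1 - s) * Y w) \<le> exp ?c * (s * exp (X w + (- ?a)) + (1 - s) * exp (Y w + (- ?b)))"
      using le1 unfolding eq1 .
  qed
  also have "\<dots> = exp ?c * (s * (\<integral>w. exp (X w + (- ?a)) \<partial>M) + (1 - s) * (\<integral>w. exp (Y w + (- ?b)) \<partial>M))"
    using bdd_integrable[OF bdd_meas_exp[OF X']] bdd_integrable[OF bdd_meas_exp[OF Y']] by simp
  also have "\<dots> = exp ?c" unfolding one by simp
  finally show "(\<integral>w. exp (s * X w + (1 - s) * Y w) \<partial>M) \<le> exp ?c" .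
qed

end

locale exp_scale =
  fixes P :: "nat \<Rightarrow> 'w measure" and \<alpha> :: "nat \<Rightarrow> real"
  assumes P: "N \<ge> 1 \<Longrightarrow> prob_space (P N)"
    and \<alpha>_pos: "N \<ge> 1 \<Longrightarrow> \<alpha> N > 0"
    and \<alpha>_top: "filterlim \<alpha> at_top sequentially"
begin

definition lmgf :: "nat \<Rightarrow> ('w \<Rightarrow> real) \<Rightarrow> real" where
  "lmgf N X = prob_space.log_mgf (P N) (\<lambda>w. \<alpha> N * X w) / \<alpha> N"

definition rvs :: "(nat \<Rightarrow> 'w \<Rightarrow> real) \<Rightarrow> bool" where
  "rvs X \<longleftrightarrow> (\<forall>N\<ge>1. X N \<in> bdd_meas (P N))"

text \<open>Exponential equivalence to 0 in the form that Hoelder's inequality consumes: arbitrarily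
  large multiples of both signs have asymptotically nonpositive cumulants at speed
  \<open>\<alpha>\<close>.\<close>

definition negligible_seq :: "(nat \<Rightarrow> 'w \<Rightarrow> real) \<Rightarrow> bool" where
  "negligible_seq r \<longleftrightarrow> rvs r \<and>
     (\<forall>L. \<forall>e>0. \<forall>\<^sub>F N in sequentially. lmgf N (\<lambda>w. L * r N w) \<le> e)"

text \<open>The limit is required along all multiples \<open>t\<close>, because the perturbation
  argument evaluates it at multiples slightly larger and slightly smaller than the one of
  interest.\<close>

definition quadratic_mgf :: "(nat \<Rightarrow> 'w \<Rightarrow> real) \<Rightarrow> real \<Rightarrow> bool" where
  "quadratic_mgf A q \<longleftrightarrow> rvs A \<and> (\<forall>t. (\<lambda>N. lmgf N (\<lambda>w. t * A N w)) \<longlonglongrightarrow> t\<^sup>2 * q)"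

lemma rvsD: "rvs X \<Longrightarrow> N \<ge> 1 \<Longrightarrow> X N \<in> bdd_meas (P N)"
  unfolding rvs_def by blast

lemma rvs_lincomb: "rvs X \<Longrightarrow> rvs Y \<Longrightarrow> rvs (\<lambda>N w. a * X N w + b * Y N w)"
  unfolding rvs_def by blast

lemma lmgf_convex:
  assumes N: "N \<ge> 1" and X: "X \<in> bdd_meas (P N)" and Y: "Y \<in> bdd_meas (P N)" and s: "0 < s" "s < 1"
  shows "lmgf N (\<lambda>w. s * X w + (1 - s) * Y w) \<le> s * lmgf N X + (1 - s) * lmgf N Y"
proof -
  interpret prob_space "P N" by (rule P[OF N])
  have "log_mgf (\<lambda>w. s * (\<alpha> N * X w) + (1 - s) * (\<alpha> N * Y w)) \<le>
      s * log_mgf (\<lambda>w. \<alpha> N * X w) + (1 - s) * log_mgf (\<lambda>w. \<alpha> N * Y w)"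
    by (intro log_mgf_convex bdd_meas_cmult X Y s)
  moreover have "(\<lambda>w. s * (\<alpha> N * X w) + (1 - s) * (\<alpha> N * Y w)) = (\<lambda>w. \<alpha> N * (s * X w + (1 - s) * Y w))"
    by (simp add: algebra_simps)
  ultimately have "log_mgf (\<lambda>w. \<alpha> N * (s * X w + (1 - s) * Y w)) / \<alpha> N \<le>
      (s * log_mgf (\<lambda>w. \<alpha> N * X w) + (1 - s) * log_mgf (\<lambda>w. \<alpha> N * Y w)) / \<alpha> N"
    using \<alpha>_pos[OF N] by (intro divide_right_mono) auto
  then show ?thesis unfolding lmgf_def by (simp add: add_divide_distrib)
qed

lemma lmgf_mono:
  assumes N: "N \<ge> 1" and X: "X \<in> bdd_meas (P N)" and Y: "Y \<in> bdd_meas (P N)"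
    and le: "\<And>w. w \<in> space (P N) \<Longrightarrow> X w \<le> Y w"
  shows "lmgf N X \<le> lmgf N Y"
  unfolding lmgf_def using \<alpha>_pos[OF N] le
  by (intro divide_right_mono prob_space.log_mgf_mono[OF P[OF N]] bdd_meas_cmult X Y mult_left_mono) auto

lemma lmgf_le:
  assumes N: "N \<ge> 1" and X: "X \<in> bdd_meas (P N)"
    and le: "(\<integral>\<^sup>+w. ennreal (exp (\<alpha> N * X w)) \<partial>P N) \<le> ennreal (exp (\<alpha> N * c))"
  shows "lmgf N X \<le> c"
proof -
  interpret prob_space "P N" by (rule P[OF N])
  have b: "(\<lambda>w. \<alpha> N * X w) \<in> bdd_meas (P N)" using X by blast
  have "ennreal (\<integral>w. exp (\<alpha> N * X w) \<partial>P N) \<le> ennreal (exp (\<alpha> N * c))"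
    using le nn_integral_eq_integral[OF bdd_integrable[OF bdd_meas_exp[OF b]]] by simp
  then have "log_mgf (\<lambda>w. \<alpha> N * X w) \<le> \<alpha> N * c" by (intro log_mgf_le b) simp
  then show ?thesis unfolding lmgf_def using \<alpha>_pos[OF N] by (simp add: field_simps)
qed

lemma negligible_add:
  assumes r: "negligible_seq r" and u: "negligible_seq u"
  shows "negligible_seq (\<lambda>N w. r N w + u N w)"
  unfolding negligible_seq_def
proof (intro conjI allI impI)
  have b: "rvs r" "rvs u" using r u unfolding negligible_seq_def by blast+
  show "rvs (\<lambda>N w. r N w + u N w)" using rvs_lincomb[OF b, of 1 1] by simp
  fix L e :: real assume e: "e > 0"
  have "\<forall>\<^sub>F N in sequentially. lmgf N (\<lambda>w. (2 * L) * r N w) \<le> e"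
    "\<forall>\<^sub>F N in sequentially. lmgf N (\<lambda>w. (2 * L) * u N w) \<le> e"
    using r u e unfolding negligible_seq_def by blast+
  then show "\<forall>\<^sub>F N in sequentially. lmgf N (\<lambda>w. L * (r N w + u N w)) \<le> e"
    using eventually_ge_at_top[of 1]
  proof eventually_elim
    case (elim N)
    have "lmgf N (\<lambda>w. (1/2) * ((2 * L) * r N w) + (1 - 1/2) * ((2 * L) * u N w))
        \<le> (1/2) * lmgf N (\<lambda>w. (2 * L) * r N w) + (1 - 1/2) * lmgf N (\<lambda>w. (2 * L) * u N w)"
      using elim b by (intro lmgf_convex bdd_meas_cmult rvsD) auto
    moreover have "(\<lambda>w. (1/2) * ((2 * L) * r N w) + (1 - 1/2) * ((2 * L) * u N w)) = (\<lambda>w. L * (r N w + u N w))"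
      by (simp add: algebra_simps)
    ultimately show ?case using elim by simp
  qed
qed

lemma negligible_cmult:
  assumes "negligible_seq r"
  shows "negligible_seq (\<lambda>N w. c * r N w)"
proof -
  have b: "rvs r" using assms unfolding negligible_seq_def by blast
  have "rvs (\<lambda>N w. c * r N w)" using rvs_lincomb[OF b b, of c 0] by simp
  then show ?thesis using assms unfolding negligible_seq_def by (simp add: mult.assoc[symmetric])
qed

lemma negligible_0: "negligible_seq (\<lambda>N w. 0)"
proof -
  have "lmgf N (\<lambda>w. 0) = 0" if "N \<ge> 1" for N
    using prob_space.prob_space[OF P[OF that]]
    unfolding lmgf_def prob_space.log_mgf_def[OF P[OF that]] by simp
  then show ?thesis
    unfolding negligible_seq_def rvs_def by (auto simp: eventually_sequentially intro!: exI[of _ 1])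
qed

text \<open>Hoelder's inequality with weight \<open>s\<close> near 1 bounds the cumulant of the sum
  by that of a slightly enlarged \<open>A\<close>. Used backwards, with \<open>A\<close> as a
  combination of the sum and a multiple of \<open>r\<close>, it gives the lower bound. The factor
  \<open>1 / (1 - s)\<close> on \<open>r\<close> is harmless since all multiples of \<open>r\<close>
  are negligible.\<close>

lemma quadratic_mgf_perturb:
  assumes A: "quadratic_mgf A q" and q: "q \<ge> 0" and r: "negligible_seq r"
  shows "quadratic_mgf (\<lambda>N w. A N w + r N w) q"
  unfolding quadratic_mgf_def
proof (intro conjI allI)
  have b: "rvs A" "rvs r" using A r unfolding quadratic_mgf_def negligible_seq_def by blast+
  show "rvs (\<lambda>N w. A N w + r N w)" using rvs_lincomb[OF b, of 1 1] by simp
  fix t :: real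
  define a where "a = t\<^sup>2 * q"
  have a: "a \<ge> 0" unfolding a_def using q by simp
  show "(\<lambda>N. lmgf N (\<lambda>w. t * (A N w + r N w))) \<longlonglongrightarrow> t\<^sup>2 * q"
    unfolding a_def[symmetric]
  proof (rule tendstoI)
    fix \<epsilon>' :: real assume \<epsilon>': "\<epsilon>' > 0"
    define \<epsilon> where "\<epsilon> = \<epsilon>' / 8"
    have \<epsilon>: "\<epsilon> > 0" "\<epsilon>' = 8 * \<epsilon>" using \<epsilon>' unfolding \<epsilon>_def by auto
    \<comment> \<open>Chosen so that both \<open>a / s\<close> and \<open>s * a\<close> are within
      \<open>\<epsilon>\<close> of \<open>a\<close>, uniformly down to \<open>a = 0\<close>, while
      \<open>s\<close> stays at least 1/2 so that one may divide by it.\<close>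
    define s where "s = (a + \<epsilon>) / (a + 2 * \<epsilon>)"
    have s: "0 < s" "s < 1" "1 / 2 \<le> s" unfolding s_def using a \<epsilon> by (simp_all add: field_simps)
    have as: "a / s \<le> a + \<epsilon>" "a - \<epsilon> \<le> s * a"
    proof -
      have p: "0 < a + \<epsilon>" "0 < a + 2 * \<epsilon>" using a \<epsilon> by auto
      have "a / s = a * (a + 2 * \<epsilon>) / (a + \<epsilon>)" unfolding s_def using p by simp
      also have "\<dots> \<le> a + \<epsilon>" using p \<epsilon> a by (simp add: divide_le_eq power2_eq_square algebra_simps)
      finally show "a / s \<le> a + \<epsilon>" .
      have "(a - \<epsilon>) * (a + 2 * \<epsilon>) \<le> (a + \<epsilon>) * a" using \<epsilon> by (simp add: algebra_simps)
      then show "a - \<epsilon> \<le> s * a" unfolding s_def using p by (simp add: le_divide_eq)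
    qed
    have lim: "\<forall>\<^sub>F N in sequentially. dist (lmgf N (\<lambda>w. u * A N w)) (u\<^sup>2 * q) < \<epsilon>" for u
      using A \<epsilon>(1) unfolding quadratic_mgf_def by (intro tendstoD) auto
    have neg: "\<forall>\<^sub>F N in sequentially. lmgf N (\<lambda>w. L * r N w) \<le> \<epsilon>" for L
      using r \<epsilon>(1) unfolding negligible_seq_def by blast
    show "\<forall>\<^sub>F N in sequentially. dist (lmgf N (\<lambda>w. t * (A N w + r N w))) a < \<epsilon>'"
      using lim[of "t / s"] lim[of "s * t"] neg[of "t / (1 - s)"] neg[of "- (s * t) / (1 - s)"] eventually_ge_at_top[of 1]
    proof eventually_elim
      case (elim N)
      note N = elim(5)
      note bb = rvsD[OF b(1) N] rvsD[OF b(2) N]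
      let ?m = "lmgf N (\<lambda>w. t * (A N w + r N w))"
      have s1: "1 - s \<noteq> 0" "s \<noteq> 0" using s by auto
      have eq1: "(\<lambda>w. t * (A N w + r N w)) = (\<lambda>w. s * ((t / s) * A N w) + (1 - s) * ((t / (1 - s)) * r N w))"
      proof
        fix w
        have "(1 - s) * ((t / (1 - s)) * r N w) = t * r N w" "s * ((t / s) * A N w) = t * A N w"
          using s1 by simp_all
        then show "t * (A N w + r N w) = s * ((t / s) * A N w) + (1 - s) * ((t / (1 - s)) * r N w)"
          by (simp add: algebra_simps)
      qed
      have "?m \<le> s * lmgf N (\<lambda>w. (t / s) * A N w) + (1 - s) * lmgf N (\<lambda>w. (t / (1 - s)) * r N w)"
        unfolding eq1 by (rule lmgf_convex[OF N bdd_meas_cmult[OF bb(1)] bdd_meas_cmult[OF bb(2)] s(1,2)])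
      also have "\<dots> \<le> s * ((t / s)\<^sup>2 * q + \<epsilon>) + (1 - s) * \<epsilon>"
        using elim(1,3) s by (intro add_mono mult_left_mono) (auto simp: dist_real_def)
      also have "\<dots> = a / s + \<epsilon>"
        unfolding a_def using s1 by (simp add: power_divide power2_eq_square algebra_simps)
      finally have up: "?m \<le> a + 2 * \<epsilon>" using as by simp
      \<comment> \<open>The roles are exchanged: the sum appears on the right side of Hoelder's
        inequality, and the multiple of \<open>r\<close> compensates.\<close>
      have eq2: "(\<lambda>w. (s * t) * A N w) = (\<lambda>w. s * (t * (A N w + r N w)) + (1 - s) * ((- (s * t) / (1 - s)) * r N w))"
      proof
        fix w
        have "(1 - s) * ((- (s * t) / (1 - s)) * r N w) = - (s * t) * r N w" using s1 by simp
        then show "(s * t) * A N w = s * (t * (A N w + r N w)) + (1 - s) * ((- (s * t) / (1 - s)) * r N w)"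
          by (simp add: algebra_simps)
      qed
      have "lmgf N (\<lambda>w. (s * t) * A N w) \<le> s * ?m + (1 - s) * lmgf N (\<lambda>w. (- (s * t) / (1 - s)) * r N w)"
        unfolding eq2 by (rule lmgf_convex[OF N bdd_meas_cmult[OF bdd_meas_add[OF bb]] bdd_meas_cmult[OF bb(2)] s(1,2)])
      also have "\<dots> \<le> s * ?m + (1 - s) * \<epsilon>" using elim(4) s by (intro add_left_mono mult_left_mono) auto
      finally have "(s * t)\<^sup>2 * q - \<epsilon> \<le> s * ?m + (1 - s) * \<epsilon>" using elim(2) by (simp add: dist_real_def)
      moreover have "(s * t)\<^sup>2 * q = s * (s * a)" unfolding a_def by (simp add: power2_eq_square)
      moreover have "(1 - s) * \<epsilon> \<le> \<epsilon>" using s \<epsilon> by simp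
      ultimately have "s * (s * a) - 2 * \<epsilon> \<le> s * ?m" by linarith
      moreover have "s * (a - \<epsilon>) \<le> s * (s * a)" using as s by (intro mult_left_mono) auto
      moreover have "2 * \<epsilon> \<le> s * (4 * \<epsilon>)" using s \<epsilon> by simp
      ultimately have "s * (a - \<epsilon>) - s * (4 * \<epsilon>) \<le> s * ?m" by linarith
      then have "s * (a - 5 * \<epsilon>) \<le> s * ?m" by (simp add: algebra_simps)
      then have lo: "a - 5 * \<epsilon> \<le> ?m" using s(1) by simp
      show ?case using up lo \<epsilon> unfolding dist_real_def by linarith
    qed
  qed
qed

end

section \<open>Mixtures and Gaussian tails\<close>

lemma mixture_bound:
  fixes R :: "'g measure" and q :: "'g \<Rightarrow> ennreal"
  assumes q: "q \<in> borel_measurable R" and qfin: "\<And>g. g \<in> space R \<Longrightarrow> q g < \<infinity>"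
    and m: "(\<integral>\<^sup>+g. q g \<partial>R) \<le> ennreal m" "0 \<le> m" and c: "c \<ge> 0"
    and hq: "\<And>g. g \<in> space R \<Longrightarrow> \<bar>h g\<bar> \<le> c * enn2real (q g)"
  shows "(\<integral>\<^sup>+g. ennreal \<bar>h g\<bar> \<partial>R) \<le> ennreal (c * m)"
proof -
  have "(\<integral>\<^sup>+g. ennreal \<bar>h g\<bar> \<partial>R) \<le> (\<integral>\<^sup>+g. ennreal c * q g \<partial>R)"
  proof (rule nn_integral_mono)
    fix g assume g: "g \<in> space R"
    have "ennreal \<bar>h g\<bar> \<le> ennreal (c * enn2real (q g))" using hq[OF g] by (rule ennreal_leI)
    also have "\<dots> = ennreal c * q g" using c qfin[OF g] by (simp add: ennreal_mult)
    finally show "ennreal \<bar>h g\<bar> \<le> ennreal c * q g" .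
  qed
  also have "\<dots> = ennreal c * (\<integral>\<^sup>+g. q g \<partial>R)" using q by (rule nn_integral_cmult)
  also have "\<dots> \<le> ennreal c * ennreal m" using m by (intro mult_left_mono) auto
  also have "\<dots> = ennreal (c * m)" using c m by (simp add: ennreal_mult)
  finally show ?thesis .
qed

text \<open>Jensen's inequality for the normalised weight \<open>q dR\<close>, then Tonelli. The measure \<open>R\<close> itself
  need not be \<open>\<sigma>\<close>-finite, but \<open>h\<close> vanishes where \<open>q\<close> does.\<close>

lemma mixture_exp_bound:
  fixes M :: "'w measure" and R :: "'g measure" and h :: "'w \<times> 'g \<Rightarrow> real" and q :: "'g \<Rightarrow> ennreal"
  assumes M: "prob_space M" and h: "h \<in> borel_measurable (M \<Otimes>\<^sub>M R)"
    and q: "q \<in> borel_measurable R" and qfin: "\<And>g. g \<in> space R \<Longrightarrow> q g < \<infinity>"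
    and m: "(\<integral>\<^sup>+g. q g \<partial>R) \<le> ennreal m" "0 \<le> m" and c: "c \<ge> 0"
    and hq: "\<And>w g. w \<in> space M \<Longrightarrow> g \<in> space R \<Longrightarrow> \<bar>h (w, g)\<bar> \<le> c * enn2real (q g)"
    and s: "0 \<le> s" and B: "1 \<le> B"
    and le: "\<And>g. g \<in> space R \<Longrightarrow> 0 < q g \<Longrightarrow>
      (\<integral>\<^sup>+w. ennreal (exp (s * m * (\<bar>h (w, g)\<bar> / enn2real (q g)))) \<partial>M) \<le> ennreal B"
  shows "(\<integral>\<^sup>+w. ennreal (exp (s * enn2real (\<integral>\<^sup>+g. ennreal \<bar>h (w, g)\<bar> \<partial>R))) \<partial>M) \<le> ennreal B"
proof -
  interpret M: prob_space M by fact
  \<comment> \<open>The actual mass, which \<open>m\<close> only bounds. Normalising the weight to a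
    probability requires its exact value, with mass 0 as a separate case.\<close>
  define m' where "m' = enn2real (\<integral>\<^sup>+g. q g \<partial>R)"
  have m': "(\<integral>\<^sup>+g. q g \<partial>R) = ennreal m'" "0 \<le> m'" "m' \<le> m"
  proof -
    show e: "(\<integral>\<^sup>+g. q g \<partial>R) = ennreal m'"
      unfolding m'_def using m(1) by (metis ennreal_enn2real ennreal_less_top le_less_trans)
    show "0 \<le> m'" unfolding m'_def by simp
    show "m' \<le> m" using m unfolding e by simp
  qed
  have hm: "(\<lambda>g. h (w, g)) \<in> borel_measurable R" if "w \<in> space M" for w
    using measurable_compose[OF measurable_Pair1'[OF that] h] .
  show ?thesis
  proof (cases "m' = 0")
    case True
    have "(\<integral>\<^sup>+g. ennreal \<bar>h (w, g)\<bar> \<partial>R) = 0" if "w \<in> space M" for w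
    proof -
      have "(\<integral>\<^sup>+g. ennreal \<bar>h (w, g)\<bar> \<partial>R) \<le> ennreal (c * 0)"
        using m' True by (intro mixture_bound[OF q qfin _ _ c hq[OF that]]) auto
      then show ?thesis by simp
    qed
    then have "(\<integral>\<^sup>+w. ennreal (exp (s * enn2real (\<integral>\<^sup>+g. ennreal \<bar>h (w, g)\<bar> \<partial>R))) \<partial>M) = (\<integral>\<^sup>+w. 1 \<partial>M)"
      by (intro nn_integral_cong) simp
    then show ?thesis using B M.emeasure_space_1 by simp
  next
    case False
    then have mp: "m' > 0" using m' by simp
    define \<rho> where "\<rho> = density R (\<lambda>g. q g / ennreal m')"
    have dm: "(\<lambda>g. q g / ennreal m') \<in> borel_measurable R" using q by simp
    have [simp]: "sets \<rho> = sets R" "space \<rho> = space R" unfolding \<rho>_def by simp_all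
    have "emeasure \<rho> (space \<rho>) = (\<integral>\<^sup>+g. q g / ennreal m' \<partial>R)"
      unfolding \<rho>_def using dm by (simp add: emeasure_density cong: nn_integral_cong)
    also have "\<dots> = ennreal m' / ennreal m'" using q m'(1) by (simp add: nn_integral_divide)
    also have "\<dots> = 1" using mp by (simp add: divide_ennreal)
    finally interpret \<rho>: prob_space \<rho> by (rule prob_spaceI)
    \<comment> \<open>Where the weight vanishes the quotient is 0 by the convention for division, in
      accordance with \<open>h\<close> being 0 there by \<open>hq\<close>.\<close>
    define k where "k w g = \<bar>h (w, g)\<bar> / enn2real (q g)" for w g
    have k0: "0 \<le> k w g" for w g unfolding k_def by simp
    have kc: "k w g \<le> c" if "w \<in> space M" "g \<in> space R" for w g
    proof (cases "enn2real (q g) = 0")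
      case True
      then show ?thesis unfolding k_def using c by simp
    next
      case False
      then have "enn2real (q g) > 0" using enn2real_nonneg[of "q g"] by linarith
      then show ?thesis unfolding k_def using hq[OF that] by (simp add: divide_le_eq)
    qed
    have kq: "ennreal \<bar>h (w, g)\<bar> = ennreal m' * (q g / ennreal m' * ennreal (k w g))"
      if "w \<in> space M" "g \<in> space R" for w g
    proof -
      define u where "u = enn2real (q g)"
      have u: "q g = ennreal u" "0 \<le> u" unfolding u_def using qfin[OF that(2)] by simp_all
      have "\<bar>h (w, g)\<bar> = m' * (u / m' * k w g)"
        unfolding k_def u_def[symmetric] using hq[OF that] mp by (cases "u = 0") (auto simp: u_def[symmetric])
      then have "ennreal \<bar>h (w, g)\<bar> = ennreal m' * ennreal (u / m' * k w g)"
        using mp u k0[of w g] by (simp only:) (intro ennreal_mult mult_nonneg_nonneg divide_nonneg_nonneg, auto)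
      also have "ennreal (u / m' * k w g) = ennreal (u / m') * ennreal (k w g)"
        using mp u k0[of w g] by (intro ennreal_mult) auto
      also have "ennreal (u / m') = q g / ennreal m'"
        unfolding u(1) using mp u(2) by (intro divide_ennreal[symmetric])
      finally show ?thesis .
    qed
    have km: "k w \<in> borel_measurable R" if "w \<in> space M" for w
      unfolding k_def[abs_def] using hm[OF that] q by measurable
    have jensen: "ennreal (exp (s * enn2real (\<integral>\<^sup>+g. ennreal \<bar>h (w, g)\<bar> \<partial>R))) \<le> (\<integral>\<^sup>+g. ennreal (exp (s * m' * k w g)) \<partial>\<rho>)"
      if w: "w \<in> space M" for w
    proof -
      have kb: "k w \<in> bdd_meas \<rho>"
        using km[OF w] kc[OF w] k0 measurable_cong_sets[of \<rho> R borel borel] by (intro bdd_measI[where c = c]) auto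
      have ki: "integrable \<rho> (k w)" by (rule \<rho>.bdd_integrable[OF kb])
      have "(\<integral>\<^sup>+g. ennreal \<bar>h (w, g)\<bar> \<partial>R) = (\<integral>\<^sup>+g. ennreal m' * (q g / ennreal m' * ennreal (k w g)) \<partial>R)"
        by (rule nn_integral_cong) (rule kq[OF w])
      also have "\<dots> = ennreal m' * (\<integral>\<^sup>+g. q g / ennreal m' * ennreal (k w g) \<partial>R)"
        by (intro nn_integral_cmult borel_measurable_times_ennreal dm measurable_compose[OF km[OF w] measurable_ennreal])
      also have "(\<integral>\<^sup>+g. q g / ennreal m' * ennreal (k w g) \<partial>R) = (\<integral>\<^sup>+g. ennreal (k w g) \<partial>\<rho>)"
        unfolding \<rho>_def using dm km[OF w] by (intro nn_integral_density[symmetric]) auto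
      also have "\<dots> = ennreal (\<integral>g. k w g \<partial>\<rho>)"
        using ki k0 by (intro nn_integral_eq_integral) auto
      also have "ennreal m' * \<dots> = ennreal (m' * (\<integral>g. k w g \<partial>\<rho>))" using mp by (simp add: ennreal_mult')
      finally have U: "s * enn2real (\<integral>\<^sup>+g. ennreal \<bar>h (w, g)\<bar> \<partial>R) = (\<integral>g. s * m' * k w g \<partial>\<rho>)"
        using mp k0 by (simp add: integral_nonneg_AE)
      let ?a = "\<integral>g. s * m' * k w g \<partial>\<rho>"
      have yb: "(\<lambda>g. s * m' * k w g) \<in> bdd_meas \<rho>" using kb by blast
      \<comment> \<open>Jensen's inequality from the tangent line of the exponential at the mean
        \<open>?a\<close>.\<close>
      have "exp ?a = (\<integral>g. exp ?a * (1 + (s * m' * k w g - ?a)) \<partial>\<rho>)"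
        using \<rho>.bdd_integrable[OF yb] \<rho>.prob_space by simp
      also have "\<dots> \<le> (\<integral>g. exp (s * m' * k w g) \<partial>\<rho>)"
      proof (rule integral_mono)
        show "integrable \<rho> (\<lambda>g. exp ?a * (1 + (s * m' * k w g - ?a)))"
          by (intro \<rho>.bdd_integrable bdd_meas_cmult bdd_meas_add bdd_meas_diff bdd_meas_const yb)
        show "integrable \<rho> (\<lambda>g. exp (s * m' * k w g))" by (intro \<rho>.bdd_integrable bdd_meas_exp yb)
        fix g
        have "exp ?a * (1 + (s * m' * k w g - ?a)) \<le> exp ?a * exp (s * m' * k w g - ?a)"
          by (intro mult_left_mono exp_ge_add_one_self) simp
        then show "exp ?a * (1 + (s * m' * k w g - ?a)) \<le> exp (s * m' * k w g)"
          by (simp add: exp_add[symmetric])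
      qed
      finally have "ennreal (exp ?a) \<le> ennreal (\<integral>g. exp (s * m' * k w g) \<partial>\<rho>)" by (rule ennreal_leI)
      also have "\<dots> = (\<integral>\<^sup>+g. ennreal (exp (s * m' * k w g)) \<partial>\<rho>)"
        by (intro nn_integral_eq_integral[symmetric] \<rho>.bdd_integrable bdd_meas_exp yb) auto
      finally show ?thesis unfolding U .
    qed
    have jm: "(\<lambda>(w, g). ennreal (exp (s * m' * k w g))) \<in> borel_measurable (M \<Otimes>\<^sub>M \<rho>)"
    proof -
      have "sets (M \<Otimes>\<^sub>M \<rho>) = sets (M \<Otimes>\<^sub>M R)" by (rule sets_pair_measure_cong) simp_all
      moreover have "(\<lambda>(w, g). ennreal (exp (s * m' * k w g))) \<in> borel_measurable (M \<Otimes>\<^sub>M R)"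
        unfolding k_def using h q by measurable
      ultimately show ?thesis using measurable_cong_sets by blast
    qed
    interpret pr: pair_sigma_finite M \<rho> ..
    have "(\<integral>\<^sup>+w. ennreal (exp (s * enn2real (\<integral>\<^sup>+g. ennreal \<bar>h (w, g)\<bar> \<partial>R))) \<partial>M)
        \<le> (\<integral>\<^sup>+w. \<integral>\<^sup>+g. ennreal (exp (s * m' * k w g)) \<partial>\<rho> \<partial>M)"
      by (rule nn_integral_mono) (rule jensen)
    also have "\<dots> = (\<integral>\<^sup>+g. \<integral>\<^sup>+w. ennreal (exp (s * m' * k w g)) \<partial>M \<partial>\<rho>)"
      using pr.Fubini'[OF jm] by simp
    also have "\<dots> \<le> (\<integral>\<^sup>+g. ennreal B \<partial>\<rho>)"
    proof (rule nn_integral_mono)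
      fix g assume "g \<in> space \<rho>"
      then have g: "g \<in> space R" by simp
      show "(\<integral>\<^sup>+w. ennreal (exp (s * m' * k w g)) \<partial>M) \<le> ennreal B"
      proof (cases "q g = 0")
        case True
        then have "(\<integral>\<^sup>+w. ennreal (exp (s * m' * k w g)) \<partial>M) = (\<integral>\<^sup>+w. 1 \<partial>M)"
          by (simp add: k_def)
        then show ?thesis using B M.emeasure_space_1 by simp
      next
        case False
        have "(\<integral>\<^sup>+w. ennreal (exp (s * m' * k w g)) \<partial>M) \<le> (\<integral>\<^sup>+w. ennreal (exp (s * m * k w g)) \<partial>M)"
          using m'(3) s k0 by (intro nn_integral_mono ennreal_leI) (auto intro!: mult_right_mono mult_left_mono)
        also have "\<dots> \<le> ennreal B" unfolding k_def using le[OF g] False by (simp add: zero_less_iff_neq_zero)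
        finally show ?thesis .
      qed
    qed
    also have "\<dots> = ennreal B" using \<rho>.emeasure_space_1 by simp
    finally show ?thesis .
  qed
qed

text \<open>The geometric series arising in \<open>exp_square_bound\<close>. What matters is that it
  depends on \<open>C\<close> alone; the maximum with 1 meets the requirement on \<open>B\<close> in
  \<open>mixture_exp_bound\<close>.\<close>

definition square_const :: "real \<Rightarrow> real" where
  "square_const C = max 1 (C * exp (1 / (16 * C)) * (\<Sum>k. exp (- 3 / (16 * C)) ^ k))"

text \<open>Cut according to the integer part \<open>k\<close> of the absolute value. On that slice
  the square is at most \<open>(k + 1)\<^sup>2\<close>, and Markov's inequality with exponent
  \<open>k / (2 * C)\<close> beats it: the \<open>k\<close>-th total exponent is at most
  \<open>(2 - 6 * k) / (32 * C)\<close>, which is summable.\<close>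

lemma exp_square_bound:
  fixes Z :: "'w \<Rightarrow> real"
  assumes Z: "Z \<in> borel_measurable M" and C: "C \<ge> 1"
    and le: "\<And>t. t \<ge> 0 \<Longrightarrow> (\<integral>\<^sup>+w. ennreal (exp (t * \<bar>Z w\<bar>)) \<partial>M) \<le> ennreal (C * exp (C * t\<^sup>2))"
  shows "(\<integral>\<^sup>+w. ennreal (exp ((Z w)\<^sup>2 / (32 * C))) \<partial>M) \<le> ennreal (square_const C)"
proof -
  let ?f = "\<lambda>k w. ennreal (exp ((real k + 1)\<^sup>2 / (32 * C) - (real k)\<^sup>2 / (2 * C))) * ennreal (exp (real k / (2 * C) * \<bar>Z w\<bar>))"
  let ?r = "exp (- 3 / (16 * C))"
  let ?b = "\<lambda>k. C * exp (1 / (16 * C)) * ?r ^ k"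
  have pt: "ennreal (exp ((Z w)\<^sup>2 / (32 * C))) \<le> (\<Sum>k. ?f k w)" for w
  proof -
    define k where "k = nat \<lfloor>\<bar>Z w\<bar>\<rfloor>"
    have k: "real k \<le> \<bar>Z w\<bar>" "\<bar>Z w\<bar> \<le> real k + 1" unfolding k_def by linarith+
    have "(Z w)\<^sup>2 \<le> (real k + 1)\<^sup>2" using power_mono[OF k(2) abs_ge_zero, of 2] by simp
    then have "(Z w)\<^sup>2 / (32 * C) \<le> (real k + 1)\<^sup>2 / (32 * C)" using C by (intro divide_right_mono) auto
    moreover have "(real k)\<^sup>2 / (2 * C) \<le> real k / (2 * C) * \<bar>Z w\<bar>"
      using k(1) C by (simp add: power2_eq_square divide_right_mono mult_left_mono)
    ultimately have "ennreal (exp ((Z w)\<^sup>2 / (32 * C))) \<le> ?f k w"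
      by (simp add: ennreal_mult[symmetric] exp_add[symmetric])
    also have "\<dots> = (\<Sum>i\<in>{k}. ?f i w)" by simp
    also have "\<dots> \<le> (\<Sum>k. ?f k w)" by (rule sum_le_suminf) auto
    finally show ?thesis .
  qed
  have trm: "(\<integral>\<^sup>+w. ?f k w \<partial>M) \<le> ennreal (?b k)" for k
  proof -
    have "(\<integral>\<^sup>+w. ?f k w \<partial>M) = ennreal (exp ((real k + 1)\<^sup>2 / (32 * C) - (real k)\<^sup>2 / (2 * C))) *
        (\<integral>\<^sup>+w. ennreal (exp (real k / (2 * C) * \<bar>Z w\<bar>)) \<partial>M)"
      using Z by (intro nn_integral_cmult) measurable
    also have "\<dots> \<le> ennreal (exp ((real k + 1)\<^sup>2 / (32 * C) - (real k)\<^sup>2 / (2 * C))) *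
        ennreal (C * exp (C * (real k / (2 * C))\<^sup>2))"
      using C by (intro mult_left_mono le) auto
    also have "\<dots> = ennreal (C * exp ((real k + 1)\<^sup>2 / (32 * C) - (real k)\<^sup>2 / (2 * C) + C * (real k / (2 * C))\<^sup>2))"
      using C by (simp add: ennreal_mult[symmetric] exp_add mult_ac)
    also have "\<dots> \<le> ennreal (C * exp (1 / (16 * C) + real k * (- 3 / (16 * C))))"
    proof -
      have kk: "real k \<le> (real k)\<^sup>2"
      proof (cases k)
        case (Suc j)
        then have "1 * real k \<le> real k * real k" by (intro mult_right_mono) auto
        then show ?thesis by (simp add: power2_eq_square)
      qed simp
      have k2: "(real k + 1)\<^sup>2 \<le> 2 * (real k)\<^sup>2 + 2"
      proof -
        have "0 \<le> (real k - 1)\<^sup>2" by simp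
        then show ?thesis by (simp add: power2_eq_square algebra_simps)
      qed
      have k3: "(real k + 1)\<^sup>2 - 8 * (real k)\<^sup>2 \<le> 2 - 6 * real k" using kk k2 by linarith
      have "(real k + 1)\<^sup>2 / (32 * C) - (real k)\<^sup>2 / (2 * C) + C * (real k / (2 * C))\<^sup>2
          = ((real k + 1)\<^sup>2 - 8 * (real k)\<^sup>2) / (32 * C)"
        using C by (simp add: power2_eq_square field_simps)
      also have "\<dots> \<le> (2 - 6 * real k) / (32 * C)" using C k3 by (intro divide_right_mono) auto
      also have "\<dots> = 1 / (16 * C) + real k * (- 3 / (16 * C))" using C by (simp add: field_simps)
      finally show ?thesis using C by (intro ennreal_leI mult_left_mono) auto
    qed
    also have "C * exp (1 / (16 * C) + real k * (- 3 / (16 * C))) = ?b k"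
      by (simp only: exp_add exp_of_nat_mult mult.assoc)
    finally show ?thesis .
  qed
  have r: "norm ?r < 1" using C by simp
  have sm: "summable ?b" by (intro summable_mult summable_geometric r)
  have "(\<integral>\<^sup>+w. ennreal (exp ((Z w)\<^sup>2 / (32 * C))) \<partial>M) \<le> (\<integral>\<^sup>+w. (\<Sum>k. ?f k w) \<partial>M)"
    by (rule nn_integral_mono) (rule pt)
  also have "\<dots> = (\<Sum>k. \<integral>\<^sup>+w. ?f k w \<partial>M)" using Z by (intro nn_integral_suminf) measurable
  also have "\<dots> \<le> (\<Sum>k. ennreal (?b k))" by (intro suminf_le trm) auto
  also have "\<dots> = ennreal (\<Sum>k. ?b k)" using C sm by (intro suminf_ennreal2) auto
  also have "(\<Sum>k. ?b k) = C * exp (1 / (16 * C)) * (\<Sum>k. ?r ^ k)"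
    by (intro suminf_mult summable_geometric r)
  also have "ennreal \<dots> \<le> ennreal (square_const C)" unfolding square_const_def by (intro ennreal_leI) simp
  finally show ?thesis .
qed

section \<open>Cumulant bounds for bounded random variables\<close>

lemma exp_taylor2:
  fixes x :: real
  assumes "\<bar>x\<bar> \<le> 1"
  shows "\<bar>exp x - (1 + x + x\<^sup>2 / 2)\<bar> \<le> \<bar>x\<bar> ^ 3"
proof -
  obtain t where t: "\<bar>t\<bar> \<le> \<bar>x\<bar>" "exp x = (\<Sum>m<3. (x ^ m) / fact m) + (exp t / fact 3) * x ^ 3"
    using Maclaurin_exp_le by blast
  have "(\<Sum>m<3. (x ^ m) / fact m) = 1 + x + x\<^sup>2 / 2"
    by (simp add: numeral_3_eq_3 fact_numeral power2_eq_square)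
  then have "\<bar>exp x - (1 + x + x\<^sup>2 / 2)\<bar> = exp t / 6 * \<bar>x\<bar> ^ 3"
    using t(2) by (simp add: abs_mult power_abs fact_numeral)
  also have "\<dots> \<le> 1 * \<bar>x\<bar> ^ 3"
  proof (rule mult_right_mono)
    have "exp t \<le> exp 1" using t(1) assms by simp
    also have "\<dots> \<le> 3" using exp_le by simp
    finally show "exp t / 6 \<le> 1" by simp
  qed simp
  finally show ?thesis by simp
qed

context
  fixes E :: "'a measure" and \<kappa> :: "'a measure" and f :: "'a \<Rightarrow> real" and a r :: real
  assumes \<kappa>: "\<kappa> \<in> probs E" and f: "f \<in> bdd_meas E" and a: "a = (\<integral>y. f y \<partial>\<kappa>)"
    and r: "\<And>y. y \<in> space E \<Longrightarrow> \<bar>f y - a\<bar> \<le> r"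
begin

lemma centered_bdd: "(\<lambda>y. f y - a) \<in> bdd_meas E"
  using f by (intro bdd_meas_diff bdd_meas_const)

lemma exp_centered_bdd: "(\<lambda>y. exp (s * (f y - a))) \<in> bdd_meas E"
  by (intro bdd_meas_exp bdd_meas_cmult centered_bdd)

lemma centered_integral: "(\<integral>y. f y - a \<partial>\<kappa>) = 0"
  using bdd_functional_diff[OF probs_functional[OF \<kappa>] f bdd_meas_const, of a] probs_const[OF \<kappa>, of a] a by simp

lemma exp_centered_pos: "0 < (\<integral>y. exp (s * (f y - a)) \<partial>\<kappa>)"
  by (intro prob_space.expectation_exp_pos[OF probsD(1)[OF \<kappa>]] probs_integrable[OF \<kappa>] exp_centered_bdd)

lemma r_nonneg: "0 \<le> r"
  using probs_nonempty[OF \<kappa>] r by (meson abs_ge_zero all_not_in_conv order_trans)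

text \<open>Hoeffding's lemma on an interval of length \<open>2 * r\<close>. It is available for
  positive exponents, so a negative \<open>s\<close> is moved onto the negative of the
  function.\<close>

lemma hoeffding_cumulant: "ln (\<integral>y. exp (s * (f y - a)) \<partial>\<kappa>) \<le> s\<^sup>2 * r\<^sup>2 / 2"
proof -
  have pos: "(\<integral>y. exp (s * g y) \<partial>\<kappa>) \<le> exp (s\<^sup>2 * r\<^sup>2 / 2)"
    if s: "s > 0" and g: "g \<in> bdd_meas E" and g0: "(\<integral>y. g y \<partial>\<kappa>) = 0" and gr: "\<And>y. y \<in> space E \<Longrightarrow> \<bar>g y\<bar> \<le> r"
    for s g
  proof -
    interpret interval_bounded_random_variable \<kappa> g "- r" r
      unfolding interval_bounded_random_variable_def interval_bounded_random_variable_axioms_def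
    proof (intro conjI)
      show "prob_space \<kappa>" by (rule probsD(1)[OF \<kappa>])
      show "g \<in> borel_measurable \<kappa>"
        using bdd_meas_measurable[OF g] measurable_cong_sets[OF probsD(2)[OF \<kappa>] refl] by blast
      show "AE x in \<kappa>. g x \<in> {- r..r}"
      proof (rule AE_I2)
        fix x assume "x \<in> space \<kappa>"
        then have "\<bar>g x\<bar> \<le> r" using gr probsD(3)[OF \<kappa>] by simp
        then show "g x \<in> {- r..r}" by (auto simp: abs_le_iff)
      qed
    qed
    have "ennreal (\<integral>y. exp (s * g y) \<partial>\<kappa>) = (\<integral>\<^sup>+y. ennreal (exp (s * g y)) \<partial>\<kappa>)"
      using probs_integrable[OF \<kappa> bdd_meas_exp[OF bdd_meas_cmult[OF g]]] by (intro nn_integral_eq_integral[symmetric]) auto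
    also have "\<dots> \<le> ennreal (exp (s\<^sup>2 * (r - - r)\<^sup>2 / 8))" by (rule Hoeffdings_lemma_nn_integral_0[OF s g0])
    also have "s\<^sup>2 * (r - - r)\<^sup>2 / 8 = s\<^sup>2 * r\<^sup>2 / 2" by (simp add: power2_eq_square)
    finally show ?thesis by simp
  qed
  have "(\<integral>y. exp (s * (f y - a)) \<partial>\<kappa>) \<le> exp (s\<^sup>2 * r\<^sup>2 / 2)"
  proof (cases s "0 :: real" rule: linorder_cases)
    case greater
    then show ?thesis by (intro pos centered_bdd centered_integral r)
  next
    case equal
    then show ?thesis using probs_const[OF \<kappa>, of 1] by simp
  next
    case less
    have "(\<integral>y. exp ((- s) * (- 1 * (f y - a))) \<partial>\<kappa>) \<le> exp ((- s)\<^sup>2 * r\<^sup>2 / 2)"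
    proof (intro pos bdd_meas_cmult centered_bdd)
      show "(\<integral>y. - 1 * (f y - a) \<partial>\<kappa>) = 0"
        by (simp only: integral_mult_right_zero centered_integral mult_zero_right)
      show "\<bar>- 1 * (f y - a)\<bar> \<le> r" if "y \<in> space E" for y
        using r[OF that] by (simp add: abs_minus_commute)
    qed (use less in simp)
    moreover have "(- s) * (- 1 * (f y - a)) = s * (f y - a)" for y by (simp add: algebra_simps)
    ultimately show ?thesis by (simp only: power2_minus)
  qed
  then show ?thesis using exp_centered_pos by (metis exp_le_cancel_iff exp_ln)
qed

text \<open>Write u for \<open>\<bar>s\<bar> * r\<close>. One u^3 is the Taylor error of the
  exponential; the other bounds the quadratic error of the logarithm, at most 2 u^4, using u at most
  1/2.\<close>

lemma cumulant_expansion: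
  assumes s: "\<bar>s\<bar> * r \<le> 1 / 2"
  shows "\<bar>ln (\<integral>y. exp (s * (f y - a)) \<partial>\<kappa>) - s\<^sup>2 * (\<integral>y. (f y - a) * (f y - a) \<partial>\<kappa>) / 2\<bar> \<le> 2 * (\<bar>s\<bar> * r) ^ 3"
proof -
  let ?v = "\<integral>y. (f y - a) * (f y - a) \<partial>\<kappa>" and ?u = "\<bar>s\<bar> * r"
  let ?p = "\<integral>y. exp (s * (f y - a)) \<partial>\<kappa>"
  have u0: "0 \<le> ?u" using r_nonneg by simp
  note L = bdd_functional_lincomb[OF probs_functional[OF \<kappa>]]
  have sqb: "(\<lambda>y. (f y - a) * (f y - a)) \<in> bdd_meas E" by (intro bdd_meas_mult centered_bdd)
  let ?q = "\<lambda>y. 1 * (1::real) + 1 * (s * (f y - a) + s\<^sup>2 / 2 * ((f y - a) * (f y - a)))"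
  have qb: "?q \<in> bdd_meas E" by (intro bdd_meas_lincomb bdd_meas_const centered_bdd sqb)
  have q: "(\<integral>y. ?q y \<partial>\<kappa>) = 1 + s\<^sup>2 * ?v / 2"
    unfolding L[OF bdd_meas_const bdd_meas_lincomb[OF centered_bdd sqb]] L[OF centered_bdd sqb]
      centered_integral probs_const[OF \<kappa>] by simp
  have "\<bar>\<integral>y. exp (s * (f y - a)) - ?q y \<partial>\<kappa>\<bar> \<le> ?u ^ 3"
  proof (rule probs_bound[OF \<kappa> bdd_meas_diff[OF exp_centered_bdd qb]])
    fix y assume "y \<in> space E"
    then have xu: "\<bar>s * (f y - a)\<bar> \<le> ?u" unfolding abs_mult using r by (intro mult_left_mono) auto
    have "\<bar>exp (s * (f y - a)) - ?q y\<bar> = \<bar>exp (s * (f y - a)) - (1 + s * (f y - a) + (s * (f y - a))\<^sup>2 / 2)\<bar>"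
      by (simp add: power2_eq_square mult_ac)
    also have "\<dots> \<le> \<bar>s * (f y - a)\<bar> ^ 3" using xu s by (intro exp_taylor2) linarith
    also have "\<dots> \<le> ?u ^ 3" using xu by (intro power_mono) auto
    finally show "\<bar>exp (s * (f y - a)) - ?q y\<bar> \<le> ?u ^ 3" .
  qed
  then have d: "\<bar>?p - (1 + s\<^sup>2 * ?v / 2)\<bar> \<le> ?u ^ 3"
    unfolding bdd_functional_diff[OF probs_functional[OF \<kappa>] exp_centered_bdd qb] q .
  have "\<bar>?v\<bar> \<le> r\<^sup>2"
  proof (rule probs_bound[OF \<kappa> sqb])
    fix y assume "y \<in> space E"
    from power_mono[OF r[OF this] abs_ge_zero, of 2]
    show "\<bar>(f y - a) * (f y - a)\<bar> \<le> r\<^sup>2" by (simp add: power2_eq_square abs_mult)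
  qed
  then have "s\<^sup>2 * \<bar>?v\<bar> \<le> s\<^sup>2 * r\<^sup>2" by (intro mult_left_mono) auto
  then have sv: "\<bar>s\<^sup>2 * ?v / 2\<bar> \<le> ?u\<^sup>2 / 2" by (simp add: abs_mult power_mult_distrib)
  have u3: "?u ^ 3 \<le> ?u\<^sup>2 / 2"
    using mult_right_mono[OF s zero_le_power2[of ?u]] by (simp add: power3_eq_cube power2_eq_square)
  have y1: "\<bar>?p - 1\<bar> \<le> ?u\<^sup>2" using d sv u3 by linarith
  have u2: "?u\<^sup>2 \<le> 1 / 4" using power_mono[OF s u0, of 2] by (simp add: power2_eq_square)
  have "\<bar>ln (1 + (?p - 1)) - (?p - 1)\<bar> \<le> 2 * (?p - 1)\<^sup>2"
    using y1 u2 by (intro abs_ln_one_plus_x_minus_x_bound) linarith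
  also have "(?p - 1)\<^sup>2 \<le> (?u\<^sup>2)\<^sup>2" using power_mono[OF y1 abs_ge_zero, of 2] by simp
  also have "(?u\<^sup>2)\<^sup>2 \<le> ?u ^ 3 / 2"
    using mult_right_mono[OF s zero_le_power[OF u0, of 3]]
    by (simp add: power3_eq_cube power2_eq_square mult_ac)
  finally have "\<bar>ln ?p - (?p - 1)\<bar> \<le> ?u ^ 3" by simp
  then show ?thesis using d by linarith
qed

end

section \<open>The particle system\<close>

locale particle_model = mf_model E K \<eta>0 D
  for E :: "nat \<Rightarrow> 'a measure" and K \<eta>0 D +
  fixes P :: "nat \<Rightarrow> 'w measure" and \<xi> :: "nat \<Rightarrow> nat \<Rightarrow> nat \<Rightarrow> 'w \<Rightarrow> 'a"
  assumes meas: "N \<ge> 1 \<Longrightarrow> i \<in> {1..N} \<Longrightarrow> A \<in> sets (E (Suc m)) \<Longrightarrow>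
        (\<lambda>x. measure (K (Suc m) (empirical (E m) N x) (x i)) A) \<in> borel_measurable (PiM {1..N} (\<lambda>_. E m))"
    and particles: "N \<ge> 1 \<Longrightarrow> particle_system E K \<eta>0 N (P N) (\<xi> N)"
begin

section \<open>Empirical measures, the past of the system and its transition kernels\<close>

lemma prob_P:
  assumes "N \<ge> 1"
  shows "prob_space (P N)"
  using particles[OF assms] unfolding particle_system_def by (elim conjE)

lemma xi_measurable:
  assumes "N \<ge> 1" "i \<in> {1..N}"
  shows "\<xi> N n i \<in> measurable (P N) (E n)"
  using particles[OF assms(1)] assms(2) unfolding particle_system_def by (elim conjE) simp

lemma xi_space: "N \<ge> 1 \<Longrightarrow> i \<in> {1..N} \<Longrightarrow> w \<in> space (P N) \<Longrightarrow> \<xi> N n i w \<in> space (E n)"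
  using measurable_space[OF xi_measurable] .

definition emp :: "nat \<Rightarrow> nat \<Rightarrow> 'w \<Rightarrow> 'a measure" where
  "emp N n w = emp_process E \<xi> N n w"

lemma empirical_probs:
  assumes N: "N \<ge> 1" and x: "\<And>i. i \<in> {1..N} \<Longrightarrow> x i \<in> space (E n)"
  shows "empirical (E n) N x \<in> probs (E n)"
    and "f \<in> bdd_meas (E n) \<Longrightarrow> (\<integral>y. f y \<partial>empirical (E n) N x) = (\<Sum>i=1..N. f (x i)) / real N"
proof -
  have ne: "{1..N} \<noteq> {}" using N by simp
  have m: "x \<in> measurable (uniform_count_measure {1..N}) (E n)"
    using x by (auto simp: measurable_def space_uniform_count_measure sets_uniform_count_measure)
  interpret u: prob_space "uniform_count_measure {1..N}" using ne by (intro prob_space_uniform_count_measure) auto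
  show "empirical (E n) N x \<in> probs (E n)"
    unfolding empirical_def space_prob_algebra using u.prob_space_distr[OF m] by simp
  assume f: "f \<in> bdd_meas (E n)"
  have "(\<integral>y. f y \<partial>empirical (E n) N x) = (\<integral>i. f (x i) \<partial>uniform_count_measure {1..N})"
    unfolding empirical_def by (rule integral_distr[OF m bdd_meas_measurable[OF f]])
  also have "\<dots> = (\<Sum>i=1..N. f (x i)) / real N"
    unfolding uniform_count_measure_def by (simp add: lebesgue_integral_point_measure_finite sum_divide_distrib)
  finally show "(\<integral>y. f y \<partial>empirical (E n) N x) = (\<Sum>i=1..N. f (x i)) / real N" .
qed

lemma emp_probs: "N \<ge> 1 \<Longrightarrow> w \<in> space (P N) \<Longrightarrow> emp N n w \<in> probs (E n)"
  unfolding emp_def emp_process_def by (intro empirical_probs(1) xi_space)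

lemma emp_integral:
  "N \<ge> 1 \<Longrightarrow> w \<in> space (P N) \<Longrightarrow> f \<in> bdd_meas (E n) \<Longrightarrow>
     (\<integral>y. f y \<partial>emp N n w) = (\<Sum>i=1..N. f (\<xi> N n i w)) / real N"
  unfolding emp_def emp_process_def by (intro empirical_probs(2) xi_space)

text \<open>Boundedness and measurability of functionals of the particles are needed both for the
  full \<sigma>-field and for that of the past; the predicate covers both at once.\<close>

definition carries :: "nat \<Rightarrow> nat \<Rightarrow> 'w measure \<Rightarrow> bool" where
  "carries N n M \<longleftrightarrow> space M = space (P N) \<and> (\<forall>m\<le>n. \<forall>i\<in>{1..N}. \<xi> N m i \<in> measurable M (E m))"

lemma carries_P: "N \<ge> 1 \<Longrightarrow> carries N n (P N)"
  unfolding carries_def using xi_measurable by blast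

lemma past_gen: "{\<xi> N k i -` A \<inter> space (P N) | k i A. k \<le> n \<and> i \<in> {1..N} \<and> A \<in> sets (E k)} \<subseteq> Pow (space (P N))"
  by auto

lemma space_past [simp]: "space (past E N (P N) (\<xi> N) n) = space (P N)"
  unfolding past_def by (rule space_measure_of[OF past_gen])

lemma carries_past: "N \<ge> 1 \<Longrightarrow> carries N n (past E N (P N) (\<xi> N) n)"
  unfolding carries_def
proof (intro conjI allI ballI impI)
  fix m i assume N: "N \<ge> 1" and m: "m \<le> n" and i: "i \<in> {1..N}"
  show "\<xi> N m i \<in> measurable (past E N (P N) (\<xi> N) n) (E m)"
  proof (rule measurableI)
    fix A assume A: "A \<in> sets (E m)"
    have "\<xi> N m i -` A \<inter> space (P N) \<in> sets (past E N (P N) (\<xi> N) n)"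
      unfolding past_def sets_measure_of[OF past_gen] using m i A by (intro sigma_sets.Basic) blast
    then show "\<xi> N m i -` A \<inter> space (past E N (P N) (\<xi> N) n) \<in> sets (past E N (P N) (\<xi> N) n)" by simp
  qed (use xi_space[OF N i] in simp)
qed simp

lemma carries_mono: "carries N n M \<Longrightarrow> m \<le> n \<Longrightarrow> carries N m M"
  unfolding carries_def by auto

lemma subalgebra_past: "N \<ge> 1 \<Longrightarrow> subalgebra (P N) (past E N (P N) (\<xi> N) n)"
  unfolding subalgebra_def
proof
  assume N: "N \<ge> 1"
  show "sets (past E N (P N) (\<xi> N) n) \<subseteq> sets (P N)"
    unfolding past_def sets_measure_of[OF past_gen]
    using measurable_sets[OF xi_measurable[OF N]] by (intro sets.sigma_sets_subset) blast
qed simp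

text \<open>The conditional law of particle \<open>i\<close> at time \<open>p\<close> given the
  past. The initial law is included as the case \<open>p = 0\<close>, so that time 0 is governed by
  the same one-step lemmas.\<close>

definition pk :: "nat \<Rightarrow> nat \<Rightarrow> nat \<Rightarrow> 'w \<Rightarrow> 'a measure" where
  "pk N p i w = (if p = 0 then \<eta>0 else K p (emp N (p - 1) w) (\<xi> N (p - 1) i w))"

lemma pk_kernel:
  assumes N: "N \<ge> 1" and M: "carries N (p - 1) M" and i: "i \<in> {1..N}"
  shows "markov_kernel M (E p) (pk N p i)"
proof (cases p)
  case 0
  then show ?thesis unfolding pk_def[abs_def] markov_kernel_def using init by (simp add: measurable_const)
next
  case (Suc m)
  have sp: "space M = space (P N)" and xm: "\<And>j. j \<in> {1..N} \<Longrightarrow> \<xi> N m j \<in> measurable M (E m)"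
    using M Suc unfolding carries_def by auto
  have kp: "K (Suc m) (emp N m w) (\<xi> N m i w) \<in> probs (E (Suc m))" if "w \<in> space M" for w
    using that sp measurable_space[OF markov[OF emp_probs[OF N]] xi_space[OF N i]] by simp
  have "(\<lambda>w. K (Suc m) (emp N m w) (\<xi> N m i w)) \<in> measurable M (prob_algebra (E (Suc m)))"
  proof (intro measurable_prob_algebraI measurable_subprob_algebra)
    fix w assume "w \<in> space M"
    note k = probsD[OF kp[OF this]]
    show "prob_space (K (Suc m) (emp N m w) (\<xi> N m i w))" by (rule k(1))
    then show "subprob_space (K (Suc m) (emp N m w) (\<xi> N m i w))" by (rule prob_space_imp_subprob_space)
    show "sets (K (Suc m) (emp N m w) (\<xi> N m i w)) = sets (E (Suc m))" by (rule k(2))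
  next
    fix A assume A: "A \<in> sets (E (Suc m))"
    \<comment> \<open>\<open>meas\<close> speaks of the product space over \<open>{1..N}\<close>.
      The empirical measure reads only these indices, so restricting the tuple changes
      nothing.\<close>
    let ?T = "\<lambda>w. \<lambda>j\<in>{1..N}. \<xi> N m j w"
    have T: "?T \<in> measurable M (PiM {1..N} (\<lambda>_. E m))" using xm by (rule measurable_restrict)
    have e: "empirical (E m) N (?T w) = emp N m w" for w
      unfolding empirical_def emp_def emp_process_def
      by (rule distr_cong) (auto simp: space_uniform_count_measure)
    have "(\<lambda>w. measure (K (Suc m) (empirical (E m) N (?T w)) (?T w i)) A) \<in> borel_measurable M"
      by (rule measurable_compose[OF T meas[OF N i A]])
    then have "(\<lambda>w. measure (K (Suc m) (emp N m w) (\<xi> N m i w)) A) \<in> borel_measurable M"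
      unfolding e using i by simp
    then have "(\<lambda>w. ennreal (measure (K (Suc m) (emp N m w) (\<xi> N m i w)) A)) \<in> borel_measurable M" by simp
    then show "(\<lambda>w. emeasure (K (Suc m) (emp N m w) (\<xi> N m i w)) A) \<in> borel_measurable M"
    proof (rule measurable_cong[THEN iffD1, rotated])
      fix w assume "w \<in> space M"
      from finite_measure.emeasure_eq_measure[OF prob_space.finite_measure[OF probsD(1)[OF kp[OF this]]]]
      show "ennreal (measure (K (Suc m) (emp N m w) (\<xi> N m i w)) A) = emeasure (K (Suc m) (emp N m w) (\<xi> N m i w)) A"
        by simp
    qed
  qed
  then show ?thesis unfolding markov_kernel_def pk_def[abs_def] Suc by simp
qed

lemma pk_probs: "N \<ge> 1 \<Longrightarrow> i \<in> {1..N} \<Longrightarrow> w \<in> space (P N) \<Longrightarrow> pk N p i w \<in> probs (E p)"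
  using markov_kernel.kx[OF pk_kernel[OF _ carries_P]] by blast

text \<open>Functions known before time \<open>p\<close>. Nothing precedes time 0, so there they are
  the constants.\<close>

definition pre :: "nat \<Rightarrow> nat \<Rightarrow> ('w \<Rightarrow> real) \<Rightarrow> bool" where
  "pre N p Y \<longleftrightarrow> (if p = 0 then \<exists>c. Y = (\<lambda>_. c) else Y \<in> bdd_meas (past E N (P N) (\<xi> N) (p - 1)))"

lemma bdd_past_P:
  assumes N: "N \<ge> 1" and "Y \<in> bdd_meas (past E N (P N) (\<xi> N) n)"
  shows "Y \<in> bdd_meas (P N)"
proof -
  obtain c where "\<And>x. x \<in> space (P N) \<Longrightarrow> \<bar>Y x\<bar> \<le> c" using assms(2) by (rule bdd_measE) auto
  moreover have "Y \<in> borel_measurable (P N)"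
    by (rule measurable_from_subalg[OF subalgebra_past[OF N] bdd_meas_measurable[OF assms(2)]])
  ultimately show ?thesis by (intro bdd_measI)
qed

lemma pre_bdd: "N \<ge> 1 \<Longrightarrow> pre N p Y \<Longrightarrow> Y \<in> bdd_meas (P N)"
  unfolding pre_def using bdd_past_P by (auto split: if_splits)

section \<open>Conditioning on the past, one particle factor at a time\<close>

lemma bdd_functional_eval:
  assumes N: "N \<ge> 1" and Z: "Z \<in> bdd_meas (P N)" and X: "X \<in> measurable (P N) F"
  shows "\<exists>C. bdd_functional F (\<lambda>g. \<integral>w. Z w * g (X w) \<partial>P N) C"
proof -
  interpret prob_space "P N" by (rule prob_P[OF N])
  obtain c where c: "c > 0" "\<And>x. x \<in> space (P N) \<Longrightarrow> \<bar>Z x\<bar> \<le> c" using Z by (rule bdd_measE) blast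
  have gX: "(\<lambda>w. g (X w)) \<in> bdd_meas (P N)" if g: "g \<in> bdd_meas F" for g
  proof -
    obtain d where d: "\<And>x. x \<in> space F \<Longrightarrow> \<bar>g x\<bar> \<le> d" using g by (rule bdd_measE) blast
    show ?thesis
      using measurable_compose[OF X bdd_meas_measurable[OF g]] d measurable_space[OF X] by (intro bdd_measI) auto
  qed
  show ?thesis
    unfolding bdd_functional_def
  proof (intro exI[of _ c] conjI ballI allI impI)
    fix g h a b assume g: "g \<in> bdd_meas F" and h: "h \<in> bdd_meas F"
    have "(\<integral>w. Z w * (a * g (X w) + b * h (X w)) \<partial>P N) = (\<integral>w. a * (Z w * g (X w)) + b * (Z w * h (X w)) \<partial>P N)"
      by (simp add: algebra_simps)
    also have "\<dots> = a * (\<integral>w. Z w * g (X w) \<partial>P N) + b * (\<integral>w. Z w * h (X w) \<partial>P N)"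
      using bdd_integrable[OF bdd_meas_mult[OF Z gX[OF g]]] bdd_integrable[OF bdd_meas_mult[OF Z gX[OF h]]] by simp
    finally show "(\<integral>w. Z w * (a * g (X w) + b * h (X w)) \<partial>P N) = \<dots>" .
  next
    fix g d assume g: "g \<in> bdd_meas F" and d: "\<forall>x\<in>space F. \<bar>g x\<bar> \<le> d"
    have "\<bar>\<integral>w. Z w * g (X w) \<partial>P N\<bar> \<le> measure (P N) (space (P N)) * (c * d)"
    proof (rule bdd_functional_bound[OF integral_bdd_functional[OF finite_measure_axioms refl]])
      show "(\<lambda>w. Z w * g (X w)) \<in> bdd_meas (P N)" by (intro bdd_meas_mult Z gX g)
      fix w assume w: "w \<in> space (P N)"
      show "\<bar>Z w * g (X w)\<bar> \<le> c * d"
        unfolding abs_mult using c d w measurable_space[OF X w] by (intro mult_mono) auto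
    qed
    then show "\<bar>\<integral>w. Z w * g (X w) \<partial>P N\<bar> \<le> c * d" by (simp add: prob_space)
  qed
qed

lemma bdd_functional_op:
  assumes N: "N \<ge> 1" and Z: "Z \<in> bdd_meas (P N)" and k: "markov_kernel (P N) F k"
  shows "\<exists>C. bdd_functional F (\<lambda>g. \<integral>w. Z w * (\<integral>y. g y \<partial>k w) \<partial>P N) C"
proof -
  interpret prob_space "P N" by (rule prob_P[OF N])
  interpret k: markov_kernel "P N" F k by (rule k)
  obtain c where c: "c > 0" "\<And>x. x \<in> space (P N) \<Longrightarrow> \<bar>Z x\<bar> \<le> c" using Z by (rule bdd_measE) blast
  show ?thesis
    unfolding bdd_functional_def k.op_def[symmetric]
  proof (intro exI[of _ c] conjI ballI allI impI)
    fix g h a b assume g: "g \<in> bdd_meas F" and h: "h \<in> bdd_meas F"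
    have "(\<integral>w. Z w * k.op (\<lambda>x. a * g x + b * h x) w \<partial>P N) = (\<integral>w. a * (Z w * k.op g w) + b * (Z w * k.op h w) \<partial>P N)"
      using k.op_lincomb[OF _ g h] by (intro Bochner_Integration.integral_cong) (auto simp: algebra_simps)
    also have "\<dots> = a * (\<integral>w. Z w * k.op g w \<partial>P N) + b * (\<integral>w. Z w * k.op h w \<partial>P N)"
      using bdd_integrable[OF bdd_meas_mult[OF Z k.op_bdd[OF g]]] bdd_integrable[OF bdd_meas_mult[OF Z k.op_bdd[OF h]]]
      by simp
    finally show "(\<integral>w. Z w * k.op (\<lambda>x. a * g x + b * h x) w \<partial>P N) = \<dots>" .
  next
    fix g d assume g: "g \<in> bdd_meas F" and d: "\<forall>x\<in>space F. \<bar>g x\<bar> \<le> d"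
    have "\<bar>\<integral>w. Z w * k.op g w \<partial>P N\<bar> \<le> measure (P N) (space (P N)) * (c * d)"
    proof (rule bdd_functional_bound[OF integral_bdd_functional[OF finite_measure_axioms refl]])
      show "(\<lambda>w. Z w * k.op g w) \<in> bdd_meas (P N)" by (intro bdd_meas_mult Z k.op_bdd g)
      fix w assume w: "w \<in> space (P N)"
      have "\<bar>k.op g w\<bar> \<le> d" using d w by (intro k.op_bound g) auto
      then show "\<bar>Z w * k.op g w\<bar> \<le> c * d"
        unfolding abs_mult using c w by (intro mult_mono) auto
    qed
    then show "\<bar>\<integral>w. Z w * k.op g w \<partial>P N\<bar> \<le> c * d" by (simp add: prob_space)
  qed
qed

lemma bdd_meas_prod: "finite I \<Longrightarrow> (\<And>i. i \<in> I \<Longrightarrow> f i \<in> bdd_meas M) \<Longrightarrow> (\<lambda>x. \<Prod>i\<in>I. f i x) \<in> bdd_meas M"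
  by (induction I rule: finite_induct) auto

lemma xi_bdd:
  assumes N: "N \<ge> 1" and i: "i \<in> {1..N}" and g: "g \<in> bdd_meas (E p)" and M: "carries N p M"
  shows "(\<lambda>w. g (\<xi> N p i w)) \<in> bdd_meas M"
proof -
  obtain d where d: "\<And>x. x \<in> space (E p) \<Longrightarrow> \<bar>g x\<bar> \<le> d" using g by (rule bdd_measE) blast
  have m: "\<xi> N p i \<in> measurable M (E p)" using M i unfolding carries_def by auto
  show ?thesis
    using measurable_compose[OF m bdd_meas_measurable[OF g]] d measurable_space[OF m] by (intro bdd_measI) auto
qed

lemma pk_bdd:
  assumes "N \<ge> 1" "i \<in> {1..N}" "g \<in> bdd_meas (E p)" "carries N (p - 1) M"
  shows "(\<lambda>w. \<integral>y. g y \<partial>pk N p i w) \<in> bdd_meas M"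
proof -
  interpret markov_kernel M "E p" "pk N p i" using assms(1,4,2) by (rule pk_kernel)
  show ?thesis using op_bdd[OF assms(3)] unfolding op_def[abs_def] .
qed

text \<open>The model prescribes conditional probabilities of rectangles only, which is the case of
  indicator factors. With all other factors frozen, both sides are bounded functionals of one
  factor, so the identity extends from sets to functions one index after another.\<close>

lemma cond_step:
  assumes N: "N \<ge> 1" and Y: "pre N p Y" and g: "\<And>i. i \<in> {1..N} \<Longrightarrow> g i \<in> bdd_meas (E p)"
  shows "(\<integral>w. Y w * (\<Prod>i=1..N. g i (\<xi> N p i w)) \<partial>P N) = (\<integral>w. Y w * (\<Prod>i=1..N. \<integral>y. g i y \<partial>pk N p i w) \<partial>P N)"
proof -
  interpret prob_space "P N" by (rule prob_P[OF N])
  note Yb = pre_bdd[OF N Y]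
  note ps = particles[OF N, unfolded particle_system_def]
  have base: "(\<integral>w. Y w * (\<Prod>i=1..N. indicator (A i) (\<xi> N p i w)) \<partial>P N)
      = (\<integral>w. Y w * (\<Prod>i=1..N. \<integral>y. indicator (A i) y \<partial>pk N p i w) \<partial>P N)"
    if A: "\<And>i. i \<in> {1..N} \<Longrightarrow> A i \<in> sets (E p)" for A
  proof (cases p)
    case 0
    then obtain c where c: "Y = (\<lambda>_. c)" using Y unfolding pre_def by auto
    have ind: "indep_vars (\<lambda>_. E 0) (\<xi> N 0) {1..N}" using ps by (elim conjE)
    have law: "distr (P N) (E 0) (\<xi> N 0 i) = \<eta>0" if "i \<in> {1..N}" for i using ps that by (elim conjE) simp
    have ib: "indicat_real (A i) \<in> borel_measurable (E 0)" if "i \<in> {1..N}" for i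
      using A[OF that] 0 by simp
    have "indep_vars (\<lambda>_. borel) (\<lambda>i. indicat_real (A i) \<circ> \<xi> N 0 i) {1..N}"
      by (rule indep_vars_compose[OF ind ib])
    then have ind': "indep_vars (\<lambda>_. borel) (\<lambda>i w. indicat_real (A i) (\<xi> N 0 i w)) {1..N}" by (simp add: o_def)
    have "(\<integral>w. (\<Prod>i\<in>{1..N}. indicator (A i) (\<xi> N 0 i w)) \<partial>P N) = (\<Prod>i\<in>{1..N}. \<integral>w. indicat_real (A i) (\<xi> N 0 i w) \<partial>P N)"
      using A 0 by (intro indep_vars_lebesgue_integral ind' bdd_integrable xi_bdd[OF N _ _ carries_P[OF N]]) auto
    also have "\<dots> = (\<Prod>i\<in>{1..N}. \<integral>y. indicator (A i) y \<partial>\<eta>0)"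
      using law xi_measurable[OF N] ib by (intro prod.cong refl) (metis integral_distr)
    finally show ?thesis unfolding c 0 pk_def using prob_space by simp
  next
    case (Suc m)
    let ?F = "past E N (P N) (\<xi> N) m"
    let ?S = "{w \<in> space (P N). \<forall>i\<in>{1..N}. \<xi> N p i w \<in> A i}"
    interpret sub: finite_measure_subalgebra "P N" ?F
      by unfold_locales (rule subalgebra_past[OF N])
    have YF: "Y \<in> bdd_meas ?F" using Y Suc unfolding pre_def by simp
    have Sm: "?S \<in> sets (P N)"
    proof -
      have "{w \<in> space (P N). \<xi> N p i w \<in> A i} \<in> sets (P N)" if "i \<in> {1..N}" for i
        using measurable_sets[OF xi_measurable[OF N that] A[OF that]] by (simp add: vimage_def Int_def conj_commute)
      then show ?thesis by (intro sets.sets_Collect_finite_All) auto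
    qed
    have prod_ind: "(\<Prod>i=1..N. indicator (A i) (\<xi> N p i w)) = indicat_real ?S w" if "w \<in> space (P N)" for w
      using that by (auto simp: indicator_def prod_zero_iff)
    have ae: "AE w in P N. real_cond_exp (P N) ?F (indicator ?S) w =
        (\<Prod>i\<in>{1..N}. measure (K (Suc m) (empirical (E m) N (\<lambda>j. \<xi> N m j w)) (\<xi> N m i w)) (A i))"
      using ps A unfolding Suc by (elim conjE) blast
    have "(\<integral>w. Y w * (\<Prod>i=1..N. indicator (A i) (\<xi> N p i w)) \<partial>P N) = (\<integral>w. Y w * indicat_real ?S w \<partial>P N)"
      using prod_ind by (intro Bochner_Integration.integral_cong) auto
    also have "\<dots> = (\<integral>w. Y w * real_cond_exp (P N) ?F (indicator ?S) w \<partial>P N)"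
      using Sm Yb bdd_meas_measurable[OF YF]
      by (intro sub.real_cond_exp_intg(2)[symmetric] bdd_integrable bdd_meas_mult bdd_meas_indicator) auto
    also have "\<dots> = (\<integral>w. Y w * (\<Prod>i=1..N. \<integral>y. indicator (A i) y \<partial>pk N p i w) \<partial>P N)"
    proof (rule integral_cong_AE)
      show "(\<lambda>w. Y w * real_cond_exp (P N) ?F (indicator ?S) w) \<in> borel_measurable (P N)"
        using bdd_meas_measurable[OF Yb] by simp
      show "(\<lambda>w. Y w * (\<Prod>i=1..N. \<integral>y. indicator (A i) y \<partial>pk N p i w)) \<in> borel_measurable (P N)"
        using A by (intro bdd_meas_measurable bdd_meas_mult Yb bdd_meas_prod pk_bdd[OF N _ _ carries_P[OF N]]) auto
      show "AE w in P N. Y w * real_cond_exp (P N) ?F (indicator ?S) w =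
          Y w * (\<Prod>i=1..N. \<integral>y. indicator (A i) y \<partial>pk N p i w)"
        using ae
      proof (rule AE_mp, intro AE_I2 impI)
        fix w assume w: "w \<in> space (P N)" and e: "real_cond_exp (P N) ?F (indicator ?S) w =
          (\<Prod>i\<in>{1..N}. measure (K (Suc m) (empirical (E m) N (\<lambda>j. \<xi> N m j w)) (\<xi> N m i w)) (A i))"
        have "(\<integral>y. indicator (A i) y \<partial>pk N p i w) = measure (K (Suc m) (empirical (E m) N (\<lambda>j. \<xi> N m j w)) (\<xi> N m i w)) (A i)"
          if i: "i \<in> {1..N}" for i
        proof -
          note k = probsD[OF pk_probs[OF N i w, of p]]
          have "A i \<inter> space (pk N p i w) = A i" using sets.sets_into_space[OF A[OF i]] k(3) by auto
          then show ?thesis using k A[OF i] unfolding pk_def emp_def emp_process_def Suc by simp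
        qed
        then show "Y w * real_cond_exp (P N) ?F (indicator ?S) w = Y w * (\<Prod>i=1..N. \<integral>y. indicator (A i) y \<partial>pk N p i w)"
          unfolding e by simp
      qed
    qed
    finally show ?thesis .
  qed
  \<comment> \<open>\<open>J\<close> collects the indices whose factor is already an arbitrary
    bounded function; the other factors are still indicators.\<close>
  have "J \<subseteq> {1..N} \<Longrightarrow> (\<And>i. i \<in> {1..N} \<Longrightarrow> g i \<in> bdd_meas (E p)) \<Longrightarrow>
      (\<And>i. i \<in> {1..N} - J \<Longrightarrow> \<exists>A\<in>sets (E p). g i = indicator A) \<Longrightarrow>
      (\<integral>w. Y w * (\<Prod>i=1..N. g i (\<xi> N p i w)) \<partial>P N) = (\<integral>w. Y w * (\<Prod>i=1..N. \<integral>y. g i y \<partial>pk N p i w) \<partial>P N)"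
    if "finite J" for J g
    using that
  proof (induction J arbitrary: g rule: finite_induct)
    case empty
    then have "\<forall>i\<in>{1..N}. \<exists>A. A \<in> sets (E p) \<and> g i = indicator A" by blast
    from bchoice[OF this] obtain A where A: "\<forall>i\<in>{1..N}. A i \<in> sets (E p) \<and> g i = indicator (A i)" ..
    then show ?case using base[of A] by simp
  next
    case (insert j J)
    have j: "j \<in> {1..N}" and J: "J \<subseteq> {1..N}" using insert by auto
    let ?Z1 = "\<lambda>w. Y w * (\<Prod>i\<in>{1..N} - {j}. g i (\<xi> N p i w))"
    let ?Z2 = "\<lambda>w. Y w * (\<Prod>i\<in>{1..N} - {j}. \<integral>y. g i y \<partial>pk N p i w)"
    have Z1: "?Z1 \<in> bdd_meas (P N)"
      using insert.prems by (intro bdd_meas_mult Yb bdd_meas_prod xi_bdd[OF N _ _ carries_P[OF N]]) auto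
    have Z2: "?Z2 \<in> bdd_meas (P N)"
      using insert.prems by (intro bdd_meas_mult Yb bdd_meas_prod pk_bdd[OF N _ _ carries_P[OF N]]) auto
    have s1: "Y w * (\<Prod>i=1..N. (g(j := u)) i (\<xi> N p i w)) = ?Z1 w * u (\<xi> N p j w)" for u w
      by (subst prod.remove[OF _ j]) (auto intro!: prod.cong simp: mult_ac)
    have s2: "Y w * (\<Prod>i=1..N. \<integral>y. (g(j := u)) i y \<partial>pk N p i w) = ?Z2 w * (\<integral>y. u y \<partial>pk N p j w)" for u w
      by (subst prod.remove[OF _ j]) (auto intro!: prod.cong simp: mult_ac)
    obtain C1 where b1: "bdd_functional (E p) (\<lambda>u. \<integral>w. ?Z1 w * u (\<xi> N p j w) \<partial>P N) C1"
      using bdd_functional_eval[OF N Z1 xi_measurable[OF N j]] by blast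
    obtain C2 where b2: "bdd_functional (E p) (\<lambda>u. \<integral>w. ?Z2 w * (\<integral>y. u y \<partial>pk N p j w) \<partial>P N) C2"
      using bdd_functional_op[OF N Z2 pk_kernel[OF N carries_P[OF N] j]] by blast
    have "(\<integral>w. ?Z1 w * g j (\<xi> N p j w) \<partial>P N) = (\<integral>w. ?Z2 w * (\<integral>y. g j y \<partial>pk N p j w) \<partial>P N)"
    proof (rule bdd_functional_unique[OF b1 b2])
      show "g j \<in> bdd_meas (E p)" by (rule insert.prems(2)[OF j])
      fix A assume A: "A \<in> sets (E p)"
      have "(\<integral>w. Y w * (\<Prod>i=1..N. (g(j := indicator A)) i (\<xi> N p i w)) \<partial>P N)
          = (\<integral>w. Y w * (\<Prod>i=1..N. \<integral>y. (g(j := indicator A)) i y \<partial>pk N p i w) \<partial>P N)"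
        using insert.prems A by (intro insert.IH[OF J]) auto
      then show "(\<integral>w. ?Z1 w * indicator A (\<xi> N p j w) \<partial>P N) = (\<integral>w. ?Z2 w * (\<integral>y. indicator A y \<partial>pk N p j w) \<partial>P N)"
        unfolding s1 s2 .
    qed
    then show ?case
      unfolding s1[of _ "g j", unfolded fun_upd_triv] s2[of _ "g j", unfolded fun_upd_triv] .
  qed
  from this[OF _ subset_refl g] show ?thesis by simp
qed

definition Vint :: "nat \<Rightarrow> nat \<Rightarrow> ('a \<Rightarrow> real) \<Rightarrow> 'w \<Rightarrow> real" where
  "Vint N p f w = (\<Sum>i=1..N. f (\<xi> N p i w) - (\<integral>y. f y \<partial>pk N p i w)) / sqrt (real N)"

text \<open>The conditional cumulant of the unnormalised centred sum over the particles: conditional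
  independence turns it into a sum over particles.\<close>

definition cgf :: "nat \<Rightarrow> nat \<Rightarrow> ('a \<Rightarrow> real) \<Rightarrow> real \<Rightarrow> 'w \<Rightarrow> real" where
  "cgf N p f s w = (\<Sum>i=1..N. ln (\<integral>y. exp (s * (f y - (\<integral>z. f z \<partial>pk N p i w))) \<partial>pk N p i w))"

lemma Vint_bdd:
  assumes N: "N \<ge> 1" and f: "f \<in> bdd_meas (E p)" and M: "carries N p M"
  shows "Vint N p f \<in> bdd_meas M"
proof -
  have M': "carries N (p - 1) M" using M by (rule carries_mono) simp
  have "(\<lambda>w. (1 / sqrt (real N)) * (\<Sum>i=1..N. f (\<xi> N p i w) - (\<integral>y. f y \<partial>pk N p i w))) \<in> bdd_meas M"
    by (intro bdd_meas_cmult bdd_meas_sum bdd_meas_diff xi_bdd[OF N _ f M] pk_bdd[OF N _ f M'])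
  then show ?thesis unfolding Vint_def[abs_def] by simp
qed

text \<open>The centring terms are functions of the past. They are moved into \<open>Y\<close>
  before \<open>cond_step\<close> is applied and returned to the integrals afterwards.\<close>

lemma exp_step:
  assumes N: "N \<ge> 1" and Y: "pre N p Y" and f: "f \<in> bdd_meas (E p)"
  shows "(\<integral>w. Y w * exp (s * (\<Sum>i=1..N. f (\<xi> N p i w) - (\<integral>y. f y \<partial>pk N p i w))) \<partial>P N)
    = (\<integral>w. Y w * exp (cgf N p f s w) \<partial>P N)"
proof -
  interpret prob_space "P N" by (rule prob_P[OF N])
  let ?m = "\<lambda>i w. \<integral>y. f y \<partial>pk N p i w"
  let ?Y = "\<lambda>w. Y w * exp (- s * (\<Sum>i=1..N. ?m i w))"
  have pY: "pre N p ?Y"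
  proof (cases "p = 0")
    case True
    then show ?thesis using Y unfolding pre_def pk_def by auto
  next
    case False
    then have "Y \<in> bdd_meas (past E N (P N) (\<xi> N) (p - 1))" using Y unfolding pre_def by simp
    then have "?Y \<in> bdd_meas (past E N (P N) (\<xi> N) (p - 1))"
      by (intro bdd_meas_mult bdd_meas_exp bdd_meas_cmult bdd_meas_sum pk_bdd[OF N _ f carries_past[OF N]])
    then show ?thesis using False unfolding pre_def by simp
  qed
  have "(\<integral>w. Y w * exp (s * (\<Sum>i=1..N. f (\<xi> N p i w) - ?m i w)) \<partial>P N)
      = (\<integral>w. ?Y w * (\<Prod>i=1..N. exp (s * f (\<xi> N p i w))) \<partial>P N)"
  proof -
    have "exp (s * (\<Sum>i=1..N. f (\<xi> N p i w) - ?m i w)) =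
        exp (- s * (\<Sum>i=1..N. ?m i w)) * (\<Prod>i=1..N. exp (s * f (\<xi> N p i w)))" for w
      unfolding exp_sum[OF finite_atLeastAtMost, symmetric] exp_add[symmetric]
      by (simp add: sum_subtractf right_diff_distrib sum_distrib_left sum_negf)
    then show ?thesis by (simp only: mult.assoc)
  qed
  also have "\<dots> = (\<integral>w. ?Y w * (\<Prod>i=1..N. \<integral>y. exp (s * f y) \<partial>pk N p i w) \<partial>P N)"
    using f by (intro cond_step[OF N pY] bdd_meas_exp bdd_meas_cmult)
  also have "\<dots> = (\<integral>w. Y w * exp (cgf N p f s w) \<partial>P N)"
  proof (intro Bochner_Integration.integral_cong refl)
    fix w assume w: "w \<in> space (P N)"
    have 1: "exp (- s * ?m i w) * (\<integral>y. exp (s * f y) \<partial>pk N p i w) = (\<integral>y. exp (s * (f y - ?m i w)) \<partial>pk N p i w)"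
      for i
    proof -
      have "(\<integral>y. exp (s * (f y - ?m i w)) \<partial>pk N p i w) = (\<integral>y. exp (- s * ?m i w) * exp (s * f y) \<partial>pk N p i w)"
        by (simp add: exp_add[symmetric] algebra_simps)
      then show ?thesis by simp
    qed
    have 2: "0 < (\<integral>y. exp (s * (f y - ?m i w)) \<partial>pk N p i w)" if "i \<in> {1..N}" for i
      using pk_probs[OF N that w] f
      by (intro prob_space.expectation_exp_pos[OF probsD(1)] probs_integrable bdd_meas_exp bdd_meas_cmult bdd_meas_diff bdd_meas_const)
    have "exp (cgf N p f s w) = (\<Prod>i=1..N. exp (- s * ?m i w) * (\<integral>y. exp (s * f y) \<partial>pk N p i w))"
      unfolding cgf_def exp_sum[OF finite_atLeastAtMost] 1 using 2 by (intro prod.cong) auto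
    also have "\<dots> = exp (- s * (\<Sum>i=1..N. ?m i w)) * (\<Prod>i=1..N. \<integral>y. exp (s * f y) \<partial>pk N p i w)"
      unfolding prod.distrib sum_distrib_left exp_sum[OF finite_atLeastAtMost] ..
    finally show "?Y w * (\<Prod>i=1..N. \<integral>y. exp (s * f y) \<partial>pk N p i w) = Y w * exp (cgf N p f s w)" by simp
  qed
  finally show ?thesis .
qed

lemma pk_dev:
  assumes "N \<ge> 1" "i \<in> {1..N}" "w \<in> space (P N)" "f \<in> bdd_meas (E p)" "y \<in> space (E p)"
  shows "\<bar>f y - (\<integral>z. f z \<partial>pk N p i w)\<bar> \<le> rosc (E p) f"
  using markov_kernel.op_dev[OF pk_kernel[OF assms(1) carries_P[OF assms(1)] assms(2)] assms(4,3,5)]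
  unfolding markov_kernel.op_def[OF pk_kernel[OF assms(1) carries_P[OF assms(1)] assms(2)]] .

lemma cgf_hoeffding:
  assumes N: "N \<ge> 1" and w: "w \<in> space (P N)" and f: "f \<in> bdd_meas (E p)"
  shows "cgf N p f s w \<le> real N * (s\<^sup>2 * (rosc (E p) f)\<^sup>2 / 2)"
proof -
  have "cgf N p f s w \<le> (\<Sum>i=1..N. s\<^sup>2 * (rosc (E p) f)\<^sup>2 / 2)"
    unfolding cgf_def
    by (intro sum_mono hoeffding_cumulant[OF pk_probs[OF N _ w] f refl] pk_dev[OF N _ w f])
  then show ?thesis by simp
qed

definition cvar :: "nat \<Rightarrow> nat \<Rightarrow> ('a \<Rightarrow> real) \<Rightarrow> 'w \<Rightarrow> real" where
  "cvar N p f w = (\<Sum>i=1..N. \<integral>y. (f y - (\<integral>z. f z \<partial>pk N p i w)) * (f y - (\<integral>z. f z \<partial>pk N p i w)) \<partial>pk N p i w) / real N"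

lemma cgf_expansion:
  assumes N: "N \<ge> 1" and w: "w \<in> space (P N)" and f: "f \<in> bdd_meas (E p)" and s: "\<bar>s\<bar> * rosc (E p) f \<le> 1 / 2"
  shows "\<bar>cgf N p f s w - real N * s\<^sup>2 * cvar N p f w / 2\<bar> \<le> real N * (2 * (\<bar>s\<bar> * rosc (E p) f) ^ 3)"
proof -
  let ?v = "\<lambda>i. \<integral>y. (f y - (\<integral>z. f z \<partial>pk N p i w)) * (f y - (\<integral>z. f z \<partial>pk N p i w)) \<partial>pk N p i w"
  let ?l = "\<lambda>i. ln (\<integral>y. exp (s * (f y - (\<integral>z. f z \<partial>pk N p i w))) \<partial>pk N p i w)"
  have "real N * s\<^sup>2 * cvar N p f w / 2 = (\<Sum>i=1..N. s\<^sup>2 * ?v i / 2)"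
    unfolding cvar_def using N by (simp add: sum_distrib_left sum_divide_distrib)
  then have eq: "cgf N p f s w - real N * s\<^sup>2 * cvar N p f w / 2 = (\<Sum>i=1..N. ?l i - s\<^sup>2 * ?v i / 2)"
    unfolding cgf_def by (simp add: sum_subtractf)
  have "\<bar>cgf N p f s w - real N * s\<^sup>2 * cvar N p f w / 2\<bar> \<le> (\<Sum>i=1..N. \<bar>?l i - s\<^sup>2 * ?v i / 2\<bar>)"
    unfolding eq by (rule sum_abs)
  also have "\<dots> \<le> (\<Sum>i=1..N. 2 * (\<bar>s\<bar> * rosc (E p) f) ^ 3)"
  proof (rule sum_mono)
    fix i assume i: "i \<in> {1..N}"
    show "\<bar>?l i - s\<^sup>2 * ?v i / 2\<bar> \<le> 2 * (\<bar>s\<bar> * rosc (E p) f) ^ 3"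
      by (rule cumulant_expansion[OF pk_probs[OF N i w] f refl pk_dev[OF N i w f] s])
  qed
  finally show ?thesis by simp
qed

end

text \<open>Measurability of partial integrals calls for a \<sigma>-finite measure, which
  \<open>R\<close> need not be. With density \<open>q\<close> it becomes finite, and the integrand
  is divided by \<open>q\<close> in exchange.\<close>

lemma mixture_measurable:
  fixes R :: "'g measure" and q :: "'g \<Rightarrow> ennreal"
  assumes h: "h \<in> borel_measurable (M \<Otimes>\<^sub>M R)"
    and q: "q \<in> borel_measurable R" and qfin: "\<And>g. g \<in> space R \<Longrightarrow> q g < \<infinity>"
    and m: "(\<integral>\<^sup>+g. q g \<partial>R) \<le> ennreal m"
    and hq: "\<And>w g. w \<in> space M \<Longrightarrow> g \<in> space R \<Longrightarrow> \<bar>h (w, g)\<bar> \<le> c * enn2real (q g)"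
  shows "(\<lambda>w. enn2real (\<integral>\<^sup>+g. ennreal \<bar>h (w, g)\<bar> \<partial>R)) \<in> borel_measurable M"
proof -
  define \<rho> where "\<rho> = density R q"
  have [simp]: "sets \<rho> = sets R" "space \<rho> = space R" unfolding \<rho>_def by simp_all
  have "emeasure \<rho> (space \<rho>) = (\<integral>\<^sup>+g. q g \<partial>R)"
    unfolding \<rho>_def using q by (simp add: emeasure_density cong: nn_integral_cong)
  then have "emeasure \<rho> (space \<rho>) \<noteq> \<infinity>"
    using le_less_trans[OF m ennreal_less_top] by simp
  then interpret finite_measure \<rho> by (rule finite_measureI)
  let ?k = "\<lambda>(w, g). ennreal (\<bar>h (w, g)\<bar> / enn2real (q g))"
  have "?k \<in> borel_measurable (M \<Otimes>\<^sub>M R)" using h q by measurable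
  moreover have "sets (M \<Otimes>\<^sub>M \<rho>) = sets (M \<Otimes>\<^sub>M R)" by (rule sets_pair_measure_cong) simp_all
  ultimately have km: "?k \<in> borel_measurable (M \<Otimes>\<^sub>M \<rho>)" using measurable_cong_sets by blast
  have "(\<lambda>w. \<integral>\<^sup>+g. ?k (w, g) \<partial>\<rho>) \<in> borel_measurable M"
    using borel_measurable_nn_integral_fst[OF km] by simp
  then have "(\<lambda>w. enn2real (\<integral>\<^sup>+g. ?k (w, g) \<partial>\<rho>)) \<in> borel_measurable M" by measurable
  moreover have "(\<integral>\<^sup>+g. ?k (w, g) \<partial>\<rho>) = (\<integral>\<^sup>+g. ennreal \<bar>h (w, g)\<bar> \<partial>R)" if w: "w \<in> space M" for w
  proof -
    have hm: "(\<lambda>g. h (w, g)) \<in> borel_measurable R"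
      using measurable_compose[OF measurable_Pair1'[OF w] h] .
    have "(\<integral>\<^sup>+g. ?k (w, g) \<partial>\<rho>) = (\<integral>\<^sup>+g. q g * ?k (w, g) \<partial>R)"
      unfolding \<rho>_def using hm q by (intro nn_integral_density) auto
    also have "\<dots> = (\<integral>\<^sup>+g. ennreal \<bar>h (w, g)\<bar> \<partial>R)"
    proof (rule nn_integral_cong)
      fix g assume g: "g \<in> space R"
      define u where "u = enn2real (q g)"
      have u: "q g = ennreal u" "0 \<le> u" unfolding u_def using qfin[OF g] by simp_all
      have "\<bar>h (w, g)\<bar> = u * (\<bar>h (w, g)\<bar> / u)"
        using hq[OF w g] u(2) unfolding u_def[symmetric] by (cases "u = 0") auto
      then have "ennreal \<bar>h (w, g)\<bar> = ennreal (u * (\<bar>h (w, g)\<bar> / u))" by simp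
      also have "\<dots> = ennreal u * ennreal (\<bar>h (w, g)\<bar> / u)" using u by (intro ennreal_mult) auto
      finally show "q g * ?k (w, g) = ennreal \<bar>h (w, g)\<bar>" unfolding u_def[symmetric] using u by simp
    qed
    finally show ?thesis .
  qed
  ultimately show ?thesis by (subst measurable_cong[symmetric]) auto
qed

text \<open>A single constant serves as prefactor and in the exponent, so that multiples, sums and
  mixtures need only one number to be tracked.\<close>

definition subg :: "'w measure \<Rightarrow> real \<Rightarrow> ('w \<Rightarrow> real) \<Rightarrow> bool" where
  "subg M C U \<longleftrightarrow> U \<in> bdd_meas M \<and> (\<forall>t\<ge>0. (\<integral>\<^sup>+w. ennreal (exp (t * \<bar>U w\<bar>)) \<partial>M) \<le> ennreal (C * exp (C * t\<^sup>2)))"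

lemma subgD: "subg M C U \<Longrightarrow> t \<ge> 0 \<Longrightarrow> (\<integral>\<^sup>+w. ennreal (exp (t * \<bar>U w\<bar>)) \<partial>M) \<le> ennreal (C * exp (C * t\<^sup>2))"
  unfolding subg_def by blast

lemma subg_bdd: "subg M C U \<Longrightarrow> U \<in> bdd_meas M"
  unfolding subg_def by blast

lemma subg_scale:
  assumes U: "subg M C U" and C: "C \<ge> 1" and V: "V \<in> bdd_meas M" and b: "b \<ge> 0"
    and le: "\<And>w. w \<in> space M \<Longrightarrow> \<bar>V w\<bar> \<le> b * \<bar>U w\<bar>" and C': "C * (1 + b\<^sup>2) \<le> C'"
  shows "subg M C' V"
  unfolding subg_def
proof (intro conjI allI impI V)
  fix t :: real assume t: "t \<ge> 0"
  have CC: "C \<le> C'" "C * b\<^sup>2 \<le> C'"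
  proof -
    have "0 \<le> C * b\<^sup>2" using C by simp
    then show "C \<le> C'" using C' by (simp add: distrib_left)
    show "C * b\<^sup>2 \<le> C'" using C' C by (simp add: distrib_left)
  qed
  have "(\<integral>\<^sup>+w. ennreal (exp (t * \<bar>V w\<bar>)) \<partial>M) \<le> (\<integral>\<^sup>+w. ennreal (exp ((t * b) * \<bar>U w\<bar>)) \<partial>M)"
    using mult_left_mono[OF le t] by (intro nn_integral_mono ennreal_leI) (simp add: mult.assoc)
  also have "\<dots> \<le> ennreal (C * exp (C * (t * b)\<^sup>2))" using t b by (intro subgD[OF U]) simp
  also have "\<dots> \<le> ennreal (C' * exp (C' * t\<^sup>2))"
  proof (intro ennreal_leI mult_mono CC)
    have "(C * b\<^sup>2) * t\<^sup>2 \<le> C' * t\<^sup>2" using CC(2) by (intro mult_right_mono) auto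
    then show "exp (C * (t * b)\<^sup>2) \<le> exp (C' * t\<^sup>2)" by (simp add: power_mult_distrib mult_ac)
  qed (use C CC in auto)
  finally show "(\<integral>\<^sup>+w. ennreal (exp (t * \<bar>V w\<bar>)) \<partial>M) \<le> ennreal (C' * exp (C' * t\<^sup>2))" .
qed

lemma subg_add:
  assumes U: "subg M C U" and V: "subg M C' V" and C: "C \<ge> 1" "C' \<ge> 1" and W: "W \<in> bdd_meas M"
    and le: "\<And>w. w \<in> space M \<Longrightarrow> \<bar>W w\<bar> \<le> \<bar>U w\<bar> + \<bar>V w\<bar>"
  shows "subg M (4 * (C + C')) W"
  unfolding subg_def
proof (intro conjI allI impI W)
  fix t :: real assume t: "t \<ge> 0"
  let ?D = "4 * (C + C')"
  note [measurable] = subg_bdd[OF U, THEN bdd_meas_measurable] subg_bdd[OF V, THEN bdd_meas_measurable]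
  have "(\<integral>\<^sup>+w. ennreal (exp (t * \<bar>W w\<bar>)) \<partial>M)
      \<le> (\<integral>\<^sup>+w. ennreal (exp ((2 * t) * \<bar>U w\<bar>)) + ennreal (exp ((2 * t) * \<bar>V w\<bar>)) \<partial>M)"
  proof (rule nn_integral_mono)
    fix w assume "w \<in> space M"
    from mult_left_mono[OF le[OF this] t] have 1: "t * \<bar>W w\<bar> \<le> t * \<bar>U w\<bar> + t * \<bar>V w\<bar>" by (simp add: distrib_left)
    have "exp (t * \<bar>W w\<bar>) \<le> exp ((2 * t) * \<bar>U w\<bar>) + exp ((2 * t) * \<bar>V w\<bar>)"
    proof (cases "t * \<bar>U w\<bar> \<le> t * \<bar>V w\<bar>")
      case True
      then have "exp (t * \<bar>W w\<bar>) \<le> exp ((2 * t) * \<bar>V w\<bar>)" using 1 by simp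
      then show ?thesis by (rule order_trans) simp
    next
      case False
      then have "exp (t * \<bar>W w\<bar>) \<le> exp ((2 * t) * \<bar>U w\<bar>)" using 1 by simp
      then show ?thesis by (rule order_trans) simp
    qed
    then show "ennreal (exp (t * \<bar>W w\<bar>)) \<le> ennreal (exp ((2 * t) * \<bar>U w\<bar>)) + ennreal (exp ((2 * t) * \<bar>V w\<bar>))"
      by (simp add: ennreal_plus[symmetric] del: ennreal_plus)
  qed
  also have "\<dots> = (\<integral>\<^sup>+w. ennreal (exp ((2 * t) * \<bar>U w\<bar>)) \<partial>M) + (\<integral>\<^sup>+w. ennreal (exp ((2 * t) * \<bar>V w\<bar>)) \<partial>M)"
    by (intro nn_integral_add; measurable)
  also have "\<dots> \<le> ennreal (C * exp (C * (2 * t)\<^sup>2)) + ennreal (C' * exp (C' * (2 * t)\<^sup>2))"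
    using t by (intro add_mono subgD[OF U] subgD[OF V]) auto
  also have "\<dots> = ennreal (C * exp (C * (2 * t)\<^sup>2) + C' * exp (C' * (2 * t)\<^sup>2))"
    using C by (simp add: ennreal_plus[symmetric] del: ennreal_plus)
  also have "\<dots> \<le> ennreal (?D * exp (?D * t\<^sup>2))"
  proof (rule ennreal_leI)
    have "C * exp (C * (2 * t)\<^sup>2) \<le> C * exp (?D * t\<^sup>2)"
      using C by (intro mult_left_mono) (auto simp: power2_eq_square algebra_simps intro!: mult_right_mono)
    moreover have "C' * exp (C' * (2 * t)\<^sup>2) \<le> C' * exp (?D * t\<^sup>2)"
      using C by (intro mult_left_mono) (auto simp: power2_eq_square algebra_simps intro!: mult_right_mono)
    ultimately have "C * exp (C * (2 * t)\<^sup>2) + C' * exp (C' * (2 * t)\<^sup>2) \<le> (C + C') * exp (?D * t\<^sup>2)"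
      by (simp add: distrib_right)
    also have "\<dots> \<le> ?D * exp (?D * t\<^sup>2)" using C by (intro mult_right_mono) auto
    finally show "C * exp (C * (2 * t)\<^sup>2) + C' * exp (C' * (2 * t)\<^sup>2) \<le> ?D * exp (?D * t\<^sup>2)" .
  qed
  finally show "(\<integral>\<^sup>+w. ennreal (exp (t * \<bar>W w\<bar>)) \<partial>M) \<le> ennreal (?D * exp (?D * t\<^sup>2))" .
qed

text \<open>The integrand is compared with \<open>u g\<close> after division by the weight, so that
  one constant \<open>C\<close> has to serve all the normalised fields. The total weight then enters
  only through \<open>m\<^sup>2\<close>.\<close>

lemma mixture_subg:
  fixes R :: "'g measure" and q :: "'g \<Rightarrow> ennreal"
  assumes M: "prob_space M" and h: "h \<in> borel_measurable (M \<Otimes>\<^sub>M R)"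
    and q: "q \<in> borel_measurable R" and qfin: "\<And>g. g \<in> space R \<Longrightarrow> q g < \<infinity>"
    and m: "(\<integral>\<^sup>+g. q g \<partial>R) \<le> ennreal m" "0 \<le> m" and c: "c \<ge> 0"
    and hq: "\<And>w g. w \<in> space M \<Longrightarrow> g \<in> space R \<Longrightarrow> \<bar>h (w, g)\<bar> \<le> c * enn2real (q g)"
    and C: "C \<ge> 1" and u: "\<And>g. g \<in> space R \<Longrightarrow> 0 < q g \<Longrightarrow> subg M C (u g)"
    and hu: "\<And>w g. w \<in> space M \<Longrightarrow> g \<in> space R \<Longrightarrow> 0 < q g \<Longrightarrow> \<bar>h (w, g)\<bar> / enn2real (q g) \<le> \<bar>u g w\<bar>"
  shows "subg M (C * (1 + m\<^sup>2)) (\<lambda>w. enn2real (\<integral>\<^sup>+g. ennreal \<bar>h (w, g)\<bar> \<partial>R))"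
  unfolding subg_def
proof (intro conjI allI impI)
  let ?U = "\<lambda>w. enn2real (\<integral>\<^sup>+g. ennreal \<bar>h (w, g)\<bar> \<partial>R)"
  show "?U \<in> bdd_meas M"
  proof (rule bdd_measI[OF mixture_measurable[OF h q qfin m(1) hq]])
    fix w assume w: "w \<in> space M"
    have "(\<integral>\<^sup>+g. ennreal \<bar>h (w, g)\<bar> \<partial>R) \<le> ennreal (c * m)"
      by (rule mixture_bound[OF q qfin m c hq[OF w]])
    then show "\<bar>?U w\<bar> \<le> c * m" using c m by (simp add: enn2real_leI)
  qed
  fix t :: real assume t: "t \<ge> 0"
  let ?B = "C * exp (C * (t * m)\<^sup>2)"
  have B: "1 \<le> ?B" using C mult_mono[of 1 C 1 "exp (C * (t * m)\<^sup>2)"] by simp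
  have "(\<integral>\<^sup>+w. ennreal (exp (t * ?U w)) \<partial>M) \<le> ennreal ?B"
  proof (rule mixture_exp_bound[OF M h q qfin m c hq t B])
    fix g assume g: "g \<in> space R" "0 < q g"
    have "(\<integral>\<^sup>+w. ennreal (exp (t * m * (\<bar>h (w, g)\<bar> / enn2real (q g)))) \<partial>M)
        \<le> (\<integral>\<^sup>+w. ennreal (exp (t * m * \<bar>u g w\<bar>)) \<partial>M)"
    proof (intro nn_integral_mono ennreal_leI)
      fix w assume w: "w \<in> space M"
      have "t * m * (\<bar>h (w, g)\<bar> / enn2real (q g)) \<le> t * m * \<bar>u g w\<bar>"
        using hu[OF w g] t m by (intro mult_left_mono) auto
      then show "exp (t * m * (\<bar>h (w, g)\<bar> / enn2real (q g))) \<le> exp (t * m * \<bar>u g w\<bar>)" by simp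
    qed
    also have "\<dots> \<le> ennreal ?B" using t m by (intro subgD[OF u[OF g]]) simp
    finally show "(\<integral>\<^sup>+w. ennreal (exp (t * m * (\<bar>h (w, g)\<bar> / enn2real (q g)))) \<partial>M) \<le> ennreal ?B" .
  qed
  also have "\<dots> \<le> ennreal (C * (1 + m\<^sup>2) * exp (C * (1 + m\<^sup>2) * t\<^sup>2))"
  proof (intro ennreal_leI mult_mono)
    show "C \<le> C * (1 + m\<^sup>2)" using C by (simp add: distrib_left)
    have "(C * m\<^sup>2) * t\<^sup>2 \<le> (C * (1 + m\<^sup>2)) * t\<^sup>2" using C by (intro mult_right_mono mult_left_mono) auto
    then show "exp (C * (t * m)\<^sup>2) \<le> exp (C * (1 + m\<^sup>2) * t\<^sup>2)" by (simp add: power_mult_distrib mult_ac)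
  qed (use C in auto)
  finally show "(\<integral>\<^sup>+w. ennreal (exp (t * \<bar>?U w\<bar>)) \<partial>M) \<le> ennreal (C * (1 + m\<^sup>2) * exp (C * (1 + m\<^sup>2) * t\<^sup>2))"
    by simp
qed

lemma bdd_meas_cong:
  assumes f: "f \<in> bdd_meas E" and eq: "\<And>x. x \<in> space E \<Longrightarrow> g x = f x"
  shows "g \<in> bdd_meas E"
proof -
  obtain c where c: "\<And>x. x \<in> space E \<Longrightarrow> \<bar>f x\<bar> \<le> c" using f by (rule bdd_measE) blast
  show ?thesis
  proof (rule bdd_measI[where c = c])
    show "g \<in> borel_measurable E" using bdd_meas_measurable[OF f] by (subst measurable_cong[OF eq])
  qed (use eq c in simp)
qed

lemma diff_int_bound:
  assumes "\<mu> \<in> probs E" "\<rho> \<in> probs E" "f \<in> bdd_meas E"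
  shows "\<bar>diff_int \<mu> \<rho> f\<bar> \<le> rosc E f"
proof -
  obtain x0 where x0: "x0 \<in> space E" using probs_nonempty[OF assms(1)] by blast
  have e: "(\<integral>x. f x \<partial>\<mu>) - a = (\<integral>x. f x - a \<partial>\<mu>)" if "\<mu> \<in> probs E" for \<mu> a
    using bdd_functional_diff[OF probs_functional[OF that] assms(3) bdd_meas_const, of a] probs_const[OF that] by simp
  have r: "\<bar>f x - (\<integral>y. f y \<partial>\<rho>)\<bar> \<le> rosc E f" if x: "x \<in> space E" for x
  proof -
    have "(\<integral>y. f y \<partial>\<rho>) - f x = (\<integral>y. f y - f x \<partial>\<rho>)" by (rule e[OF assms(2)])
    also have "\<bar>\<dots>\<bar> \<le> rosc E f"
      using rosc_bound[OF assms(3) _ x] assms by (intro probs_bound bdd_meas_diff bdd_meas_const)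
    finally show ?thesis by (simp add: abs_minus_commute)
  qed
  have "diff_int \<mu> \<rho> f = (\<integral>x. f x - (\<integral>y. f y \<partial>\<rho>) \<partial>\<mu>)" unfolding diff_int_def by (rule e[OF assms(1)])
  then show ?thesis using r assms by (simp add: probs_bound bdd_meas_diff)
qed

lemma diff_int_lincomb:
  assumes "\<mu> \<in> probs E" "\<rho> \<in> probs E" "f \<in> bdd_meas E" "g \<in> bdd_meas E"
  shows "diff_int \<mu> \<rho> (\<lambda>x. a * f x + b * g x) = a * diff_int \<mu> \<rho> f + b * diff_int \<mu> \<rho> g"
  unfolding diff_int_def bdd_functional_lincomb[OF probs_functional[OF assms(1)] assms(3,4)]
    bdd_functional_lincomb[OF probs_functional[OF assms(2)] assms(3,4)] by (simp add: algebra_simps)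

lemma diff_int_cmult:
  assumes "\<mu> \<in> probs E" "\<rho> \<in> probs E" "f \<in> bdd_meas E"
  shows "diff_int \<mu> \<rho> (\<lambda>x. a * f x) = a * diff_int \<mu> \<rho> f"
  using diff_int_lincomb[OF assms(1,2,3,3), of a 0] by simp

lemma Osc1_normalize:
  assumes f: "f \<in> bdd_meas E" and r: "rosc E f \<le> r" "r > 0"
  shows "(\<lambda>x. (1 / r) * f x) \<in> Osc1 E"
proof (rule Osc1I)
  show "(\<lambda>x. (1 / r) * f x) \<in> bdd_meas E" using f by blast
  have "rosc E (\<lambda>x. (1 / r) * f x) \<le> \<bar>1 / r\<bar> * rosc E f" by (rule rosc_cmult[OF f])
  also have "\<dots> \<le> 1" using r by simp
  finally show "rosc E (\<lambda>x. (1 / r) * f x) \<le> 1" .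
qed

section \<open>Subgaussian bounds for the particle fields\<close>

context particle_model
begin

definition Wd :: "nat \<Rightarrow> nat \<Rightarrow> ('a \<Rightarrow> real) \<Rightarrow> 'w \<Rightarrow> real" where
  "Wd N n g w = sqrt (real N) * diff_int (emp N n w) (\<eta> n) g"

lemma emp_bdd: "N \<ge> 1 \<Longrightarrow> g \<in> bdd_meas (E n) \<Longrightarrow> (\<lambda>w. \<integral>y. g y \<partial>emp N n w) \<in> bdd_meas (P N)"
proof -
  assume N: "N \<ge> 1" and g: "g \<in> bdd_meas (E n)"
  have b: "(\<lambda>w. (1 / real N) * (\<Sum>i=1..N. g (\<xi> N n i w))) \<in> bdd_meas (P N)"
    by (intro bdd_meas_cmult bdd_meas_sum xi_bdd[OF N _ g carries_P[OF N]])
  show ?thesis by (rule bdd_meas_cong[OF b]) (simp add: emp_integral[OF N _ g])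
qed

lemma Wd_bdd: "N \<ge> 1 \<Longrightarrow> g \<in> bdd_meas (E n) \<Longrightarrow> Wd N n g \<in> bdd_meas (P N)"
  unfolding Wd_def[abs_def] diff_int_def by (intro bdd_meas_cmult bdd_meas_diff emp_bdd bdd_meas_const)

lemma Phi_integral:
  assumes \<rho>: "\<rho> \<in> probs (E m)" and f: "f \<in> bdd_meas (E (Suc m))"
  shows "(\<integral>y. f y \<partial>Phi K (Suc m) \<rho>) = (\<integral>x. (\<integral>y. f y \<partial>K (Suc m) \<rho> x) \<partial>\<rho>)"
proof -
  interpret k: markov_kernel "E m" "E (Suc m)" "K (Suc m) \<rho>" using markov[OF \<rho>] by (rule markov_kernel.intro)
  have bf: "bdd_functional (E (Suc m)) (\<lambda>f. \<integral>x. k.op f x \<partial>\<rho>) 1"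
    unfolding bdd_functional_def
  proof (intro conjI ballI allI impI)
    fix f g a b assume f: "f \<in> bdd_meas (E (Suc m))" and g: "g \<in> bdd_meas (E (Suc m))"
    have "(\<integral>x. k.op (\<lambda>y. a * f y + b * g y) x \<partial>\<rho>) = (\<integral>x. a * k.op f x + b * k.op g x \<partial>\<rho>)"
      using k.op_lincomb[OF _ f g] probsD(3)[OF \<rho>] by (intro Bochner_Integration.integral_cong) auto
    then show "(\<integral>x. k.op (\<lambda>y. a * f y + b * g y) x \<partial>\<rho>) = a * (\<integral>x. k.op f x \<partial>\<rho>) + b * (\<integral>x. k.op g x \<partial>\<rho>)"
      using bdd_functional_lincomb[OF probs_functional[OF \<rho>] k.op_bdd[OF f] k.op_bdd[OF g]] by simp
  next
    fix f c assume f: "f \<in> bdd_meas (E (Suc m))" and c: "\<forall>x\<in>space (E (Suc m)). \<bar>f x\<bar> \<le> c"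
    have "\<bar>\<integral>x. k.op f x \<partial>\<rho>\<bar> \<le> c" using c by (intro probs_bound[OF \<rho>] k.op_bdd f k.op_bound[OF f]) auto
    then show "\<bar>\<integral>x. k.op f x \<partial>\<rho>\<bar> \<le> 1 * c" by simp
  qed
  interpret sub: subprob_space \<rho> using probsD(1)[OF \<rho>] by (rule prob_space_imp_subprob_space)
  have kM: "K (Suc m) \<rho> \<in> measurable \<rho> (subprob_algebra (E (Suc m)))"
    using measurable_prob_algebraD[OF markov[OF \<rho>]] measurable_cong_sets[OF probsD(2)[OF \<rho>] refl] by blast
  have "(\<integral>y. f y \<partial>Phi K (Suc m) \<rho>) = (\<integral>x. k.op f x \<partial>\<rho>)"
  proof (rule bdd_functional_unique[OF probs_functional[OF Phi_probs[OF \<rho>]] bf _ f])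
    fix A assume A: "A \<in> sets (E (Suc m))"
    note p = probsD[OF Phi_probs[OF \<rho>]]
    have AI: "A \<inter> space (E (Suc m)) = A" using sets.sets_into_space[OF A] by auto
    have "(\<integral>y. indicator A y \<partial>Phi K (Suc m) \<rho>) = measure (Phi K (Suc m) \<rho>) A" using p A AI by simp
    also have "\<dots> = (\<integral>x. measure (K (Suc m) \<rho> x) A \<partial>\<rho>)" unfolding Phi_def by (rule sub.measure_bind[OF kM A])
    also have "\<dots> = (\<integral>x. k.op (indicator A) x \<partial>\<rho>)"
    proof (rule Bochner_Integration.integral_cong)
      fix x assume "x \<in> space \<rho>"
      then have "x \<in> space (E m)" using probsD(3)[OF \<rho>] by simp
      note q = probsD[OF k.kx[OF this]]
      show "measure (K (Suc m) \<rho> x) A = k.op (indicator A) x" unfolding k.op_def using q A AI by simp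
    qed simp
    finally show "(\<integral>y. indicator A y \<partial>Phi K (Suc m) \<rho>) = (\<integral>x. k.op (indicator A) x \<partial>\<rho>)" .
  qed
  then show ?thesis unfolding k.op_def .
qed

abbreviation Rem :: "nat \<Rightarrow> nat \<Rightarrow> ('a \<Rightarrow> real) \<Rightarrow> 'w \<Rightarrow> real" where
  "Rem N m f w \<equiv> remainder (E (Suc m)) (Phi K (Suc m)) (D (Suc m)) (emp N m w) (\<eta> m) f"

lemma mult_div_sqrt: "real N * d / sqrt (real N) = sqrt (real N) * d"
  unfolding times_divide_eq_left[symmetric] by (simp only: real_div_sqrt of_nat_0_le_iff)

lemma Wd_0: "N \<ge> 1 \<Longrightarrow> w \<in> space (P N) \<Longrightarrow> g \<in> bdd_meas (E 0) \<Longrightarrow> Wd N 0 g w = Vint N 0 g w"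
proof -
  assume N: "N \<ge> 1" and w: "w \<in> space (P N)" and g: "g \<in> bdd_meas (E 0)"
  have "(\<Sum>i=1..N. g (\<xi> N 0 i w) - (\<integral>y. g y \<partial>\<eta>0)) = real N * diff_int (emp N 0 w) (\<eta> 0) g"
    unfolding diff_int_def emp_integral[OF N w g] using N by (simp add: sum_subtractf algebra_simps)
  then show ?thesis
    unfolding Wd_def Vint_def pk_def by (simp add: mult_div_sqrt)
qed

lemma Phi_emp_integral:
  assumes N: "N \<ge> 1" and w: "w \<in> space (P N)" and g: "g \<in> bdd_meas (E (Suc m))"
  shows "(\<integral>y. g y \<partial>Phi K (Suc m) (emp N m w)) = (\<Sum>i=1..N. \<integral>y. g y \<partial>pk N (Suc m) i w) / real N"
proof -
  note e = emp_probs[OF N w, of m]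
  interpret k: markov_kernel "E m" "E (Suc m)" "K (Suc m) (emp N m w)" using markov[OF e] by (rule markov_kernel.intro)
  show ?thesis
    unfolding Phi_integral[OF e g] using emp_integral[OF N w k.op_bdd[OF g]] unfolding k.op_def pk_def by simp
qed

lemma Wd_Suc':
  assumes N: "N \<ge> 1" and w: "w \<in> space (P N)" and g: "g \<in> bdd_meas (E (Suc m))"
  shows "Wd N (Suc m) g w = Vint N (Suc m) g w + sqrt (real N) * diff_int (Phi K (Suc m) (emp N m w)) (Phi K (Suc m) (\<eta> m)) g"
proof -
  let ?a = "(\<Sum>i=1..N. g (\<xi> N (Suc m) i w)) / real N" and ?b = "(\<Sum>i=1..N. \<integral>y. g y \<partial>pk N (Suc m) i w) / real N"
  have "(\<Sum>i=1..N. g (\<xi> N (Suc m) i w) - (\<integral>y. g y \<partial>pk N (Suc m) i w)) = real N * (?a - ?b)"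
    using N by (simp add: sum_subtractf field_simps)
  then have "Vint N (Suc m) g w = sqrt (real N) * (?a - ?b)"
    unfolding Vint_def by (simp add: mult_div_sqrt)
  then show ?thesis
    unfolding Wd_def diff_int_def emp_integral[OF N w g] Phi_emp_integral[OF N w g] by (simp add: algebra_simps)
qed

text \<open>The one-step error recursion: fresh sampling error, transported old error, and the
  remainder of the first-order expansion.\<close>

lemma Wd_Suc:
  assumes N: "N \<ge> 1" and w: "w \<in> space (P N)" and g: "g \<in> bdd_meas (E (Suc m))"
  shows "Wd N (Suc m) g w = Vint N (Suc m) g w + Wd N m (Dstep (Suc m) g) w + sqrt (real N) * Rem N m g w"
  unfolding Wd_Suc'[OF assms] unfolding remainder_def Dstep_Suc Wd_def by (simp add: algebra_simps)

text \<open>The definition evaluates \<open>Phi\<close> at a random measure, from which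
  measurability is not visible. Solving the recursion \<open>Wd_Suc\<close> for the remainder
  expresses it by fields already known to be measurable.\<close>

lemma Rem_bdd: "N \<ge> 1 \<Longrightarrow> g \<in> bdd_meas (E (Suc m)) \<Longrightarrow> Rem N m g \<in> bdd_meas (P N)"
proof -
  assume N: "N \<ge> 1" and g: "g \<in> bdd_meas (E (Suc m))"
  let ?f = "\<lambda>w. (1 / sqrt (real N)) * (Wd N (Suc m) g w - Vint N (Suc m) g w - Wd N m (Dstep (Suc m) g) w)"
  have b: "?f \<in> bdd_meas (P N)"
    by (intro bdd_meas_cmult bdd_meas_diff Wd_bdd[OF N] Vint_bdd[OF N g carries_P[OF N]] g bounded_op_bdd[OF bounded_op_Dstep])
  have "Rem N m g w = ?f w" if "w \<in> space (P N)" for w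
    unfolding Wd_Suc[OF N that g] using N by simp
  then show ?thesis by (rule bdd_meas_cong[OF b])
qed

lemma Vint_exp:
  assumes N: "N \<ge> 1" and g: "g \<in> bdd_meas (E p)" and r: "rosc (E p) g \<le> 1"
  shows "(\<integral>\<^sup>+w. ennreal (exp (t * Vint N p g w)) \<partial>P N) \<le> ennreal (exp (t\<^sup>2 / 2))"
proof -
  interpret prob_space "P N" by (rule prob_P[OF N])
  let ?s = "t / sqrt (real N)"
  note Vb = Vint_bdd[OF N g carries_P[OF N]]
  have one: "pre N p (\<lambda>_. 1)" unfolding pre_def by auto
  have e: "(\<integral>w. exp (t * Vint N p g w) \<partial>P N) = (\<integral>w. exp (cgf N p g ?s w) \<partial>P N)"
    using exp_step[OF N one g, of ?s] unfolding Vint_def by simp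
  also have "\<dots> \<le> exp (t\<^sup>2 / 2)"
  \<comment> \<open>A nonintegrable function has integral 0, for which the bound is immediate;
    measurability of \<open>cgf\<close> thus does not have to be settled here.\<close>
  proof (cases "integrable (P N) (\<lambda>w. exp (cgf N p g ?s w))")
    case True
    have "(\<integral>w. exp (cgf N p g ?s w) \<partial>P N) \<le> (\<integral>w. exp (t\<^sup>2 / 2) \<partial>P N)"
    proof (rule integral_mono[OF True])
      fix w assume w: "w \<in> space (P N)"
      have "(rosc (E p) g)\<^sup>2 \<le> 1" using power_mono[OF r rosc_nonneg, of 2] by simp
      then have "t\<^sup>2 * (rosc (E p) g)\<^sup>2 \<le> t\<^sup>2 * 1" by (intro mult_left_mono) auto
      then have "real N * (?s\<^sup>2 * (rosc (E p) g)\<^sup>2 / 2) \<le> t\<^sup>2 / 2" using N by (simp add: power_divide)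
      then show "exp (cgf N p g ?s w) \<le> exp (t\<^sup>2 / 2)" using cgf_hoeffding[OF N w g, of ?s] by simp
    qed simp
    then show ?thesis using prob_space by simp
  qed (simp add: not_integrable_integral_eq)
  finally have "ennreal (\<integral>w. exp (t * Vint N p g w) \<partial>P N) \<le> ennreal (exp (t\<^sup>2 / 2))" by (rule ennreal_leI)
  then show ?thesis
    using nn_integral_eq_integral[OF bdd_integrable[OF bdd_meas_exp[OF bdd_meas_cmult[OF Vb]]], of t] by simp
qed

lemma Vint_subg:
  assumes N: "N \<ge> 1" and g: "g \<in> Osc1 (E p)"
  shows "subg (P N) 2 (Vint N p g)"
  unfolding subg_def
proof (intro conjI allI impI)
  note gb = Osc1_bdd_meas[OF g]
  show Vb: "Vint N p g \<in> bdd_meas (P N)" by (rule Vint_bdd[OF N gb(1) carries_P[OF N]])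
  note [measurable] = bdd_meas_measurable[OF Vb]
  fix t :: real assume t: "t \<ge> 0"
  have "(\<integral>\<^sup>+w. ennreal (exp (t * \<bar>Vint N p g w\<bar>)) \<partial>P N)
      \<le> (\<integral>\<^sup>+w. ennreal (exp (t * Vint N p g w)) + ennreal (exp ((- t) * Vint N p g w)) \<partial>P N)"
    by (intro nn_integral_mono) (auto simp: abs_if ennreal_plus[symmetric] simp del: ennreal_plus)
  also have "\<dots> = (\<integral>\<^sup>+w. ennreal (exp (t * Vint N p g w)) \<partial>P N) + (\<integral>\<^sup>+w. ennreal (exp ((- t) * Vint N p g w)) \<partial>P N)"
    by (intro nn_integral_add; measurable)
  also have "\<dots> \<le> ennreal (exp (t\<^sup>2 / 2)) + ennreal (exp ((- t)\<^sup>2 / 2))"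
    by (intro add_mono Vint_exp N gb)
  also have "\<dots> = ennreal (2 * exp (t\<^sup>2 / 2))" by (simp add: ennreal_plus[symmetric] del: ennreal_plus)
  also have "\<dots> \<le> ennreal (2 * exp (2 * t\<^sup>2))" by (intro ennreal_leI) simp
  finally show "(\<integral>\<^sup>+w. ennreal (exp (t * \<bar>Vint N p g w\<bar>)) \<partial>P N) \<le> ennreal (2 * exp (2 * t\<^sup>2))" .
qed

text \<open>Tonelli's theorem in the mixture bounds needs this in both variables. Integration
  against the empirical measure is a finite sum of evaluations, which are jointly measurable by the
  hypothesis on \<open>T\<close>.\<close>

lemma joint_linear:
  assumes N: "N \<ge> 1" and T: "space T \<subseteq> bdd_meas (E m)" and h: "(\<lambda>(x, h). h x) \<in> borel_measurable (E m \<Otimes>\<^sub>M T)"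
  shows "(\<lambda>(w, h). diff_int (emp N m w) (\<eta> m) h) \<in> borel_measurable (P N \<Otimes>\<^sub>M T)"
proof -
  note fp = probsD[OF flow_probs[of m]]
  interpret prob_space "\<eta> m" by (rule fp(1))
  have 1: "(\<lambda>z. snd z (\<xi> N m i (fst z))) \<in> borel_measurable (P N \<Otimes>\<^sub>M T)" if "i \<in> {1..N}" for i
  proof -
    have "(\<lambda>z. (\<xi> N m i (fst z), snd z)) \<in> measurable (P N \<Otimes>\<^sub>M T) (E m \<Otimes>\<^sub>M T)"
      by (rule measurable_Pair[OF measurable_compose[OF measurable_fst xi_measurable[OF N that]] measurable_snd])
    from measurable_compose[OF this h] show ?thesis by simp
  qed
  have 2: "(\<lambda>z. \<integral>y. snd z y \<partial>\<eta> m) \<in> borel_measurable (P N \<Otimes>\<^sub>M T)"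
  proof -
    have "snd \<in> measurable (T \<Otimes>\<^sub>M \<eta> m) (E m)"
      using measurable_snd[of T "\<eta> m"] measurable_cong_sets[OF refl fp(2)] by blast
    from measurable_Pair[OF this measurable_fst]
    have "(\<lambda>z. (snd z, fst z)) \<in> measurable (T \<Otimes>\<^sub>M \<eta> m) (E m \<Otimes>\<^sub>M T)" .
    from measurable_compose[OF this h] have "(\<lambda>(h, y). h y) \<in> borel_measurable (T \<Otimes>\<^sub>M \<eta> m)" by (simp add: case_prod_unfold)
    then have "(\<lambda>h. \<integral>y. h y \<partial>\<eta> m) \<in> borel_measurable T" by (intro borel_measurable_lebesgue_integral)
    from measurable_compose[OF measurable_snd this] show ?thesis .
  qed
  have "(\<lambda>z. (\<Sum>i=1..N. snd z (\<xi> N m i (fst z))) / real N - (\<integral>y. snd z y \<partial>\<eta> m)) \<in> borel_measurable (P N \<Otimes>\<^sub>M T)"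
    by (intro borel_measurable_diff borel_measurable_divide borel_measurable_sum borel_measurable_const 1 2)
  then show ?thesis
  proof (rule measurable_cong[THEN iffD1, rotated])
    fix z assume "z \<in> space (P N \<Otimes>\<^sub>M T)"
    then obtain w h where z: "z = (w, h)" "w \<in> space (P N)" "h \<in> space T" by (auto simp: space_pair_measure)
    then have "h \<in> bdd_meas (E m)" using T by blast
    then show "(\<Sum>i=1..N. snd z (\<xi> N m i (fst z))) / real N - (\<integral>y. snd z y \<partial>\<eta> m)
        = (case z of (w, h) \<Rightarrow> diff_int (emp N m w) (\<eta> m) h)"
      unfolding z diff_int_def using emp_integral[OF N z(2)] by simp
  qed
qed

text \<open>Only the product \<open>g1 x * g2 y\<close> is known to be jointly measurable, not its
  factors. The product of differences is therefore expanded into four double integrals of that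
  product.\<close>

lemma joint_quadratic:
  assumes N: "N \<ge> 1" and R: "space R \<subseteq> Osc1 (E m) \<times> Osc1 (E m)"
    and h: "(\<lambda>((x, y), (g1, g2)). g1 x * g2 y) \<in> borel_measurable ((E m \<Otimes>\<^sub>M E m) \<Otimes>\<^sub>M R)"
  shows "(\<lambda>(w, (g1, g2)). diff_int (emp N m w) (\<eta> m) g1 * diff_int (emp N m w) (\<eta> m) g2) \<in> borel_measurable (P N \<Otimes>\<^sub>M R)"
proof -
  note fp = probsD[OF flow_probs[of m]]
  interpret prob_space "\<eta> m" by (rule fp(1))
  let ?H = "\<lambda>x y g. fst g x * snd g y"
  have h': "(\<lambda>z. ?H (fst (fst z)) (snd (fst z)) (snd z)) \<in> borel_measurable ((E m \<Otimes>\<^sub>M E m) \<Otimes>\<^sub>M R)"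
    using h by (simp add: case_prod_unfold)
  have comp: "(\<lambda>z. ?H (a z) (b z) (c z)) \<in> borel_measurable M"
    if "a \<in> measurable M (E m)" "b \<in> measurable M (E m)" "c \<in> measurable M R" for a b c and M :: "'c measure"
  proof -
    have "(\<lambda>z. ((a z, b z), c z)) \<in> measurable M ((E m \<Otimes>\<^sub>M E m) \<Otimes>\<^sub>M R)" using that by measurable
    from measurable_compose[OF this h'] show ?thesis by simp
  qed
  have sndE: "snd \<in> measurable (M \<Otimes>\<^sub>M \<eta> m) (E m)" for M :: "'c measure"
    using measurable_snd[of M "\<eta> m"] measurable_cong_sets[OF refl fp(2)] by blast
  have xf: "(\<lambda>z. \<xi> N m i (fst z)) \<in> measurable (P N \<Otimes>\<^sub>M M) (E m)" if "i \<in> {1..N}" for i and M :: "'c measure"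
    using xi_measurable[OF N that] by measurable
  let ?M = "P N \<Otimes>\<^sub>M R"
  have 1: "(\<lambda>z. ?H (\<xi> N m i (fst z)) (\<xi> N m j (fst z)) (snd z)) \<in> borel_measurable ?M"
    if "i \<in> {1..N}" "j \<in> {1..N}" for i j
    using that by (intro comp xf measurable_snd)
  have 2: "(\<lambda>z. \<integral>y. ?H (\<xi> N m i (fst z)) y (snd z) \<partial>\<eta> m) \<in> borel_measurable ?M" if i: "i \<in> {1..N}" for i
  proof (rule borel_measurable_lebesgue_integral)
    show "(\<lambda>(z, y). ?H (\<xi> N m i (fst z)) y (snd z)) \<in> borel_measurable (?M \<Otimes>\<^sub>M \<eta> m)"
      unfolding case_prod_unfold
      by (intro comp sndE measurable_compose[OF measurable_fst xf[OF i]] measurable_compose[OF measurable_fst measurable_snd])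
  qed
  have 3: "(\<lambda>z. \<integral>x. ?H x (\<xi> N m i (fst z)) (snd z) \<partial>\<eta> m) \<in> borel_measurable ?M" if i: "i \<in> {1..N}" for i
  proof (rule borel_measurable_lebesgue_integral)
    show "(\<lambda>(z, y). ?H y (\<xi> N m i (fst z)) (snd z)) \<in> borel_measurable (?M \<Otimes>\<^sub>M \<eta> m)"
      unfolding case_prod_unfold
      by (intro comp sndE measurable_compose[OF measurable_fst xf[OF i]] measurable_compose[OF measurable_fst measurable_snd])
  qed
  have 4: "(\<lambda>z. \<integral>x. \<integral>y. ?H x y (snd z) \<partial>\<eta> m \<partial>\<eta> m) \<in> borel_measurable ?M"
  proof (intro borel_measurable_lebesgue_integral)
    have "(\<lambda>(w, y). ?H (snd w) y (snd (fst w))) \<in> borel_measurable ((?M \<Otimes>\<^sub>M \<eta> m) \<Otimes>\<^sub>M \<eta> m)"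
      unfolding case_prod_unfold
      by (intro comp sndE measurable_compose[OF measurable_fst sndE]
          measurable_compose[OF measurable_fst measurable_compose[OF measurable_fst measurable_snd]])
    then have "(\<lambda>w. \<integral>y. ?H (snd w) y (snd (fst w)) \<partial>\<eta> m) \<in> borel_measurable (?M \<Otimes>\<^sub>M \<eta> m)"
      by (intro borel_measurable_lebesgue_integral)
    then show "(\<lambda>(z, x). \<integral>y. ?H x y (snd z) \<partial>\<eta> m) \<in> borel_measurable (?M \<Otimes>\<^sub>M \<eta> m)"
      by (simp add: case_prod_unfold)
  qed
  let ?F = "\<lambda>z. (\<Sum>i=1..N. \<Sum>j=1..N. ?H (\<xi> N m i (fst z)) (\<xi> N m j (fst z)) (snd z)) / (real N * real N)
      - (\<Sum>i=1..N. \<integral>y. ?H (\<xi> N m i (fst z)) y (snd z) \<partial>\<eta> m) / real N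
      - (\<Sum>i=1..N. \<integral>x. ?H x (\<xi> N m i (fst z)) (snd z) \<partial>\<eta> m) / real N
      + (\<integral>x. \<integral>y. ?H x y (snd z) \<partial>\<eta> m \<partial>\<eta> m)"
  have "?F \<in> borel_measurable ?M"
    using 1 2 3 4 by (intro borel_measurable_add borel_measurable_diff borel_measurable_divide borel_measurable_sum
        borel_measurable_const)
  then show ?thesis
  proof (rule measurable_cong[THEN iffD1, rotated])
    fix z assume "z \<in> space ?M"
    then obtain w g1 g2 where z: "z = (w, (g1, g2))" "w \<in> space (P N)" "(g1, g2) \<in> space R"
      by (auto simp: space_pair_measure)
    then have g: "g1 \<in> bdd_meas (E m)" "g2 \<in> bdd_meas (E m)" using R Osc1_bdd_meas by blast+
    have "(\<Sum>i=1..N. \<Sum>j=1..N. g1 (\<xi> N m i w) * g2 (\<xi> N m j w)) = (\<Sum>i=1..N. g1 (\<xi> N m i w)) * (\<Sum>j=1..N. g2 (\<xi> N m j w))"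
      by (simp add: sum_product)
    moreover have "(\<Sum>i=1..N. g1 (\<xi> N m i w)) = real N * (\<integral>x. g1 x \<partial>emp N m w)"
      "(\<Sum>i=1..N. g2 (\<xi> N m i w)) = real N * (\<integral>x. g2 x \<partial>emp N m w)"
      using emp_integral[OF N z(2)] g N by simp_all
    ultimately show "?F z = (case z of (w, (g1, g2)) \<Rightarrow> diff_int (emp N m w) (\<eta> m) g1 * diff_int (emp N m w) (\<eta> m) g2)"
      unfolding z diff_int_def using N
      by (simp add: sum_distrib_left[symmetric] sum_distrib_right[symmetric]) (simp add: algebra_simps)
  qed
qed

end

lemma scaled_mixture_le:
  assumes k: "k \<in> borel_measurable R" and s: "s \<ge> 0" and a: "a \<ge> 0"
    and le: "ennreal a \<le> (\<integral>\<^sup>+g. ennreal \<bar>k g\<bar> \<partial>R)"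
    and fin: "(\<integral>\<^sup>+g. ennreal \<bar>s * k g\<bar> \<partial>R) \<le> ennreal b"
  shows "s * a \<le> enn2real (\<integral>\<^sup>+g. ennreal \<bar>s * k g\<bar> \<partial>R)"
proof -
  have "ennreal (s * a) = ennreal s * ennreal a" using s a by (intro ennreal_mult)
  also have "\<dots> \<le> ennreal s * (\<integral>\<^sup>+g. ennreal \<bar>k g\<bar> \<partial>R)" by (intro mult_left_mono le) simp
  also have "\<dots> = (\<integral>\<^sup>+g. ennreal s * ennreal \<bar>k g\<bar> \<partial>R)" using k by (intro nn_integral_cmult[symmetric]) simp
  also have "\<dots> = (\<integral>\<^sup>+g. ennreal \<bar>s * k g\<bar> \<partial>R)" using s by (intro nn_integral_cong) (simp add: abs_mult ennreal_mult)
  finally have "enn2real (ennreal (s * a)) \<le> enn2real (\<integral>\<^sup>+g. ennreal \<bar>s * k g\<bar> \<partial>R)"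
    using le_less_trans[OF fin ennreal_less_top] by (intro enn2real_mono)
  then show ?thesis using s a by simp
qed

section \<open>Propagation of subgaussian bounds in time\<close>

context particle_model
begin

text \<open>Uniformity over all functions of oscillation at most 1 is essential, because the next
  time step integrates over unknown such functions.\<close>

definition subgW :: "nat \<Rightarrow> real \<Rightarrow> bool" where
  "subgW m C \<longleftrightarrow> C \<ge> 1 \<and> (\<forall>N\<ge>1. \<forall>g\<in>Osc1 (E m). subg (P N) C (Wd N m g))"

lemma Wd_cmult:
  "N \<ge> 1 \<Longrightarrow> w \<in> space (P N) \<Longrightarrow> g \<in> bdd_meas (E m) \<Longrightarrow> Wd N m (\<lambda>x. a * g x) w = a * Wd N m g w"
  unfolding Wd_def by (simp add: diff_int_cmult[OF emp_probs flow_probs])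

lemma Wd_subg:
  assumes W: "subgW m C" and N: "N \<ge> 1" and g: "g \<in> bdd_meas (E m)" and b: "rosc (E m) g \<le> b" "b > 0"
  shows "subg (P N) (C * (1 + b\<^sup>2)) (Wd N m g)"
proof (rule subg_scale[where b = b])
  let ?g = "\<lambda>x. (1 / b) * g x"
  show "subg (P N) C (Wd N m ?g)" using W N Osc1_normalize[OF g b] unfolding subgW_def by blast
  show "1 \<le> C" using W unfolding subgW_def by blast
  fix w assume w: "w \<in> space (P N)"
  show "\<bar>Wd N m g w\<bar> \<le> b * \<bar>Wd N m ?g w\<bar>" unfolding Wd_cmult[OF N w g] using b by (simp add: abs_mult)
qed (use b Wd_bdd[OF N g] in auto)

lemma normalized_Wd:
  assumes N: "N \<ge> 1" and w: "w \<in> space (P N)" and g: "g \<in> bdd_meas (E m)" and q: "rosc (E m) g > 0"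
  shows "sqrt (real N) * \<bar>diff_int (emp N m w) (\<eta> m) g\<bar> / rosc (E m) g = \<bar>Wd N m (\<lambda>x. (1 / rosc (E m) g) * g x) w\<bar>"
  unfolding Wd_cmult[OF N w g] unfolding Wd_def using q by (simp add: abs_mult)

definition linear_majorant :: "nat \<Rightarrow> ('a \<Rightarrow> real) \<Rightarrow> real \<Rightarrow> ('a \<Rightarrow> real) measure \<Rightarrow> bool" where
  "linear_majorant m f d T \<longleftrightarrow>
     space T \<subseteq> bdd_meas (E m) \<and> (\<lambda>(x, h). h x) \<in> borel_measurable (E m \<Otimes>\<^sub>M T) \<and>
     osc (E m) \<in> borel_measurable T \<and>
     (\<forall>\<mu>\<in>probs (E m). (SUP x\<in>space (E m). ennreal \<bar>diff_int (K (Suc m) \<mu> x) (K (Suc m) (\<eta> m) x) f\<bar>)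
        \<le> (\<integral>\<^sup>+h. ennreal \<bar>diff_int \<mu> (\<eta> m) h\<bar> \<partial>T)) \<and>
     (\<integral>\<^sup>+h. osc (E m) h \<partial>T) \<le> ennreal d"

lemma linear_majorant_ex: "\<exists>d\<ge>0. \<forall>f\<in>Osc1 (E (Suc m)). \<exists>T. linear_majorant m f d T"
  using H1_K[of m] unfolding cond_K_def
proof (elim exE conjE, goal_cases)
  case (1 \<delta>)
  show ?case
  proof (intro exI[of _ "enn2real \<delta>"] conjI enn2real_nonneg ballI)
    fix f assume f: "f \<in> Osc1 (E (Suc m))"
    have "osc (E (Suc m)) f * \<delta> \<le> 1 * \<delta>" using f unfolding Osc1_def by (intro mult_right_mono) auto
    then have le: "osc (E (Suc m)) f * \<delta> \<le> ennreal (enn2real \<delta>)" using 1(1) by simp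
    from bspec[OF bspec[OF 1(2) flow_probs] f] show "\<exists>T. linear_majorant m f (enn2real \<delta>) T"
      unfolding linear_majorant_def
      by (elim exE conjE, intro exI conjI) (assumption | rule order_trans[OF _ le])+
  qed
qed

text \<open>The same random variable bounds the difference at every \<open>x\<close>, because the
  difference is later integrated over the random positions of the particles. Condition (K), being in
  supremum norm, allows this.\<close>

lemma K_mixture:
  assumes W: "subgW m C"
  shows "\<exists>C'\<ge>1. \<forall>f\<in>Osc1 (E (Suc m)). \<exists>U. \<forall>N\<ge>1. subg (P N) C' (U N) \<and>
    (\<forall>w\<in>space (P N). \<forall>x\<in>space (E m).
       sqrt (real N) * \<bar>diff_int (K (Suc m) (emp N m w) x) (K (Suc m) (\<eta> m) x) f\<bar> \<le> U N w)"
proof -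
  have C: "C \<ge> 1" using W unfolding subgW_def by blast
  obtain d where d: "d \<ge> 0" and ex: "\<forall>f\<in>Osc1 (E (Suc m)). \<exists>T. linear_majorant m f d T"
    using linear_majorant_ex[of m] by (elim exE conjE)
  show ?thesis
  proof (intro exI[of _ "C * (1 + d\<^sup>2)"] conjI ballI)
    show "1 \<le> C * (1 + d\<^sup>2)" using C mult_mono[of 1 C 1 "1 + d\<^sup>2"] by simp
    fix f assume f: "f \<in> Osc1 (E (Suc m))"
    from ex[rule_format, OF f] obtain T :: "('a \<Rightarrow> real) measure" where
      T: "space T \<subseteq> bdd_meas (E m)" "(\<lambda>(x, h). h x) \<in> borel_measurable (E m \<Otimes>\<^sub>M T)" "osc (E m) \<in> borel_measurable T"
      and dom: "\<forall>\<mu>\<in>probs (E m). (SUP x\<in>space (E m). ennreal \<bar>diff_int (K (Suc m) \<mu> x) (K (Suc m) (\<eta> m) x) f\<bar>)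
        \<le> (\<integral>\<^sup>+h. ennreal \<bar>diff_int \<mu> (\<eta> m) h\<bar> \<partial>T)"
      and mass: "(\<integral>\<^sup>+h. osc (E m) h \<partial>T) \<le> ennreal d"
      unfolding linear_majorant_def by (elim exE conjE)
    let ?h = "\<lambda>N z. sqrt (real N) * diff_int (emp N m (fst z)) (\<eta> m) (snd z)"
    let ?U = "\<lambda>N w. enn2real (\<integral>\<^sup>+h. ennreal \<bar>?h N (w, h)\<bar> \<partial>T)"
    have fin: "osc (E m) h < \<infinity>" if "h \<in> space T" for h using osc_finite T(1) that by blast
    have hm: "?h N \<in> borel_measurable (P N \<Otimes>\<^sub>M T)" if N: "N \<ge> 1" for N
      using joint_linear[OF N T(1,2)] by (simp add: case_prod_unfold)
    have hq: "\<bar>?h N (w, h)\<bar> \<le> sqrt (real N) * enn2real (osc (E m) h)"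
      if "N \<ge> 1" "w \<in> space (P N)" "h \<in> space T" for N w h
      using diff_int_bound[OF emp_probs[OF that(1,2)] flow_probs] that(3) T(1) unfolding rosc_def
      by (auto simp: abs_mult intro!: mult_left_mono)
    have sub: "subg (P N) (C * (1 + d\<^sup>2)) (?U N)" if N: "N \<ge> 1" for N
    proof (rule mixture_subg[OF prob_P[OF N] hm[OF N] T(3) fin mass d _ hq[OF N] C])
      fix h assume h: "h \<in> space T" "0 < osc (E m) h"
      have hb: "h \<in> bdd_meas (E m)" using T(1) h(1) by blast
      have pos: "rosc (E m) h > 0" using h(2) osc_eq_rosc[OF hb] by simp
      show "subg (P N) C (Wd N m (\<lambda>x. (1 / rosc (E m) h) * h x))"
        using W N Osc1_normalize[OF hb order_refl pos] unfolding subgW_def by blast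
      fix w assume w: "w \<in> space (P N)"
      show "\<bar>?h N (w, h)\<bar> / enn2real (osc (E m) h) \<le> \<bar>Wd N m (\<lambda>x. (1 / rosc (E m) h) * h x) w\<bar>"
        using normalized_Wd[OF N w hb pos] unfolding rosc_def[symmetric] by (simp add: abs_mult)
    qed auto
    have le: "sqrt (real N) * \<bar>diff_int (K (Suc m) (emp N m w) x) (K (Suc m) (\<eta> m) x) f\<bar> \<le> ?U N w"
      if N: "N \<ge> 1" and w: "w \<in> space (P N)" and x: "x \<in> space (E m)" for N w x
    proof -
      have m1: "(\<lambda>h. diff_int (emp N m w) (\<eta> m) h) \<in> borel_measurable T"
        using measurable_compose[OF measurable_Pair1'[OF w] joint_linear[OF N T(1,2)]] by simp
      have fin1: "(\<integral>\<^sup>+h. ennreal \<bar>?h N (w, h)\<bar> \<partial>T) \<le> ennreal (sqrt (real N) * d)"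
        by (rule mixture_bound[OF T(3) fin mass d _ hq[OF N w]]) simp_all
      have "ennreal \<bar>diff_int (K (Suc m) (emp N m w) x) (K (Suc m) (\<eta> m) x) f\<bar> \<le>
          (SUP x\<in>space (E m). ennreal \<bar>diff_int (K (Suc m) (emp N m w) x) (K (Suc m) (\<eta> m) x) f\<bar>)"
        by (rule SUP_upper[OF x])
      also have "\<dots> \<le> (\<integral>\<^sup>+h. ennreal \<bar>diff_int (emp N m w) (\<eta> m) h\<bar> \<partial>T)" by (rule dom[rule_format, OF emp_probs[OF N w]])
      finally have le1: "ennreal \<bar>diff_int (K (Suc m) (emp N m w) x) (K (Suc m) (\<eta> m) x) f\<bar> \<le> (\<integral>\<^sup>+h. ennreal \<bar>diff_int (emp N m w) (\<eta> m) h\<bar> \<partial>T)" .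
      show ?thesis
        using scaled_mixture_le[OF m1 _ abs_ge_zero le1, of "sqrt (real N)", OF _ fin1[unfolded fst_conv snd_conv]] by simp
    qed
    show "\<exists>U. \<forall>N\<ge>1. subg (P N) (C * (1 + d\<^sup>2)) (U N) \<and>
    (\<forall>w\<in>space (P N). \<forall>x\<in>space (E m).
       sqrt (real N) * \<bar>diff_int (K (Suc m) (emp N m w) x) (K (Suc m) (\<eta> m) x) f\<bar> \<le> U N w)"
      by (intro exI[of _ ?U] allI impI conjI ballI sub le)
  qed
qed

definition quadratic_majorant :: "nat \<Rightarrow> ('a \<Rightarrow> real) \<Rightarrow> real \<Rightarrow> (('a \<Rightarrow> real) \<times> ('a \<Rightarrow> real)) measure \<Rightarrow> bool" where
  "quadratic_majorant m f d R \<longleftrightarrow>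
     space R \<subseteq> Osc1 (E m) \<times> Osc1 (E m) \<and>
     (\<lambda>((x, y), (g1, g2)). g1 x * g2 y) \<in> borel_measurable ((E m \<Otimes>\<^sub>M E m) \<Otimes>\<^sub>M R) \<and>
     (\<lambda>g. osc (E m) (fst g) * osc (E m) (snd g)) \<in> borel_measurable R \<and>
     (\<forall>\<mu>\<in>probs (E m). ennreal \<bar>remainder (E (Suc m)) (Phi K (Suc m)) (D (Suc m)) \<mu> (\<eta> m) f\<bar>
        \<le> (\<integral>\<^sup>+g. ennreal \<bar>diff_int \<mu> (\<eta> m) (fst g) * diff_int \<mu> (\<eta> m) (snd g)\<bar> \<partial>R)) \<and>
     (\<integral>\<^sup>+g. osc (E m) (fst g) * osc (E m) (snd g) \<partial>R) \<le> ennreal d"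

lemma quadratic_majorant_ex:
  "\<exists>d\<ge>0. \<forall>f\<in>bdd_meas (E (Suc m)). \<exists>R. quadratic_majorant m f (rosc (E (Suc m)) f * d) R"
  using H1_Phi[of m] unfolding upsilon_with_def
proof (elim exE conjE, goal_cases)
  case (1 \<delta>)
  show ?case
  proof (intro exI[of _ "enn2real \<delta>"] conjI enn2real_nonneg ballI)
    fix f assume f: "f \<in> bdd_meas (E (Suc m))"
    have "osc (E (Suc m)) f * \<delta> = ennreal (rosc (E (Suc m)) f) * ennreal (enn2real \<delta>)"
      unfolding osc_eq_rosc[OF f] using 1 by simp
    also have "\<dots> = ennreal (rosc (E (Suc m)) f * enn2real \<delta>)"
      by (intro ennreal_mult[symmetric] rosc_nonneg enn2real_nonneg)
    finally have e: "osc (E (Suc m)) f * \<delta> = ennreal (rosc (E (Suc m)) f * enn2real \<delta>)" .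
    from bspec[OF bspec[OF 1(5) flow_probs] f] show "\<exists>R. quadratic_majorant m f (rosc (E (Suc m)) f * enn2real \<delta>) R"
      unfolding quadratic_majorant_def e case_prod_unfold .
  qed
qed

lemma R_integrand:
  assumes R: "space R \<subseteq> Osc1 (E m) \<times> Osc1 (E m)" and N: "N \<ge> 1" and w: "w \<in> space (P N)" and g: "g \<in> space R"
    and c: "c \<ge> 0"
  shows "\<bar>c * (diff_int (emp N m w) (\<eta> m) (fst g) * diff_int (emp N m w) (\<eta> m) (snd g))\<bar>
    \<le> c * enn2real (osc (E m) (fst g) * osc (E m) (snd g))"
proof -
  have g: "fst g \<in> bdd_meas (E m)" "snd g \<in> bdd_meas (E m)" using subsetD[OF R g] by (auto intro: Osc1_bdd_meas(1))
  note b = diff_int_bound[OF emp_probs[OF N w] flow_probs g(1)] diff_int_bound[OF emp_probs[OF N w] flow_probs g(2)]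
  show ?thesis
    using mult_mono[OF b rosc_nonneg abs_ge_zero] c unfolding rosc_def enn2real_mult
    by (auto simp: abs_mult intro!: mult_left_mono)
qed

text \<open>At scale \<open>sqrt N\<close> only one of the two factors is treated as a fluctuating
  field; the other is bounded by its oscillation. This crude bound is enough for subgaussianity,
  while \<open>negligible_Rem\<close> uses both factors.\<close>

lemma R_mixture:
  assumes W: "subgW m C"
  shows "\<exists>C'\<ge>1. \<forall>f\<in>Osc1 (E (Suc m)). \<exists>U. \<forall>N\<ge>1. subg (P N) C' (U N) \<and>
    (\<forall>w\<in>space (P N). sqrt (real N) * \<bar>Rem N m f w\<bar> \<le> U N w)"
proof -
  have C: "C \<ge> 1" using W unfolding subgW_def by blast
  obtain d where d: "d \<ge> 0" and ex: "\<forall>f\<in>bdd_meas (E (Suc m)). \<exists>R. quadratic_majorant m f (rosc (E (Suc m)) f * d) R"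
    using quadratic_majorant_ex[of m] by (elim exE conjE)
  show ?thesis
  proof (intro exI[of _ "C * (1 + d\<^sup>2)"] conjI ballI)
    show "1 \<le> C * (1 + d\<^sup>2)" using C mult_mono[of 1 C 1 "1 + d\<^sup>2"] by simp
    fix f assume f: "f \<in> Osc1 (E (Suc m))"
    from ex[rule_format, OF Osc1_bdd_meas(1)[OF f]] obtain R :: "(('a \<Rightarrow> real) \<times> ('a \<Rightarrow> real)) measure" where
      R: "space R \<subseteq> Osc1 (E m) \<times> Osc1 (E m)"
        "(\<lambda>((x, y), (g1, g2)). g1 x * g2 y) \<in> borel_measurable ((E m \<Otimes>\<^sub>M E m) \<Otimes>\<^sub>M R)"
        "(\<lambda>g. osc (E m) (fst g) * osc (E m) (snd g)) \<in> borel_measurable R"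
      and dom: "\<forall>\<mu>\<in>probs (E m). ennreal \<bar>remainder (E (Suc m)) (Phi K (Suc m)) (D (Suc m)) \<mu> (\<eta> m) f\<bar>
        \<le> (\<integral>\<^sup>+g. ennreal \<bar>diff_int \<mu> (\<eta> m) (fst g) * diff_int \<mu> (\<eta> m) (snd g)\<bar> \<partial>R)"
      and mass': "(\<integral>\<^sup>+g. osc (E m) (fst g) * osc (E m) (snd g) \<partial>R) \<le> ennreal (rosc (E (Suc m)) f * d)"
      unfolding quadratic_majorant_def by (elim exE conjE)
    have mass: "(\<integral>\<^sup>+g. osc (E m) (fst g) * osc (E m) (snd g) \<partial>R) \<le> ennreal d"
      using mass' by (rule order_trans) (use Osc1_bdd_meas(2)[OF f] d in \<open>auto intro!: ennreal_leI mult_left_le_one_le rosc_nonneg\<close>)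
    let ?q = "\<lambda>g. osc (E m) (fst g) * osc (E m) (snd g)"
    let ?k = "\<lambda>N w g. diff_int (emp N m w) (\<eta> m) (fst g) * diff_int (emp N m w) (\<eta> m) (snd g)"
    let ?h = "\<lambda>N z. sqrt (real N) * ?k N (fst z) (snd z)"
    let ?U = "\<lambda>N w. enn2real (\<integral>\<^sup>+g. ennreal \<bar>?h N (w, g)\<bar> \<partial>R)"
    have gb: "fst g \<in> bdd_meas (E m)" "snd g \<in> bdd_meas (E m)" if "g \<in> space R" for g
      using subsetD[OF R(1) that] by (auto intro: Osc1_bdd_meas(1))
    have fin: "?q g < \<infinity>" if "g \<in> space R" for g
      using osc_finite[OF gb(1)[OF that]] osc_finite[OF gb(2)[OF that]] by (simp add: ennreal_mult_less_top)
    have jm: "(\<lambda>z. ?k N (fst z) (snd z)) \<in> borel_measurable (P N \<Otimes>\<^sub>M R)" if N: "N \<ge> 1" for N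
      using joint_quadratic[OF N R(1,2)] by (simp add: case_prod_unfold)
    have hm: "?h N \<in> borel_measurable (P N \<Otimes>\<^sub>M R)" if N: "N \<ge> 1" for N
      using jm[OF N] by simp
    have hq: "\<bar>?h N (w, g)\<bar> \<le> sqrt (real N) * enn2real (?q g)"
      if "N \<ge> 1" "w \<in> space (P N)" "g \<in> space R" for N w g
      using R_integrand[OF R(1) that] by simp
    have sub: "subg (P N) (C * (1 + d\<^sup>2)) (?U N)" if N: "N \<ge> 1" for N
    proof (rule mixture_subg[OF prob_P[OF N] hm[OF N] R(3) fin mass d _ hq[OF N] C])
      fix g assume g: "g \<in> space R" "0 < ?q g"
      note gb = gb[OF g(1)]
      have pos: "rosc (E m) (fst g) > 0" "rosc (E m) (snd g) > 0"
        using g(2) osc_eq_rosc[OF gb(1)] osc_eq_rosc[OF gb(2)] by (auto simp: zero_less_iff_neq_zero ennreal_eq_0_iff not_le)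
      show "subg (P N) C (Wd N m (\<lambda>x. (1 / rosc (E m) (fst g)) * fst g x))"
        using W N Osc1_normalize[OF gb(1) order_refl pos(1)] unfolding subgW_def by blast
      fix w assume w: "w \<in> space (P N)"
      have "\<bar>?h N (w, g)\<bar> / enn2real (?q g) = (sqrt (real N) * \<bar>diff_int (emp N m w) (\<eta> m) (fst g)\<bar> / rosc (E m) (fst g))
          * (\<bar>diff_int (emp N m w) (\<eta> m) (snd g)\<bar> / rosc (E m) (snd g))"
        unfolding enn2real_mult rosc_def[symmetric] by (simp add: abs_mult)
      also have "\<dots> = \<bar>Wd N m (\<lambda>x. (1 / rosc (E m) (fst g)) * fst g x) w\<bar>
          * (\<bar>diff_int (emp N m w) (\<eta> m) (snd g)\<bar> / rosc (E m) (snd g))"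
        unfolding normalized_Wd[OF N w gb(1) pos(1)] ..
      also have "\<dots> \<le> \<bar>Wd N m (\<lambda>x. (1 / rosc (E m) (fst g)) * fst g x) w\<bar> * 1"
        using diff_int_bound[OF emp_probs[OF N w] flow_probs gb(2)] pos(2) by (intro mult_left_mono) auto
      finally show "\<bar>?h N (w, g)\<bar> / enn2real (?q g) \<le> \<bar>Wd N m (\<lambda>x. (1 / rosc (E m) (fst g)) * fst g x) w\<bar>" by simp
    qed auto
    have le: "sqrt (real N) * \<bar>Rem N m f w\<bar> \<le> ?U N w"
      if N: "N \<ge> 1" and w: "w \<in> space (P N)" for N w
    proof -
      have m1: "?k N w \<in> borel_measurable R"
        using measurable_compose[OF measurable_Pair1'[OF w] jm[OF N]] by simp
      have fin1: "(\<integral>\<^sup>+g. ennreal \<bar>?h N (w, g)\<bar> \<partial>R) \<le> ennreal (sqrt (real N) * d)"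
        by (rule mixture_bound[OF R(3) fin mass d _ hq[OF N w]]) simp_all
      show ?thesis
        using scaled_mixture_le[OF m1 _ abs_ge_zero dom[rule_format, OF emp_probs[OF N w]], of "sqrt (real N)", OF _ fin1[unfolded fst_conv snd_conv]]
        by simp
    qed
    show "\<exists>U. \<forall>N\<ge>1. subg (P N) (C * (1 + d\<^sup>2)) (U N) \<and>
      (\<forall>w\<in>space (P N). sqrt (real N) * \<bar>Rem N m f w\<bar> \<le> U N w)"
      by (intro exI[of _ ?U] allI impI conjI ballI sub le)
  qed
qed

text \<open>The constants of the two mixtures depend on the model only, so subgaussianity propagates in time.\<close>

lemma subgW_ex: "\<exists>C. subgW n C"
proof (induction n)
  case 0
  have "subg (P N) 2 (Wd N 0 g)" if N: "N \<ge> 1" and g: "g \<in> Osc1 (E 0)" for N g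
  proof -
    have e: "(\<integral>\<^sup>+w. ennreal (exp (t * \<bar>Wd N 0 g w\<bar>)) \<partial>P N) = (\<integral>\<^sup>+w. ennreal (exp (t * \<bar>Vint N 0 g w\<bar>)) \<partial>P N)" for t
      using Wd_0[OF N _ Osc1_bdd_meas(1)[OF g]] by (intro nn_integral_cong) simp
    show ?thesis
      using Vint_subg[OF N g] Wd_bdd[OF N Osc1_bdd_meas(1)[OF g]] unfolding subg_def e by blast
  qed
  then show ?case unfolding subgW_def by (intro exI[of _ 2]) simp
next
  case (Suc m)
  then obtain C where W: "subgW m C" ..
  have C: "C \<ge> 1" using W unfolding subgW_def by blast
  obtain C' where C': "C' \<ge> 1" and mix: "\<forall>f\<in>Osc1 (E (Suc m)). \<exists>U. \<forall>N\<ge>1. subg (P N) C' (U N) \<and>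
    (\<forall>w\<in>space (P N). sqrt (real N) * \<bar>Rem N m f w\<bar> \<le> U N w)"
    using R_mixture[OF W] by (elim exE conjE)
  obtain \<beta> where \<beta>: "\<beta> \<ge> 0" "\<And>f. f \<in> bdd_meas (E (Suc m)) \<Longrightarrow> rosc (E m) (Dstep (Suc m) f) \<le> \<beta> * rosc (E (Suc m)) f"
    by (rule bounded_op_rosc[OF bounded_op_Dstep[of m]]) blast
  \<comment> \<open>\<open>Wd_subg\<close> normalises by this number, which must be positive even if
    \<open>\<beta>\<close> is 0.\<close>
  let ?b = "\<beta> + 1"
  let ?C1 = "4 * (2 + C * (1 + ?b\<^sup>2))"
  have C1: "C * (1 + ?b\<^sup>2) \<ge> 1" using C mult_mono[of 1 C 1 "1 + ?b\<^sup>2"] by simp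
  have "subg (P N) (4 * (?C1 + C')) (Wd N (Suc m) g)" if N: "N \<ge> 1" and g: "g \<in> Osc1 (E (Suc m))" for N g
  proof -
    note gb = Osc1_bdd_meas[OF g]
    have Dg: "Dstep (Suc m) g \<in> bdd_meas (E m)" by (rule bounded_op_bdd[OF bounded_op_Dstep gb(1)])
    have "\<beta> * rosc (E (Suc m)) g \<le> \<beta> * 1" by (intro mult_left_mono gb \<beta>)
    then have "rosc (E m) (Dstep (Suc m) g) \<le> ?b" using \<beta>(2)[OF gb(1)] by linarith
    then have 1: "subg (P N) (C * (1 + ?b\<^sup>2)) (Wd N m (Dstep (Suc m) g))"
      using \<beta>(1) by (intro Wd_subg[OF W N Dg]) auto
    have S: "(\<lambda>w. Vint N (Suc m) g w + Wd N m (Dstep (Suc m) g) w) \<in> bdd_meas (P N)"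
      by (intro bdd_meas_add Wd_bdd[OF N Dg] Vint_bdd[OF N gb(1) carries_P[OF N]])
    have 2: "subg (P N) ?C1 (\<lambda>w. Vint N (Suc m) g w + Wd N m (Dstep (Suc m) g) w)"
      by (rule subg_add[OF Vint_subg[OF N g] 1 _ C1 S]) (auto simp: abs_triangle_ineq)
    from mix[rule_format, OF g] obtain U where U: "\<forall>N\<ge>1. subg (P N) C' (U N) \<and>
      (\<forall>w\<in>space (P N). sqrt (real N) * \<bar>Rem N m g w\<bar> \<le> U N w)" ..
    have U1: "subg (P N) C' (U N)" using U N by blast
    show ?thesis
    proof (rule subg_add[OF 2 U1 _ C' Wd_bdd[OF N gb(1)]])
      show "1 \<le> ?C1" using C1 by simp
      fix w assume w: "w \<in> space (P N)"
      have "sqrt (real N) * \<bar>Rem N m g w\<bar> \<le> U N w" using U N w by blast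
      then have "\<bar>sqrt (real N) * Rem N m g w\<bar> \<le> \<bar>U N w\<bar>" by (simp add: abs_mult)
      then show "\<bar>Wd N (Suc m) g w\<bar> \<le> \<bar>Vint N (Suc m) g w + Wd N m (Dstep (Suc m) g) w\<bar> + \<bar>U N w\<bar>"
        unfolding Wd_Suc[OF N w gb(1)] by linarith
    qed
  qed
  moreover have "4 * (?C1 + C') \<ge> 1" using C1 C' by simp
  ultimately show ?case unfolding subgW_def by blast
qed

end

locale particle_scale = particle_model E K \<eta>0 D P \<xi> + exp_scale P \<alpha>
  for E :: "nat \<Rightarrow> 'a measure" and K \<eta>0 D and P :: "nat \<Rightarrow> 'w measure" and \<xi> \<alpha> +
  assumes alpha_N: "(\<lambda>N. \<alpha> N / real N) \<longlonglongrightarrow> 0"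
begin

section \<open>Cumulants of the particle fields at the moderate scale\<close>

lemma const_over_scale: "\<forall>\<^sub>F N in sequentially. a / \<alpha> N \<le> e" if "e > 0"
proof -
  have "((\<lambda>N. a / \<alpha> N) \<longlongrightarrow> 0) sequentially" by (rule real_tendsto_divide_at_top[OF tendsto_const \<alpha>_top])
  from order_tendstoD(2)[OF this that] show ?thesis by eventually_elim simp
qed

lemma scale_small: "(\<lambda>N. c * sqrt (\<alpha> N / real N)) \<longlonglongrightarrow> 0"
  using tendsto_mult[OF tendsto_const[of c] tendsto_real_sqrt[OF alpha_N]] by simp

lemma lmgf_cong:
  assumes N: "N \<ge> 1" and X: "X \<in> bdd_meas (P N)" and Y: "Y \<in> bdd_meas (P N)"
    and eq: "\<And>w. w \<in> space (P N) \<Longrightarrow> X w = Y w"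
  shows "lmgf N X = lmgf N Y"
  using eq by (intro antisym lmgf_mono N X Y) auto

lemma lmgf_const: "N \<ge> 1 \<Longrightarrow> lmgf N (\<lambda>_. c) = c"
proof -
  assume N: "N \<ge> 1"
  interpret prob_space "P N" by (rule P[OF N])
  show ?thesis unfolding lmgf_def log_mgf_def using \<alpha>_pos[OF N] by (simp add: prob_space)
qed

lemma lmgf_add_const: "N \<ge> 1 \<Longrightarrow> X \<in> bdd_meas (P N) \<Longrightarrow> lmgf N (\<lambda>w. X w + c) = lmgf N X + c"
  using prob_space.log_mgf_add_const[OF P[of N] bdd_meas_cmult[of X "P N" "\<alpha> N"], of "\<alpha> N * c"] \<alpha>_pos[of N]
  unfolding lmgf_def by (simp add: distrib_left add_divide_distrib)

lemma negligible_cong: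
  assumes r: "negligible_seq r" and u: "rvs u" and eq: "\<And>N w. N \<ge> 1 \<Longrightarrow> w \<in> space (P N) \<Longrightarrow> u N w = r N w"
  shows "negligible_seq u"
  unfolding negligible_seq_def
proof (intro conjI allI impI u)
  have rr: "rvs r" using r unfolding negligible_seq_def by blast
  fix L e :: real assume "e > 0"
  then have "\<forall>\<^sub>F N in sequentially. lmgf N (\<lambda>w. L * r N w) \<le> e" using r unfolding negligible_seq_def by blast
  then show "\<forall>\<^sub>F N in sequentially. lmgf N (\<lambda>w. L * u N w) \<le> e"
    using eventually_ge_at_top[of 1]
  proof eventually_elim
    case (elim N)
    have "lmgf N (\<lambda>w. L * u N w) = lmgf N (\<lambda>w. L * r N w)"
      using eq[OF elim(2)] by (intro lmgf_cong elim bdd_meas_cmult rvsD[OF u] rvsD[OF rr]) auto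
    then show ?case using elim by simp
  qed
qed

lemma negligible_deterministic:
  assumes r: "rvs r" and b: "b \<longlonglongrightarrow> 0"
    and le: "\<forall>\<^sub>F N in sequentially. \<forall>w\<in>space (P N). \<bar>r N w\<bar> \<le> b N"
  shows "negligible_seq r"
  unfolding negligible_seq_def
proof (intro conjI allI impI r)
  fix L e :: real assume e: "e > 0"
  have "(\<lambda>N. \<bar>L\<bar> * b N) \<longlonglongrightarrow> 0" using tendsto_mult[OF tendsto_const[of "\<bar>L\<bar>"] b] by simp
  from order_tendstoD(2)[OF this e] le show "\<forall>\<^sub>F N in sequentially. lmgf N (\<lambda>w. L * r N w) \<le> e"
    using eventually_ge_at_top[of 1]
  proof eventually_elim
    case (elim N)
    have "lmgf N (\<lambda>w. L * r N w) \<le> lmgf N (\<lambda>w. \<bar>L\<bar> * b N)"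
    proof (intro lmgf_mono elim bdd_meas_cmult rvsD[OF r] bdd_meas_const)
      fix w assume "w \<in> space (P N)"
      then have "\<bar>L\<bar> * \<bar>r N w\<bar> \<le> \<bar>L\<bar> * b N" using elim(2) by (intro mult_left_mono) auto
      then show "L * r N w \<le> \<bar>L\<bar> * b N" unfolding abs_mult[symmetric] by linarith
    qed
    then show ?case using elim lmgf_const[OF elim(3)] by simp
  qed
qed

text \<open>The subgaussian bound at exponent \<open>\<alpha> N * \<bar>L\<bar> / sqrt N\<close>
  gives a scaled cumulant of at most
  \<open>ln C / \<alpha> N + C * L\<^sup>2 * (\<alpha> N / N)\<close>. The first term vanishes as
  the speed grows, the second as it stays below \<open>N\<close>.\<close>

lemma negligible_subg:
  assumes U: "\<And>N. N \<ge> 1 \<Longrightarrow> subg (P N) C (U N)" and C: "C \<ge> 1" and r: "rvs r"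
    and le: "\<And>N w. N \<ge> 1 \<Longrightarrow> w \<in> space (P N) \<Longrightarrow> sqrt (real N) * \<bar>r N w\<bar> \<le> \<bar>U N w\<bar>"
  shows "negligible_seq r"
  unfolding negligible_seq_def
proof (intro conjI allI impI r)
  fix L e :: real assume e: "e > 0"
  have "(\<lambda>N. C * L\<^sup>2 * (\<alpha> N / real N)) \<longlonglongrightarrow> 0"
    using tendsto_mult[OF tendsto_const[of "C * L\<^sup>2"] alpha_N] by simp
  from order_tendstoD(2)[OF this, of "e / 2"] e have "\<forall>\<^sub>F N in sequentially. C * L\<^sup>2 * (\<alpha> N / real N) < e / 2" by simp
  moreover have "\<forall>\<^sub>F N in sequentially. ln C / \<alpha> N \<le> e / 2" using e by (intro const_over_scale) simp
  ultimately show "\<forall>\<^sub>F N in sequentially. lmgf N (\<lambda>w. L * r N w) \<le> e"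
    using eventually_ge_at_top[of 1]
  proof eventually_elim
    case (elim N)
    note N = elim(3)
    let ?s = "\<alpha> N * \<bar>L\<bar> / sqrt (real N)"
    have "lmgf N (\<lambda>w. L * r N w) \<le> ln C / \<alpha> N + C * L\<^sup>2 * (\<alpha> N / real N)"
    proof (rule lmgf_le[OF N bdd_meas_cmult[OF rvsD[OF r N]]])
      have "(\<integral>\<^sup>+w. ennreal (exp (\<alpha> N * (L * r N w))) \<partial>P N) \<le> (\<integral>\<^sup>+w. ennreal (exp (?s * \<bar>U N w\<bar>)) \<partial>P N)"
      proof (intro nn_integral_mono ennreal_leI)
        fix w assume w: "w \<in> space (P N)"
        have "\<alpha> N * (L * r N w) \<le> \<alpha> N * (\<bar>L\<bar> * \<bar>r N w\<bar>)"
          using \<alpha>_pos[OF N] by (intro mult_left_mono) (auto simp: abs_mult[symmetric])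
        also have "\<dots> = ?s * (sqrt (real N) * \<bar>r N w\<bar>)" using N by simp
        also have "\<dots> \<le> ?s * \<bar>U N w\<bar>" using \<alpha>_pos[OF N] by (intro mult_left_mono le[OF N w]) auto
        finally show "exp (\<alpha> N * (L * r N w)) \<le> exp (?s * \<bar>U N w\<bar>)" by simp
      qed
      also have "\<dots> \<le> ennreal (C * exp (C * ?s\<^sup>2))" using \<alpha>_pos[OF N] by (intro subgD[OF U[OF N]]) auto
      also have "C * exp (C * ?s\<^sup>2) = exp (ln C + C * ?s\<^sup>2)" using C by (simp add: exp_add)
      also have "ln C + C * ?s\<^sup>2 = \<alpha> N * (ln C / \<alpha> N + C * L\<^sup>2 * (\<alpha> N / real N))"
        using \<alpha>_pos[OF N] N by (simp add: power_divide power_mult_distrib power2_eq_square[of "\<alpha> N"] field_simps)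
      finally show "(\<integral>\<^sup>+w. ennreal (exp (\<alpha> N * (L * r N w))) \<partial>P N)
          \<le> ennreal (exp (\<alpha> N * (ln C / \<alpha> N + C * L\<^sup>2 * (\<alpha> N / real N))))" .
    qed
    then show ?case using elim by linarith
  qed
qed

text \<open>The remainder is quadratic in \<open>W\<close>, so exponentials of its square-root scale are controlled by
  Gaussian square-exponential moments.\<close>

lemma negligible_Rem:
  assumes f: "f \<in> bdd_meas (E (Suc m))"
  shows "negligible_seq (\<lambda>N w. sqrt (real N / \<alpha> N) * Rem N m f w)"
proof -
  obtain C where W: "subgW m C" using subgW_ex by blast
  have C: "C \<ge> 1" using W unfolding subgW_def by blast
  obtain d0 where d0: "d0 \<ge> 0" and ex: "\<forall>f\<in>bdd_meas (E (Suc m)). \<exists>R. quadratic_majorant m f (rosc (E (Suc m)) f * d0) R"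
    using quadratic_majorant_ex[of m] by (elim exE conjE)
  define d where "d = rosc (E (Suc m)) f * d0"
  have d: "d \<ge> 0" unfolding d_def by (intro mult_nonneg_nonneg d0 rosc_nonneg)
  from ex[rule_format, OF f] obtain R :: "(('a \<Rightarrow> real) \<times> ('a \<Rightarrow> real)) measure" where
    R: "space R \<subseteq> Osc1 (E m) \<times> Osc1 (E m)"
      "(\<lambda>((x, y), (g1, g2)). g1 x * g2 y) \<in> borel_measurable ((E m \<Otimes>\<^sub>M E m) \<Otimes>\<^sub>M R)"
      "(\<lambda>g. osc (E m) (fst g) * osc (E m) (snd g)) \<in> borel_measurable R"
    and dom: "\<forall>\<mu>\<in>probs (E m). ennreal \<bar>remainder (E (Suc m)) (Phi K (Suc m)) (D (Suc m)) \<mu> (\<eta> m) f\<bar>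
      \<le> (\<integral>\<^sup>+g. ennreal \<bar>diff_int \<mu> (\<eta> m) (fst g) * diff_int \<mu> (\<eta> m) (snd g)\<bar> \<partial>R)"
    and mass: "(\<integral>\<^sup>+g. osc (E m) (fst g) * osc (E m) (snd g) \<partial>R) \<le> ennreal d"
    unfolding d_def quadratic_majorant_def by (elim exE conjE)
  let ?q = "\<lambda>g. osc (E m) (fst g) * osc (E m) (snd g)"
  let ?k = "\<lambda>N w g. diff_int (emp N m w) (\<eta> m) (fst g) * diff_int (emp N m w) (\<eta> m) (snd g)"
  let ?h = "\<lambda>N z. real N * ?k N (fst z) (snd z)"
  let ?M = "\<lambda>N w. enn2real (\<integral>\<^sup>+g. ennreal \<bar>?h N (w, g)\<bar> \<partial>R)"
  have gb: "fst g \<in> bdd_meas (E m)" "snd g \<in> bdd_meas (E m)" if "g \<in> space R" for g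
    using subsetD[OF R(1) that] by (auto intro: Osc1_bdd_meas(1))
  have fin: "?q g < \<infinity>" if "g \<in> space R" for g
    using osc_finite[OF gb(1)[OF that]] osc_finite[OF gb(2)[OF that]] by (simp add: ennreal_mult_less_top)
  have jm: "(\<lambda>z. ?k N (fst z) (snd z)) \<in> borel_measurable (P N \<Otimes>\<^sub>M R)" if N: "N \<ge> 1" for N
    using joint_quadratic[OF N R(1,2)] by (simp add: case_prod_unfold)
  have hm: "?h N \<in> borel_measurable (P N \<Otimes>\<^sub>M R)" if N: "N \<ge> 1" for N
    using jm[OF N] by simp
  have hq: "\<bar>?h N (w, g)\<bar> \<le> real N * enn2real (?q g)"
    if "N \<ge> 1" "w \<in> space (P N)" "g \<in> space R" for N w g
    using R_integrand[OF R(1) that, of "real N"] by simp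
  have le: "real N * \<bar>Rem N m f w\<bar> \<le> ?M N w"
    if N: "N \<ge> 1" and w: "w \<in> space (P N)" for N w
  proof -
    have m1: "?k N w \<in> borel_measurable R"
      using measurable_compose[OF measurable_Pair1'[OF w] jm[OF N]] by simp
    have fin1: "(\<integral>\<^sup>+g. ennreal \<bar>?h N (w, g)\<bar> \<partial>R) \<le> ennreal (real N * d)"
      by (rule mixture_bound[OF R(3) fin mass d _ hq[OF N w]]) simp_all
    show ?thesis
      using scaled_mixture_le[OF m1 _ abs_ge_zero dom[rule_format, OF emp_probs[OF N w]], of "real N", OF _ fin1[unfolded fst_conv snd_conv]]
      by simp
  qed
  have rv: "rvs (\<lambda>N w. sqrt (real N / \<alpha> N) * Rem N m f w)"
    unfolding rvs_def by (intro allI impI bdd_meas_cmult Rem_bdd f)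
  show ?thesis
    unfolding negligible_seq_def
  proof (intro conjI allI impI rv)
    fix L e :: real assume e: "e > 0"
    let ?B = "square_const C"
    have B: "?B \<ge> 1" unfolding square_const_def by simp
    \<comment> \<open>\<open>1 / (32 * C)\<close> is the exponent at which squares of the fields
      have uniformly bounded exponential moments.\<close>
    have "\<forall>\<^sub>F N in sequentially. (\<bar>L\<bar> * d) * sqrt (\<alpha> N / real N) < 1 / (32 * C)"
      using order_tendstoD(2)[OF scale_small, of "1 / (32 * C)" "\<bar>L\<bar> * d"] C by simp
    then show "\<forall>\<^sub>F N in sequentially. lmgf N (\<lambda>w. L * (sqrt (real N / \<alpha> N) * Rem N m f w)) \<le> e"
      using const_over_scale[OF e, of "ln ?B"] eventually_ge_at_top[of 1]
    proof eventually_elim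
      case (elim N)
      note N = elim(3)
      let ?s = "\<bar>L\<bar> * sqrt (\<alpha> N / real N)"
      have s: "?s \<ge> 0" by (simp add: \<alpha>_pos[OF N, THEN less_imp_le])
      have sd: "?s * d \<le> 1 / (32 * C)" using elim(1) by (simp add: mult_ac)
      have "lmgf N (\<lambda>w. L * (sqrt (real N / \<alpha> N) * Rem N m f w)) \<le> ln ?B / \<alpha> N"
      proof (rule lmgf_le[OF N bdd_meas_cmult[OF rvsD[OF rv N]]])
        have "(\<integral>\<^sup>+w. ennreal (exp (\<alpha> N * (L * (sqrt (real N / \<alpha> N) * Rem N m f w)))) \<partial>P N)
            \<le> (\<integral>\<^sup>+w. ennreal (exp (?s * ?M N w)) \<partial>P N)"
        proof (intro nn_integral_mono ennreal_leI)
          fix w assume w: "w \<in> space (P N)"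
          \<comment> \<open>In exponential scale the quantity \<open>N * Rem\<close> receives the
            small weight \<open>sqrt (\<alpha> N / N)\<close>; this is where the slow growth of
            \<open>\<alpha>\<close> compared with \<open>N\<close> enters.\<close>
          have "\<alpha> N * sqrt (real N / \<alpha> N) = sqrt (\<alpha> N / real N) * real N"
          proof -
            define x y where "x = sqrt (\<alpha> N)" and "y = sqrt (real N)"
            have a: "\<alpha> N = x * x" "real N = y * y" "x > 0" "y > 0"
              unfolding x_def y_def using \<alpha>_pos[OF N] N by simp_all
            have r: "sqrt (real N / \<alpha> N) = y / x" "sqrt (\<alpha> N / real N) = x / y"
              unfolding x_def y_def by (rule real_sqrt_divide)+
            show ?thesis unfolding r unfolding a(1,2) using a(3,4) by simp
          qed
          then have "\<alpha> N * (L * (sqrt (real N / \<alpha> N) * Rem N m f w)) = sqrt (\<alpha> N / real N) * real N * (L * Rem N m f w)"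
            by (metis mult.assoc mult.left_commute)
          also have "\<dots> \<le> sqrt (\<alpha> N / real N) * real N * (\<bar>L\<bar> * \<bar>Rem N m f w\<bar>)"
            using \<alpha>_pos[OF N] by (intro mult_left_mono) (auto simp: abs_mult[symmetric])
          also have "\<dots> = ?s * (real N * \<bar>Rem N m f w\<bar>)" by simp
          also have "\<dots> \<le> ?s * ?M N w" by (intro mult_left_mono le[OF N w] s)
          finally show "exp (\<alpha> N * (L * (sqrt (real N / \<alpha> N) * Rem N m f w))) \<le> exp (?s * ?M N w)" by simp
        qed
        also have "\<dots> \<le> ennreal ?B"
        proof (rule mixture_exp_bound[OF prob_P[OF N] hm[OF N] R(3) fin mass d _ hq[OF N] s B])
          fix g assume g: "g \<in> space R" "0 < ?q g"
          note gb = gb[OF g(1)]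
          have pos: "rosc (E m) (fst g) > 0" "rosc (E m) (snd g) > 0"
            using g(2) osc_eq_rosc[OF gb(1)] osc_eq_rosc[OF gb(2)]
            by (auto simp: zero_less_iff_neq_zero ennreal_eq_0_iff not_le)
          let ?w1 = "Wd N m (\<lambda>x. (1 / rosc (E m) (fst g)) * fst g x)"
          let ?w2 = "Wd N m (\<lambda>x. (1 / rosc (E m) (snd g)) * snd g x)"
          have S: "subg (P N) C ?w1" "subg (P N) C ?w2"
            using W N Osc1_normalize[OF gb(1) order_refl pos(1)] Osc1_normalize[OF gb(2) order_refl pos(2)]
            unfolding subgW_def by blast+
          note [measurable] = S[THEN subg_bdd, THEN bdd_meas_measurable]
          have "(\<integral>\<^sup>+w. ennreal (exp (?s * d * (\<bar>?h N (w, g)\<bar> / enn2real (?q g)))) \<partial>P N)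
              \<le> (\<integral>\<^sup>+w. ennreal (1 / 2) * ennreal (exp ((?w1 w)\<^sup>2 / (32 * C))) + ennreal (1 / 2) * ennreal (exp ((?w2 w)\<^sup>2 / (32 * C))) \<partial>P N)"
          proof (rule nn_integral_mono)
            fix w assume w: "w \<in> space (P N)"
            have "\<bar>?h N (w, g)\<bar> / enn2real (?q g) = (sqrt (real N) * \<bar>diff_int (emp N m w) (\<eta> m) (fst g)\<bar> / rosc (E m) (fst g))
                * (sqrt (real N) * \<bar>diff_int (emp N m w) (\<eta> m) (snd g)\<bar> / rosc (E m) (snd g))"
              unfolding enn2real_mult rosc_def[symmetric] by (simp add: abs_mult)
            also have "\<dots> = \<bar>?w1 w\<bar> * \<bar>?w2 w\<bar>"
              unfolding normalized_Wd[OF N w gb(1) pos(1)] normalized_Wd[OF N w gb(2) pos(2)] ..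
            finally have eq: "\<bar>?h N (w, g)\<bar> / enn2real (?q g) = \<bar>?w1 w\<bar> * \<bar>?w2 w\<bar>" .
            let ?a = "(?w1 w)\<^sup>2 / (32 * C)" and ?b = "(?w2 w)\<^sup>2 / (32 * C)"
            \<comment> \<open>The product of the two normalised fields is at most the mean of their
              squares. Convexity then separates the exponentials, so no joint law of the two fields
              is needed.\<close>
            have "?s * d * (\<bar>?w1 w\<bar> * \<bar>?w2 w\<bar>) \<le> 1 / (32 * C) * (((?w1 w)\<^sup>2 + (?w2 w)\<^sup>2) / 2)"
            proof (intro mult_mono sd)
              show "\<bar>?w1 w\<bar> * \<bar>?w2 w\<bar> \<le> ((?w1 w)\<^sup>2 + (?w2 w)\<^sup>2) / 2"
                using sum_squares_bound[of "\<bar>?w1 w\<bar>" "\<bar>?w2 w\<bar>"] by simp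
            qed (use C in auto)
            also have "\<dots> = ?a / 2 + ?b / 2" by (simp add: add_divide_distrib)
            finally have "exp (?s * d * (\<bar>?h N (w, g)\<bar> / enn2real (?q g))) \<le> exp (?a / 2) * exp (?b / 2)"
              unfolding eq exp_add[symmetric] by simp
            also have "\<dots> \<le> ((exp (?a / 2))\<^sup>2 + (exp (?b / 2))\<^sup>2) / 2"
              using sum_squares_bound[of "exp (?a / 2)" "exp (?b / 2)"] by simp
            also have "\<dots> = 1 / 2 * exp ?a + 1 / 2 * exp ?b"
              by (simp add: power2_eq_square exp_add[symmetric] add_divide_distrib)
            finally have "ennreal (exp (?s * d * (\<bar>?h N (w, g)\<bar> / enn2real (?q g)))) \<le> ennreal (1 / 2 * exp ?a + 1 / 2 * exp ?b)"
              by (rule ennreal_leI)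
            also have "\<dots> = ennreal (1 / 2 * exp ?a) + ennreal (1 / 2 * exp ?b)" by (rule ennreal_plus) simp_all
            also have "\<dots> = ennreal (1 / 2) * ennreal (exp ?a) + ennreal (1 / 2) * ennreal (exp ?b)"
              by (intro arg_cong2[of _ _ _ _ "(+)"] ennreal_mult) simp_all
            finally show "ennreal (exp (?s * d * (\<bar>?h N (w, g)\<bar> / enn2real (?q g)))) \<le>
                ennreal (1 / 2) * ennreal (exp ?a) + ennreal (1 / 2) * ennreal (exp ?b)" .
          qed
          also have "\<dots> = (\<integral>\<^sup>+w. ennreal (1 / 2) * ennreal (exp ((?w1 w)\<^sup>2 / (32 * C))) \<partial>P N)
              + (\<integral>\<^sup>+w. ennreal (1 / 2) * ennreal (exp ((?w2 w)\<^sup>2 / (32 * C))) \<partial>P N)"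
            by (intro nn_integral_add; measurable)
          also have "\<dots> = ennreal (1 / 2) * (\<integral>\<^sup>+w. ennreal (exp ((?w1 w)\<^sup>2 / (32 * C))) \<partial>P N)
              + ennreal (1 / 2) * (\<integral>\<^sup>+w. ennreal (exp ((?w2 w)\<^sup>2 / (32 * C))) \<partial>P N)"
            by (intro arg_cong2[of _ _ _ _ "(+)"] nn_integral_cmult; measurable)
          also have "\<dots> \<le> ennreal (1 / 2) * ennreal ?B + ennreal (1 / 2) * ennreal ?B"
            by (intro add_mono mult_left_mono exp_square_bound[OF bdd_meas_measurable[OF subg_bdd[OF S(1)]] C subgD[OF S(1)]]
                exp_square_bound[OF bdd_meas_measurable[OF subg_bdd[OF S(2)]] C subgD[OF S(2)]]; simp)
          also have "\<dots> = ennreal (1 / 2 * ?B + 1 / 2 * ?B)"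
          proof -
            have "ennreal (1 / 2) * ennreal ?B = ennreal (1 / 2 * ?B)" using B by (intro ennreal_mult[symmetric]) auto
            then show ?thesis using B by (simp only:) (intro ennreal_plus[symmetric]; simp)
          qed
          finally show "(\<integral>\<^sup>+w. ennreal (exp (?s * d * (\<bar>?h N (w, g)\<bar> / enn2real (?q g)))) \<partial>P N) \<le> ennreal ?B" by simp
        qed auto
        also have "?B = exp (\<alpha> N * (ln ?B / \<alpha> N))" using B \<alpha>_pos[OF N] by simp
        finally show "(\<integral>\<^sup>+w. ennreal (exp (\<alpha> N * (L * (sqrt (real N / \<alpha> N) * Rem N m f w)))) \<partial>P N)
            \<le> ennreal (exp (\<alpha> N * (ln ?B / \<alpha> N)))" .
      qed
      then show ?case using elim(2) by linarith
    qed
  qed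
qed

end

context particle_scale
begin

section \<open>Conditional variances and their exponential concentration\<close>

lemma cvar_alt:
  assumes N: "N \<ge> 1" and w: "w \<in> space (P N)" and f: "f \<in> bdd_meas (E p)"
  shows "cvar N p f w = (\<Sum>i=1..N. (\<integral>y. f y * f y \<partial>pk N p i w) - (\<integral>y. f y \<partial>pk N p i w) * (\<integral>y. f y \<partial>pk N p i w)) / real N"
proof -
  have "(\<integral>y. (f y - (\<integral>z. f z \<partial>pk N p i w)) * (f y - (\<integral>z. f z \<partial>pk N p i w)) \<partial>pk N p i w)
      = (\<integral>y. f y * f y \<partial>pk N p i w) - (\<integral>y. f y \<partial>pk N p i w) * (\<integral>y. f y \<partial>pk N p i w)" if i: "i \<in> {1..N}" for i
  proof -
    interpret k: markov_kernel "P N" "E p" "pk N p i" by (rule pk_kernel[OF N carries_P[OF N] i])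
    show ?thesis using k.op_covariance[OF f f w] unfolding k.op_def .
  qed
  then show ?thesis unfolding cvar_def by simp
qed

lemma cvar_bdd:
  assumes N: "N \<ge> 1" and f: "f \<in> bdd_meas (E p)"
  shows "cvar N p f \<in> bdd_meas (P N)"
proof -
  let ?F = "\<lambda>w. (1 / real N) * (\<Sum>i=1..N. (\<integral>y. f y * f y \<partial>pk N p i w) - (\<integral>y. f y \<partial>pk N p i w) * (\<integral>y. f y \<partial>pk N p i w))"
  have b: "?F \<in> bdd_meas (P N)"
    by (intro bdd_meas_cmult bdd_meas_sum bdd_meas_diff bdd_meas_mult pk_bdd[OF N _ _ carries_P[OF N]] f)
  show ?thesis by (rule bdd_meas_cong[OF b]) (simp add: cvar_alt[OF N _ f])
qed

lemma cgf_bdd: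
  assumes N: "N \<ge> 1" and f: "f \<in> bdd_meas (E p)"
  shows "cgf N p f s \<in> bdd_meas (P N)"
proof (rule bdd_measI[where c = "\<Sum>i=1..N. \<bar>s\<bar> * rosc (E p) f"])
  let ?k = "\<lambda>i w. \<integral>y. f y \<partial>pk N p i w"
  let ?I = "\<lambda>i w. \<integral>y. exp (s * (f y - ?k i w)) \<partial>pk N p i w"
  have e: "?I i w = exp (- s * ?k i w) * (\<integral>y. exp (s * f y) \<partial>pk N p i w)" for i w
  proof -
    have "?I i w = (\<integral>y. exp (- s * ?k i w) * exp (s * f y) \<partial>pk N p i w)" by (simp add: exp_add[symmetric] algebra_simps)
    then show ?thesis by simp
  qed
  have [measurable]: "?k i \<in> borel_measurable (P N)" "(\<lambda>w. \<integral>y. exp (s * f y) \<partial>pk N p i w) \<in> borel_measurable (P N)"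
    if "i \<in> {1..N}" for i
    by (rule bdd_meas_measurable[OF pk_bdd[OF N that _ carries_P[OF N]]]; intro f bdd_meas_exp bdd_meas_cmult)+
  show "cgf N p f s \<in> borel_measurable (P N)" unfolding cgf_def[abs_def] e by measurable
  fix w assume w: "w \<in> space (P N)"
  show "\<bar>cgf N p f s w\<bar> \<le> (\<Sum>i=1..N. \<bar>s\<bar> * rosc (E p) f)"
    unfolding cgf_def
  proof (rule order_trans[OF sum_abs sum_mono])
    fix i assume i: "i \<in> {1..N}"
    note pr = pk_probs[OF N i w, of p]
    let ?r = "\<bar>s\<bar> * rosc (E p) f"
    have b: "(\<lambda>y. exp (s * (f y - ?k i w))) \<in> bdd_meas (E p)"
      by (intro bdd_meas_exp bdd_meas_cmult bdd_meas_diff f bdd_meas_const)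
    have d: "\<bar>s * (f y - ?k i w)\<bar> \<le> ?r" if "y \<in> space (E p)" for y
      unfolding abs_mult by (intro mult_left_mono pk_dev[OF N i w f that]) simp
    have "(\<integral>y. exp (- ?r) \<partial>pk N p i w) \<le> ?I i w"
    proof (rule probs_mono[OF pr bdd_meas_const b])
      fix y assume "y \<in> space (E p)" from d[OF this] show "exp (- ?r) \<le> exp (s * (f y - ?k i w))" by simp
    qed
    moreover have "?I i w \<le> (\<integral>y. exp ?r \<partial>pk N p i w)"
    proof (rule probs_mono[OF pr b bdd_meas_const])
      fix y assume "y \<in> space (E p)" from d[OF this] show "exp (s * (f y - ?k i w)) \<le> exp ?r" by simp
    qed
    ultimately have 1: "exp (- ?r) \<le> ?I i w" "?I i w \<le> exp ?r" unfolding probs_const[OF pr] .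
    have 2: "0 < ?I i w" using less_le_trans[OF exp_gt_zero 1(1)] .
    have "- ?r \<le> ln (?I i w)" using ln_le_cancel_iff[OF exp_gt_zero 2] 1(1) by simp
    moreover have "ln (?I i w) \<le> ?r" using ln_le_cancel_iff[OF 2 exp_gt_zero] 1(2) by simp
    ultimately show "\<bar>ln (?I i w)\<bar> \<le> ?r" by linarith
  qed
qed

definition usubg :: "(nat \<Rightarrow> 'w \<Rightarrow> real) \<Rightarrow> bool" where
  "usubg U \<longleftrightarrow> (\<exists>C\<ge>1. \<forall>N\<ge>1. subg (P N) C (U N))"

lemma usubg_add:
  assumes "usubg U" "usubg V"
  shows "usubg (\<lambda>N w. \<bar>U N w\<bar> + \<bar>V N w\<bar>)"
proof -
  obtain C C' where C: "C \<ge> 1" "C' \<ge> 1" and U: "\<forall>N\<ge>1. subg (P N) C (U N)" and V: "\<forall>N\<ge>1. subg (P N) C' (V N)"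
    using assms unfolding usubg_def by (elim exE conjE)
  have "subg (P N) (4 * (C + C')) (\<lambda>w. \<bar>U N w\<bar> + \<bar>V N w\<bar>)" if N: "N \<ge> 1" for N
  proof (rule subg_add[OF U[rule_format, OF N] V[rule_format, OF N] C])
    note b = subg_bdd[OF U[rule_format, OF N]] subg_bdd[OF V[rule_format, OF N]]
    note [measurable] = b[THEN bdd_meas_measurable]
    obtain c where c: "\<And>x. x \<in> space (P N) \<Longrightarrow> \<bar>U N x\<bar> \<le> c" using b(1) by (rule bdd_measE) blast
    obtain c' where c': "\<And>x. x \<in> space (P N) \<Longrightarrow> \<bar>V N x\<bar> \<le> c'" using b(2) by (rule bdd_measE) blast
    show "(\<lambda>w. \<bar>U N w\<bar> + \<bar>V N w\<bar>) \<in> bdd_meas (P N)"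
    proof (rule bdd_measI)
      fix x assume "x \<in> space (P N)"
      from c[OF this] c'[OF this] show "\<bar>\<bar>U N x\<bar> + \<bar>V N x\<bar>\<bar> \<le> c + c'" by linarith
    qed measurable
  qed simp
  moreover have "4 * (C + C') \<ge> 1" using C by simp
  ultimately show ?thesis unfolding usubg_def by blast
qed

lemma usubg_scale:
  assumes U: "usubg U" and V: "rvs V" and b: "b \<ge> 0"
    and le: "\<And>N w. N \<ge> 1 \<Longrightarrow> w \<in> space (P N) \<Longrightarrow> \<bar>V N w\<bar> \<le> b * \<bar>U N w\<bar>"
  shows "usubg V"
proof -
  obtain C where C: "C \<ge> 1" and U: "\<forall>N\<ge>1. subg (P N) C (U N)" using U unfolding usubg_def by (elim exE conjE)
  have "subg (P N) (C * (1 + b\<^sup>2)) (V N)" if N: "N \<ge> 1" for N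
    by (rule subg_scale[OF U[rule_format, OF N] C rvsD[OF V N] b le[OF N] order_refl])
  moreover have "C * (1 + b\<^sup>2) \<ge> 1" using C mult_mono[of 1 C 1 "1 + b\<^sup>2"] by simp
  ultimately show ?thesis unfolding usubg_def by blast
qed

lemma usubg_Wd: "g \<in> bdd_meas (E m) \<Longrightarrow> usubg (\<lambda>N. Wd N m g)"
proof -
  assume g: "g \<in> bdd_meas (E m)"
  obtain C where W: "subgW m C" using subgW_ex by blast
  have C: "C \<ge> 1" using W unfolding subgW_def by blast
  let ?b = "rosc (E m) g + 1"
  have "C * (1 + ?b\<^sup>2) \<ge> 1" using C mult_mono[of 1 C 1 "1 + ?b\<^sup>2"] by simp
  moreover have "subg (P N) (C * (1 + ?b\<^sup>2)) (Wd N m g)" if "N \<ge> 1" for N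
    using rosc_nonneg[of "E m" g] by (intro Wd_subg[OF W that g]) linarith+
  ultimately show ?thesis unfolding usubg_def by blast
qed

lemma usubg_Vint: "g \<in> bdd_meas (E p) \<Longrightarrow> usubg (\<lambda>N. Vint N p g)"
proof -
  assume g: "g \<in> bdd_meas (E p)"
  let ?b = "rosc (E p) g + 1"
  have b: "rosc (E p) g \<le> ?b" "?b > 0" using rosc_nonneg[of "E p" g] by linarith+
  have "usubg (\<lambda>N. Vint N p (\<lambda>x. (1 / ?b) * g x))"
    unfolding usubg_def using Vint_subg[OF _ Osc1_normalize[OF g b]] by (intro exI[of _ 2]) auto
  then show ?thesis
  proof (rule usubg_scale)
    show "rvs (\<lambda>N. Vint N p g)" unfolding rvs_def using Vint_bdd[OF _ g carries_P] by blast
    fix N w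
    have "(\<Sum>i=1..N. (1 / ?b) * g (\<xi> N p i w) - (\<integral>y. (1 / ?b) * g y \<partial>pk N p i w))
        = (1 / ?b) * (\<Sum>i=1..N. g (\<xi> N p i w) - (\<integral>y. g y \<partial>pk N p i w))"
      unfolding integral_mult_right_zero sum_distrib_left right_diff_distrib ..
    then have "Vint N p (\<lambda>x. (1 / ?b) * g x) w = (1 / ?b) * Vint N p g w" unfolding Vint_def by simp
    then show "\<bar>Vint N p g w\<bar> \<le> ?b * \<bar>Vint N p (\<lambda>x. (1 / ?b) * g x) w\<bar>" using b(2) by (simp only: abs_mult) simp
  qed (use b in simp)
qed

lemma negligible_usubg:
  assumes "usubg U" and "rvs r"
    and "\<And>N w. N \<ge> 1 \<Longrightarrow> w \<in> space (P N) \<Longrightarrow> sqrt (real N) * \<bar>r N w\<bar> \<le> \<bar>U N w\<bar>"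
  shows "negligible_seq r"
  using assms(1) unfolding usubg_def by (elim exE conjE) (rule negligible_subg[OF _ _ assms(2,3)], auto)

text \<open>\<open>K_mixture\<close> for a general bounded function. The divisor is the oscillation
  plus 1, so that constant functions cause no division by 0.\<close>

lemma kernel_variation:
  assumes f: "f \<in> bdd_meas (E (Suc m))"
  shows "\<exists>U. usubg U \<and> (\<forall>N\<ge>1. \<forall>w\<in>space (P N). \<forall>x\<in>space (E m).
       sqrt (real N) * \<bar>diff_int (K (Suc m) (emp N m w) x) (K (Suc m) (\<eta> m) x) f\<bar> \<le> \<bar>U N w\<bar>)"
proof -
  let ?b = "rosc (E (Suc m)) f + 1"
  have b: "rosc (E (Suc m)) f \<le> ?b" "?b > 0" using rosc_nonneg[of "E (Suc m)" f] by linarith+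
  let ?f = "\<lambda>x. (1 / ?b) * f x"
  obtain C where W: "subgW m C" using subgW_ex by blast
  obtain C' where C': "C' \<ge> 1" and ex: "\<forall>f\<in>Osc1 (E (Suc m)). \<exists>U. \<forall>N\<ge>1. subg (P N) C' (U N) \<and>
    (\<forall>w\<in>space (P N). \<forall>x\<in>space (E m).
       sqrt (real N) * \<bar>diff_int (K (Suc m) (emp N m w) x) (K (Suc m) (\<eta> m) x) f\<bar> \<le> U N w)"
    using K_mixture[OF W] by (elim exE conjE)
  from ex[rule_format, OF Osc1_normalize[OF f b]] obtain U where U: "\<forall>N\<ge>1. subg (P N) C' (U N) \<and>
    (\<forall>w\<in>space (P N). \<forall>x\<in>space (E m).
       sqrt (real N) * \<bar>diff_int (K (Suc m) (emp N m w) x) (K (Suc m) (\<eta> m) x) ?f\<bar> \<le> U N w)" ..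
  have uU: "usubg U" unfolding usubg_def using C' U by blast
  have rU: "rvs U" unfolding rvs_def using U subg_bdd by blast
  have "usubg (\<lambda>N w. ?b * U N w)"
    using b(2) rU unfolding rvs_def by (intro usubg_scale[OF uU, where b = ?b]) (auto simp: rvs_def abs_mult)
  moreover have "sqrt (real N) * \<bar>diff_int (K (Suc m) (emp N m w) x) (K (Suc m) (\<eta> m) x) f\<bar> \<le> \<bar>?b * U N w\<bar>"
    if N: "N \<ge> 1" and w: "w \<in> space (P N)" and x: "x \<in> space (E m)" for N w x
  proof -
    note k = markov_kernel.kx[OF markov_kernel.intro[OF markov[OF emp_probs[OF N w]]] x]
      markov_kernel.kx[OF markov_kernel.intro[OF markov[OF flow_probs]] x]
    let ?d = "diff_int (K (Suc m) (emp N m w) x) (K (Suc m) (\<eta> m) x) f"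
    have "sqrt (real N) * \<bar>diff_int (K (Suc m) (emp N m w) x) (K (Suc m) (\<eta> m) x) ?f\<bar> \<le> U N w"
      using U N w x by blast
    then have "sqrt (real N) * \<bar>(1 / ?b) * ?d\<bar> \<le> U N w" unfolding diff_int_cmult[OF k f] .
    then have "?b * (sqrt (real N) * \<bar>(1 / ?b) * ?d\<bar>) \<le> ?b * U N w" using b(2) by (intro mult_left_mono) auto
    moreover have "?b * (sqrt (real N) * \<bar>(1 / ?b) * ?d\<bar>) = sqrt (real N) * \<bar>?d\<bar>"
      unfolding abs_mult using b(2) by simp
    ultimately show ?thesis by linarith
  qed
  ultimately show ?thesis by blast
qed

text \<open>The conditional variance is an average of \<open>f\<^sup>2\<close> under the one-step
  image of the empirical measure, minus an empirical average of the squared conditional mean. Both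
  differ from their limits by subgaussian terms of order \<open>1 / sqrt N\<close>: fields applied
  to fixed functions, and the variation of the kernel controlled by (K). At time 0 there is no
  difference at all.\<close>

lemma negligible_cvar:
  assumes f: "f \<in> bdd_meas (E p)"
  shows "negligible_seq (\<lambda>N w. cvar N p f w - field_cov K \<eta>0 p f f)"
proof (cases p)
  case 0
  have r: "rvs (\<lambda>N w. cvar N p f w - field_cov K \<eta>0 p f f)"
    unfolding rvs_def by (intro allI impI bdd_meas_diff cvar_bdd f bdd_meas_const)
  show ?thesis
  proof (rule negligible_cong[OF negligible_0 r])
    fix N w assume "N \<ge> (1::nat)"
    then show "cvar N p f w - field_cov K \<eta>0 p f f = 0" unfolding cvar_def 0 pk_def by simp
  qed
next
  case (Suc m)
  have r: "rvs (\<lambda>N w. cvar N p f w - field_cov K \<eta>0 p f f)"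
    unfolding rvs_def by (intro allI impI bdd_meas_diff cvar_bdd f bdd_meas_const)
  have f: "f \<in> bdd_meas (E (Suc m))" using f Suc by simp
  have ff: "(\<lambda>y. f y * f y) \<in> bdd_meas (E (Suc m))" using f by blast
  obtain c where c: "c > 0" "\<And>y. y \<in> space (E (Suc m)) \<Longrightarrow> \<bar>f y\<bar> \<le> c" using f by (rule bdd_measE) blast
  interpret l: markov_kernel "E m" "E (Suc m)" "K (Suc m) (\<eta> m)" using markov[OF flow_probs] by (rule markov_kernel.intro)
  let ?b = "l.op f"
  have bb: "(\<lambda>x. ?b x * ?b x) \<in> bdd_meas (E m)" by (intro bdd_meas_mult l.op_bdd f)
  have fc: "field_cov K \<eta>0 (Suc m) f f = (\<integral>y. f y * f y \<partial>Phi K (Suc m) (\<eta> m)) - (\<integral>x. ?b x * ?b x \<partial>\<eta> m)"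
    unfolding field_cov_eq lim_kernel_def using l.cv_alt[OF flow_probs f f]
      bdd_functional_diff[OF probs_functional[OF flow_probs] l.op_bdd[OF ff] bb]
    by (simp add: Phi_integral[OF flow_probs ff] l.op_def[abs_def])
  obtain U where U: "usubg U" and Ule: "\<forall>N\<ge>1. \<forall>w\<in>space (P N). \<forall>x\<in>space (E m).
       sqrt (real N) * \<bar>diff_int (K (Suc m) (emp N m w) x) (K (Suc m) (\<eta> m) x) f\<bar> \<le> \<bar>U N w\<bar>"
    using kernel_variation[OF f] by (elim exE conjE)
  let ?T = "\<lambda>N w. \<bar>\<bar>\<bar>Wd N (Suc m) (\<lambda>y. f y * f y) w\<bar> + \<bar>Vint N (Suc m) (\<lambda>y. f y * f y) w\<bar>\<bar> + \<bar>2 * c * U N w\<bar>\<bar>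
      + \<bar>Wd N m (\<lambda>x. ?b x * ?b x) w\<bar>"
  have rU: "rvs U" using U subg_bdd unfolding usubg_def rvs_def by blast
  have "usubg (\<lambda>N w. 2 * c * U N w)"
    using c rU by (intro usubg_scale[OF U, where b = "2 * c"]) (auto simp: rvs_def abs_mult)
  then have T: "usubg ?T" by (intro usubg_add usubg_Wd usubg_Vint ff bb)
  show ?thesis
  proof (rule negligible_usubg[OF T r])
    fix N w assume N: "N \<ge> 1" and w: "w \<in> space (P N)"
    note e = emp_probs[OF N w, of m]
    interpret k: markov_kernel "E m" "E (Suc m)" "K (Suc m) (emp N m w)" using markov[OF e] by (rule markov_kernel.intro)
    let ?a = "k.op f"
    have ab: "(\<lambda>x. ?a x * ?a x) \<in> bdd_meas (E m)" by (intro bdd_meas_mult k.op_bdd f)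
    have "cvar N (Suc m) f w = (\<integral>x. k.op (\<lambda>y. f y * f y) x - ?a x * ?a x \<partial>emp N m w)"
      unfolding cvar_alt[OF N w f] emp_integral[OF N w k.cv_integrand_bdd[OF f f]] unfolding k.op_def pk_def by simp
    also have "\<dots> = (\<integral>y. f y * f y \<partial>Phi K (Suc m) (emp N m w)) - (\<integral>x. ?a x * ?a x \<partial>emp N m w)"
      using bdd_functional_diff[OF probs_functional[OF e] k.op_bdd[OF ff] ab]
      by (simp add: Phi_integral[OF e ff] k.op_def[abs_def])
    finally have cv: "cvar N (Suc m) f w = (\<integral>y. f y * f y \<partial>Phi K (Suc m) (emp N m w)) - (\<integral>x. ?a x * ?a x \<partial>emp N m w)" .
    let ?Z = "\<integral>x. ?a x * ?a x - ?b x * ?b x \<partial>emp N m w"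
    have Z: "?Z = (\<integral>x. ?a x * ?a x \<partial>emp N m w) - (\<integral>x. ?b x * ?b x \<partial>emp N m w)"
      by (rule bdd_functional_diff[OF probs_functional[OF e] ab bb])
    \<comment> \<open>The one-step image of the empirical measure is reached from the field at time
      \<open>Suc m\<close> by removing the sampling error. The random kernel in the squared mean is
      first replaced by the limiting one, at cost \<open>?Z\<close>, so that the last field acts on
      a fixed function.\<close>
    have eq: "sqrt (real N) * (cvar N (Suc m) f w - field_cov K \<eta>0 (Suc m) f f) =
        (Wd N (Suc m) (\<lambda>y. f y * f y) w - Vint N (Suc m) (\<lambda>y. f y * f y) w) - sqrt (real N) * ?Z - Wd N m (\<lambda>x. ?b x * ?b x) w"
      unfolding Wd_Suc'[OF N w ff] unfolding cv fc Z Wd_def diff_int_def by (simp add: algebra_simps)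
    have "\<bar>sqrt (real N) * ?Z\<bar> \<le> \<bar>2 * c * U N w\<bar>"
    proof -
      have "\<bar>\<integral>x. sqrt (real N) * (?a x * ?a x - ?b x * ?b x) \<partial>emp N m w\<bar> \<le> \<bar>2 * c * U N w\<bar>"
      proof (rule probs_bound[OF e])
        show "(\<lambda>x. sqrt (real N) * (?a x * ?a x - ?b x * ?b x)) \<in> bdd_meas (E m)" by (intro bdd_meas_cmult bdd_meas_diff ab bb)
        fix x assume x: "x \<in> space (E m)"
        have 1: "sqrt (real N) * \<bar>?a x - ?b x\<bar> \<le> \<bar>U N w\<bar>"
          using Ule N w x unfolding diff_int_def k.op_def l.op_def by blast
        have 2: "\<bar>?a x + ?b x\<bar> \<le> 2 * c" using k.op_bound[OF f c(2) x] l.op_bound[OF f c(2) x] by linarith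
        have "\<bar>sqrt (real N) * (?a x * ?a x - ?b x * ?b x)\<bar> = \<bar>?a x + ?b x\<bar> * (sqrt (real N) * \<bar>?a x - ?b x\<bar>)"
          unfolding square_diff_square_factored abs_mult by simp
        also have "\<dots> \<le> (2 * c) * \<bar>U N w\<bar>" using c(1) by (intro mult_mono 1 2) auto
        finally show "\<bar>sqrt (real N) * (?a x * ?a x - ?b x * ?b x)\<bar> \<le> \<bar>2 * c * U N w\<bar>" using c(1) by (simp add: abs_mult)
      qed
      then show ?thesis by simp
    qed
    moreover have "sqrt (real N) * \<bar>cvar N (Suc m) f w - field_cov K \<eta>0 (Suc m) f f\<bar>
        = \<bar>sqrt (real N) * (cvar N (Suc m) f w - field_cov K \<eta>0 (Suc m) f f)\<bar>"
      by (simp add: abs_mult del: field_cov.simps)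
    ultimately show "sqrt (real N) * \<bar>cvar N p f w - field_cov K \<eta>0 p f f\<bar> \<le> \<bar>?T N w\<bar>"
      unfolding Suc eq by linarith
  qed
qed

end

section \<open>Limiting cumulants of the fields V and W\<close>

context particle_scale
begin

text \<open>\<open>A\<close> is known before time \<open>p\<close>, so conditioning replaces the
  exponential of the new field by that of its conditional cumulant. The latter is a constant up to a
  negligible perturbation, which is removed together with \<open>A\<close>; the constant is the new
  variance term.\<close>

lemma quadratic_step:
  assumes A: "quadratic_mgf A q" and q: "q \<ge> 0"
    and pA: "\<And>N t. N \<ge> 1 \<Longrightarrow> pre N p (\<lambda>w. exp (t * A N w))"
    and f: "f \<in> bdd_meas (E p)"
  shows "quadratic_mgf (\<lambda>N w. A N w + Vint N p f w / sqrt (\<alpha> N)) (q + field_cov K \<eta>0 p f f / 2)"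
proof -
  let ?v = "field_cov K \<eta>0 p f f" and ?r = "rosc (E p) f"
  let ?X = "\<lambda>N w. Vint N p f w / sqrt (\<alpha> N)"
  have rA: "rvs A" using A unfolding quadratic_mgf_def by blast
  have Xb: "?X N \<in> bdd_meas (P N)" if N: "N \<ge> 1" for N
    using bdd_meas_cmult[OF Vint_bdd[OF N f carries_P[OF N]], of "1 / sqrt (\<alpha> N)"] by simp
  have rS: "rvs (\<lambda>N w. A N w + ?X N w)"
    unfolding rvs_def by (intro allI impI bdd_meas_add Xb rvsD[OF rA])
  have lim: "(\<lambda>N. lmgf N (\<lambda>w. t * (A N w + ?X N w))) \<longlonglongrightarrow> t\<^sup>2 * (q + ?v / 2)" for t
  proof -
    \<comment> \<open>The factor with which the unnormalised centred sum appears in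
      \<open>\<alpha> N * t * Vint / sqrt (\<alpha> N)\<close>.\<close>
    let ?s = "\<lambda>N. t * sqrt (\<alpha> N / real N)"
    \<comment> \<open>The error of the second-order expansion, bounded by a deterministic multiple
      of \<open>sqrt (\<alpha> N / N)\<close>. The next abbreviation adds the fluctuation of the
      conditional variance.\<close>
    let ?\<theta> = "\<lambda>N w. cgf N p f (?s N) w / \<alpha> N - t\<^sup>2 * cvar N p f w / 2"
    let ?\<rho> = "\<lambda>N w. ?\<theta> N w + t\<^sup>2 / 2 * (cvar N p f w - ?v)"
    have s2: "real N * (?s N)\<^sup>2 = t\<^sup>2 * \<alpha> N" if N: "N \<ge> 1" for N
      using N \<alpha>_pos[OF N] by (simp add: power_mult_distrib)
    have r\<theta>: "rvs ?\<theta>"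
      unfolding rvs_def
    proof (intro allI impI)
      fix N :: nat assume N: "1 \<le> N"
      have "(\<lambda>w. (1 / \<alpha> N) * cgf N p f (?s N) w - (t\<^sup>2 / 2) * cvar N p f w) \<in> bdd_meas (P N)"
        by (intro bdd_meas_diff bdd_meas_cmult cgf_bdd cvar_bdd N f)
      then show "?\<theta> N \<in> bdd_meas (P N)" by simp
    qed
    have "negligible_seq ?\<theta>"
    proof (rule negligible_deterministic[OF r\<theta>])
      show "(\<lambda>N. (2 * (\<bar>t\<bar> * ?r) ^ 3) * sqrt (\<alpha> N / real N)) \<longlonglongrightarrow> 0" by (rule scale_small)
      have "\<forall>\<^sub>F N in sequentially. (\<bar>t\<bar> * ?r) * sqrt (\<alpha> N / real N) < 1 / 2"
        by (rule order_tendstoD(2)[OF scale_small]) simp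
      then show "\<forall>\<^sub>F N in sequentially. \<forall>w\<in>space (P N). \<bar>?\<theta> N w\<bar> \<le> (2 * (\<bar>t\<bar> * ?r) ^ 3) * sqrt (\<alpha> N / real N)"
        using eventually_ge_at_top[of 1]
      proof eventually_elim
        case (elim N)
        note N = elim(2) and a = \<alpha>_pos[OF elim(2)]
        define y where "y = sqrt (\<alpha> N / real N)"
        have y: "y \<ge> 0" "y * y = \<alpha> N / real N" unfolding y_def using a by simp_all
        have sr: "\<bar>?s N\<bar> * ?r = (\<bar>t\<bar> * ?r) * y" using y unfolding y_def[symmetric] by (simp add: abs_mult)
        show ?case
        proof
          fix w assume w: "w \<in> space (P N)"
          have "\<bar>cgf N p f (?s N) w - real N * (?s N)\<^sup>2 * cvar N p f w / 2\<bar> \<le> real N * (2 * (\<bar>?s N\<bar> * ?r) ^ 3)"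
            using elim(1) by (intro cgf_expansion[OF N w f]) (simp add: sr y_def)
          then have "\<bar>cgf N p f (?s N) w - t\<^sup>2 * \<alpha> N * cvar N p f w / 2\<bar> / \<alpha> N \<le> real N * (2 * ((\<bar>t\<bar> * ?r) * y) ^ 3) / \<alpha> N"
            unfolding s2[OF N] sr using a by (intro divide_right_mono) auto
          moreover have "\<bar>cgf N p f (?s N) w - t\<^sup>2 * \<alpha> N * cvar N p f w / 2\<bar> / \<alpha> N = \<bar>?\<theta> N w\<bar>"
            using a by (simp add: abs_div_pos diff_divide_distrib)
          moreover have "real N * (2 * ((\<bar>t\<bar> * ?r) * y) ^ 3) / \<alpha> N = (2 * (\<bar>t\<bar> * ?r) ^ 3) * y"
          proof -
            have "real N * (2 * ((\<bar>t\<bar> * ?r) * y) ^ 3) / \<alpha> N = (2 * (\<bar>t\<bar> * ?r) ^ 3) * y * ((y * y) * (real N / \<alpha> N))"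
              by (simp add: power_mult_distrib power3_eq_cube)
            then show ?thesis unfolding y(2) using a N by simp
          qed
          ultimately show "\<bar>?\<theta> N w\<bar> \<le> (2 * (\<bar>t\<bar> * ?r) ^ 3) * sqrt (\<alpha> N / real N)"
            unfolding y_def[symmetric] by linarith
        qed
      qed
    qed
    then have \<rho>: "negligible_seq ?\<rho>" by (intro negligible_add negligible_cmult negligible_cvar f)
    have r\<rho>: "rvs ?\<rho>" using \<rho> unfolding negligible_seq_def by blast
    have tA: "quadratic_mgf (\<lambda>N w. t * A N w) (t\<^sup>2 * q)"
      unfolding quadratic_mgf_def
    proof (intro conjI allI)
      show "rvs (\<lambda>N w. t * A N w)" unfolding rvs_def by (intro allI impI bdd_meas_cmult rvsD[OF rA])
      fix u
      have "(\<lambda>N. lmgf N (\<lambda>w. (u * t) * A N w)) \<longlonglongrightarrow> (u * t)\<^sup>2 * q" using A unfolding quadratic_mgf_def by blast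
      then show "(\<lambda>N. lmgf N (\<lambda>w. u * (t * A N w))) \<longlonglongrightarrow> u\<^sup>2 * (t\<^sup>2 * q)"
        by (simp add: mult.assoc power_mult_distrib)
    qed
    have "quadratic_mgf (\<lambda>N w. t * A N w + ?\<rho> N w) (t\<^sup>2 * q)"
      using q by (intro quadratic_mgf_perturb[OF tA _ \<rho>]) simp
    then have "(\<lambda>N. lmgf N (\<lambda>w. 1 * (t * A N w + ?\<rho> N w))) \<longlonglongrightarrow> 1\<^sup>2 * (t\<^sup>2 * q)" unfolding quadratic_mgf_def by blast
    then have "(\<lambda>N. lmgf N (\<lambda>w. t * A N w + ?\<rho> N w) + t\<^sup>2 * ?v / 2) \<longlonglongrightarrow> t\<^sup>2 * q + t\<^sup>2 * ?v / 2"
      by (intro tendsto_add tendsto_const) simp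
    moreover have "\<forall>\<^sub>F N in sequentially. lmgf N (\<lambda>w. t * A N w + ?\<rho> N w) + t\<^sup>2 * ?v / 2 = lmgf N (\<lambda>w. t * (A N w + ?X N w))"
      using eventually_ge_at_top[of 1]
    proof eventually_elim
      case N: (elim N)
      have a: "\<alpha> N > 0" by (rule \<alpha>_pos[OF N])
      have sx: "\<alpha> N * (t * (x / sqrt (real N) / sqrt (\<alpha> N))) = ?s N * x" for x
      proof -
        have "\<alpha> N * (t * (x / sqrt (real N) / sqrt (\<alpha> N))) = t * ((\<alpha> N / sqrt (\<alpha> N)) / sqrt (real N)) * x" by (simp add: mult_ac)
        also have "\<alpha> N / sqrt (\<alpha> N) = sqrt (\<alpha> N)" using a by (intro real_div_sqrt) simp
        finally show ?thesis unfolding real_sqrt_divide .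
      qed
      have "(\<integral>w. exp (\<alpha> N * (t * (A N w + ?X N w))) \<partial>P N)
          = (\<integral>w. exp ((\<alpha> N * t) * A N w) * exp (?s N * (\<Sum>i=1..N. f (\<xi> N p i w) - (\<integral>y. f y \<partial>pk N p i w))) \<partial>P N)"
        unfolding Vint_def distrib_left exp_add sx by (simp only: mult.assoc)
      also have "\<dots> = (\<integral>w. exp ((\<alpha> N * t) * A N w) * exp (cgf N p f (?s N) w) \<partial>P N)"
        by (rule exp_step[OF N pA[OF N] f])
      also have "\<dots> = (\<integral>w. exp (\<alpha> N * ((t * A N w + ?\<rho> N w) + t\<^sup>2 * ?v / 2)) \<partial>P N)"
      proof (intro Bochner_Integration.integral_cong refl)
        fix w
        have "\<alpha> N * ((t * A N w + ?\<rho> N w) + t\<^sup>2 * ?v / 2) = \<alpha> N * (t * A N w + cgf N p f (?s N) w / \<alpha> N)"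
          by (simp add: right_diff_distrib)
        also have "\<dots> = (\<alpha> N * t) * A N w + cgf N p f (?s N) w" using a by (simp add: distrib_left)
        finally show "exp ((\<alpha> N * t) * A N w) * exp (cgf N p f (?s N) w) = exp (\<alpha> N * ((t * A N w + ?\<rho> N w) + t\<^sup>2 * ?v / 2))"
          unfolding exp_add[symmetric] by simp
      qed
      finally have "lmgf N (\<lambda>w. t * (A N w + ?X N w)) = lmgf N (\<lambda>w. (t * A N w + ?\<rho> N w) + t\<^sup>2 * ?v / 2)"
        unfolding lmgf_def prob_space.log_mgf_def[OF P[OF N]] by simp
      also have "\<dots> = lmgf N (\<lambda>w. t * A N w + ?\<rho> N w) + t\<^sup>2 * ?v / 2"
        by (intro lmgf_add_const[OF N] bdd_meas_add[OF bdd_meas_cmult[OF rvsD[OF rA N]] rvsD[OF r\<rho> N]])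
      finally show ?case ..
    qed
    ultimately have "(\<lambda>N. lmgf N (\<lambda>w. t * (A N w + ?X N w))) \<longlonglongrightarrow> t\<^sup>2 * q + t\<^sup>2 * ?v / 2"
      by (rule Lim_transform_eventually)
    then show ?thesis by (simp add: distrib_left)
  qed
  show ?thesis unfolding quadratic_mgf_def using rS lim by blast
qed

text \<open>Times are added one by one, the newest field being integrated out first: all earlier
  fields are functions of its past. The limiting variances add up, as if the fields were
  independent.\<close>

lemma quadratic_V:
  assumes "\<And>p. p < n \<Longrightarrow> f p \<in> bdd_meas (E p)"
  shows "quadratic_mgf (\<lambda>N w. \<Sum>p<n. Vint N p (f p) w / sqrt (\<alpha> N)) ((\<Sum>p<n. field_cov K \<eta>0 p (f p) (f p)) / 2)"
  using assms
proof (induction n)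
  case 0
  have "(\<lambda>N. lmgf N (\<lambda>_. 0)) \<longlonglongrightarrow> 0"
    by (rule tendsto_eventually, rule eventually_mono[OF eventually_ge_at_top[of 1]], rule lmgf_const)
  then show ?case unfolding quadratic_mgf_def rvs_def by simp
next
  case (Suc n)
  have "0 \<le> field_cov K \<eta>0 p (f p) (f p)" if "p < Suc n" for p
    using psd_form.Q_nonneg[OF cov_form_psd[OF cov_form_field] Suc.prems[OF that]] .
  then have q: "0 \<le> (\<Sum>p<n. field_cov K \<eta>0 p (f p) (f p)) / 2" by (intro divide_nonneg_nonneg sum_nonneg) auto
  have "quadratic_mgf (\<lambda>N w. (\<Sum>p<n. Vint N p (f p) w / sqrt (\<alpha> N)) + Vint N n (f n) w / sqrt (\<alpha> N))
      ((\<Sum>p<n. field_cov K \<eta>0 p (f p) (f p)) / 2 + field_cov K \<eta>0 n (f n) (f n) / 2)"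
  proof (rule quadratic_step[OF Suc.IH q])
    show "f n \<in> bdd_meas (E n)" by (intro Suc.prems) simp
    fix N t assume N: "N \<ge> (1::nat)"
    show "pre N n (\<lambda>w. exp (t * (\<Sum>p<n. Vint N p (f p) w / sqrt (\<alpha> N))))"
    proof (cases "n = 0")
      case False
      have "(\<lambda>w. exp (t * (\<Sum>p<n. (1 / sqrt (\<alpha> N)) * Vint N p (f p) w))) \<in> bdd_meas (past E N (P N) (\<xi> N) (n - 1))"
      proof (intro bdd_meas_exp bdd_meas_cmult bdd_meas_sum)
        fix p assume p: "p \<in> {..<n}"
        show "Vint N p (f p) \<in> bdd_meas (past E N (P N) (\<xi> N) (n - 1))"
          using p by (intro Vint_bdd[OF N Suc.prems carries_mono[OF carries_past[OF N]]]) auto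
      qed
      then show ?thesis using False unfolding pre_def by simp
    qed (simp add: pre_def fun_eq_iff)
  qed (use Suc.prems in simp)
  then show ?case by (simp add: add_divide_distrib)
qed

text \<open>\<open>Wd_Suc\<close> is unrolled backwards in time. The transported error is handled by
  the induction hypothesis for \<open>Dstep (Suc n) f\<close>, which is why \<open>f\<close> is
  generalised, and each step leaves one negligible remainder.\<close>

lemma W_decomposition:
  "f \<in> bdd_meas (E n) \<Longrightarrow>
    negligible_seq (\<lambda>N w. Wd N n f w / sqrt (\<alpha> N) - (\<Sum>p\<le>n. Vint N p (Dsg p n f) w / sqrt (\<alpha> N)))"
proof (induction n arbitrary: f)
  case 0
  have b: "(\<lambda>w. Wd N 0 f w / sqrt (\<alpha> N) - (\<Sum>p\<le>0. Vint N p (Dsg p 0 f) w / sqrt (\<alpha> N))) \<in> bdd_meas (P N)" if N: "N \<ge> 1" for N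
  proof -
    have "(\<lambda>w. (1 / sqrt (\<alpha> N)) * Wd N 0 f w - (1 / sqrt (\<alpha> N)) * Vint N 0 f w) \<in> bdd_meas (P N)"
      by (intro bdd_meas_diff bdd_meas_cmult Wd_bdd N 0 Vint_bdd carries_P)
    then show ?thesis by (simp add: Dsg_same)
  qed
  show ?case
  proof (rule negligible_cong[OF negligible_0])
    show "rvs (\<lambda>N w. Wd N 0 f w / sqrt (\<alpha> N) - (\<Sum>p\<le>0. Vint N p (Dsg p 0 f) w / sqrt (\<alpha> N)))"
      unfolding rvs_def using b by blast
  qed (simp add: Dsg_same Wd_0 0)
next
  case (Suc n)
  let ?f = "Dstep (Suc n) f"
  have f': "?f \<in> bdd_meas (E n)" by (rule bounded_op_bdd[OF bounded_op_Dstep Suc.prems])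
  let ?r = "\<lambda>N w. Wd N n ?f w / sqrt (\<alpha> N) - (\<Sum>p\<le>n. Vint N p (Dsg p n ?f) w / sqrt (\<alpha> N))"
  have Ds: "Dsg p (Suc n) f = Dsg p n ?f" if "p \<le> n" for p using Dsg_Suc[OF that] by simp
  have neg: "negligible_seq (\<lambda>N w. ?r N w + sqrt (real N / \<alpha> N) * Rem N n f w)"
    by (intro negligible_add Suc.IH f' negligible_Rem Suc.prems)
  show ?case
  proof (rule negligible_cong[OF neg])
    show "rvs (\<lambda>N w. Wd N (Suc n) f w / sqrt (\<alpha> N) - (\<Sum>p\<le>Suc n. Vint N p (Dsg p (Suc n) f) w / sqrt (\<alpha> N)))"
      unfolding rvs_def
    proof (intro allI impI)
      fix N :: nat assume N: "1 \<le> N"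
      have "(\<lambda>w. (1 / sqrt (\<alpha> N)) * Wd N (Suc n) f w - (\<Sum>p\<le>Suc n. (1 / sqrt (\<alpha> N)) * Vint N p (Dsg p (Suc n) f) w)) \<in> bdd_meas (P N)"
        by (intro bdd_meas_diff bdd_meas_cmult bdd_meas_sum Wd_bdd[OF N] Vint_bdd[OF N Dsg_bdd carries_P[OF N]] Suc.prems) auto
      then show "(\<lambda>w. Wd N (Suc n) f w / sqrt (\<alpha> N) - (\<Sum>p\<le>Suc n. Vint N p (Dsg p (Suc n) f) w / sqrt (\<alpha> N))) \<in> bdd_meas (P N)"
        by simp
    qed
    fix N w assume N: "N \<ge> 1" and w: "w \<in> space (P N)"
    have "(\<Sum>p\<le>Suc n. Vint N p (Dsg p (Suc n) f) w / sqrt (\<alpha> N))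
        = (\<Sum>p\<le>n. Vint N p (Dsg p n ?f) w / sqrt (\<alpha> N)) + Vint N (Suc n) f w / sqrt (\<alpha> N)"
      by (simp add: Ds Dsg_same)
    then show "Wd N (Suc n) f w / sqrt (\<alpha> N) - (\<Sum>p\<le>Suc n. Vint N p (Dsg p (Suc n) f) w / sqrt (\<alpha> N))
        = ?r N w + sqrt (real N / \<alpha> N) * Rem N n f w"
      unfolding Wd_Suc[OF N w Suc.prems] by (simp add: add_divide_distrib real_sqrt_divide)
  qed
qed

lemma quadratic_W:
  assumes f: "f \<in> bdd_meas (E n)"
  shows "quadratic_mgf (\<lambda>N w. Wd N n f w / sqrt (\<alpha> N)) (QW n f f / 2)"
proof -
  have A: "quadratic_mgf (\<lambda>N w. \<Sum>p\<le>n. Vint N p (Dsg p n f) w / sqrt (\<alpha> N)) (QW n f f / 2)"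
    using quadratic_V[of "Suc n" "\<lambda>p. Dsg p n f"] Dsg_bdd[OF _ f] unfolding QW_def lessThan_Suc_atMost by auto
  have "0 \<le> QW n f f / 2" using psd_form.Q_nonneg[OF cov_form_psd[OF cov_form_QW] f] by simp
  from quadratic_mgf_perturb[OF A this W_decomposition[OF f]] show ?thesis by simp
qed

end

section \<open>Moderate deviations of the particle fields\<close>

lemma diff_signed_measure:
  assumes \<rho>: "\<rho> \<in> probs E" and \<sigma>: "\<sigma> \<in> probs E"
  shows "(\<lambda>A. c * (measure \<rho> A - measure \<sigma> A)) \<in> signed_measures E"
    and "f \<in> bdd_meas E \<Longrightarrow> sm_integral E (\<lambda>A. c * (measure \<rho> A - measure \<sigma> A)) f = c * ((\<integral>x. f x \<partial>\<rho>) - (\<integral>x. f x \<partial>\<sigma>))"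
proof -
  note r = probsD[OF \<rho>] and s = probsD[OF \<sigma>]
  interpret r: prob_space \<rho> by (rule r(1))
  interpret s: prob_space \<sigma> by (rule s(1))
  show S: "(\<lambda>A. c * (measure \<rho> A - measure \<sigma> A)) \<in> signed_measures E"
    unfolding signed_measures_def mem_Collect_eq
  proof (intro conjI allI impI)
    fix A assume "A \<notin> sets E"
    then show "c * (measure \<rho> A - measure \<sigma> A) = 0" using r(2) s(2) by (simp add: measure_notin_sets)
  next
    fix F :: "nat \<Rightarrow> 'a set" assume "range F \<subseteq> sets E" "disjoint_family F"
    then show "(\<lambda>i. c * (measure \<rho> (F i) - measure \<sigma> (F i))) sums (c * (measure \<rho> (\<Union>i. F i) - measure \<sigma> (\<Union>i. F i)))"
      using r(2) s(2) by (intro sums_mult sums_diff r.finite_measure_UNION s.finite_measure_UNION) auto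
  qed
  assume f: "f \<in> bdd_meas E"
  have "sm_integral E (\<lambda>A. c * (measure \<rho> A - measure \<sigma> A)) f = c * (\<integral>x. f x \<partial>\<rho>) + (- c) * (\<integral>x. f x \<partial>\<sigma>)"
  proof (rule sm_integral_eqI[OF S bdd_functional_lin[OF probs_functional[OF \<rho>] probs_functional[OF \<sigma>]] f])
    fix A assume A: "A \<in> sets E"
    then have "A \<inter> space \<rho> = A" "A \<inter> space \<sigma> = A" using sets.sets_into_space r(3) s(3) by auto
    then show "c * (\<integral>x. indicator A x \<partial>\<rho>) + (- c) * (\<integral>x. indicator A x \<partial>\<sigma>) = c * (measure \<rho> A - measure \<sigma> A)"
      using A r(2) s(2) by (simp add: right_diff_distrib)
  qed
  then show "sm_integral E (\<lambda>A. c * (measure \<rho> A - measure \<sigma> A)) f = c * ((\<integral>x. f x \<partial>\<rho>) - (\<integral>x. f x \<partial>\<sigma>))"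
    by (simp add: right_diff_distrib)
qed

lemma measurable_sm_algebra:
  assumes X: "\<And>w. w \<in> space M \<Longrightarrow> X w \<in> signed_measures E"
    and m: "\<And>A. A \<in> sets E \<Longrightarrow> (\<lambda>w. X w A) \<in> borel_measurable M"
  shows "X \<in> measurable M (sm_algebra E)"
  unfolding sm_algebra_def
proof (rule measurable_measure_of)
  fix y assume "y \<in> {{\<mu> \<in> signed_measures E. \<mu> A \<in> B} | A B. A \<in> sets E \<and> B \<in> sets borel}"
  then obtain A and B :: "real set" where y: "y = {\<mu> \<in> signed_measures E. \<mu> A \<in> B}" "A \<in> sets E" "B \<in> sets borel" by blast
  have "X -` y \<inter> space M = (\<lambda>w. X w A) -` B \<inter> space M" unfolding y using X by auto
  then show "X -` y \<inter> space M \<in> sets M" using measurable_sets[OF m[OF y(2)] y(3)] by simp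
qed (use X in auto)

lemma good_rate_function_cong:
  assumes "good_rate_function S I" and eq: "\<And>x. x \<in> topspace S \<Longrightarrow> I x = I' x"
  shows "good_rate_function S I'"
proof -
  have "{x \<in> topspace S. I' x \<le> ereal a} = {x \<in> topspace S. I x \<le> ereal a}" for a using eq by auto
  then show ?thesis using assms unfolding good_rate_function_def by simp
qed

lemma LDP_cong:
  assumes L: "LDP S \<SS> P X \<alpha> I" and eq: "\<And>x. x \<in> topspace S \<Longrightarrow> I x = I' x"
  shows "LDP S \<SS> P X \<alpha> I'"
proof -
  have "(INF x\<in>S interior_of A. I' x) = (INF x\<in>S interior_of A. I x)"
    "(INF x\<in>S closure_of A. I' x) = (INF x\<in>S closure_of A. I x)" for A
    using eq interior_of_subset_topspace[of S A] closure_of_subset_topspace[of S A] by (intro INF_cong refl; force)+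
  moreover have "good_rate_function S I'"
  proof (rule good_rate_function_cong[OF _ eq])
    show "good_rate_function S I" using L unfolding LDP_def by blast
  qed
  ultimately show ?thesis using L unfolding LDP_def by simp
qed

section \<open>The fields as random signed measures, and both deviation principles\<close>

context particle_scale
begin

lemma quadratic_mgf_cong:
  assumes A: "quadratic_mgf A q" and eq: "\<And>N w. N \<ge> 1 \<Longrightarrow> w \<in> space (P N) \<Longrightarrow> B N w = A N w"
  shows "quadratic_mgf B q"
proof -
  have rA: "rvs A" using A unfolding quadratic_mgf_def by blast
  have Bb: "B N \<in> bdd_meas (P N)" if N: "N \<ge> 1" for N
    by (rule bdd_meas_cong[OF rvsD[OF rA N] eq[OF N]])
  have "(\<lambda>N. lmgf N (\<lambda>w. t * B N w)) \<longlonglongrightarrow> t\<^sup>2 * q" for t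
  proof (rule Lim_transform_eventually)
    show "(\<lambda>N. lmgf N (\<lambda>w. t * A N w)) \<longlonglongrightarrow> t\<^sup>2 * q" using A unfolding quadratic_mgf_def by blast
    show "\<forall>\<^sub>F N in sequentially. lmgf N (\<lambda>w. t * A N w) = lmgf N (\<lambda>w. t * B N w)"
      using eventually_ge_at_top[of 1]
    proof eventually_elim
      case N: (elim N)
      show ?case using eq[OF N] by (intro lmgf_cong N bdd_meas_cmult rvsD[OF rA] Bb) auto
    qed
  qed
  then show ?thesis unfolding quadratic_mgf_def rvs_def using Bb by blast
qed

text \<open>Boundedness is built into \<open>quadratic_mgf\<close> and yields measurability and
  integrability of the exponentials. The multiple \<open>t = 1\<close> suffices, since
  \<open>T\<close> is closed under scalar multiples.\<close>

lemma ldp_familyI: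
  assumes C: "coord_space T Q S \<phi>"
    and X: "\<And>N w. N \<ge> 1 \<Longrightarrow> w \<in> space (P N) \<Longrightarrow> X N w \<in> topspace S"
    and q: "\<And>f. f \<in> T \<Longrightarrow> quadratic_mgf (\<lambda>N w. \<phi> f (X N w)) (Q f f / 2)"
  shows "ldp_family T Q S \<phi> P X \<alpha>"
proof -
  interpret coord_space T Q S \<phi> by (rule C)
  have b: "(\<lambda>w. \<phi> f (X N w)) \<in> bdd_meas (P N)" if "f \<in> T" "N \<ge> 1" for f N
    using q[OF that(1)] that(2) unfolding quadratic_mgf_def rvs_def by blast
  show ?thesis
  proof (rule ldp_family.intro[OF C ldp_family_axioms.intro])
    fix N f assume N: "N \<ge> (1::nat)" and f: "f \<in> T"
    show "(\<lambda>w. \<phi> f (X N w)) \<in> borel_measurable (P N)" by (rule bdd_meas_measurable[OF b[OF f N]])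
    show "integrable (P N) (\<lambda>w. exp (\<alpha> N * \<phi> f (X N w)))"
      by (intro prob_space.bdd_integrable[OF P[OF N]] bdd_meas_exp bdd_meas_cmult b f N)
  next
    fix f assume f: "f \<in> T"
    have "(\<lambda>N. lmgf N (\<lambda>w. 1 * \<phi> f (X N w))) \<longlonglongrightarrow> 1\<^sup>2 * (Q f f / 2)"
      using q[OF f] unfolding quadratic_mgf_def by blast
    then have "(\<lambda>N. lmgf N (\<lambda>w. \<phi> f (X N w))) \<longlonglongrightarrow> Q f f / 2" by simp
    moreover have "\<forall>\<^sub>F N in sequentially. lmgf N (\<lambda>w. \<phi> f (X N w)) = ln (\<integral>w. exp (\<alpha> N * \<phi> f (X N w)) \<partial>P N) / \<alpha> N"
      using eventually_ge_at_top[of 1] by eventually_elim (simp add: lmgf_def prob_space.log_mgf_def[OF P])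
    ultimately show "(\<lambda>N. ln (\<integral>w. exp (\<alpha> N * \<phi> f (X N w)) \<partial>P N) / \<alpha> N) \<longlonglongrightarrow> Q f f / 2"
      by (rule Lim_transform_eventually)
  qed (fact X \<alpha>_pos \<alpha>_top P)+
qed

lemma V_field_eq:
  "V_field E K \<eta>0 \<xi> N p w = (\<lambda>A. sqrt (real N) *
     (measure (emp N p w) A - measure (if p = 0 then \<eta>0 else Phi K p (emp N (p - 1) w)) A))"
  by (cases p) (simp_all add: emp_def Phi_def)

lemma V_field_signed:
  assumes N: "N \<ge> 1" and w: "w \<in> space (P N)"
  shows "sm_scale c (V_field E K \<eta>0 \<xi> N p w) \<in> signed_measures (E p)"
    and "f \<in> bdd_meas (E p) \<Longrightarrow> sm_integral (E p) (sm_scale c (V_field E K \<eta>0 \<xi> N p w)) f = c * Vint N p f w"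
proof -
  let ?\<sigma> = "if p = 0 then \<eta>0 else Phi K p (emp N (p - 1) w)"
  have s: "?\<sigma> \<in> probs (E p)" using init Phi_probs[OF emp_probs[OF N w, of "p - 1"]] by (cases p) auto
  have e: "sm_scale c (V_field E K \<eta>0 \<xi> N p w) = (\<lambda>A. (c * sqrt (real N)) * (measure (emp N p w) A - measure ?\<sigma> A))"
    unfolding sm_scale_def V_field_eq by (simp only: mult.assoc)
  show "sm_scale c (V_field E K \<eta>0 \<xi> N p w) \<in> signed_measures (E p)"
    unfolding e by (rule diff_signed_measure(1)[OF emp_probs[OF N w] s])
  assume f: "f \<in> bdd_meas (E p)"
  have "sqrt (real N) * ((\<integral>x. f x \<partial>emp N p w) - (\<integral>x. f x \<partial>?\<sigma>)) = Vint N p f w"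
  proof (cases p)
    case 0
    then show ?thesis using Wd_0[OF N w, of f] f unfolding Wd_def diff_int_def by simp
  next
    case (Suc m)
    then show ?thesis using Wd_Suc'[OF N w, of f m] f unfolding Wd_def diff_int_def by (simp add: right_diff_distrib)
  qed
  then show "sm_integral (E p) (sm_scale c (V_field E K \<eta>0 \<xi> N p w)) f = c * Vint N p f w"
    unfolding e diff_signed_measure(2)[OF emp_probs[OF N w] s f] by (simp only: mult.assoc)
qed

lemma W_field_signed:
  assumes N: "N \<ge> 1" and w: "w \<in> space (P N)"
  shows "sm_scale c (W_field E K \<eta>0 \<xi> N p w) \<in> signed_measures (E p)"
    and "f \<in> bdd_meas (E p) \<Longrightarrow> sm_integral (E p) (sm_scale c (W_field E K \<eta>0 \<xi> N p w)) f = c * Wd N p f w"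
proof -
  have e: "sm_scale c (W_field E K \<eta>0 \<xi> N p w) = (\<lambda>A. (c * sqrt (real N)) * (measure (emp N p w) A - measure (\<eta> p) A))"
    unfolding sm_scale_def W_field_def emp_def by (simp only: mult.assoc)
  show "sm_scale c (W_field E K \<eta>0 \<xi> N p w) \<in> signed_measures (E p)"
    unfolding e by (rule diff_signed_measure(1)[OF emp_probs[OF N w] flow_probs])
  assume f: "f \<in> bdd_meas (E p)"
  show "sm_integral (E p) (sm_scale c (W_field E K \<eta>0 \<xi> N p w)) f = c * Wd N p f w"
    unfolding e diff_signed_measure(2)[OF emp_probs[OF N w] flow_probs f] Wd_def diff_int_def by (simp only: mult.assoc)
qed

lemma V_field_measurable:
  assumes N: "N \<ge> 1"
  shows "(\<lambda>w. sm_scale c (V_field E K \<eta>0 \<xi> N p w)) \<in> measurable (P N) (sm_algebra (E p))"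
proof (rule measurable_sm_algebra[OF V_field_signed(1)[OF N]])
  fix A assume A: "A \<in> sets (E p)"
  have "sm_scale c (V_field E K \<eta>0 \<xi> N p w) A = c * Vint N p (indicator A) w" if w: "w \<in> space (P N)" for w
    using sm_integral_indicator[OF V_field_signed(1)[OF N w] A] V_field_signed(2)[OF N w bdd_meas_indicator[OF A]] by simp
  then show "(\<lambda>w. sm_scale c (V_field E K \<eta>0 \<xi> N p w) A) \<in> borel_measurable (P N)"
    using bdd_meas_measurable[OF bdd_meas_cmult[OF Vint_bdd[OF N bdd_meas_indicator[OF A] carries_P[OF N]]]]
    by (subst measurable_cong)
qed

lemma W_field_measurable:
  assumes N: "N \<ge> 1"
  shows "(\<lambda>w. sm_scale c (W_field E K \<eta>0 \<xi> N p w)) \<in> measurable (P N) (sm_algebra (E p))"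
proof (rule measurable_sm_algebra[OF W_field_signed(1)[OF N]])
  fix A assume A: "A \<in> sets (E p)"
  have "sm_scale c (W_field E K \<eta>0 \<xi> N p w) A = c * Wd N p (indicator A) w" if w: "w \<in> space (P N)" for w
    using sm_integral_indicator[OF W_field_signed(1)[OF N w] A] W_field_signed(2)[OF N w bdd_meas_indicator[OF A]] by simp
  then show "(\<lambda>w. sm_scale c (W_field E K \<eta>0 \<xi> N p w) A) \<in> borel_measurable (P N)"
    using bdd_meas_measurable[OF bdd_meas_cmult[OF Wd_bdd[OF N bdd_meas_indicator[OF A]]]]
    by (subst measurable_cong)
qed

theorem MDP_V:
  "MDP (\<lambda>c \<mu>. \<lambda>p\<in>{..n}. sm_scale c (\<mu> p)) (product_topology (\<lambda>p. tau_topology (E p)) {..n})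
     (PiM {..n} (\<lambda>p. sm_algebra (E p))) P (\<lambda>N w. \<lambda>p\<in>{..n}. V_field E K \<eta>0 \<xi> N p w) \<alpha>
     (\<lambda>\<mu>. \<Sum>p\<le>n. rate_I E K \<eta>0 p (\<mu> p))"
proof -
  let ?X = "\<lambda>N w. \<lambda>p\<in>{..n}. sm_scale (1 / sqrt (\<alpha> N)) (V_field E K \<eta>0 \<xi> N p w)"
  let ?S = "product_topology (\<lambda>p. tau_topology (E p)) {..n}"
  let ?ev = "\<lambda>f \<mu>. \<Sum>p\<le>n. sm_integral (E p) (\<mu> p) (slice f p)"
  let ?T = "prod_space n (\<lambda>p. simples (E p))"
  have top: "topspace ?S = (\<Pi>\<^sub>E p\<in>{..n}. signed_measures (E p))" by (simp add: topspace_tau)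
  have sl: "slice f p \<in> bdd_meas (E p)" if "f \<in> ?T" "p \<le> n" for f p
    using that simples_bdd_meas unfolding prod_space_def by blast
  interpret L: ldp_family ?T "prod_form n (field_cov K \<eta>0)" ?S ?ev P ?X \<alpha>
  proof (rule ldp_familyI[OF coord_space_prod_tau[OF nonempty cov_form_field]])
    fix N w assume "N \<ge> (1::nat)" "w \<in> space (P N)"
    from V_field_signed(1)[OF this] show "?X N w \<in> topspace ?S" unfolding top by simp
  next
    fix f assume f: "f \<in> ?T"
    \<comment> \<open>A coordinate of the tuple is a sum of single fields at the slices of
      \<open>f\<close>; \<open>Suc n\<close> appears because \<open>quadratic_V\<close> counts times
      strictly below its bound.\<close>
    have "quadratic_mgf (\<lambda>N w. \<Sum>p<Suc n. Vint N p (slice f p) w / sqrt (\<alpha> N))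
        ((\<Sum>p<Suc n. field_cov K \<eta>0 p (slice f p) (slice f p)) / 2)"
      using sl[OF f] by (intro quadratic_V) simp
    then have q: "quadratic_mgf (\<lambda>N w. \<Sum>p\<le>n. Vint N p (slice f p) w / sqrt (\<alpha> N)) (prod_form n (field_cov K \<eta>0) f f / 2)"
      unfolding prod_form_def lessThan_Suc_atMost .
    show "quadratic_mgf (\<lambda>N w. ?ev f (?X N w)) (prod_form n (field_cov K \<eta>0) f f / 2)"
    proof (rule quadratic_mgf_cong[OF q])
      fix N w assume "N \<ge> (1::nat)" "w \<in> space (P N)"
      from V_field_signed(2)[OF this sl[OF f]]
      show "?ev f (?X N w) = (\<Sum>p\<le>n. Vint N p (slice f p) w / sqrt (\<alpha> N))" by (intro sum.cong) auto
    qed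
  qed
  have "LDP ?S (PiM {..n} (\<lambda>p. sm_algebra (E p))) P ?X \<alpha> L.rate"
    by (rule L.ldp) (intro measurable_restrict V_field_measurable)
  then have "LDP ?S (PiM {..n} (\<lambda>p. sm_algebra (E p))) P ?X \<alpha> (\<lambda>\<mu>. \<Sum>p\<le>n. rate_I E K \<eta>0 p (\<mu> p))"
  proof (rule LDP_cong)
    fix \<mu> assume "\<mu> \<in> topspace ?S"
    then have "\<mu> p \<in> signed_measures (E p)" if "p \<le> n" for p using that unfolding top by auto
    from prod_form_rate[of n E "field_cov K \<eta>0", OF cov_form_field this]
    show "L.rate \<mu> = (\<Sum>p\<le>n. rate_I E K \<eta>0 p (\<mu> p))" unfolding L.rate_def rate_I_def by simp
  qed
  moreover have "(\<lambda>N w. \<lambda>p\<in>{..n}. sm_scale (1 / sqrt (\<alpha> N)) ((\<lambda>p\<in>{..n}. V_field E K \<eta>0 \<xi> N p w) p)) = ?X"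
    by (auto simp: fun_eq_iff restrict_def)
  ultimately show ?thesis unfolding MDP_def by simp
qed

lemma good_rate_I: "good_rate_function (tau_topology (E p)) (rate_I E K \<eta>0 p)"
proof -
  interpret coord_space "simples (E p)" "field_cov K \<eta>0 p" "tau_topology (E p)" "\<lambda>f \<mu>. sm_integral (E p) \<mu> f"
    by (rule coord_space_tau[OF nonempty cov_form_field])
  show ?thesis
    using good_rate
  proof (rule good_rate_function_cong)
    fix \<mu> assume "\<mu> \<in> topspace (tau_topology (E p))"
    then have "\<mu> \<in> signed_measures (E p)" by (simp add: topspace_tau)
    from rate_simples_eq[OF cov_form_field this] show "rate \<mu> = rate_I E K \<eta>0 p \<mu>" unfolding rate_def rate_I_def .
  qed
qed

text \<open>The general principle yields the Legendre transform of \<open>QW n\<close> over simple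
  functions. \<open>rate_simples_eq\<close> enlarges the supremum to bounded functions, and
  \<open>rate_J_eq\<close> identifies it with the constrained infimum.\<close>

theorem MDP_W:
  "MDP sm_scale (tau_topology (E n)) (sm_algebra (E n)) P (\<lambda>N w. W_field E K \<eta>0 \<xi> N n w) \<alpha> (rate_J E K \<eta>0 D n)"
proof -
  let ?X = "\<lambda>N w. sm_scale (1 / sqrt (\<alpha> N)) (W_field E K \<eta>0 \<xi> N n w)"
  interpret L: ldp_family "simples (E n)" "QW n" "tau_topology (E n)" "\<lambda>f \<mu>. sm_integral (E n) \<mu> f" P ?X \<alpha>
  proof (rule ldp_familyI[OF coord_space_tau[OF nonempty cov_form_QW]])
    fix N w assume "N \<ge> (1::nat)" "w \<in> space (P N)"
    from W_field_signed(1)[OF this] show "?X N w \<in> topspace (tau_topology (E n))" unfolding topspace_tau .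
  next
    fix f assume "f \<in> simples (E n)"
    then have f: "f \<in> bdd_meas (E n)" using simples_bdd_meas by blast
    show "quadratic_mgf (\<lambda>N w. sm_integral (E n) (?X N w) f) (QW n f f / 2)"
      by (rule quadratic_mgf_cong[OF quadratic_W[OF f]]) (simp add: W_field_signed(2)[OF _ _ f])
  qed
  have "LDP (tau_topology (E n)) (sm_algebra (E n)) P ?X \<alpha> L.rate"
    by (rule L.ldp) (rule W_field_measurable)
  then have "LDP (tau_topology (E n)) (sm_algebra (E n)) P ?X \<alpha> (rate_J E K \<eta>0 D n)"
  proof (rule LDP_cong)
    fix \<nu> assume "\<nu> \<in> topspace (tau_topology (E n))"
    then have \<nu>: "\<nu> \<in> signed_measures (E n)" by (simp add: topspace_tau)
    show "L.rate \<nu> = rate_J E K \<eta>0 D n \<nu>"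
      unfolding L.rate_def rate_simples_eq[OF cov_form_QW \<nu>] rate_J_eq[OF \<nu>] ..
  qed
  then show ?thesis unfolding MDP_def .
qed

end

theorem theorem2p7:
  fixes E :: "nat \<Rightarrow> 'a measure"
    and K :: "nat \<Rightarrow> 'a measure \<Rightarrow> 'a \<Rightarrow> 'a measure"
    and \<eta>0 :: "'a measure"
    and D :: "nat \<Rightarrow> 'a measure \<Rightarrow> 'a \<Rightarrow> 'a set \<Rightarrow> real"
    and P :: "nat \<Rightarrow> 'w measure"
    and \<xi> :: "nat \<Rightarrow> nat \<Rightarrow> nat \<Rightarrow> 'w \<Rightarrow> 'a"
    and \<alpha> :: "nat \<Rightarrow> real"
    and n :: nat
  assumes polish: "\<And>m. polish_borel (E m)"
    and init: "\<eta>0 \<in> probs (E 0)"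
    and markov: "\<And>m \<eta>. \<eta> \<in> probs (E m) \<Longrightarrow> K (Suc m) \<eta> \<in> measurable (E m) (prob_algebra (E (Suc m)))"
    and meas: "\<And>m N i A. N \<ge> 1 \<Longrightarrow> i \<in> {1..N} \<Longrightarrow> A \<in> sets (E (Suc m)) \<Longrightarrow>
        (\<lambda>x. measure (K (Suc m) (empirical (E m) N x) (x i)) A)
          \<in> borel_measurable (PiM {1..N} (\<lambda>_. E m))"
    and H1_K: "\<And>m. cond_K (E m) (E (Suc m)) (K (Suc m))"
    and H1_Phi: "\<And>m. upsilon_with (E m) (E (Suc m)) (Phi K (Suc m)) (D (Suc m))"
    and particles: "\<And>N. N \<ge> 1 \<Longrightarrow> particle_system E K \<eta>0 N (P N) (\<xi> N)"
    and alpha_pos: "\<And>N. N \<ge> 1 \<Longrightarrow> \<alpha> N > 0"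
    and alpha_mono: "\<And>M N. 1 \<le> M \<Longrightarrow> M \<le> N \<Longrightarrow> \<alpha> M \<le> \<alpha> N"
    and alpha_top: "filterlim \<alpha> at_top sequentially"
    and alpha_N: "(\<lambda>N. \<alpha> N / real N) \<longlonglongrightarrow> 0"
  shows "MDP (\<lambda>c \<mu>. \<lambda>p\<in>{..n}. sm_scale c (\<mu> p))
           (product_topology (\<lambda>p. tau_topology (E p)) {..n})
           (PiM {..n} (\<lambda>p. sm_algebra (E p)))
           P (\<lambda>N \<omega>. \<lambda>p\<in>{..n}. V_field E K \<eta>0 \<xi> N p \<omega>) \<alpha>
           (\<lambda>\<mu>. \<Sum>p\<le>n. rate_I E K \<eta>0 p (\<mu> p))
       \<and> (\<forall>p\<le>n. good_rate_function (tau_topology (E p)) (rate_I E K \<eta>0 p))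
       \<and> MDP sm_scale (tau_topology (E n)) (sm_algebra (E n))
           P (\<lambda>N \<omega>. W_field E K \<eta>0 \<xi> N n \<omega>) \<alpha> (rate_J E K \<eta>0 D n)
       \<and> (\<forall>(G :: 'g measure) V. limit_fields E K \<eta>0 G V \<longrightarrow>
            (\<forall>\<nu>\<in>signed_measures (E n).
               rate_J E K \<eta>0 D n \<nu> =
               (SUP f\<in>bdd_meas (E n). ereal (sm_integral (E n) \<nu> f
                  - (\<integral>\<omega>. (W_limit E K \<eta>0 D V n f \<omega>)\<^sup>2 \<partial>G) / 2))))"
proof -
  have model: "mf_model E K \<eta>0 D"
    by (rule mf_model.intro) (fact init markov H1_K H1_Phi)+
  have system: "particle_model E K \<eta>0 D P \<xi>"
    by (rule particle_model.intro[OF model particle_model_axioms.intro]) (fact meas particles)+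
  have scale: "exp_scale P \<alpha>"
    by (rule exp_scale.intro) (fact particle_model.prob_P[OF system] alpha_pos alpha_top)+
  interpret particle_scale E K \<eta>0 D P \<xi> \<alpha>
    by (rule particle_scale.intro[OF system scale particle_scale_axioms.intro]) (fact alpha_N)
  show ?thesis
  proof (intro conjI allI impI ballI)
    fix G :: "'g measure" and V \<nu>
    assume V: "limit_fields E K \<eta>0 G V" and \<nu>: "\<nu> \<in> signed_measures (E n)"
    show "rate_J E K \<eta>0 D n \<nu> = (SUP f\<in>bdd_meas (E n). ereal (sm_integral (E n) \<nu> f
        - (\<integral>w. (W_limit E K \<eta>0 D V n f w)\<^sup>2 \<partial>G) / 2))"
      unfolding rate_J_eq[OF \<nu>] using limit_variance[OF V] by (intro SUP_cong) auto
  qed (rule MDP_V good_rate_I MDP_W)+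
qed

end
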